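(* Let $\Lambda,\Lambda_2>0$ and let $g_k=e^{2u_k}g_{euc}$ be a sequence of smooth metrics on the unit disk $D$ such that each $(D,g_k)$ can be extended to a complete surface whose total absolute Gauss curvature is at most $\Lambda$, such that $$\int_D|K(g_k)|\,d\mu_{g_k}<\tau\le\epsilon_0\quad\text{for all }k,$$ where $\epsilon_0=\epsilon_0(\Lambda)$ is the constant described in the context, and such that $\mu(D,g_k)<\Lambda_2$ for all $k$. Then, after passing to a subsequence, $e^{u_k}$ converges in $L^q(D_r)$ for any $q<\frac{4\pi}{\tau}$, and for any $r\in(0,1)$ and $p\in(1,2)$ one of the following two alternatives holds: (a) $u_k$ converges weakly in $W^{1,p}(D_r)$; (b) $e^{u_k}$ converges to $0$ in $L^q(D_r)$, and both $\mu(D_r,g_k)$ and $\mathrm{diam}(D_r,g_k)$ converge to $0$. Moreover, when (b) happens, one can find constants $c_k\in\mathbb{R}$ such that $u_k-c_k$ converges weakly in $W^{1,p}(D_r)$.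
   Context: $D_r$ is the open Euclidean disk of radius $r$ centred at $0$ in $\mathbb{C}=\mathbb{R}^2$, $D=D_1$, $g_{euc}=dx^2+dy^2$. For $g=e^{2u}g_{euc}$: $K(g)=-e^{-2u}\Delta u$ is the Gauss curvature, $d\mu_g=e^{2u}dx\,dy$, $\mu(A,g)=\int_Ae^{2u}dx\,dy$, and $\mathrm{diam}(A,g)$ is the diameter of $A$ with respect to $g$. "$(D,g_k)$ can be extended to a complete surface with total absolute Gauss curvature at most $\Lambda$" means that $(D,g_k)$ is isometric to an open subset of a complete Riemannian surface $(\Sigma_k,h_k)$ with $\int_{\Sigma_k}|K(h_k)|\,d\mu_{h_k}\le\Lambda$. The constant $\epsilon_0=\epsilon_0(\Lambda)\in(0,\frac43\pi)$ is a small constant with the following property: for every smooth metric $e^{2u}g_{euc}$ on $D$ that can be extended to a complete surface of total absolute curvature at most $\Lambda$ and has $\int_D|K|d\mu\le\epsilon_0$, one has $\|\nabla u\|_{L^{2,\infty}(D_{1/2})}<C$ and $\|u\|_{W^{1,p}(D_{1/2})}\le C(1+|\log\mu(D_{1/2},e^{2u}g_{euc})|)$ for $p\in(1,2)$, with $C$ independent of $u$ (depending on $\Lambda$, $\epsilon_0$, and $p$). *)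

theory Defs
  imports "HOL-Analysis.Analysis"
begin

text \<open>The plane is identified with the type \<^typ>\<open>complex\<close>, with coordinate directions
  \<open>1\<close> and \<open>\<i>\<close>; the Euclidean metric is the inner product \<open>v \<bullet> w\<close>.\<close>

abbreviation disc :: "real \<Rightarrow> complex set" where
  "disc r \<equiv> ball 0 r"


section \<open>Smooth functions\<close>

text \<open>Intended for open sets. In the successor case all directional derivatives are again
  of class \<open>C^k\<close>.\<close>

primrec Ck_on :: "nat \<Rightarrow> 'a::real_normed_vector set \<Rightarrow> ('a \<Rightarrow> 'b::real_normed_vector) \<Rightarrow> bool" where
  "Ck_on 0 S f \<longleftrightarrow> continuous_on S f"
| "Ck_on (Suc k) S f \<longleftrightarrow> (\<forall>x\<in>S. f differentiable at x) \<and>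
     (\<forall>v. Ck_on k S (\<lambda>x. frechet_derivative f (at x) v))"

definition smooth_on :: "'a::real_normed_vector set \<Rightarrow> ('a \<Rightarrow> 'b::real_normed_vector) \<Rightarrow> bool" where
  "smooth_on S f \<longleftrightarrow> (\<forall>k. Ck_on k S f)"

definition pderiv_dir :: "complex \<Rightarrow> (complex \<Rightarrow> 'b::real_normed_vector) \<Rightarrow> complex \<Rightarrow> 'b" where
  "pderiv_dir v f z = frechet_derivative f (at z) v"

definition grad :: "(complex \<Rightarrow> real) \<Rightarrow> complex \<Rightarrow> complex" where
  "grad f z = Complex (pderiv_dir 1 f z) (pderiv_dir \<i> f z)"

definition laplacian :: "(complex \<Rightarrow> real) \<Rightarrow> complex \<Rightarrow> real" where
  "laplacian f z = pderiv_dir 1 (pderiv_dir 1 f) z + pderiv_dir \<i> (pderiv_dir \<i> f) z"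


section \<open>Riemannian metrics on plane domains\<close>

text \<open>\<open>g z v w\<close> is the inner product of the tangent vectors \<open>v\<close> and \<open>w\<close> at the point \<open>z\<close>.\<close>

type_synonym metric_tensor = "complex \<Rightarrow> complex \<Rightarrow> complex \<Rightarrow> real"

definition riem_metric_on :: "complex set \<Rightarrow> metric_tensor \<Rightarrow> bool" where
  "riem_metric_on \<Omega> g \<longleftrightarrow>
     (\<forall>z\<in>\<Omega>. bilinear (g z) \<and> (\<forall>v w. g z v w = g z w v) \<and> (\<forall>v. v \<noteq> 0 \<longrightarrow> g z v v > 0)) \<and>
     (\<forall>v w. smooth_on \<Omega> (\<lambda>z. g z v w))"

definition gdet :: "metric_tensor \<Rightarrow> complex \<Rightarrow> real" where
  "gdet g z = g z 1 1 * g z \<i> \<i> - (g z 1 \<i>)\<^sup>2"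

text \<open>Entries of the inverse matrix, for \<open>i, j \<in> {1, \<i>}\<close>: multiplication by \<open>\<i>\<close> turns
  the coefficients into the cofactors, e.g. \<open>g(\<i>, \<i>\<sup>2) = - g(1, \<i>)\<close>.\<close>

definition ginv :: "metric_tensor \<Rightarrow> complex \<Rightarrow> complex \<Rightarrow> complex \<Rightarrow> real" where
  "ginv g z i j = g z (\<i> * i) (\<i> * j) / gdet g z"

text \<open>The vector \<open>\<nabla>\<^sub>i \<partial>\<^sub>j\<close>, whose components are the Christoffel symbols of the Levi-Civita
  connection; the indices run through \<open>Basis = {1, \<i>}\<close>.\<close>

definition christoffel :: "metric_tensor \<Rightarrow> complex \<Rightarrow> complex \<Rightarrow> complex \<Rightarrow> complex" where
  "christoffel g z i j =
     (\<Sum>k\<in>Basis. (\<Sum>l\<in>Basis. ginv g z k l *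
         (pderiv_dir i (\<lambda>z. g z j l) z + pderiv_dir j (\<lambda>z. g z i l) z
            - pderiv_dir l (\<lambda>z. g z i j) z) / 2) *\<^sub>R k)"

definition cov_deriv :: "metric_tensor \<Rightarrow> complex \<Rightarrow> (complex \<Rightarrow> complex) \<Rightarrow> complex \<Rightarrow> complex" where
  "cov_deriv g i V z = pderiv_dir i V z + (\<Sum>k\<in>Basis. (V z \<bullet> k) *\<^sub>R christoffel g z i k)"

definition gauss_curv :: "metric_tensor \<Rightarrow> complex \<Rightarrow> real" where
  "gauss_curv g z =
     g z (cov_deriv g 1 (cov_deriv g \<i> (\<lambda>_. \<i>)) z - cov_deriv g \<i> (cov_deriv g 1 (\<lambda>_. \<i>)) z) 1
       / gdet g z"

text \<open>The length is extended-valued because a \<^const>\<open>valid_path\<close> is only required to be continuous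
  where it fails to be \<open>C\<^sup>1\<close>, so that it need not be rectifiable.\<close>

definition glength :: "metric_tensor \<Rightarrow> (real \<Rightarrow> complex) \<Rightarrow> ennreal" where
  "glength g \<gamma> = (\<integral>\<^sup>+t\<in>{0..1}. ennreal (sqrt (g (\<gamma> t) (vector_derivative \<gamma> (at t))
                                              (vector_derivative \<gamma> (at t)))) \<partial>lborel)"


section \<open>Abstract Riemannian surfaces\<close>

text \<open>A chart is a pair of a domain and a coordinate map, which is only relevant on the domain;
  \<open>metric S c\<close> is the expression of the Riemannian metric in the coordinates of \<open>c\<close>.\<close>

type_synonym 'p chart = "'p set \<times> ('p \<Rightarrow> complex)"

record 'p surface =
  stop :: "'p topology"
  atlas :: "'p chart set"
  metric :: "'p chart \<Rightarrow> metric_tensor"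

definition transition :: "'p chart \<Rightarrow> 'p chart \<Rightarrow> complex \<Rightarrow> complex" where
  "transition c d = snd d \<circ> inv_into (fst c) (snd c)"

definition riemannian_surface :: "'p surface \<Rightarrow> bool" where
  "riemannian_surface S \<longleftrightarrow>
     Hausdorff_space (stop S) \<and> second_countable (stop S) \<and> connected_space (stop S) \<and>
     (\<Union>c\<in>atlas S. fst c) = topspace (stop S) \<and>
     (\<forall>(U, \<phi>)\<in>atlas S. openin (stop S) U \<and> open (\<phi> ` U) \<and>
        homeomorphic_map (subtopology (stop S) U) (top_of_set (\<phi> ` U)) \<phi> \<and>
        riem_metric_on (\<phi> ` U) (metric S (U, \<phi>))) \<and>
     (\<forall>c\<in>atlas S. \<forall>d\<in>atlas S.
        smooth_on (snd c ` (fst c \<inter> fst d)) (transition c d) \<and>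
        (\<forall>z\<in>snd c ` (fst c \<inter> fst d). \<forall>v w.
           metric S c z v w = metric S d (transition c d z)
             (pderiv_dir v (transition c d) z) (pderiv_dir w (transition c d) z)))"

text \<open>\<open>surface_joined S p q L\<close>: some piecewise \<open>C\<^sup>1\<close> curve of length \<open>L\<close> joins \<open>p\<close> to \<open>q\<close>. Curves are
  concatenations of arcs each of which stays in one chart.\<close>

inductive surface_joined :: "'p surface \<Rightarrow> 'p \<Rightarrow> 'p \<Rightarrow> ennreal \<Rightarrow> bool" for S where
  refl: "p \<in> topspace (stop S) \<Longrightarrow> surface_joined S p p 0"
| step: "surface_joined S p q L \<Longrightarrow> (U, \<phi>) \<in> atlas S \<Longrightarrow> q \<in> U \<Longrightarrow> r \<in> U \<Longrightarrow>
         valid_path \<gamma> \<Longrightarrow> path_image \<gamma> \<subseteq> \<phi> ` U \<Longrightarrow> pathstart \<gamma> = \<phi> q \<Longrightarrow> pathfinish \<gamma> = \<phi> r \<Longrightarrow>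
         surface_joined S p r (L + glength (metric S (U, \<phi>)) \<gamma>)"

definition surface_dist :: "'p surface \<Rightarrow> 'p \<Rightarrow> 'p \<Rightarrow> real" where
  "surface_dist S p q = enn2real (Inf {L. surface_joined S p q L})"

definition complete_surface :: "'p surface \<Rightarrow> bool" where
  "complete_surface S \<longleftrightarrow>
     riemannian_surface S \<and> Metric_space.mcomplete (topspace (stop S)) (surface_dist S)"

text \<open>The Riemannian area measure: the unique Borel measure that is \<open>\<surd>(det g) dx dy\<close> in every chart.\<close>

definition surface_area :: "'p surface \<Rightarrow> 'p measure" where
  "surface_area S = (THE \<mu>. space \<mu> = topspace (stop S) \<and>
     sets \<mu> = sigma_sets (topspace (stop S)) {U. openin (stop S) U} \<and>
     (\<forall>(U, \<phi>)\<in>atlas S. \<forall>A\<in>sets \<mu>. A \<subseteq> U \<longrightarrow>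
        emeasure \<mu> A = (\<integral>\<^sup>+z\<in>\<phi> ` A. ennreal (sqrt (gdet (metric S (U, \<phi>)) z)) \<partial>lborel)))"

text \<open>The Gauss curvature does not depend on the chart in which it is computed.\<close>

definition surface_curv :: "'p surface \<Rightarrow> 'p \<Rightarrow> real" where
  "surface_curv S p =
     (let c = (SOME c. c \<in> atlas S \<and> p \<in> fst c) in gauss_curv (metric S c) (snd c p))"

definition total_abs_curv :: "'p surface \<Rightarrow> ennreal" where
  "total_abs_curv S = (\<integral>\<^sup>+p. ennreal \<bar>surface_curv S p\<bar> \<partial>surface_area S)"


section \<open>Conformal metrics on the unit disc\<close>

text \<open>In this section \<open>u\<close> stands for the metric \<open>e\<^sup>2\<^sup>u (dx\<^sup>2 + dy\<^sup>2)\<close> on \<^term>\<open>disc 1\<close>.\<close>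

definition conf :: "(complex \<Rightarrow> real) \<Rightarrow> metric_tensor" where
  "conf u z v w = exp (2 * u z) * (v \<bullet> w)"

definition conf_curv :: "(complex \<Rightarrow> real) \<Rightarrow> complex \<Rightarrow> real" where
  "conf_curv u z = - exp (- 2 * u z) * laplacian u z"

definition conf_area :: "(complex \<Rightarrow> real) \<Rightarrow> complex measure" where
  "conf_area u = density (lebesgue_on (disc 1)) (\<lambda>z. ennreal (exp (2 * u z)))"

definition conf_dist :: "(complex \<Rightarrow> real) \<Rightarrow> complex \<Rightarrow> complex \<Rightarrow> ennreal" where
  "conf_dist u x y = Inf {glength (conf u) \<gamma> | \<gamma>. valid_path \<gamma> \<and> path_image \<gamma> \<subseteq> disc 1 \<and>
                            pathstart \<gamma> = x \<and> pathfinish \<gamma> = y}"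

definition conf_diam :: "(complex \<Rightarrow> real) \<Rightarrow> complex set \<Rightarrow> ennreal" where
  "conf_diam u A = (SUP x\<in>A. SUP y\<in>A. conf_dist u x y)"

definition isometric_embedding :: "(complex \<Rightarrow> real) \<Rightarrow> 'p surface \<Rightarrow> (complex \<Rightarrow> 'p) \<Rightarrow> bool" where
  "isometric_embedding u S f \<longleftrightarrow>
     embedding_map (top_of_set (disc 1)) (stop S) f \<and> openin (stop S) (f ` disc 1) \<and>
     (\<forall>(U, \<phi>)\<in>atlas S. smooth_on (disc 1 \<inter> f -` U) (\<phi> \<circ> f) \<and>
        (\<forall>z\<in>disc 1 \<inter> f -` U. \<forall>v w.
           conf u z v w = metric S (U, \<phi>) (\<phi> (f z))
             (pderiv_dir v (\<phi> \<circ> f) z) (pderiv_dir w (\<phi> \<circ> f) z)))"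

text \<open>A nonempty connected second countable surface has exactly continuum many points, so letting
  them be taken from the type \<^typ>\<open>real\<close>, with an arbitrary topology, is no restriction.\<close>

definition extends_to_complete :: "real \<Rightarrow> (complex \<Rightarrow> real) \<Rightarrow> bool" where
  "extends_to_complete \<Lambda> u \<longleftrightarrow>
     (\<exists>(S :: real surface) f. complete_surface S \<and> total_abs_curv S \<le> ennreal \<Lambda> \<and>
        isometric_embedding u S f)"


section \<open>Lebesgue and Sobolev spaces\<close>

definition Lp :: "real \<Rightarrow> complex set \<Rightarrow> (complex \<Rightarrow> 'b::euclidean_space) set" where
  "Lp p \<Omega> = {f. f \<in> borel_measurable (lebesgue_on \<Omega>) \<and>
                integrable (lebesgue_on \<Omega>) (\<lambda>z. norm (f z) powr p)}"

definition Lp_norm :: "real \<Rightarrow> complex set \<Rightarrow> (complex \<Rightarrow> 'b::euclidean_space) \<Rightarrow> real" where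
  "Lp_norm p \<Omega> f = (\<integral>z. norm (f z) powr p \<partial>lebesgue_on \<Omega>) powr (1 / p)"

definition Lp_converges ::
    "real \<Rightarrow> complex set \<Rightarrow> (nat \<Rightarrow> complex \<Rightarrow> real) \<Rightarrow> (complex \<Rightarrow> real) \<Rightarrow> bool" where
  "Lp_converges p \<Omega> f F \<longleftrightarrow> (\<forall>k. f k \<in> Lp p \<Omega>) \<and> F \<in> Lp p \<Omega> \<and>
     (\<lambda>k. Lp_norm p \<Omega> (\<lambda>z. f k z - F z)) \<longlonglongrightarrow> 0"

text \<open>The weak Lebesgue norm of \<open>L\<^sup>2\<^sup>,\<^sup>\<infinity>\<close>; since \<^const>\<open>measure\<close> sends infinite measure to \<open>0\<close>, only
  sets \<open>\<Omega>\<close> of finite measure are intended.\<close>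

definition weak_L2_norm :: "complex set \<Rightarrow> (complex \<Rightarrow> 'b::real_normed_vector) \<Rightarrow> ereal" where
  "weak_L2_norm \<Omega> f =
     (SUP t\<in>{0<..}. ereal (t * sqrt (measure lebesgue {z\<in>\<Omega>. t < norm (f z)})))"

definition test_function :: "complex set \<Rightarrow> (complex \<Rightarrow> real) \<Rightarrow> bool" where
  "test_function \<Omega> \<psi> \<longleftrightarrow>
     smooth_on UNIV \<psi> \<and> (\<exists>K. compact K \<and> K \<subseteq> \<Omega> \<and> (\<forall>z. z \<notin> K \<longrightarrow> \<psi> z = 0))"

definition has_weak_grad :: "complex set \<Rightarrow> (complex \<Rightarrow> real) \<Rightarrow> (complex \<Rightarrow> complex) \<Rightarrow> bool" where
  "has_weak_grad \<Omega> f G \<longleftrightarrow>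
     (\<forall>K. compact K \<and> K \<subseteq> \<Omega> \<longrightarrow> f absolutely_integrable_on K \<and> G absolutely_integrable_on K) \<and>
     (\<forall>\<psi>. test_function \<Omega> \<psi> \<longrightarrow> (\<forall>v\<in>Basis.
        (\<integral>z. f z * pderiv_dir v \<psi> z \<partial>lebesgue_on \<Omega>) = - (\<integral>z. (G z \<bullet> v) * \<psi> z \<partial>lebesgue_on \<Omega>)))"

text \<open>Weak gradients are unique up to null sets.\<close>

definition weak_grad :: "complex set \<Rightarrow> (complex \<Rightarrow> real) \<Rightarrow> complex \<Rightarrow> complex" where
  "weak_grad \<Omega> f = (SOME G. has_weak_grad \<Omega> f G)"

definition W1p :: "real \<Rightarrow> complex set \<Rightarrow> (complex \<Rightarrow> real) set" where
  "W1p p \<Omega> = {f. f \<in> Lp p \<Omega> \<and> (\<exists>G. has_weak_grad \<Omega> f G \<and> G \<in> Lp p \<Omega>)}"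

definition W1p_norm :: "real \<Rightarrow> complex set \<Rightarrow> (complex \<Rightarrow> real) \<Rightarrow> real" where
  "W1p_norm p \<Omega> f =
     ((Lp_norm p \<Omega> f) powr p + (Lp_norm p \<Omega> (weak_grad \<Omega> f)) powr p) powr (1 / p)"

text \<open>Elements of \<open>W\<^sup>1\<^sup>,\<^sup>p\<close> are represented by functions; boundedness with respect to the seminorm
  makes a functional constant on classes of functions that agree almost everywhere on \<open>\<Omega>\<close>.\<close>

definition W1p_functional :: "real \<Rightarrow> complex set \<Rightarrow> ((complex \<Rightarrow> real) \<Rightarrow> real) \<Rightarrow> bool" where
  "W1p_functional p \<Omega> \<Phi> \<longleftrightarrow>
     (\<forall>f\<in>W1p p \<Omega>. \<forall>h\<in>W1p p \<Omega>. \<Phi> (\<lambda>z. f z + h z) = \<Phi> f + \<Phi> h) \<and>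
     (\<forall>f\<in>W1p p \<Omega>. \<forall>a. \<Phi> (\<lambda>z. a * f z) = a * \<Phi> f) \<and>
     (\<exists>C. \<forall>f\<in>W1p p \<Omega>. \<bar>\<Phi> f\<bar> \<le> C * W1p_norm p \<Omega> f)"

definition W1p_converges_weakly ::
    "real \<Rightarrow> complex set \<Rightarrow> (nat \<Rightarrow> complex \<Rightarrow> real) \<Rightarrow> (complex \<Rightarrow> real) \<Rightarrow> bool" where
  "W1p_converges_weakly p \<Omega> f F \<longleftrightarrow> (\<forall>k. f k \<in> W1p p \<Omega>) \<and> F \<in> W1p p \<Omega> \<and>
     (\<forall>\<Phi>. W1p_functional p \<Omega> \<Phi> \<longrightarrow> (\<lambda>k. \<Phi> (f k)) \<longlonglongrightarrow> \<Phi> F)"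


section \<open>The constant of the epsilon-regularity estimate\<close>

definition eps_regularity :: "real \<Rightarrow> real \<Rightarrow> bool" where
  "eps_regularity \<Lambda> \<epsilon> \<longleftrightarrow> 0 < \<epsilon> \<and> \<epsilon> < 4 / 3 * pi \<and>
     (\<forall>p. 1 < p \<and> p < 2 \<longrightarrow> (\<exists>C. \<forall>u.
        smooth_on (disc 1) u \<and> extends_to_complete \<Lambda> u \<and>
        (\<integral>\<^sup>+z. ennreal \<bar>conf_curv u z\<bar> \<partial>conf_area u) \<le> ennreal \<epsilon> \<longrightarrow>
          weak_L2_norm (disc (1/2)) (grad u) < ereal C \<and>
          W1p_norm p (disc (1/2)) u \<le> C * (1 + \<bar>ln (measure (conf_area u) (disc (1/2)))\<bar>)))"

end

(* Subtract from u_k its mean c_k over the disk of radius 1/2 and put w_k = u_k - c_k.  The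
   eps-regularity hypothesis, rescaled to small balls, bounds the gradients in weak L^2, hence in
   L^p for p < 2 on every smaller disk, and the Poincare inequality bounds w_k in L^1.  Writing a
   cut-off of w_k as a Newtonian potential of its Laplacian, whose mass is at most tau, Jensen's
   inequality bounds exp (q |w_k|) in L^1 for q < 4 pi / tau, and 3 < 4 pi / tau.  A diagonal
   argument on the means over grid squares gives a subsequence converging in L^1 on every disk and
   along which exp c_k, bounded by the area bound, converges.  Testing the Laplacian of w_i - w_j,
   which is bounded in L^1, against a truncation of w_i - w_j shows that the gradients converge
   strongly in L^1, so the weak W^{1,p} convergence is in fact strong.  The alternatives are
   lim exp c_k > 0 and lim exp c_k = 0.  For the diameter, two points are joined by a
   two-parameter family of parabolas, whose average length is controlled by the L^3 norm of the
   conformal factor. *)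
theory Submission
  imports Defs "HOL-Library.Diagonal_Subsequence"
begin

subsection \<open>Functions of class C^k\<close>

text \<open>Weak convergence is tested here with every bounded functional on W^{1,p}, and no
  subsequence can be adapted to uncountably many functionals one by one. Strong convergence settles
  all of them through their boundedness and needs no description of the dual space. The obstacle is
  that Laplacians are bounded only in L^1, so a difference cannot be tested against itself; hence
  the truncation. The hypothesis on the half disc becomes a local estimate because the L^1 norm of
  the Laplacian and the weak L^2 norm of the gradient are both invariant under z -> a + s z in
  dimension two, and a restricted metric still extends to the same complete surface. The bound 4/3
  pi on the constant yields the exponent 3: third exponential moments control the tails in the
  convergence of exp w_k, and an exponent above 2 makes the average length of the parabolas finite
  near their common end points. Nothing bounds c_k from below, and this is the only source of (b).
  As c_k depends neither on r nor on p, one subsequence and one alternative serve all r and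
  p.\<close>

lemma pderiv_dir_eq: "(f has_derivative f') (at z) \<Longrightarrow> pderiv_dir v f z = f' v"
  unfolding pderiv_dir_def using frechet_derivative_at by metis

lemma has_derivative_pderiv_dir:
  "f differentiable (at z) \<Longrightarrow> (f has_derivative (\<lambda>v. pderiv_dir v f z)) (at z)"
  unfolding pderiv_dir_def using frechet_derivative_works by metis

lemma has_derivative_frechet:
  "f differentiable (at x) \<Longrightarrow> (f has_derivative frechet_derivative f (at x)) (at x)"
  using frechet_derivative_works by blast

lemma frechet_transform:
  assumes "open S" "x \<in> S" "\<And>y. y \<in> S \<Longrightarrow> f y = g y" "f differentiable (at x)"
  shows "g differentiable (at x)" "frechet_derivative g (at x) = frechet_derivative f (at x)"
proof -
  have f: "(f has_derivative frechet_derivative f (at x)) (at x)"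
    using assms(4) frechet_derivative_works by blast
  have g: "(g has_derivative frechet_derivative f (at x)) (at x)"
    using has_derivative_transform_within_open[OF f assms(1,2)] assms(3) by auto
  show "g differentiable (at x)" using g differentiable_def by blast
  show "frechet_derivative g (at x) = frechet_derivative f (at x)"
    using frechet_derivative_at[OF g] by simp
qed

text \<open>Each closure rule below proves the regularity of a formula for the derivative and passes
  to \<open>frechet_derivative\<close> with this lemma. The formula is known on S only; openness of
  S makes agreement on S enough for equal derivatives there.\<close>

lemma Ck_on_transform:
  assumes "open S" "Ck_on k S f" "\<And>x. x \<in> S \<Longrightarrow> f x = g x"
  shows "Ck_on k S g"
  using assms(2,3)
proof (induction k arbitrary: f g)
  case 0
  then show ?case using continuous_on_cong by (metis Ck_on.simps(1))
next
  case (Suc k)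
  have d: "f differentiable (at x)" if "x \<in> S" for x using Suc.prems that by auto
  have t: "g differentiable (at x)" "frechet_derivative g (at x) = frechet_derivative f (at x)" if "x \<in> S" for x
    using frechet_transform[OF assms(1) that Suc.prems(2) d[OF that]] by auto
  show ?case
    unfolding Ck_on.simps
  proof (intro conjI allI ballI)
    fix v
    show "Ck_on k S (\<lambda>x. frechet_derivative g (at x) v)"
      by (rule Suc.IH[of "\<lambda>x. frechet_derivative f (at x) v"]) (use Suc.prems t in auto)
  qed (use t in auto)
qed

lemma Ck_on_subset: "Ck_on k S f \<Longrightarrow> T \<subseteq> S \<Longrightarrow> Ck_on k T f"
proof (induction k arbitrary: f)
  case 0
  then show ?case using continuous_on_subset by (metis Ck_on.simps(1))
next
  case (Suc k)
  then show ?case by (auto simp: subset_eq)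
qed

lemma Ck_on_Suc_D: "Ck_on (Suc k) S f \<Longrightarrow> Ck_on k S f"
proof (induction k arbitrary: f)
  case 0
  then show ?case
    by (auto intro!: continuous_at_imp_continuous_on differentiable_imp_continuous_within)
next
  case (Suc k)
  then show ?case by (metis Ck_on.simps(2))
qed

lemma Ck_on_const: "Ck_on k S (\<lambda>x. c)"
  by (induction k arbitrary: c) (auto simp: frechet_derivative_const)

lemma Ck_on_bounded_linear:
  assumes "bounded_linear f" shows "Ck_on k S f"
proof (cases k)
  case 0
  then show ?thesis using assms by (simp add: linear_continuous_on)
next
  case (Suc n)
  have "(f has_derivative f) (at x)" for x using assms bounded_linear_imp_has_derivative by blast
  then have "frechet_derivative f (at x) = f" "f differentiable (at x)" for x
    using frechet_derivative_at differentiable_def by metis+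
  then show ?thesis using Suc by (simp add: Ck_on_const)
qed

lemma Ck_on_add:
  assumes "open S" "Ck_on k S f" "Ck_on k S g"
  shows "Ck_on k S (\<lambda>x. f x + g x)"
  using assms(2,3)
proof (induction k arbitrary: f g)
  case 0
  then show ?case by (auto intro: continuous_intros)
next
  case (Suc k)
  show ?case unfolding Ck_on.simps
  proof (intro conjI allI ballI)
    fix v
    have "Ck_on k S (\<lambda>x. frechet_derivative f (at x) v + frechet_derivative g (at x) v)"
      using Suc by auto
    then show "Ck_on k S (\<lambda>x. frechet_derivative (\<lambda>x. f x + g x) (at x) v)"
    proof (rule Ck_on_transform[OF assms(1)])
      fix x assume "x \<in> S"
      then have "(f has_derivative frechet_derivative f (at x)) (at x)"
        "(g has_derivative frechet_derivative g (at x)) (at x)"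
        using Suc.prems by (auto intro!: has_derivative_frechet)
      from frechet_derivative_at[OF has_derivative_add[OF this]]
      show "frechet_derivative f (at x) v + frechet_derivative g (at x) v =
        frechet_derivative (\<lambda>x. f x + g x) (at x) v" by metis
    qed
  qed (use Suc.prems in auto)
qed

lemma Ck_on_mult:
  fixes f g :: "'a::real_normed_vector \<Rightarrow> real"
  assumes "open S" "Ck_on k S f" "Ck_on k S g"
  shows "Ck_on k S (\<lambda>x. f x * g x)"
  using assms(2,3)
proof (induction k arbitrary: f g)
  case 0
  then show ?case by (auto intro: continuous_intros)
next
  case (Suc k)
  show ?case unfolding Ck_on.simps
  proof (intro conjI allI ballI)
    fix v
    have "Ck_on k S (\<lambda>x. f x * frechet_derivative g (at x) v + frechet_derivative f (at x) v * g x)"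
    proof (rule Ck_on_add[OF assms(1)])
      show "Ck_on k S (\<lambda>x. f x * frechet_derivative g (at x) v)"
        using Suc.prems(2) by (intro Suc.IH Ck_on_Suc_D[OF Suc.prems(1)]) auto
      show "Ck_on k S (\<lambda>x. frechet_derivative f (at x) v * g x)"
        using Suc.prems(1) by (intro Suc.IH Ck_on_Suc_D[OF Suc.prems(2)]) auto
    qed
    then show "Ck_on k S (\<lambda>x. frechet_derivative (\<lambda>x. f x * g x) (at x) v)"
    proof (rule Ck_on_transform[OF assms(1)])
      fix x assume "x \<in> S"
      then have "(f has_derivative frechet_derivative f (at x)) (at x)"
        "(g has_derivative frechet_derivative g (at x)) (at x)"
        using Suc.prems by (auto intro!: has_derivative_frechet)
      from frechet_derivative_at[OF has_derivative_mult[OF this]]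
      show "f x * frechet_derivative g (at x) v + frechet_derivative f (at x) v * g x =
        frechet_derivative (\<lambda>x. f x * g x) (at x) v" by metis
    qed
  qed (use Suc.prems in auto)
qed

lemma frechet_derivative_real: 
  fixes f :: "real \<Rightarrow> real"
  assumes "f differentiable (at y)"
  shows "frechet_derivative f (at y) v = v * frechet_derivative f (at y) 1"
proof -
  have "linear (frechet_derivative f (at y))" using assms linear_frechet_derivative by blast
  from linear_cmul[OF this, of v 1] show ?thesis by simp
qed

text \<open>The outer function lives on the reals, where a derivative is multiplication by its value
  in direction 1. The chain rule thus becomes a product of two real functions, and
  \<open>Ck_on_mult\<close> closes the induction.\<close>

lemma Ck_on_compose_real:
  fixes f :: "real \<Rightarrow> real" and g :: "'a::real_normed_vector \<Rightarrow> real"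
  assumes "open S" "Ck_on k T f" "Ck_on k S g" "g ` S \<subseteq> T"
  shows "Ck_on k S (\<lambda>x. f (g x))"
  using assms(2,3)
proof (induction k arbitrary: f)
  case 0
  then show ?case using continuous_on_compose2[of T f S g] assms(4) by auto
next
  case (Suc k)
  have d: "(g has_derivative frechet_derivative g (at x)) (at x)"
    "(f has_derivative frechet_derivative f (at (g x))) (at (g x))" 
    "f differentiable at (g x)" if "x \<in> S" for x
    using Suc.prems(1,2) that assms(4) by (auto intro!: has_derivative_frechet)
  note c = has_derivative_compose[OF d(1,2)]
  show ?case unfolding Ck_on.simps
  proof (intro conjI allI ballI)
    fix v
    have "Ck_on k S (\<lambda>x. frechet_derivative g (at x) v * frechet_derivative f (at (g x)) 1)"
    proof (rule Ck_on_mult[OF assms(1)])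
      show "Ck_on k S (\<lambda>x. frechet_derivative g (at x) v)" using Suc.prems by auto
      show "Ck_on k S (\<lambda>x. frechet_derivative f (at (g x)) 1)"
        by (rule Suc.IH[of "\<lambda>y. frechet_derivative f (at y) 1"]) (use Suc.prems(1) Ck_on_Suc_D[OF Suc.prems(2)] in auto)
    qed
    then show "Ck_on k S (\<lambda>x. frechet_derivative (\<lambda>x. f (g x)) (at x) v)"
    proof (rule Ck_on_transform[OF assms(1)])
      fix x assume x: "x \<in> S"
      show "frechet_derivative g (at x) v * frechet_derivative f (at (g x)) 1 =
        frechet_derivative (\<lambda>x. f (g x)) (at x) v"
        using fun_cong[OF frechet_derivative_at[OF c[OF x x]], of v]
          frechet_derivative_real[OF d(3)[OF x], of "frechet_derivative g (at x) v"] by simp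
    qed
  next
    fix x assume "x \<in> S"
    then show "(\<lambda>x. f (g x)) differentiable at x" using c differentiable_def by blast
  qed
qed

text \<open>The derivative of the composite in direction v is that of f in direction s v. As
  \<open>Ck_on\<close> quantifies over all directions, the induction needs no linearity. The values
  lie in any normed space because the lemma serves conformal factors as well as embeddings read in a
  chart.\<close>

lemma Ck_on_affine:
  fixes f :: "'a::real_normed_vector \<Rightarrow> 'b::real_normed_vector"
  assumes "open S" "Ck_on k T f" "(\<lambda>x. a + s *\<^sub>R x) ` S \<subseteq> T"
  shows "Ck_on k S (\<lambda>x. f (a + s *\<^sub>R x))"
  using assms(2)
proof (induction k arbitrary: f)
  case 0
  have "continuous_on S (\<lambda>x. a + s *\<^sub>R x)" by (intro continuous_intros)
  then show ?case using 0 continuous_on_compose2[of T f S "\<lambda>x. a + s *\<^sub>R x"] assms(3) by auto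
next
  case (Suc k)
  have c: "((\<lambda>x. f (a + s *\<^sub>R x)) has_derivative (\<lambda>v. frechet_derivative f (at (a + s *\<^sub>R x)) (s *\<^sub>R v))) (at x)" if "x \<in> S" for x
  proof (rule has_derivative_compose[of "\<lambda>x. a + s *\<^sub>R x"])
    show "((\<lambda>x. a + s *\<^sub>R x) has_derivative (*\<^sub>R) s) (at x)" by (auto intro!: derivative_eq_intros)
    show "(f has_derivative frechet_derivative f (at (a + s *\<^sub>R x))) (at (a + s *\<^sub>R x))"
      using Suc.prems that assms(3) by (intro has_derivative_frechet) auto
  qed
  show ?case unfolding Ck_on.simps
  proof (intro conjI allI ballI)
    fix v
    have "Ck_on k S (\<lambda>x. frechet_derivative f (at (a + s *\<^sub>R x)) (s *\<^sub>R v))"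
        by (rule Suc.IH[of "\<lambda>y. frechet_derivative f (at y) (s *\<^sub>R v)"]) (use Suc.prems in auto)
    then show "Ck_on k S (\<lambda>x. frechet_derivative (\<lambda>x. f (a + s *\<^sub>R x)) (at x) v)"
    proof (rule Ck_on_transform[OF assms(1)])
      fix x assume x: "x \<in> S"
      show "frechet_derivative f (at (a + s *\<^sub>R x)) (s *\<^sub>R v) =
        frechet_derivative (\<lambda>x. f (a + s *\<^sub>R x)) (at x) v"
        using frechet_derivative_at[OF c[OF x]] by metis
    qed
  next
    fix x assume "x \<in> S"
    then show "(\<lambda>x. f (a + s *\<^sub>R x)) differentiable at x" using c differentiable_def by blast
  qed
qed

lemma smooth_on_imp_Ck_on: "smooth_on S f \<Longrightarrow> Ck_on k S f"
  by (simp add: smooth_on_def)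

lemma Ck_on_2_D:
  assumes "Ck_on 2 S f"
  shows "\<And>z. z \<in> S \<Longrightarrow> f differentiable (at z)"
    "\<And>v z. z \<in> S \<Longrightarrow> pderiv_dir v f differentiable (at z)"
    "continuous_on S f" "\<And>v. continuous_on S (pderiv_dir v f)"
    "\<And>v w. continuous_on S (pderiv_dir w (pderiv_dir v f))"
proof -
  have a: "Ck_on (Suc (Suc 0)) S f" using assms by (simp add: numeral_2_eq_2)
  have b: "Ck_on (Suc 0) S (\<lambda>z. pderiv_dir v f z)" for v using a unfolding pderiv_dir_def by (metis Ck_on.simps(2))
  show "\<And>z. z \<in> S \<Longrightarrow> f differentiable (at z)" using a by auto
  show "\<And>v z. z \<in> S \<Longrightarrow> pderiv_dir v f differentiable (at z)" using b by auto
  show "continuous_on S f" using a Ck_on_Suc_D by (metis Ck_on.simps(1))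
  show "continuous_on S (pderiv_dir v f)" for v using b[of v] Ck_on_Suc_D by (metis Ck_on.simps(1))
  show "continuous_on S (pderiv_dir w (pderiv_dir v f))" for v w using b[of v]
    unfolding pderiv_dir_def[of w, abs_def] by auto
qed

section \<open>Calculus of directional derivatives and gradients\<close>

lemma pderiv_dir_add:
  assumes "f differentiable (at z)" "g differentiable (at z)"
  shows "pderiv_dir v (\<lambda>z. f z + g z) z = pderiv_dir v f z + pderiv_dir v g z"
  by (rule pderiv_dir_eq) (intro derivative_intros has_derivative_pderiv_dir assms)

lemma pderiv_dir_diff:
  assumes "f differentiable (at z)" "g differentiable (at z)"
  shows "pderiv_dir v (\<lambda>z. f z - g z) z = pderiv_dir v f z - pderiv_dir v g z"
  by (rule pderiv_dir_eq) (intro derivative_intros has_derivative_pderiv_dir assms)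

lemma pderiv_dir_mult:
  fixes f g :: "complex \<Rightarrow> real"
  assumes "f differentiable (at z)" "g differentiable (at z)"
  shows "pderiv_dir v (\<lambda>z. f z * g z) z = f z * pderiv_dir v g z + pderiv_dir v f z * g z"
  by (rule pderiv_dir_eq) (intro has_derivative_mult has_derivative_pderiv_dir assms)

lemma pderiv_dir_compose_real:
  fixes f :: "complex \<Rightarrow> real"
  assumes "f differentiable (at z)" "(T has_real_derivative d) (at (f z))"
  shows "pderiv_dir v (\<lambda>z. T (f z)) z = d * pderiv_dir v f z" "(\<lambda>z. T (f z)) differentiable (at z)"
proof -
  have "((\<lambda>z. T (f z)) has_derivative (\<lambda>v. d * pderiv_dir v f z)) (at z)"
    using has_derivative_compose[OF has_derivative_pderiv_dir[OF assms(1)], of T "\<lambda>x. d * x"]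
      assms(2) unfolding has_field_derivative_def by auto
  then show "pderiv_dir v (\<lambda>z. T (f z)) z = d * pderiv_dir v f z" "(\<lambda>z. T (f z)) differentiable (at z)"
    using pderiv_dir_eq differentiable_def by blast+
qed

lemma pderiv_dir_transform:
  assumes "open S" "z \<in> S" "\<And>y. y \<in> S \<Longrightarrow> f y = g y" "f differentiable (at z)"
  shows "g differentiable (at z)" "pderiv_dir v g z = pderiv_dir v f z"
  using frechet_transform[OF assms] unfolding pderiv_dir_def by auto

text \<open>The first form keeps the factor s in the direction, where a metric tensor expects it;
  the second pulls it out, for the scaling of gradients and Laplacians.\<close>

lemma pderiv_dir_affine:
  assumes "f differentiable (at (a + s *\<^sub>R z))"
  shows "pderiv_dir v (\<lambda>z. f (a + s *\<^sub>R z)) z = pderiv_dir (s *\<^sub>R v) f (a + s *\<^sub>R z)"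
    "pderiv_dir v (\<lambda>z. f (a + s *\<^sub>R z)) z = s *\<^sub>R pderiv_dir v f (a + s *\<^sub>R z)"
proof -
  show 1: "pderiv_dir v (\<lambda>z. f (a + s *\<^sub>R z)) z = pderiv_dir (s *\<^sub>R v) f (a + s *\<^sub>R z)"
    by (rule pderiv_dir_eq, rule has_derivative_compose[of "\<lambda>x. a + s *\<^sub>R x"])
      (use assms has_derivative_pderiv_dir in \<open>auto intro!: derivative_eq_intros\<close>)
  have "linear (frechet_derivative f (at (a + s *\<^sub>R z)))" using assms linear_frechet_derivative by blast
  then show "pderiv_dir v (\<lambda>z. f (a + s *\<^sub>R z)) z = s *\<^sub>R pderiv_dir v f (a + s *\<^sub>R z)"
    unfolding 1 unfolding pderiv_dir_def by (rule linear_cmul)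
qed

lemma grad_inner: "f differentiable (at z) \<Longrightarrow> grad f z \<bullet> v = pderiv_dir v f z"
proof -
  assume "f differentiable (at z)"
  then have l: "linear (\<lambda>v. pderiv_dir v f z)" using has_derivative_pderiv_dir has_derivative_linear by blast
  have "v = Re v *\<^sub>R 1 + Im v *\<^sub>R \<i>" by (simp add: complex_eq_iff)
  then have "pderiv_dir v f z = Re v * pderiv_dir 1 f z + Im v * pderiv_dir \<i> f z"
    using linear_add[OF l] linear_cmul[OF l] by (metis real_scaleR_def)
  then show ?thesis by (simp add: grad_def inner_complex_def mult.commute)
qed

lemma continuous_on_grad:
  assumes "continuous_on S (pderiv_dir 1 f)" "continuous_on S (pderiv_dir \<i> f)"
  shows "continuous_on S (grad f)"
proof -
  have "grad f = (\<lambda>z. complex_of_real (pderiv_dir 1 f z) + \<i> * complex_of_real (pderiv_dir \<i> f z))"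
    by (auto simp: grad_def complex_eq_iff)
  then show ?thesis using assms by (auto intro!: continuous_intros)
qed

subsection \<open>Integrals over the plane\<close>

lemma nn_integral_affine_complex:
  fixes f :: "complex \<Rightarrow> ennreal"
  assumes [measurable]: "f \<in> borel_measurable borel" and s: "s \<noteq> 0"
  shows "(\<integral>\<^sup>+z. f (a + s *\<^sub>R z) \<partial>lborel) = ennreal (1 / s\<^sup>2) * (\<integral>\<^sup>+z. f z \<partial>lborel)"
proof -
  have "(\<integral>\<^sup>+z. f z \<partial>lborel) = (\<integral>\<^sup>+z. f z \<partial>density (distr lborel borel (\<lambda>x. a + s *\<^sub>R x)) (\<lambda>_. \<bar>s\<bar>^DIM(complex)))"
    using lborel_affine[OF s, of a] by simp
  also have "\<dots> = ennreal (s\<^sup>2) * (\<integral>\<^sup>+z. f (a + s *\<^sub>R z) \<partial>lborel)"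
    by (simp add: nn_integral_density nn_integral_distr nn_integral_cmult ennreal_power)
  finally have "ennreal (1 / s\<^sup>2) * (\<integral>\<^sup>+z. f z \<partial>lborel) = (ennreal (1 / s\<^sup>2) * ennreal (s\<^sup>2)) * (\<integral>\<^sup>+z. f (a + s *\<^sub>R z) \<partial>lborel)"
    by (simp add: mult.assoc)
  also have "ennreal (1 / s\<^sup>2) * ennreal (s\<^sup>2) = 1"
    using s by (subst ennreal_mult[symmetric]) auto
  finally show ?thesis by simp
qed

lemma emeasure_disc_complex: "r \<ge> 0 \<Longrightarrow> emeasure lborel (ball (a::complex) r) = ennreal (pi * r\<^sup>2)"
  using emeasure_ball[of r a] by (simp add: unit_ball_vol_2)

text \<open>Dyadic layers: where g > 1, some n has 2^n < g \<le> 2^(n+1), and that layer contributes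
  at most (2^(n+1))^p times C / 4^n. These products form a geometric series of ratio 2^(p-2), which
  converges because p < 2. The measure of the whole space pays for the points with g \<le>
  1.\<close>

lemma weak_L2_imp_Lp_bound:
  fixes g :: "'a \<Rightarrow> real"
  assumes [measurable]: "g \<in> borel_measurable M" and g: "\<And>x. g x \<ge> 0"
    and p: "0 < p" "p < 2" and C: "0 \<le> C"
    and w: "\<And>n. emeasure M {x \<in> space M. g x > 2 ^ n} \<le> ennreal (C / 4 ^ n)"
  shows "(\<integral>\<^sup>+x. ennreal (g x powr p) \<partial>M) \<le> emeasure M (space M) + ennreal (C * 2 powr p / (1 - 2 powr (p - 2)))"
proof -
  have q: "2 powr (p - 2) < (1::real)" using p by (simp add: powr_less_one)
  have e: "2 powr (real (Suc n) * p) * (C / 4 ^ n) = (C * 2 powr p) * (2 powr (p - 2)) ^ n" for n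
  proof -
    have 1: "2 powr (real (Suc n) * p) = 2 powr p * (2 powr p) ^ n"
    proof -
      have "(2 powr p) ^ n = 2 powr (p * real n)" by (simp add: powr_powr flip: powr_realpow)
      then show ?thesis by (simp add: algebra_simps powr_add)
    qed
    have 2: "2 powr (p - 2) = 2 powr p / (4::real)" by (simp add: powr_diff)
    show ?thesis unfolding 1 2 by (simp add: power_divide)
  qed
  have *: "ennreal (g x powr p) \<le> 1 + (\<Sum>n. ennreal (2 powr (real (Suc n) * p)) * indicator {x \<in> space M. g x > 2 ^ n} x)"
    if x: "x \<in> space M" for x
  proof (cases "g x \<le> 1")
    case True
    then have "ennreal (g x powr p) \<le> 1" using p g[of x] by (simp add: powr_le1)
    then show ?thesis by (meson add_increasing2 order_trans zero_le)
  next
    case False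
    define P where "P n \<longleftrightarrow> g x \<le> 2 ^ n" for n :: nat
    have ex: "\<exists>n. P n" unfolding P_def using real_arch_pow[of 2 "g x"] by (auto intro: less_imp_le)
    \<comment> \<open>\<open>m\<close> is the first exponent whose power of 2 dominates g x. It is
      positive because g x > 1, so the preceding power lies strictly below g x and x belongs to that
      layer.\<close>
    define m where "m = (LEAST n. P n)"
    have m: "P m" unfolding m_def using ex by (rule LeastI_ex)
    have "m \<noteq> 0"
    proof
      assume "m = 0"
      then show False using m False by (simp add: P_def)
    qed
    then obtain n where n: "m = Suc n" using not0_implies_Suc by blast
    have "\<not> P n" using not_less_Least[of n P] n m_def by auto
    then have n1: "g x > 2 ^ n" by (simp add: P_def)
    have "g x powr p \<le> (2 ^ Suc n) powr p" using m n g[of x] p by (intro powr_mono2) (auto simp: P_def)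
    also have "\<dots> = 2 powr (real (Suc n) * p)" by (metis powr_powr powr_realpow zero_less_numeral)
    finally have "ennreal (g x powr p) \<le> ennreal (2 powr (real (Suc n) * p)) * indicator {x \<in> space M. g x > 2 ^ n} x"
      using n1 x by (simp add: indicator_def ennreal_leI)
    also have "\<dots> \<le> (\<Sum>n. ennreal (2 powr (real (Suc n) * p)) * indicator {x \<in> space M. g x > 2 ^ n} x)"
    proof -
      have "h n \<le> (\<Sum>n. h n)" for h :: "nat \<Rightarrow> ennreal" using sum_le_suminf[of h "{n}"] by simp
      then show ?thesis .
    qed
    finally show ?thesis by (meson add_increasing order_trans zero_le)
  qed
  have "(\<integral>\<^sup>+x. ennreal (g x powr p) \<partial>M)
      \<le> (\<integral>\<^sup>+x. 1 + (\<Sum>n. ennreal (2 powr (real (Suc n) * p)) * indicator {x \<in> space M. g x > 2 ^ n} x) \<partial>M)"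
    by (intro nn_integral_mono *)
  also have "\<dots> = emeasure M (space M) + (\<Sum>n. ennreal (2 powr (real (Suc n) * p)) * emeasure M {x \<in> space M. g x > 2 ^ n})"
    by (simp add: nn_integral_add nn_integral_suminf nn_integral_cmult_indicator)
  also have "(\<Sum>n. ennreal (2 powr (real (Suc n) * p)) * emeasure M {x \<in> space M. g x > 2 ^ n})
     \<le> (\<Sum>n. ennreal ((C * 2 powr p) * (2 powr (p - 2)) ^ n))"
  proof (intro suminf_le allI)
    fix n
    have "ennreal (2 powr (real (Suc n) * p)) * emeasure M {x \<in> space M. g x > 2 ^ n}
      \<le> ennreal (2 powr (real (Suc n) * p)) * ennreal (C / 4 ^ n)"
      by (intro mult_left_mono w) auto
    also have "\<dots> = ennreal ((C * 2 powr p) * (2 powr (p - 2)) ^ n)"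
      using C by (subst e[symmetric], subst ennreal_mult) auto
    finally show "ennreal (2 powr (real (Suc n) * p)) * emeasure M {x \<in> space M. g x > 2 ^ n} \<le> \<dots>" .
  qed auto
  also have "\<dots> = ennreal (\<Sum>n. (C * 2 powr p) * (2 powr (p - 2)) ^ n)"
    using C q by (intro suminf_ennreal2 summable_mult summable_geometric) auto
  also have "(\<Sum>n. (C * 2 powr p) * (2 powr (p - 2)) ^ n) = C * 2 powr p / (1 - 2 powr (p - 2))"
    using q by (subst suminf_mult) (auto simp: suminf_geometric intro!: summable_geometric)
  finally show ?thesis by (simp add: add_left_mono)
qed

text \<open>The function 1 / |z - \<zeta>| is in weak L^2: it exceeds 2^n only on the disc of radius
  2^(-n), whose area is pi / 4^n. The previous lemma with C = pi gives a bound that does not depend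
  on the centre.\<close>

lemma nn_integral_inverse_norm_powr:
  assumes a: "0 < a" "a < 2" and R: "R > 0"
  shows "\<exists>K\<ge>0. \<forall>\<zeta>. (\<integral>\<^sup>+z\<in>ball (\<zeta>::complex) R. ennreal ((1 / norm (z - \<zeta>)) powr a) \<partial>lborel) \<le> ennreal K"
proof -
  define K where "K = pi * R\<^sup>2 + pi * 2 powr a / (1 - 2 powr (a - 2))"
  have q: "2 powr (a - 2) < (1::real)" using a by (simp add: powr_less_one)
  have "(\<integral>\<^sup>+z\<in>ball \<zeta> R. ennreal ((1 / norm (z - \<zeta>)) powr a) \<partial>lborel) \<le> ennreal K" for \<zeta> :: complex
  proof -
    have [measurable]: "ball \<zeta> R \<in> sets lborel" by simp
    have "(\<integral>\<^sup>+z\<in>ball \<zeta> R. ennreal ((1 / norm (z - \<zeta>)) powr a) \<partial>lborel) =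
       (\<integral>\<^sup>+z. ennreal ((1 / norm (z - \<zeta>)) powr a) \<partial>restrict_space lborel (ball \<zeta> R))"
      by (subst nn_integral_restrict_space) auto
    also have "\<dots> \<le> emeasure (restrict_space lborel (ball \<zeta> R)) (space (restrict_space lborel (ball \<zeta> R))) +
        ennreal (pi * 2 powr a / (1 - 2 powr (a - 2)))"
    proof (rule weak_L2_imp_Lp_bound)
      show "(\<lambda>z. 1 / norm (z - \<zeta>)) \<in> borel_measurable (restrict_space lborel (ball \<zeta> R))"
        by (intro measurable_restrict_space1) simp
      fix n
      have "emeasure (restrict_space lborel (ball \<zeta> R)) {x \<in> space (restrict_space lborel (ball \<zeta> R)). 2 ^ n < 1 / norm (x - \<zeta>)}
        \<le> emeasure lborel {x \<in> ball \<zeta> R. 2 ^ n < 1 / norm (x - \<zeta>)}"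
        by (subst emeasure_restrict_space) (auto simp: space_restrict_space)
      also have "\<dots> \<le> emeasure lborel (ball \<zeta> (1 / 2 ^ n))"
      proof (rule emeasure_mono)
        show "{x \<in> ball \<zeta> R. 2 ^ n < 1 / norm (x - \<zeta>)} \<subseteq> ball \<zeta> (1 / 2 ^ n)"
        proof
          fix x assume "x \<in> {x \<in> ball \<zeta> R. 2 ^ n < 1 / norm (x - \<zeta>)}"
          then have h: "2 ^ n < 1 / norm (x - \<zeta>)" by simp
          then have "norm (x - \<zeta>) > 0" by (cases "x = \<zeta>") auto
          then show "x \<in> ball \<zeta> (1 / 2 ^ n)" using h by (simp add: dist_norm norm_minus_commute field_simps)
        qed
      qed auto
      also have "\<dots> = ennreal (pi / 4 ^ n)"
      proof -
        have "(2 ^ n)\<^sup>2 = (4::real) ^ n" by (simp add: power2_eq_square flip: power_mult_distrib)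
        then show ?thesis by (simp add: emeasure_disc_complex power_divide)
      qed
      finally show "emeasure (restrict_space lborel (ball \<zeta> R)) {x \<in> space (restrict_space lborel (ball \<zeta> R)). 2 ^ n < 1 / norm (x - \<zeta>)} \<le> ennreal (pi / 4 ^ n)" .
    qed (use a in auto)
    also have "emeasure (restrict_space lborel (ball \<zeta> R)) (space (restrict_space lborel (ball \<zeta> R))) = ennreal (pi * R\<^sup>2)"
      using R by (simp add: emeasure_restrict_space space_restrict_space emeasure_disc_complex)
    finally show ?thesis using q by (simp add: K_def ennreal_plus[symmetric] del: ennreal_plus)
  qed
  moreover have "K \<ge> 0" unfolding K_def using q by auto
  ultimately show ?thesis by blast
qed

text \<open>The integrand is the Laplacian of half of ln (1 + |z|^2), the regularised logarithmic kernel.\<close>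
lemma nn_integral_poisson_weight:
  "(\<integral>\<^sup>+z. ennreal (2 / (1 + (norm (z::complex))\<^sup>2)\<^sup>2) \<partial>lborel) = ennreal (2 * pi)"
proof -
  \<comment> \<open>Polar coordinates are replaced by a layer argument: the weight is the integral
    of 4 / (1 + s)^3 over s \<ge> |z|^2. Exchanging the integrals over the region \<open>E\<close>
    above the paraboloid leaves the area pi s of a disc and a one-dimensional integral.\<close>
  define E where "E = {p::complex \<times> real. (norm (fst p))\<^sup>2 \<le> snd p}"
  let ?h = "\<lambda>s::real. 4 / (1 + s) ^ 3"
  have 1: "ennreal (2 / (1 + (norm z)\<^sup>2)\<^sup>2) = (\<integral>\<^sup>+s. ennreal (?h s) * indicator {(norm z)\<^sup>2..} s \<partial>lborel)" for z :: complex
  proof (subst nn_integral_FTC_atLeast[where F = "\<lambda>s. - 2 / (1 + s)\<^sup>2" and T = 0])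
    fix s :: real assume "(norm z)\<^sup>2 \<le> s"
    then have s: "s \<ge> 0" by (meson order_trans zero_le_power2)
    show "((\<lambda>s. - 2 / (1 + s)\<^sup>2) has_real_derivative ?h s) (at s)"
    proof -
      have n: "1 + s \<noteq> 0" using s by simp
      have "((\<lambda>s. - 2 / (1 + s)\<^sup>2) has_real_derivative
          - ((- 4 - 4 * s) / ((1 + s) * (1 + s) * ((1 + s) * (1 + s))))) (at s)"
        using n by (auto intro!: derivative_eq_intros simp: power2_eq_square)
      also have "- ((- 4 - 4 * s) / ((1 + s) * (1 + s) * ((1 + s) * (1 + s)))) = ?h s"
      proof -
        have e: "- 4 - 4 * s = - (4 * (1 + s))" by simp
        show ?thesis unfolding e using n by (simp add: power3_eq_cube del: distrib_left_numeral)
      qed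
      finally show ?thesis .
    qed
    show "0 \<le> ?h s" using s by simp
  next
    show "((\<lambda>s::real. - 2 / (1 + s)\<^sup>2) \<longlongrightarrow> 0) at_top"
    proof -
      have "filterlim (\<lambda>s::real. (1 + s)\<^sup>2) at_top at_top"
        by (intro filterlim_pow_at_top filterlim_tendsto_add_at_top[OF tendsto_const] filterlim_ident) auto
      from tendsto_divide_0[OF tendsto_const filterlim_at_top_imp_at_infinity[OF this]]
      show ?thesis .
    qed
  qed auto
  have "(\<integral>\<^sup>+z. ennreal (2 / (1 + (norm (z::complex))\<^sup>2)\<^sup>2) \<partial>lborel)
     = (\<integral>\<^sup>+z. (\<integral>\<^sup>+s. ennreal (?h s) * indicator E (z, s) \<partial>lborel) \<partial>lborel)"
    by (intro nn_integral_cong, subst 1) (auto intro!: nn_integral_cong simp: indicator_def E_def)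
  also have "\<dots> = (\<integral>\<^sup>+s. (\<integral>\<^sup>+z. ennreal (?h s) * indicator E (z, s) \<partial>lborel) \<partial>lborel)"
  proof (rule lborel_pair.Fubini'[symmetric])
    have "closed E"
      unfolding E_def by (intro closed_Collect_le continuous_intros)
    then have "E \<in> sets borel" by (rule borel_closed)
    then have [measurable]: "E \<in> sets (borel \<Otimes>\<^sub>M borel)"
      by (simp only: borel_prod)
    show "(\<lambda>(x, y). ennreal (?h y) * indicator E (x, y)) \<in> borel_measurable (lborel \<Otimes>\<^sub>M lborel)"
      by measurable
  qed
  also have "\<dots> = (\<integral>\<^sup>+s. ennreal (4 * pi * s / (1 + s) ^ 3) * indicator {0..} s \<partial>lborel)"
  proof (intro nn_integral_cong)
    fix s :: real
    have "(\<integral>\<^sup>+z. ennreal (?h s) * indicator E (z, s) \<partial>lborel)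
       = (\<integral>\<^sup>+z. ennreal (?h s) * indicator {z. (norm z)\<^sup>2 \<le> s} (z::complex) \<partial>lborel)"
      by (intro nn_integral_cong) (auto simp: indicator_def E_def)
    also have "\<dots> = ennreal (?h s) * emeasure lborel {z::complex. (norm z)\<^sup>2 \<le> s}"
      by (intro nn_integral_cmult_indicator) measurable
    also have "\<dots> = ennreal (4 * pi * s / (1 + s) ^ 3) * indicator {0..} s"
    proof (cases "s \<ge> 0")
      case True
      have "{z::complex. (norm z)\<^sup>2 \<le> s} = cball 0 (sqrt s)"
      proof (rule set_eqI)
        fix z :: complex
        have "(norm z)\<^sup>2 \<le> s" if "norm z \<le> sqrt s" using sqrt_ge_absD[of "norm z" s] that by simp
        then show "z \<in> {z. (norm z)\<^sup>2 \<le> s} \<longleftrightarrow> z \<in> cball 0 (sqrt s)" using real_le_rsqrt by auto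
      qed
      then have "emeasure lborel {z::complex. (norm z)\<^sup>2 \<le> s} = ennreal (pi * s)"
        using True by (simp add: emeasure_cball unit_ball_vol_2)
      then show ?thesis using True by (simp add: ennreal_mult[symmetric] mult.commute mult.left_commute)
    next
      case False
      then have "{z::complex. (norm z)\<^sup>2 \<le> s} = {}" by (auto simp: not_le intro: less_le_trans)
      then show ?thesis using False by simp
    qed
    finally show "(\<integral>\<^sup>+z. ennreal (?h s) * indicator E (z, s) \<partial>lborel) = \<dots>" .
  qed
  \<comment> \<open>The antiderivative is 2 pi (s / (1 + s))^2; it vanishes at 0 and tends to 2
    pi.\<close>
  also have "\<dots> = ennreal (2 * pi - 2 * pi * (0 / (1 + 0))\<^sup>2)"
  proof (rule nn_integral_FTC_atLeast)
    fix s :: real assume s: "0 \<le> s"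
    show "((\<lambda>s. 2 * pi * (s / (1 + s))\<^sup>2) has_real_derivative 4 * pi * s / (1 + s) ^ 3) (at s)"
    proof -
      have n: "1 + s \<noteq> 0" using s by simp
      have d: "((\<lambda>s. s / (1 + s)) has_real_derivative 1 / (1 + s)\<^sup>2) (at s)"
        using n by (auto intro!: derivative_eq_intros simp: power2_eq_square)
      have "((\<lambda>s. 2 * pi * (s / (1 + s))\<^sup>2) has_real_derivative 2 * pi * (2 * (s / (1 + s)) * (1 / (1 + s)\<^sup>2))) (at s)"
        by (rule DERIV_cong[OF DERIV_cmult[OF DERIV_power[OF d, of 2], of "2 * pi"]]) simp
      also have "2 * pi * (2 * (s / (1 + s)) * (1 / (1 + s)\<^sup>2)) = 4 * pi * s / (1 + s) ^ 3"
        by (simp add: power2_eq_square power3_eq_cube mult.assoc)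
      finally show ?thesis .
    qed
    show "0 \<le> 4 * pi * s / (1 + s) ^ 3" using s by simp
  next
    show "((\<lambda>s. 2 * pi * (s / (1 + s))\<^sup>2) \<longlongrightarrow> 2 * pi) at_top"
    proof -
      have "((\<lambda>s::real. 1 / (1 + s)) \<longlongrightarrow> 0) at_top"
        by (intro tendsto_divide_0[OF tendsto_const] filterlim_at_top_imp_at_infinity
            filterlim_tendsto_add_at_top[OF tendsto_const] filterlim_ident)
      then have "((\<lambda>s::real. 2 * pi * (1 - 1 / (1 + s))\<^sup>2) \<longlongrightarrow> 2 * pi * (1 - 0)\<^sup>2) at_top"
        by (intro tendsto_intros)
      moreover have "eventually (\<lambda>s::real. 2 * pi * (1 - 1 / (1 + s))\<^sup>2 = 2 * pi * (s / (1 + s))\<^sup>2) at_top"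
        using eventually_ge_at_top[of 0] by eventually_elim (simp add: field_simps)
      ultimately have "((\<lambda>s::real. 2 * pi * (s / (1 + s))\<^sup>2) \<longlongrightarrow> 2 * pi * (1 - 0)\<^sup>2) at_top"
        by (rule Lim_transform_eventually)
      then show ?thesis by simp
    qed
  qed simp
  finally show ?thesis by simp
qed

section \<open>Diagonal subsequences\<close>

lemma diagonal_convergent_subseq:
  fixes a :: "nat \<Rightarrow> nat \<Rightarrow> real"
  assumes "\<And>i. bounded (range (a i))"
  obtains \<sigma> :: "nat \<Rightarrow> nat" where "strict_mono \<sigma>" "\<And>i. convergent (\<lambda>k. a i (\<sigma> k))"
proof -
  interpret subseqs "\<lambda>i s. convergent (\<lambda>k. a i (s k))"
  proof
    fix i and s :: "nat \<Rightarrow> nat"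
    have "bounded (range (\<lambda>k. a i (s k)))" using assms[of i] by (rule bounded_subset) auto
    then obtain l r where "strict_mono r" "((\<lambda>k. a i (s k)) \<circ> r) \<longlonglongrightarrow> l"
      using bounded_imp_convergent_subsequence by blast
    then show "\<exists>r'. strict_mono r' \<and> convergent (\<lambda>k. a i ((s \<circ> r') k))"
      by (auto simp: convergent_def o_def)
  qed
  have "convergent (\<lambda>k. a i (diagseq k))" for i
  proof -
    \<comment> \<open>The diagonal sequence inherits the i-th property only after its first Suc i
      terms have been dropped; convergence does not notice the initial segment.\<close>
    have "convergent (\<lambda>k. a i ((diagseq \<circ> ((+) (Suc i))) k))"
    proof (rule diagseq_holds)
      fix r s :: "nat \<Rightarrow> nat" and n assume "strict_mono r" "convergent (\<lambda>k. a n (s k))"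
      then show "convergent (\<lambda>k. a n ((s \<circ> r) k))"
        using convergent_subseq_convergent[of "\<lambda>k. a n (s k)" r] by (simp add: o_def)
    qed
    then have "convergent (\<lambda>k. a i (diagseq (k + Suc i)))" by (simp add: o_def add.commute)
    then show ?thesis using convergent_ignore_initial_segment[of "\<lambda>k. a i (diagseq k)" "Suc i"] by simp
  qed
  then show ?thesis using that subseq_diagseq by blast
qed

subsection \<open>Convergence in L^q\<close>

text \<open>This replaces Hoelder interpolation: small convergence in L^1, a bound in L^s and finite
  measure together make the L^q integral small, where the price C depends on \<delta> alone. Small t
  are paid by the constant, large t by t^s, and the range between by the linear term.\<close>

lemma powr_interpolation:
  fixes q s \<delta> :: real
  assumes "0 < q" "q < s" "\<delta> > 0"
  shows "\<exists>C\<ge>0. \<forall>t\<ge>0. t powr q \<le> \<delta> + \<delta> * t powr s + C * t"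
proof -
  \<comment> \<open>Up to \<open>a\<close> one has t^q \<le> \<delta>, and beyond \<open>b\<close>
    one has t^(q-s) \<le> \<delta>; between them t^q is at most b^q \<le> (b^q / a) t.\<close>
  define a where "a = \<delta> powr (1 / q)"
  define b where "b = max a (\<delta> powr (1 / (q - s)))"
  have a: "a > 0" "a powr q = \<delta>" using assms by (auto simp: a_def powr_powr)
  have b: "b \<ge> a" "b > 0" using a by (auto simp: b_def)
  have "b powr (q - s) \<le> (\<delta> powr (1 / (q - s))) powr (q - s)"
    using assms by (intro powr_mono2') (auto simp: b_def)
  then have bs: "b powr (q - s) \<le> \<delta>" using assms by (simp add: powr_powr)
  show ?thesis
  proof (intro exI[of _ "b powr q / a"] conjI allI impI)
    fix t :: real assume t: "0 \<le> t"
    have pos: "\<delta> * t powr s \<ge> 0" "b powr q / a * t \<ge> 0" using assms a t by auto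
    consider "t \<le> a" | "a < t" "t \<le> b" | "b < t" by linarith
    then show "t powr q \<le> \<delta> + \<delta> * t powr s + b powr q / a * t"
    proof cases
      case 1
      then have "t powr q \<le> \<delta>" using powr_mono2[of q t a] t assms a by simp
      then show ?thesis using pos by linarith
    next
      case 2
      have "t powr q \<le> b powr q" using powr_mono2[of q t b] t assms 2 by simp
      also have "\<dots> \<le> b powr q / a * t" using 2 a by (simp add: field_simps mult_left_mono)
      finally show ?thesis using pos assms by linarith
    next
      case 3
      have "t powr q = t powr (q - s) * t powr s" by (simp flip: powr_add)
      also have "\<dots> \<le> \<delta> * t powr s"
        using powr_mono2'[of "q - s" b t] b 3 assms bs by (intro mult_right_mono) auto
      finally show ?thesis using pos assms by linarith
    qed
  qed (use a in auto)
qed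

lemma norm_diff_powr_le:
  fixes x y :: "'a::real_normed_vector"
  assumes "s > 0"
  shows "norm (x - y) powr s \<le> 2 powr s * (norm x powr s + norm y powr s)"
proof -
  have "norm (x - y) powr s \<le> (2 * max (norm x) (norm y)) powr s"
    using assms norm_triangle_ineq4[of x y] by (intro powr_mono2) auto
  also have "\<dots> = 2 powr s * max (norm x) (norm y) powr s" by (simp add: powr_mult)
  also have "\<dots> \<le> 2 powr s * (norm x powr s + norm y powr s)"
    by (intro mult_left_mono) (auto simp: max_def)
  finally show ?thesis .
qed

lemma le_one_plus_powr: "0 \<le> t \<Longrightarrow> 0 < q \<Longrightarrow> q \<le> s \<Longrightarrow> t powr q \<le> 1 + t powr (s::real)"
proof (cases "t \<le> 1")
  case True
  assume "0 \<le> t" "0 < q" then show ?thesis using True powr_le1[of q t] by (smt (verit) powr_ge_zero)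
next
  case False
  assume "q \<le> s" then have "t powr q \<le> t powr s" using False by (intro powr_mono) auto
  then show ?thesis by simp
qed

text \<open>The limit is taken almost everywhere along a subsequence. Fatou's lemma carries the L^s
  bound to it, and applied in the second index of the Cauchy condition it gives L^1 convergence of
  the whole sequence. \<open>powr_interpolation\<close> raises the exponent to any q < s.\<close>

lemma L1_Cauchy_imp_Lq_limit:
  fixes f :: "nat \<Rightarrow> 'a \<Rightarrow> 'b::euclidean_space"
  assumes meas [measurable]: "\<And>k. f k \<in> borel_measurable M"
    and fin: "emeasure M (space M) < \<infinity>"
    and s: "1 < s"
    and bd: "\<And>k. (\<integral>\<^sup>+x. ennreal (norm (f k x) powr s) \<partial>M) \<le> ennreal K"
    and cau: "\<And>e. e > 0 \<Longrightarrow> \<exists>N. \<forall>i\<ge>N. \<forall>j\<ge>N. (\<integral>\<^sup>+x. ennreal (norm (f i x - f j x)) \<partial>M) \<le> ennreal e"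
  obtains F where "F \<in> borel_measurable M"
    "(\<integral>\<^sup>+x. ennreal (norm (F x) powr s) \<partial>M) \<le> ennreal K"
    "\<And>q. 0 < q \<Longrightarrow> q < s \<Longrightarrow> (\<lambda>k. \<integral>\<^sup>+x. ennreal (norm (f k x - F x) powr q) \<partial>M) \<longlonglongrightarrow> 0"
proof -
  have int: "integrable M (f k)" for k
  proof (rule integrableI_bounded)
    have "(\<integral>\<^sup>+x. ennreal (norm (f k x)) \<partial>M) \<le> (\<integral>\<^sup>+x. 1 + ennreal (norm (f k x) powr s) \<partial>M)"
    proof (intro nn_integral_mono)
      fix x
      have "norm (f k x) \<le> 1 + norm (f k x) powr s"
        using le_one_plus_powr[of "norm (f k x)" 1 s] s by simp
      then have "ennreal (norm (f k x)) \<le> ennreal (1 + norm (f k x) powr s)" by (rule ennreal_leI)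
      then show "ennreal (norm (f k x)) \<le> 1 + ennreal (norm (f k x) powr s)" by simp
    qed
    also have "\<dots> = emeasure M (space M) + (\<integral>\<^sup>+x. ennreal (norm (f k x) powr s) \<partial>M)"
      by (simp add: nn_integral_add)
    also have "\<dots> < \<infinity>" using fin bd[of k] by (simp add: order_le_less_trans)
    finally show "(\<integral>\<^sup>+x. ennreal (norm (f k x)) \<partial>M) < \<infinity>" .
  qed simp
  have cau': "\<exists>N. \<forall>i\<ge>N. \<forall>j\<ge>N. (LINT x|M. norm (f i x - f j x)) < e" if epos: "e > 0" for e
  proof -
    obtain N where N: "\<forall>i\<ge>N. \<forall>j\<ge>N. (\<integral>\<^sup>+x. ennreal (norm (f i x - f j x)) \<partial>M) \<le> ennreal (e / 2)"
      using cau[OF half_gt_zero[OF epos]] by blast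
    have "(LINT x|M. norm (f i x - f j x)) < e" if "i \<ge> N" "j \<ge> N" for i j
    proof -
      have "ennreal (LINT x|M. norm (f i x - f j x)) \<le> ennreal (e / 2)"
        using N that by (subst nn_integral_eq_integral[symmetric]) (auto intro!: Bochner_Integration.integrable_diff int)
      then show ?thesis using \<open>e > 0\<close> by (simp add: ennreal_le_iff)
    qed
    then show ?thesis by blast
  qed
  obtain r where r: "strict_mono r" "AE x in M. Cauchy (\<lambda>i. f (r i) x)"
    using cauchy_L1_AE_cauchy_subseq[OF int cau'] by blast
  define F where "F x = lim (\<lambda>i. f (r i) x)" for x
  have F [measurable]: "F \<in> borel_measurable M"
    unfolding F_def by (rule borel_measurable_lim_metric) simp
  have lim: "AE x in M. (\<lambda>i. f (r i) x) \<longlonglongrightarrow> F x"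
    using r(2) by eventually_elim (simp add: F_def Cauchy_convergent_iff convergent_LIMSEQ_iff)
  have Fs: "(\<integral>\<^sup>+x. ennreal (norm (F x) powr s) \<partial>M) \<le> ennreal K"
  proof -
    have "(\<integral>\<^sup>+x. ennreal (norm (F x) powr s) \<partial>M) = (\<integral>\<^sup>+x. liminf (\<lambda>i. ennreal (norm (f (r i) x) powr s)) \<partial>M)"
    proof (rule nn_integral_cong_AE, use lim in eventually_elim)
      fix x assume "(\<lambda>i. f (r i) x) \<longlonglongrightarrow> F x"
      then have "(\<lambda>i. ennreal (norm (f (r i) x) powr s)) \<longlonglongrightarrow> ennreal (norm (F x) powr s)"
        using s by (intro tendsto_ennrealI tendsto_powr' tendsto_norm tendsto_const) auto
      then show "ennreal (norm (F x) powr s) = liminf (\<lambda>i. ennreal (norm (f (r i) x) powr s))"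
        by (rule lim_imp_Liminf[symmetric, rotated]) simp
    qed
    also have "\<dots> \<le> liminf (\<lambda>i. \<integral>\<^sup>+x. ennreal (norm (f (r i) x) powr s) \<partial>M)"
      by (rule nn_integral_liminf) simp
    also have "\<dots> \<le> ennreal K"
      using Liminf_le[of sequentially "\<lambda>i. \<integral>\<^sup>+x. ennreal (norm (f (r i) x) powr s) \<partial>M" "ennreal K"] bd by simp
    finally show ?thesis .
  qed
  \<comment> \<open>Only the second index runs along the subsequence, so the estimate holds for
    every k \<ge> N.\<close>
  have L1: "\<exists>N. \<forall>k\<ge>N. (\<integral>\<^sup>+x. ennreal (norm (f k x - F x)) \<partial>M) \<le> ennreal e" if epos: "e > 0" for e
  proof -
    obtain N where N: "\<forall>i\<ge>N. \<forall>j\<ge>N. (\<integral>\<^sup>+x. ennreal (norm (f i x - f j x)) \<partial>M) \<le> ennreal e"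
      using cau[OF epos] by blast
    have "(\<integral>\<^sup>+x. ennreal (norm (f k x - F x)) \<partial>M) \<le> ennreal e" if k: "k \<ge> N" for k
    proof -
      have "(\<integral>\<^sup>+x. ennreal (norm (f k x - F x)) \<partial>M) = (\<integral>\<^sup>+x. liminf (\<lambda>i. ennreal (norm (f k x - f (r i) x))) \<partial>M)"
      proof (rule nn_integral_cong_AE, use lim in eventually_elim)
        fix x assume "(\<lambda>i. f (r i) x) \<longlonglongrightarrow> F x"
        then have "(\<lambda>i. ennreal (norm (f k x - f (r i) x))) \<longlonglongrightarrow> ennreal (norm (f k x - F x))"
          by (intro tendsto_ennrealI tendsto_norm tendsto_diff tendsto_const) auto
        then show "ennreal (norm (f k x - F x)) = liminf (\<lambda>i. ennreal (norm (f k x - f (r i) x)))"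
          by (rule lim_imp_Liminf[symmetric, rotated]) simp
      qed
      also have "\<dots> \<le> liminf (\<lambda>i. \<integral>\<^sup>+x. ennreal (norm (f k x - f (r i) x)) \<partial>M)"
        by (rule nn_integral_liminf) simp
      also have "\<dots> \<le> ennreal e"
      proof (rule Liminf_le)
        have "eventually (\<lambda>i. r i \<ge> N) sequentially"
          using filterlim_subseq[OF r(1)] by (simp add: filterlim_at_top)
        then show "\<forall>\<^sub>F i in sequentially. (\<integral>\<^sup>+x. ennreal (norm (f k x - f (r i) x)) \<partial>M) \<le> ennreal e"
          by eventually_elim (use N k in auto)
      qed simp
      finally show ?thesis .
    qed
    then show ?thesis by blast
  qed
  have K0: "(\<integral>\<^sup>+x. ennreal (norm (f k x - F x) powr s) \<partial>M) \<le> ennreal (2 powr s) * (ennreal K + ennreal K)" for k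
  proof -
    have "(\<integral>\<^sup>+x. ennreal (norm (f k x - F x) powr s) \<partial>M)
      \<le> (\<integral>\<^sup>+x. ennreal (2 powr s) * (ennreal (norm (f k x) powr s) + ennreal (norm (F x) powr s)) \<partial>M)"
      using s by (intro nn_integral_mono)
       (simp add: ennreal_leI norm_diff_powr_le flip: ennreal_plus ennreal_mult)
    also have "\<dots> = ennreal (2 powr s) * ((\<integral>\<^sup>+x. ennreal (norm (f k x) powr s) \<partial>M) + (\<integral>\<^sup>+x. ennreal (norm (F x) powr s) \<partial>M))"
      by (simp add: nn_integral_cmult nn_integral_add)
    also have "\<dots> \<le> ennreal (2 powr s) * (ennreal K + ennreal K)"
      by (intro mult_left_mono add_mono bd Fs) auto
    finally show ?thesis .
  qed
  have "(\<lambda>k. \<integral>\<^sup>+x. ennreal (norm (f k x - F x) powr q) \<partial>M) \<longlonglongrightarrow> 0" if q: "0 < q" "q < s" for q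
  proof (rule tendsto_zero_ennreal)
    fix e :: real assume e: "e > 0"
    obtain m where m: "emeasure M (space M) = ennreal m" "m \<ge> 0" using fin by (cases "emeasure M (space M)") auto
    \<comment> \<open>The sign of K is not known; the absolute values make the real constant
      non-negative, so that it can be moved through \<open>ennreal\<close>.\<close>
    define K' where "K' = 2 powr s * (\<bar>K\<bar> + \<bar>K\<bar>)"
    have K': "(\<integral>\<^sup>+x. ennreal (norm (f k x - F x) powr s) \<partial>M) \<le> ennreal K'" for k
    proof -
      have "ennreal (2 powr s) * (ennreal K + ennreal K) \<le> ennreal (2 powr s) * (ennreal \<bar>K\<bar> + ennreal \<bar>K\<bar>)"
        by (intro mult_left_mono add_mono ennreal_leI) auto
      also have "\<dots> = ennreal K'"
        unfolding K'_def by (subst ennreal_mult, simp, simp, subst ennreal_plus) auto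
      finally show ?thesis using K0[of k] order_trans by blast
    qed
    define S where "S = m + K' + 1"
    \<comment> \<open>\<open>\<delta>\<close> is chosen so that \<delta> times the measure plus
      \<delta> times K' is at most e / 4. This fixes C, and only afterwards N makes C times the L^1
      distance at most e / 4.\<close>
    define \<delta> where "\<delta> = e / (4 * S)"
    have K'0: "K' \<ge> 0" by (simp add: K'_def)
    have S: "S > 0" using m K'0 by (simp add: S_def)
    have \<delta>: "\<delta> > 0" using e S by (simp add: \<delta>_def)
    obtain C where C: "C \<ge> 0" "\<And>t. t \<ge> 0 \<Longrightarrow> t powr q \<le> \<delta> + \<delta> * t powr s + C * t"
      using powr_interpolation[OF q \<delta>] by blast
    obtain N where N: "\<forall>k\<ge>N. (\<integral>\<^sup>+x. ennreal (norm (f k x - F x)) \<partial>M) \<le> ennreal (e / (4 * (C + 1)))"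
      using L1[of "e / (4 * (C + 1))"] e C(1) by (auto simp: divide_pos_pos)
    have "(\<integral>\<^sup>+x. ennreal (norm (f k x - F x) powr q) \<partial>M) < ennreal e" if k: "k \<ge> N" for k
    proof -
      have "(\<integral>\<^sup>+x. ennreal (norm (f k x - F x) powr q) \<partial>M)
        \<le> (\<integral>\<^sup>+x. ennreal \<delta> + ennreal \<delta> * ennreal (norm (f k x - F x) powr s) + ennreal C * ennreal (norm (f k x - F x)) \<partial>M)"
        using C \<delta> by (intro nn_integral_mono) (simp add: ennreal_leI flip: ennreal_plus ennreal_mult)
      also have "\<dots> = ennreal \<delta> * ennreal m + ennreal \<delta> * (\<integral>\<^sup>+x. ennreal (norm (f k x - F x) powr s) \<partial>M)
          + ennreal C * (\<integral>\<^sup>+x. ennreal (norm (f k x - F x)) \<partial>M)"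
        by (simp add: nn_integral_cmult nn_integral_add m)
      also have "\<dots> \<le> ennreal \<delta> * ennreal m + ennreal \<delta> * ennreal K' + ennreal C * ennreal (e / (4 * (C + 1)))"
        using N k by (intro add_mono mult_left_mono K') auto
      also have "\<dots> = ennreal (\<delta> * m + \<delta> * K' + C * (e / (4 * (C + 1))))"
        using \<delta> m K'0 C e by (simp flip: ennreal_mult ennreal_plus)
      also have "\<dots> < ennreal e"
      proof (rule ennreal_lessI[OF e])
        have "\<delta> * m + \<delta> * K' \<le> \<delta> * S" using \<delta> by (simp add: S_def algebra_simps)
        also have "\<dots> = e / 4" using S by (simp add: \<delta>_def)
        finally have 1: "\<delta> * m + \<delta> * K' \<le> e / 4" .
        have "C * (e / (4 * (C + 1))) \<le> e / 4" using C e by (simp add: field_simps)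
        then show "\<delta> * m + \<delta> * K' + C * (e / (4 * (C + 1))) < e" using 1 e by linarith
      qed
      finally show ?thesis .
    qed
    then show "\<forall>\<^sub>F k in sequentially. (\<integral>\<^sup>+x. ennreal (norm (f k x - F x) powr q) \<partial>M) < ennreal e"
      unfolding eventually_sequentially by blast
  qed
  then show ?thesis using that F Fs by blast
qed

subsection \<open>Poincare inequality\<close>

text \<open>Fundamental theorem along the segment from x to y, which stays in \<Omega> by convexity.
  The indicator is harmless there, and it makes the integrand meaningful for all points, as the
  gradient is controlled on \<Omega> only.\<close>

lemma abs_diff_le_integral_grad:
  fixes f :: "complex \<Rightarrow> real"
  assumes diff: "\<And>z. z \<in> \<Omega> \<Longrightarrow> f differentiable (at z)"
    and cont: "continuous_on \<Omega> (grad f)" and conv: "convex \<Omega>" and x: "x \<in> \<Omega>" "y \<in> \<Omega>"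
  shows "ennreal \<bar>f y - f x\<bar> \<le> ennreal (norm (y - x)) *
    (\<integral>\<^sup>+t\<in>{0..1}. ennreal (norm (grad f (x + t *\<^sub>R (y - x))) * indicator \<Omega> (x + t *\<^sub>R (y - x))) \<partial>lborel)"
proof -
  define h where "h t = grad f (x + t *\<^sub>R (y - x)) \<bullet> (y - x)" for t
  have in_seg: "x + t *\<^sub>R (y - x) \<in> \<Omega>" if "t \<in> {0..1}" for t
  proof -
    have "(1 - t) *\<^sub>R x + t *\<^sub>R y \<in> \<Omega>" using convexD_alt[OF conv x, of t] that by auto
    then show ?thesis by (simp add: algebra_simps)
  qed
  have der: "((\<lambda>t. f (x + t *\<^sub>R (y - x))) has_vector_derivative h t) (at t within {0..1})" if "t \<in> {0..1}" for t
  proof -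
    have 1: "((\<lambda>t. x + t *\<^sub>R (y - x)) has_derivative (\<lambda>s. s *\<^sub>R (y - x))) (at t within {0..1})"
      by (auto intro!: derivative_eq_intros)
    have 2: "(f has_derivative (\<lambda>v. pderiv_dir v f (x + t *\<^sub>R (y - x)))) (at (x + t *\<^sub>R (y - x)))"
      by (intro has_derivative_pderiv_dir diff in_seg that)
    have "((\<lambda>t. f (x + t *\<^sub>R (y - x))) has_derivative (\<lambda>s. pderiv_dir (s *\<^sub>R (y - x)) f (x + t *\<^sub>R (y - x)))) (at t within {0..1})"
      using has_derivative_compose[OF 1 2] .
    moreover have "(\<lambda>s. pderiv_dir (s *\<^sub>R (y - x)) f (x + t *\<^sub>R (y - x))) = (\<lambda>s. s *\<^sub>R h t)"
      using linear_cmul[OF has_derivative_linear[OF 2]] grad_inner[OF diff[OF in_seg[OF that]]]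
      by (auto simp: h_def)
    ultimately show ?thesis unfolding has_vector_derivative_def by simp
  qed
  have hc: "continuous_on {0..1} h"
    unfolding h_def using in_seg by (intro continuous_intros continuous_on_compose2[OF cont]) auto
  have int: "(h has_integral (f (x + 1 *\<^sub>R (y - x)) - f (x + 0 *\<^sub>R (y - x)))) {0..1}"
    by (rule fundamental_theorem_of_calculus) (use der in auto)
  have "(\<lambda>t. norm (h t)) integrable_on {0..1}"
    by (intro integrable_continuous_interval continuous_intros hc)
  then have "norm (f y - f x) \<le> integral {0..1} (\<lambda>t. norm (h t))"
    using int integral_norm_bound_integral[of h "{0..1}" "\<lambda>t. norm (h t)"] hc
    by (auto simp: integrable_continuous_interval continuous_on_norm has_integral_iff)
  also have "\<dots> \<le> integral {0..1} (\<lambda>t. norm (y - x) * norm (grad f (x + t *\<^sub>R (y - x))))"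
    using hc in_seg unfolding h_def
    by (intro integral_le integrable_continuous_interval continuous_intros continuous_on_compose2[OF cont])
       (auto simp: mult.commute[of "norm (y - x)"] Cauchy_Schwarz_ineq2)
  finally have *: "\<bar>f y - f x\<bar> \<le> integral {0..1} (\<lambda>t. norm (y - x) * norm (grad f (x + t *\<^sub>R (y - x))))" by simp
  have c2: "continuous_on {0..1} (\<lambda>t. norm (y - x) * norm (grad f (x + t *\<^sub>R (y - x))))"
    using in_seg by (intro continuous_intros continuous_on_compose2[OF cont]) auto
  have m: "(\<lambda>t. norm (grad f (x + t *\<^sub>R (y - x))) * indicator {0..1} t) \<in> borel_measurable borel"
  proof -
    have "(\<lambda>t. indicator {0..1} t *\<^sub>R norm (grad f (x + t *\<^sub>R (y - x)))) \<in> borel_measurable borel"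
      by (rule borel_measurable_continuous_on_indicator)
        (use in_seg in \<open>auto intro!: continuous_intros continuous_on_compose2[OF cont]\<close>)
    then show ?thesis by (simp add: mult.commute)
  qed
  have "ennreal (integral {0..1} (\<lambda>t. norm (y - x) * norm (grad f (x + t *\<^sub>R (y - x)))))
     = (\<integral>\<^sup>+t\<in>{0..1}. ennreal (norm (y - x) * norm (grad f (x + t *\<^sub>R (y - x)))) \<partial>lborel)"
  proof -
    have "set_integrable lborel {0..1} (\<lambda>t. norm (y - x) * norm (grad f (x + t *\<^sub>R (y - x))))"
      using c2 by (rule borel_integrable_atLeastAtMost')
    then have i: "integrable lborel (\<lambda>t. indicator {0..1} t *\<^sub>R (norm (y - x) * norm (grad f (x + t *\<^sub>R (y - x)))))"
      and eq: "integral {0..1} (\<lambda>t. norm (y - x) * norm (grad f (x + t *\<^sub>R (y - x)))) =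
        (LBINT t. indicator {0..1} t *\<^sub>R (norm (y - x) * norm (grad f (x + t *\<^sub>R (y - x)))))"
      using set_borel_integral_eq_integral(2)[of "{0..1}" "\<lambda>t. norm (y - x) * norm (grad f (x + t *\<^sub>R (y - x)))"]
      unfolding set_integrable_def set_lebesgue_integral_def by simp_all
    show ?thesis unfolding eq
      by (subst nn_integral_eq_integral[OF i, symmetric]) (auto intro!: nn_integral_cong simp: indicator_def)
  qed
  also have "\<dots> = (\<integral>\<^sup>+t. ennreal (norm (y - x)) * (ennreal (norm (grad f (x + t *\<^sub>R (y - x))) * indicator {0..1} t)) \<partial>lborel)"
    by (intro nn_integral_cong) (auto simp: indicator_def ennreal_mult)
  also have "\<dots> = ennreal (norm (y - x)) * (\<integral>\<^sup>+t. ennreal (norm (grad f (x + t *\<^sub>R (y - x))) * indicator {0..1} t) \<partial>lborel)"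
    by (rule nn_integral_cmult) (use m in measurable)
  also have "(\<integral>\<^sup>+t. ennreal (norm (grad f (x + t *\<^sub>R (y - x))) * indicator {0..1} t) \<partial>lborel)
    = (\<integral>\<^sup>+t\<in>{0..1}. ennreal (norm (grad f (x + t *\<^sub>R (y - x))) * indicator \<Omega> (x + t *\<^sub>R (y - x))) \<partial>lborel)"
    using in_seg by (intro nn_integral_cong) (auto simp: indicator_def)
  finally show ?thesis using * by (metis ennreal_leI)
qed

text \<open>For a fixed position t on the segment, x + t (y - x) is an affine function of y with
  factor t and of x with factor 1 - t. Substituting in the variable whose factor is at least 1/2
  costs a Jacobian of at most 4, so no singularity arises at t = 0 or t = 1. The remaining variable
  contributes the area of \<Omega>.\<close>

lemma Poincare_convex:
  fixes f :: "complex \<Rightarrow> real"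
  assumes diff: "\<And>z. z \<in> \<Omega> \<Longrightarrow> f differentiable (at z)"
    and cont: "continuous_on \<Omega> (grad f)" and conv: "convex \<Omega>" and [measurable]: "\<Omega> \<in> sets borel"
    and d: "\<And>x y. x \<in> \<Omega> \<Longrightarrow> y \<in> \<Omega> \<Longrightarrow> norm (x - y) \<le> d"
  shows "(\<integral>\<^sup>+x\<in>\<Omega>. (\<integral>\<^sup>+y\<in>\<Omega>. ennreal \<bar>f y - f x\<bar> \<partial>lborel) \<partial>lborel)
     \<le> ennreal (4 * d) * emeasure lborel \<Omega> * (\<integral>\<^sup>+z\<in>\<Omega>. ennreal (norm (grad f z)) \<partial>lborel)"
proof -
  define h where "h z = ennreal (norm (grad f z) * indicator \<Omega> z)" for z
  have h [measurable]: "h \<in> borel_measurable borel"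
  proof -
    have "(\<lambda>z. indicator \<Omega> z *\<^sub>R norm (grad f z)) \<in> borel_measurable borel"
      by (rule borel_measurable_continuous_on_indicator) (auto intro!: continuous_intros cont)
    then have "(\<lambda>z. norm (grad f z) * indicator \<Omega> z) \<in> borel_measurable borel" by (simp add: mult.commute)
    then show ?thesis unfolding h_def by measurable
  qed
  let ?H = "\<integral>\<^sup>+z. h z \<partial>lborel"
  have H: "(\<integral>\<^sup>+z\<in>\<Omega>. ennreal (norm (grad f z)) \<partial>lborel) = ?H"
    unfolding h_def by (intro nn_integral_cong) (auto simp: indicator_def)
  have 1: "(\<integral>\<^sup>+x. (\<integral>\<^sup>+y. h (x + t *\<^sub>R (y - x)) * indicator \<Omega> x * indicator \<Omega> y \<partial>lborel) \<partial>lborel)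
     \<le> 4 * emeasure lborel \<Omega> * ?H" if t: "t \<in> {0..1}" for t
  proof -
    have aff: "(\<integral>\<^sup>+y. h (a + s *\<^sub>R y) \<partial>lborel) \<le> 4 * ?H" if "s \<ge> 1/2" for a s
    proof -
      have "1 \<le> (2 * s)\<^sup>2" using that by (intro one_le_power) simp
      then have "1 / s\<^sup>2 \<le> 4" using that by (simp add: power_mult_distrib divide_le_eq)
      then have "ennreal (1 / s\<^sup>2) \<le> 4" using ennreal_leI by fastforce
      then show ?thesis using that by (subst nn_integral_affine_complex) (auto intro: mult_right_mono)
    qed
    show ?thesis
    proof (cases "t \<ge> 1/2")
      case True
      have "(\<integral>\<^sup>+x. (\<integral>\<^sup>+y. h (x + t *\<^sub>R (y - x)) * indicator \<Omega> x * indicator \<Omega> y \<partial>lborel) \<partial>lborel)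
        \<le> (\<integral>\<^sup>+x. (4 * ?H) * indicator \<Omega> x \<partial>lborel)"
      proof (rule nn_integral_mono)
        fix x
        have "(\<integral>\<^sup>+y. h (x + t *\<^sub>R (y - x)) * indicator \<Omega> x * indicator \<Omega> y \<partial>lborel)
          \<le> (\<integral>\<^sup>+y. h ((1 - t) *\<^sub>R x + t *\<^sub>R y) * indicator \<Omega> x \<partial>lborel)"
          by (intro nn_integral_mono) (auto simp: indicator_def algebra_simps)
        also have "\<dots> \<le> (4 * ?H) * indicator \<Omega> x"
          using aff[OF True, of "(1 - t) *\<^sub>R x"] by (auto simp: indicator_def)
        finally show "(\<integral>\<^sup>+y. h (x + t *\<^sub>R (y - x)) * indicator \<Omega> x * indicator \<Omega> y \<partial>lborel) \<le> (4 * ?H) * indicator \<Omega> x" .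
      qed
      also have "\<dots> = (4 * ?H) * emeasure lborel \<Omega>" by (rule nn_integral_cmult_indicator) simp
      finally show ?thesis by (simp add: mult_ac)
    next
      case False
      then have t2: "1 - t \<ge> 1/2" by simp
      have "(\<integral>\<^sup>+x. (\<integral>\<^sup>+y. h (x + t *\<^sub>R (y - x)) * indicator \<Omega> x * indicator \<Omega> y \<partial>lborel) \<partial>lborel)
        = (\<integral>\<^sup>+y. (\<integral>\<^sup>+x. h (x + t *\<^sub>R (y - x)) * indicator \<Omega> x * indicator \<Omega> y \<partial>lborel) \<partial>lborel)"
        by (rule lborel_pair.Fubini'[symmetric]) measurable
      also have "\<dots> \<le> (\<integral>\<^sup>+y. (4 * ?H) * indicator \<Omega> y \<partial>lborel)"
      proof (rule nn_integral_mono)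
        fix y
        have "(\<integral>\<^sup>+x. h (x + t *\<^sub>R (y - x)) * indicator \<Omega> x * indicator \<Omega> y \<partial>lborel)
          \<le> (\<integral>\<^sup>+x. h (t *\<^sub>R y + (1 - t) *\<^sub>R x) * indicator \<Omega> y \<partial>lborel)"
          by (intro nn_integral_mono) (auto simp: indicator_def algebra_simps)
        also have "\<dots> \<le> (4 * ?H) * indicator \<Omega> y"
          using aff[OF t2, of "t *\<^sub>R y"] by (auto simp: indicator_def)
        finally show "(\<integral>\<^sup>+x. h (x + t *\<^sub>R (y - x)) * indicator \<Omega> x * indicator \<Omega> y \<partial>lborel) \<le> (4 * ?H) * indicator \<Omega> y" .
      qed
      also have "\<dots> = (4 * ?H) * emeasure lborel \<Omega>" by (rule nn_integral_cmult_indicator) simp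
      finally show ?thesis by (simp add: mult_ac)
    qed
  qed
  have "(\<integral>\<^sup>+x\<in>\<Omega>. (\<integral>\<^sup>+y\<in>\<Omega>. ennreal \<bar>f y - f x\<bar> \<partial>lborel) \<partial>lborel)
    \<le> (\<integral>\<^sup>+x. (\<integral>\<^sup>+y. (\<integral>\<^sup>+t. ennreal d * (h (x + t *\<^sub>R (y - x)) * indicator \<Omega> x * indicator \<Omega> y * indicator {0..1} t) \<partial>lborel) \<partial>lborel) \<partial>lborel)"
  proof (rule nn_integral_mono)
    fix x
    have pt: "ennreal \<bar>f y - f x\<bar> * indicator \<Omega> y
      \<le> (\<integral>\<^sup>+t. ennreal d * (h (x + t *\<^sub>R (y - x)) * indicator \<Omega> x * indicator \<Omega> y * indicator {0..1} t) \<partial>lborel)"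
      if x: "x \<in> \<Omega>" for y
    proof (cases "y \<in> \<Omega>")
      case True
      have "ennreal \<bar>f y - f x\<bar> \<le> ennreal (norm (y - x)) *
          (\<integral>\<^sup>+t\<in>{0..1}. ennreal (norm (grad f (x + t *\<^sub>R (y - x))) * indicator \<Omega> (x + t *\<^sub>R (y - x))) \<partial>lborel)"
        by (rule abs_diff_le_integral_grad[OF diff cont conv x True])
      also have "\<dots> \<le> ennreal d * (\<integral>\<^sup>+t. h (x + t *\<^sub>R (y - x)) * indicator {0..1} t \<partial>lborel)"
        unfolding h_def by (intro mult_right_mono ennreal_leI d True x) auto
      also have "\<dots> = (\<integral>\<^sup>+t. ennreal d * (h (x + t *\<^sub>R (y - x)) * indicator {0..1} t) \<partial>lborel)"
        by (rule nn_integral_cmult[symmetric]) measurable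
      finally show ?thesis using True x by simp
    qed simp
    show "(\<integral>\<^sup>+y\<in>\<Omega>. ennreal \<bar>f y - f x\<bar> \<partial>lborel) * indicator \<Omega> x
      \<le> (\<integral>\<^sup>+y. (\<integral>\<^sup>+t. ennreal d * (h (x + t *\<^sub>R (y - x)) * indicator \<Omega> x * indicator \<Omega> y * indicator {0..1} t) \<partial>lborel) \<partial>lborel)"
    proof (cases "x \<in> \<Omega>")
      case True
      then show ?thesis using pt[OF True] by (auto intro!: nn_integral_mono)
    qed simp
  qed
  also have "\<dots> = (\<integral>\<^sup>+t. (\<integral>\<^sup>+x. (\<integral>\<^sup>+y. ennreal d * (h (x + t *\<^sub>R (y - x)) * indicator \<Omega> x * indicator \<Omega> y * indicator {0..1} t) \<partial>lborel) \<partial>lborel) \<partial>lborel)"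
  proof -
    have "(\<integral>\<^sup>+x. (\<integral>\<^sup>+y. (\<integral>\<^sup>+t. ennreal d * (h (x + t *\<^sub>R (y - x)) * indicator \<Omega> x * indicator \<Omega> y * indicator {0..1} t) \<partial>lborel) \<partial>lborel) \<partial>lborel)
      = (\<integral>\<^sup>+x. (\<integral>\<^sup>+t. (\<integral>\<^sup>+y. ennreal d * (h (x + t *\<^sub>R (y - x)) * indicator \<Omega> x * indicator \<Omega> y * indicator {0..1} t) \<partial>lborel) \<partial>lborel) \<partial>lborel)"
      by (intro nn_integral_cong lborel_pair.Fubini'[symmetric]) measurable
    also have "\<dots> = (\<integral>\<^sup>+t. (\<integral>\<^sup>+x. (\<integral>\<^sup>+y. ennreal d * (h (x + t *\<^sub>R (y - x)) * indicator \<Omega> x * indicator \<Omega> y * indicator {0..1} t) \<partial>lborel) \<partial>lborel) \<partial>lborel)"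
      by (intro lborel_pair.Fubini'[symmetric]) measurable
    finally show ?thesis .
  qed
  also have "\<dots> = (\<integral>\<^sup>+t. ennreal d * indicator {0..1} t * (\<integral>\<^sup>+x. (\<integral>\<^sup>+y. h (x + t *\<^sub>R (y - x)) * indicator \<Omega> x * indicator \<Omega> y \<partial>lborel) \<partial>lborel) \<partial>lborel)"
    by (intro nn_integral_cong) (auto simp: nn_integral_cmult indicator_def)
  also have "\<dots> \<le> (\<integral>\<^sup>+t. (ennreal d * (4 * emeasure lborel \<Omega> * ?H)) * indicator {0..1} (t::real) \<partial>lborel)"
    using 1 by (intro nn_integral_mono) (auto simp: indicator_def intro!: mult_left_mono)
  also have "\<dots> = ennreal d * (4 * emeasure lborel \<Omega> * ?H)"
    by (subst nn_integral_cmult_indicator) auto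
  \<comment> \<open>A negative d can occur only if \<Omega> is empty; \<open>ennreal\<close> sends
    it to 0.\<close>
  also have "\<dots> = ennreal (4 * d) * emeasure lborel \<Omega> * ?H"
  proof (cases "d \<ge> 0")
    case True
    then have "ennreal (4 * d) = 4 * ennreal d" by (simp add: ennreal_mult)
    then show ?thesis by (simp add: mult_ac)
  next
    case False
    then show ?thesis by (simp add: ennreal_neg)
  qed
  finally show ?thesis unfolding H .
qed

subsection \<open>Newtonian potential\<close>

lemma lborel_integral_translate:
  fixes g :: "complex \<Rightarrow> real"
  assumes [measurable]: "g \<in> borel_measurable borel"
  shows "(LBINT z. g (z + a)) = (LBINT z. g z)"
proof -
  have "(LBINT z. g z) = integral\<^sup>L (distr lborel borel ((+) a)) g" by (simp add: lborel_distr_plus)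
  also have "\<dots> = (LBINT z. g (a + z))" by (rule integral_distr) auto
  finally show ?thesis by (simp add: add.commute)
qed

lemma lborel_integrable_translate:
  fixes g :: "complex \<Rightarrow> real"
  assumes [measurable]: "integrable lborel g"
  shows "integrable lborel (\<lambda>z. g (z + a))"
proof -
  have "integrable (distr lborel borel ((+) a)) g" using assms by (simp add: lborel_distr_plus)
  then have "integrable lborel (\<lambda>z. g (a + z))" by (subst (asm) integrable_distr_eq) auto
  then show ?thesis by (simp add: add.commute)
qed

lemma integrable_continuous_compact_support:
  fixes g :: "complex \<Rightarrow> 'b::{banach, second_countable_topology}"
  assumes "continuous_on K g" "compact K" "\<And>z. z \<notin> K \<Longrightarrow> g z = 0"
  shows "integrable lborel g"
proof -
  have "integrable lborel (\<lambda>x. indicator K x *\<^sub>R g x)" using borel_integrable_compact[OF assms(2,1)]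
    by (simp add: set_integrable_def)
  moreover have "(\<lambda>x. indicator K x *\<^sub>R g x) = g" using assms(3) by (auto simp: indicator_def)
  ultimately show ?thesis by simp
qed

text \<open>By translation invariance the integral of V (z + v) - V z is 0. The difference is also
  the integral of the derivative over t in [0, 1] at z + t v; after Fubini and one more translation
  each t contributes the same number, which is the integral in question. This works in every
  direction v without splitting the plane into coordinates.\<close>

lemma integral_pderiv_dir_eq_0:
  fixes V :: "complex \<Rightarrow> real"
  assumes diff: "\<And>z. V differentiable (at z)" and cont: "continuous_on UNIV (pderiv_dir v V)"
    and K: "compact K" "\<And>z. z \<notin> K \<Longrightarrow> V z = 0"
  shows "integrable lborel (pderiv_dir v V)" "(LBINT z. pderiv_dir v V z) = 0"
proof -
  let ?g = "pderiv_dir v V"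
  have g0: "?g z = 0" if "z \<notin> K" for z
  proof -
    have "pderiv_dir v V z = pderiv_dir v (\<lambda>_. 0) z"
      by (rule pderiv_dir_transform(2)[of "- K"]) (use that K compact_imp_closed in auto)
    then show ?thesis by (simp add: pderiv_dir_def frechet_derivative_const)
  qed
  show g: "integrable lborel ?g"
    using integrable_continuous_compact_support[of K ?g] K cont g0 continuous_on_subset by blast
  have [measurable]: "?g \<in> borel_measurable borel" using cont borel_measurable_continuous_onI by blast
  have Vc: "continuous_on UNIV V" 
    using diff by (auto intro!: continuous_at_imp_continuous_on differentiable_imp_continuous_within)
  then have V: "integrable lborel V" 
    using integrable_continuous_compact_support[of K V] K continuous_on_subset by blast
  have [measurable]: "V \<in> borel_measurable borel" using Vc borel_measurable_continuous_onI by blast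
  have FTC: "(LBINT t. indicator {0..1} t *\<^sub>R ?g (z + t *\<^sub>R v)) = V (z + v) - V z" for z
  proof -
    have der: "((\<lambda>t. V (z + t *\<^sub>R v)) has_vector_derivative ?g (z + t *\<^sub>R v)) (at t within {0..1})" for t
    proof -
      have 1: "((\<lambda>t. z + t *\<^sub>R v) has_derivative (\<lambda>s. s *\<^sub>R v)) (at t within {0..1})"
        by (auto intro!: derivative_eq_intros)
      have 2: "(V has_derivative (\<lambda>w. pderiv_dir w V (z + t *\<^sub>R v))) (at (z + t *\<^sub>R v))"
        by (intro has_derivative_pderiv_dir diff)
      show ?thesis using has_derivative_compose[OF 1 2] linear_cmul[OF has_derivative_linear[OF 2]]
        unfolding has_vector_derivative_def by simp
    qed
    have c: "continuous_on {0..1} (\<lambda>t. ?g (z + t *\<^sub>R v))"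
      by (intro continuous_on_compose2[OF cont] continuous_intros) auto
    have "((\<lambda>t. ?g (z + t *\<^sub>R v)) has_integral (V (z + 1 *\<^sub>R v) - V (z + 0 *\<^sub>R v))) {0..1}"
      by (rule fundamental_theorem_of_calculus) (use der in auto)
    moreover have "set_integrable lborel {0..1} (\<lambda>t. ?g (z + t *\<^sub>R v))"
      using c by (rule borel_integrable_atLeastAtMost')
    ultimately show ?thesis
      using set_borel_integral_eq_integral(2)[of "{0..1}" "\<lambda>t. ?g (z + t *\<^sub>R v)"]
      by (simp add: set_lebesgue_integral_def has_integral_iff)
  qed
  have pair: "integrable (lborel \<Otimes>\<^sub>M lborel) (\<lambda>(t, z). indicator {0..1::real} t *\<^sub>R ?g (z + t *\<^sub>R v))"
  proof (rule lborel_pair.Fubini_integrable)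
    show "(\<lambda>(t, z). indicator {0..1::real} t *\<^sub>R ?g (z + t *\<^sub>R v)) \<in> borel_measurable (lborel \<Otimes>\<^sub>M lborel)"
      by measurable
    have "(LBINT z. norm (indicator {0..1::real} t *\<^sub>R ?g (z + t *\<^sub>R v))) = indicator {0..1} t *\<^sub>R (LBINT z. norm (?g z))" for t
      using lborel_integral_translate[of "\<lambda>z. norm (?g z)" "t *\<^sub>R v"] by (auto simp: indicator_def)
    then show "integrable lborel (\<lambda>t. LBINT z. norm (case (t, z) of (t, z) \<Rightarrow> indicator {0..1::real} t *\<^sub>R ?g (z + t *\<^sub>R v)))"
      by (simp add: integrable_mult_left_iff)
    show "AE t in lborel. integrable lborel (\<lambda>z. case (t, z) of (t, z) \<Rightarrow> indicator {0..1::real} t *\<^sub>R ?g (z + t *\<^sub>R v))"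
      using lborel_integrable_translate[OF g] by (intro AE_I2) auto
  qed
  have "0 = (LBINT z. V (z + v)) - (LBINT z. V z)" by (simp add: lborel_integral_translate)
  also have "\<dots> = (LBINT z. V (z + v) - V z)"
    by (intro Bochner_Integration.integral_diff[symmetric] V lborel_integrable_translate)
  also have "\<dots> = (LBINT z. (LBINT t. indicator {0..1} t *\<^sub>R ?g (z + t *\<^sub>R v)))" by (simp only: FTC)
  also have "\<dots> = (LBINT t. (LBINT z. indicator {0..1} t *\<^sub>R ?g (z + t *\<^sub>R v)))"
    by (rule lborel_pair.Fubini_integral[OF pair])
  also have "\<dots> = (LBINT t. indicator {0..1::real} t *\<^sub>R (LBINT z. ?g z))"
    by (simp add: lborel_integral_translate)
  also have "\<dots> = (LBINT z. ?g z)" by (simp add: content_real)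
  finally show "(LBINT z. ?g z) = 0" by simp
qed

text \<open>Since V vanishes off the compact set K, it is differentiable with derivative 0 on the
  open complement of K. That complement and \<Omega> cover the plane, which reduces the claim to the
  global version.\<close>

lemma integral_pderiv_dir_eq_0_on:
  fixes V :: "complex \<Rightarrow> real"
  assumes \<Omega>: "open \<Omega>" and diff: "\<And>z. z \<in> \<Omega> \<Longrightarrow> V differentiable (at z)"
    and cont: "continuous_on \<Omega> (pderiv_dir v V)"
    and K: "compact K" "K \<subseteq> \<Omega>" "\<And>z. z \<notin> K \<Longrightarrow> V z = 0"
  shows "integrable lborel (pderiv_dir v V)" "(LBINT z. pderiv_dir v V z) = 0"
    "\<And>z. z \<notin> K \<Longrightarrow> pderiv_dir v V z = 0"
proof -
  have oK: "open (- K)" using K(1) compact_imp_closed by auto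
  have tr: "V differentiable (at z)" "pderiv_dir v V z = pderiv_dir v (\<lambda>_. 0) z" if "z \<notin> K" for z
    using pderiv_dir_transform(1)[of "- K" z "\<lambda>_. 0" V] pderiv_dir_transform(2)[of "- K" z "\<lambda>_. 0" V v] that K(3) oK by auto
  show z: "pderiv_dir v V z = 0" if "z \<notin> K" for z
    using tr(2)[OF that] by (simp add: pderiv_dir_def frechet_derivative_const)
  have "continuous_on (- K) (pderiv_dir v V)"
    using z continuous_on_cong[of "- K" "- K" "pderiv_dir v V" "\<lambda>_. 0"] by auto
  then have "continuous_on (\<Omega> \<union> - K) (pderiv_dir v V)"
    using \<Omega> oK cont by (intro continuous_on_open_Un)
  moreover have "\<Omega> \<union> - K = UNIV" using K(2) by auto
  ultimately have c: "continuous_on UNIV (pderiv_dir v V)" by simp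
  have "V differentiable (at z)" for z using diff tr(1) K(2) by (cases "z \<in> K") auto
  from integral_pderiv_dir_eq_0[OF this c K(1) K(3)]
  show "integrable lborel (pderiv_dir v V)" "(LBINT z. pderiv_dir v V z) = 0" by auto
qed

lemma lborel_integral_affine_complex:
  fixes g :: "complex \<Rightarrow> real"
  assumes [measurable]: "g \<in> borel_measurable borel" and s: "s \<noteq> 0"
  shows "(LBINT z. g z) = s\<^sup>2 * (LBINT z. g (a + s *\<^sub>R z))"
proof -
  have "(LBINT z. g z) = integral\<^sup>L (density (distr lborel borel (\<lambda>x. a + s *\<^sub>R x)) (\<lambda>_. \<bar>s\<bar>^DIM(complex))) g"
    using lborel_affine[OF s, of a] by simp
  also have "\<dots> = s\<^sup>2 * (LBINT z. g (a + s *\<^sub>R z))"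
    by (subst integral_density) (auto simp: integral_distr)
  finally show ?thesis .
qed

text \<open>Adding \<epsilon> removes the singularity of ln |\<zeta> - z|. The Laplacian of the
  result is the weight of \<open>nn_integral_poisson_weight\<close> rescaled by the square root of
  \<epsilon>, an approximate identity of mass 2 pi.\<close>

lemma laplacian_log_kernel:
  fixes z :: complex
  assumes e: "\<epsilon> > 0"
  defines "L \<equiv> \<lambda>\<zeta>. ln ((norm (\<zeta> - z))\<^sup>2 + \<epsilon>) / 2"
  shows "L differentiable (at \<zeta>)" "pderiv_dir v L \<zeta> = ((\<zeta> - z) \<bullet> v) / ((norm (\<zeta> - z))\<^sup>2 + \<epsilon>)"
    "pderiv_dir v L differentiable (at \<zeta>)"
    "pderiv_dir v (pderiv_dir v L) \<zeta> = (v \<bullet> v) / ((norm (\<zeta> - z))\<^sup>2 + \<epsilon>) - 2 * ((\<zeta> - z) \<bullet> v)\<^sup>2 / ((norm (\<zeta> - z))\<^sup>2 + \<epsilon>)\<^sup>2"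
    "laplacian L \<zeta> = 2 * \<epsilon> / ((norm (\<zeta> - z))\<^sup>2 + \<epsilon>)\<^sup>2"
proof -
  have pos: "(\<zeta> - z) \<bullet> (\<zeta> - z) + \<epsilon> > 0" for \<zeta> using e by (simp add: add_nonneg_pos)
  have L: "L = (\<lambda>\<zeta>. ln ((\<zeta> - z) \<bullet> (\<zeta> - z) + \<epsilon>) / 2)" by (simp add: L_def power2_norm_eq_inner)
  have d1: "(L has_derivative (\<lambda>v. ((\<zeta> - z) \<bullet> v) / ((norm (\<zeta> - z))\<^sup>2 + \<epsilon>))) (at \<zeta>)" for \<zeta>
    unfolding L using pos[of \<zeta>]
    by (auto intro!: derivative_eq_intros simp: power2_norm_eq_inner inner_commute field_simps)
  show "L differentiable (at \<zeta>)" using d1 differentiable_def by blast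
  have p1: "pderiv_dir v L = (\<lambda>\<zeta>. ((\<zeta> - z) \<bullet> v) / ((\<zeta> - z) \<bullet> (\<zeta> - z) + \<epsilon>))" for v
    using pderiv_dir_eq[OF d1] by (auto simp: power2_norm_eq_inner)
  then show "pderiv_dir v L \<zeta> = ((\<zeta> - z) \<bullet> v) / ((norm (\<zeta> - z))\<^sup>2 + \<epsilon>)" by (simp add: power2_norm_eq_inner)
  have d2: "(pderiv_dir v L has_derivative (\<lambda>w. (w \<bullet> v) / ((\<zeta> - z) \<bullet> (\<zeta> - z) + \<epsilon>)
      - ((\<zeta> - z) \<bullet> v) * (2 * ((\<zeta> - z) \<bullet> w)) / ((\<zeta> - z) \<bullet> (\<zeta> - z) + \<epsilon>)\<^sup>2)) (at \<zeta>)" for v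
    unfolding p1 using pos[of \<zeta>]
    by (auto intro!: derivative_eq_intros simp: inner_commute divide_simps power2_eq_square)
  show "pderiv_dir v L differentiable (at \<zeta>)" using d2 differentiable_def by blast
  show pp: "pderiv_dir v (pderiv_dir v L) \<zeta> = (v \<bullet> v) / ((norm (\<zeta> - z))\<^sup>2 + \<epsilon>) - 2 * ((\<zeta> - z) \<bullet> v)\<^sup>2 / ((norm (\<zeta> - z))\<^sup>2 + \<epsilon>)\<^sup>2" for v
    unfolding pderiv_dir_eq[OF d2] power2_norm_eq_inner by (simp add: power2_eq_square mult_ac)
  have n: "(norm (\<zeta> - z))\<^sup>2 = ((\<zeta> - z) \<bullet> 1)\<^sup>2 + ((\<zeta> - z) \<bullet> \<i>)\<^sup>2"
    by (simp add: cmod_power2 inner_complex_def)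
  define D where "D = (norm (\<zeta> - z))\<^sup>2 + \<epsilon>"
  have D: "D > 0" using pos[of \<zeta>] by (simp add: D_def power2_norm_eq_inner)
  have "laplacian L \<zeta> = 2 / D - 2 * (norm (\<zeta> - z))\<^sup>2 / D\<^sup>2"
    unfolding laplacian_def pp D_def[symmetric] by (simp add: n inner_complex_def diff_divide_distrib add_divide_distrib)
  also have "\<dots> = (2 * D - 2 * (norm (\<zeta> - z))\<^sup>2) / D\<^sup>2"
    using D by (simp add: diff_divide_distrib power2_eq_square)
  also have "2 * D - 2 * (norm (\<zeta> - z))\<^sup>2 = 2 * \<epsilon>" by (simp add: D_def)
  finally show "laplacian L \<zeta> = 2 * \<epsilon> / ((norm (\<zeta> - z))\<^sup>2 + \<epsilon>)\<^sup>2" by (simp add: D_def)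
qed

text \<open>Green's second identity, one direction at a time: the derivative of L W_v - W L_v in
  direction v is L W_vv - W L_vv, and the integral of such a derivative is 0 because W has compact
  support.\<close>

lemma integral_log_kernel_laplacian:
  fixes W :: "complex \<Rightarrow> real"
  assumes W: "Ck_on 2 UNIV W" and K: "compact K" "\<And>z. z \<notin> K \<Longrightarrow> W z = 0" and e: "\<epsilon> > 0"
  shows "(LBINT \<zeta>. ln ((norm (\<zeta> - z))\<^sup>2 + \<epsilon>) / 2 * laplacian W \<zeta>) =
    (LBINT \<zeta>. W \<zeta> * (2 * \<epsilon> / ((norm (\<zeta> - z))\<^sup>2 + \<epsilon>)\<^sup>2))"
proof -
  define L where "L \<zeta> = ln ((norm (\<zeta> - z))\<^sup>2 + \<epsilon>) / 2" for \<zeta>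
  note lk = laplacian_log_kernel[OF e, where z = z, folded L_def[abs_def]]
  note Wd = Ck_on_2_D[OF W, simplified]
  have pos: "(norm (\<zeta> - z))\<^sup>2 + \<epsilon> > 0" for \<zeta> using e by (simp add: add_nonneg_pos)
  have pos': "(norm (\<zeta> - z))\<^sup>2 + \<epsilon> \<noteq> 0" for \<zeta> using pos[of \<zeta>] by linarith
  have cL: "continuous_on UNIV L" unfolding L_def by (intro continuous_intros) (use pos' in auto)
  have cLL: "continuous_on UNIV (pderiv_dir v (pderiv_dir v L))" for v
  proof -
    have eq: "pderiv_dir v (pderiv_dir v L) = (\<lambda>\<zeta>. (v \<bullet> v) / ((norm (\<zeta> - z))\<^sup>2 + \<epsilon>) - 2 * ((\<zeta> - z) \<bullet> v)\<^sup>2 / ((norm (\<zeta> - z))\<^sup>2 + \<epsilon>)\<^sup>2)"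
      using lk(4) by auto
    show ?thesis unfolding eq by (intro continuous_intros) (use pos' in auto)
  qed
  define V where "V v \<zeta> = L \<zeta> * pderiv_dir v W \<zeta> - W \<zeta> * pderiv_dir v L \<zeta>" for v \<zeta>
  have V1: "V v differentiable (at \<zeta>)" for v \<zeta>
    unfolding V_def by (intro differentiable_diff differentiable_mult Wd lk)
  have V2: "pderiv_dir v (V v) = (\<lambda>\<zeta>. L \<zeta> * pderiv_dir v (pderiv_dir v W) \<zeta> - W \<zeta> * pderiv_dir v (pderiv_dir v L) \<zeta>)" for v
    unfolding V_def
    by (rule ext, subst pderiv_dir_diff, intro differentiable_mult Wd lk, intro differentiable_mult Wd lk)
       (simp add: pderiv_dir_mult Wd lk(1,3))
  have W0: "pderiv_dir v W \<zeta> = 0" "pderiv_dir w (pderiv_dir v W) \<zeta> = 0" if "\<zeta> \<notin> K" for v w \<zeta>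
  proof -
    have oK: "open (- K)" using K(1) compact_imp_closed by auto
    have 1: "pderiv_dir v W \<zeta> = 0" if "\<zeta> \<notin> K" for \<zeta>
      using pderiv_dir_transform(2)[of "- K" \<zeta> "\<lambda>_. 0" W v] that K oK by (simp add: pderiv_dir_def frechet_derivative_const)
    then show "pderiv_dir v W \<zeta> = 0" using that by blast
    show "pderiv_dir w (pderiv_dir v W) \<zeta> = 0"
      using pderiv_dir_transform(2)[of "- K" \<zeta> "\<lambda>_. 0" "pderiv_dir v W" w] that 1 oK by (simp add: pderiv_dir_def frechet_derivative_const)
  qed
  have i1: "integrable lborel (\<lambda>\<zeta>. L \<zeta> * pderiv_dir v (pderiv_dir v W) \<zeta>)" for v
    by (rule integrable_continuous_compact_support[OF _ K(1)])
      (use W0 in \<open>auto intro!: continuous_intros continuous_on_subset[OF cL] continuous_on_subset[OF Wd(5)]\<close>)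
  have i2: "integrable lborel (\<lambda>\<zeta>. W \<zeta> * pderiv_dir v (pderiv_dir v L) \<zeta>)" for v
    by (rule integrable_continuous_compact_support[OF _ K(1)])
      (use K in \<open>auto intro!: continuous_intros continuous_on_subset[OF cLL] continuous_on_subset[OF Wd(3)]\<close>)
  have eq: "(LBINT \<zeta>. L \<zeta> * pderiv_dir v (pderiv_dir v W) \<zeta>) = (LBINT \<zeta>. W \<zeta> * pderiv_dir v (pderiv_dir v L) \<zeta>)" for v
  proof -
    have "continuous_on UNIV (pderiv_dir v (V v))"
      unfolding V2 by (intro continuous_intros cL cLL Wd)
    from integral_pderiv_dir_eq_0(2)[OF V1 this K(1)] have "(LBINT z. pderiv_dir v (V v) z) = 0"
      using W0 K(2) by (auto simp: V_def)
    then show ?thesis unfolding V2 using i1 i2 by (simp add: Bochner_Integration.integral_diff)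
  qed
  have "(LBINT \<zeta>. L \<zeta> * laplacian W \<zeta>) = (LBINT \<zeta>. L \<zeta> * pderiv_dir 1 (pderiv_dir 1 W) \<zeta>) + (LBINT \<zeta>. L \<zeta> * pderiv_dir \<i> (pderiv_dir \<i> W) \<zeta>)"
    unfolding laplacian_def by (subst Bochner_Integration.integral_add[symmetric]) (auto simp: i1 distrib_left)
  also have "\<dots> = (LBINT \<zeta>. W \<zeta> * laplacian L \<zeta>)"
    unfolding laplacian_def eq by (subst Bochner_Integration.integral_add[symmetric]) (auto simp: i2 distrib_left)
  finally show ?thesis unfolding lk(5) by (simp add: L_def)
qed

lemma continuous_compact_support_bounded:
  fixes g :: "complex \<Rightarrow> real"
  assumes "continuous_on UNIV g" "compact K" "\<And>z. z \<notin> K \<Longrightarrow> g z = 0"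
  obtains B where "B \<ge> 0" "\<And>z. \<bar>g z\<bar> \<le> B"
proof -
  have "compact (g ` K)" using assms continuous_on_subset compact_continuous_image by blast
  then obtain B where "\<forall>x\<in>g ` K. norm x \<le> B" using compact_imp_bounded bounded_iff by metis
  then have "\<bar>g z\<bar> \<le> max B 0" for z using assms(3)[of z] by (cases "z \<in> K") auto
  then show ?thesis using that[of "max B 0"] by auto
qed

lemma abs_ln_le: "t > 0 \<Longrightarrow> \<bar>ln t\<bar> \<le> t + 1 / (t::real)"
proof -
  assume t: "t > 0"
  have "ln t \<le> t" using ln_bound[OF t] .
  moreover have "- ln t \<le> 1 / t" using ln_bound[of "1/t"] t by (simp add: ln_div)
  moreover have "1 / t \<ge> 0" using t by simp
  ultimately show ?thesis using t by linarith
qed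

text \<open>Dominated convergence on both sides of the regularised identity: on the left the kernels
  tend to the logarithm under an integrable majorant, on the right the approximate identity
  concentrates at z.\<close>

lemma newtonian_representation:
  fixes W :: "complex \<Rightarrow> real"
  assumes W: "Ck_on 2 UNIV W" and K: "compact K" "\<And>z. z \<notin> K \<Longrightarrow> W z = 0"
  shows "integrable lborel (\<lambda>\<zeta>. ln (norm (\<zeta> - z)) * laplacian W \<zeta>)"
    "(LBINT \<zeta>. ln (norm (\<zeta> - z)) * laplacian W \<zeta>) = 2 * pi * W z"
proof -
  note Wd = Ck_on_2_D[OF W, simplified]
  have oK: "open (- K)" using K(1) compact_imp_closed by auto
  have lap0: "laplacian W \<zeta> = 0" if "\<zeta> \<notin> K" for \<zeta>
  proof -
    have 1: "pderiv_dir v W \<zeta> = 0" if "\<zeta> \<notin> K" for \<zeta> v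
      using pderiv_dir_transform(2)[of "- K" \<zeta> "\<lambda>_. 0" W v] that K oK by (simp add: pderiv_dir_def frechet_derivative_const)
    have "pderiv_dir w (pderiv_dir v W) \<zeta> = 0" for v w
      using pderiv_dir_transform(2)[of "- K" \<zeta> "\<lambda>_. 0" "pderiv_dir v W" w] that 1 oK by (simp add: pderiv_dir_def frechet_derivative_const)
    then show ?thesis by (simp add: laplacian_def)
  qed
  have capl: "continuous_on UNIV (laplacian W)"
    unfolding laplacian_def[abs_def] by (intro continuous_intros Wd)
  have [measurable]: "laplacian W \<in> borel_measurable borel" "W \<in> borel_measurable borel"
    using capl Wd(3) borel_measurable_continuous_onI by blast+
  obtain B where B: "B \<ge> 0" "\<And>\<zeta>. \<bar>laplacian W \<zeta>\<bar> \<le> B"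
    using continuous_compact_support_bounded[OF capl K(1) lap0] by blast
  obtain BW where BW: "BW \<ge> 0" "\<And>\<zeta>. \<bar>W \<zeta>\<bar> \<le> BW"
    using continuous_compact_support_bounded[OF Wd(3) K] by blast
  obtain R where R: "R > 0" "K \<subseteq> ball z R"
    using bounded_subset_ballD[OF compact_imp_bounded[OF K(1)], of z] by blast
  \<comment> \<open>A square, so that the length scale in the substitution below is the rational
    number 1 / (n + 1).\<close>
  define \<epsilon> where "\<epsilon> n = (1 / real (Suc n))\<^sup>2" for n
  have e: "\<epsilon> n > 0" "\<epsilon> n \<le> 1" for n unfolding \<epsilon>_def by (auto simp: power_le_one)
  have s0: "(\<lambda>n. 1 / real (Suc n)) \<longlonglongrightarrow> 0" by (rule LIMSEQ_Suc[OF lim_1_over_n])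
  have elim: "\<epsilon> \<longlonglongrightarrow> 0" unfolding \<epsilon>_def
    using tendsto_power[OF s0, of 2] by (simp only: zero_power2)
  define L where "L n \<zeta> = ln ((norm (\<zeta> - z))\<^sup>2 + \<epsilon> n) / 2" for n \<zeta>
  \<comment> \<open>One majorant for all regularised kernels and for the logarithm: with t =
    |\<zeta> - z| they are bounded by t + 1/t + t^2, and the Laplacian of W lives in the ball of
    radius R. The exponent 1 only matches the form of
    \<open>nn_integral_inverse_norm_powr\<close>.\<close>
  define G where "G \<zeta> = B * ((2 * R + R\<^sup>2) * indicator (ball z R) \<zeta> + (1 / norm (\<zeta> - z)) powr 1 * indicator (ball z R) \<zeta>)" for \<zeta>
  have Gint: "integrable lborel G"
  proof -
    have [measurable]: "ball z R \<in> sets borel" by simp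
    have "integrable lborel (\<lambda>\<zeta>. (1 / norm (\<zeta> - z)) powr 1 * indicator (ball z R) \<zeta>)"
    proof (rule integrableI_bounded)
      obtain Kc where "Kc \<ge> 0" "\<forall>\<zeta>. (\<integral>\<^sup>+z\<in>ball (\<zeta>::complex) R. ennreal ((1 / norm (z - \<zeta>)) powr 1) \<partial>lborel) \<le> ennreal Kc"
        using nn_integral_inverse_norm_powr[of 1 R] R by auto
      then have "(\<integral>\<^sup>+\<zeta>\<in>ball z R. ennreal ((1 / norm (\<zeta> - z)) powr 1) \<partial>lborel) \<le> ennreal Kc"
        by blast
      also have "ennreal Kc < \<infinity>" by simp
      finally have "(\<integral>\<^sup>+\<zeta>\<in>ball z R. ennreal ((1 / norm (\<zeta> - z)) powr 1) \<partial>lborel) < \<infinity>" .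
      then show "(\<integral>\<^sup>+\<zeta>. ennreal (norm ((1 / norm (\<zeta> - z)) powr 1 * indicator (ball z R) \<zeta>)) \<partial>lborel) < \<infinity>"
        by (rule order_le_less_trans[rotated]) (auto intro!: nn_integral_mono simp: indicator_def)
    qed measurable
    then show ?thesis unfolding G_def by (auto simp: emeasure_disc_complex[OF less_imp_le[OF R(1)]])
  qed
  have ne: "AE \<zeta> in lborel. \<zeta> \<noteq> z" using AE_lborel_singleton[of z] by (auto elim: eventually_mono)
  have bnd: "norm (L n \<zeta> * laplacian W \<zeta>) \<le> G \<zeta>" "norm (ln (norm (\<zeta> - z)) * laplacian W \<zeta>) \<le> G \<zeta>" if nz: "\<zeta> \<noteq> z" for n \<zeta>
  proof -
    define t where "t = norm (\<zeta> - z)"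
    have t: "t > 0" using nz by (simp add: t_def)
    \<comment> \<open>The regularised kernel lies between ln t and, since \<epsilon> is at most 1,
      ln (1 + t^2) / 2.\<close>
    have l1: "ln t \<le> L n \<zeta>"
    proof -
      have "ln t = ln (t\<^sup>2) / 2" using t by (simp add: ln_realpow)
      also have "\<dots> \<le> L n \<zeta>" using t e[of n] unfolding L_def t_def[symmetric] by (simp add: add_pos_pos)
      finally show ?thesis .
    qed
    have l2: "L n \<zeta> \<le> t\<^sup>2 / 2"
    proof -
      have "L n \<zeta> \<le> ln (1 + t\<^sup>2) / 2" using t e[of n] unfolding L_def t_def[symmetric] by (simp add: add_pos_pos)
      also have "\<dots> \<le> t\<^sup>2 / 2" by (simp add: ln_add_one_self_le_self)
      finally show ?thesis .
    qed
    have a: "\<bar>ln t\<bar> \<le> t + 1 / t" using abs_ln_le[OF t] .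
    have Lb: "\<bar>L n \<zeta>\<bar> \<le> t + 1 / t + t\<^sup>2"
    proof -
      have "t\<^sup>2 \<ge> 0" "1 / t \<ge> 0" using t by simp_all
      then show ?thesis using a l1 l2 t by linarith
    qed
    have lb: "\<bar>ln t\<bar> \<le> t + 1 / t + t\<^sup>2"
    proof -
      have "t\<^sup>2 \<ge> 0" by simp
      then show ?thesis using a by linarith
    qed
    have main: "X * \<bar>laplacian W \<zeta>\<bar> \<le> G \<zeta>" if X: "X \<le> t + 1 / t + t\<^sup>2" for X
    proof (cases "\<zeta> \<in> K")
      case True
      then have in_b: "\<zeta> \<in> ball z R" using R by auto
      then have tR: "t \<le> R" by (simp add: t_def dist_norm norm_minus_commute)
      have "t + t\<^sup>2 \<le> 2 * R + R\<^sup>2" using tR t power_mono[of t R 2] by linarith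
      then have X2: "X \<le> (2 * R + R\<^sup>2) + 1 / t" using X by linarith
      have pos: "0 \<le> (2 * R + R\<^sup>2) + 1 / t" using R t by simp
      have "X * \<bar>laplacian W \<zeta>\<bar> \<le> ((2 * R + R\<^sup>2) + 1 / t) * B"
        using X2 B pos by (intro mult_mono) auto
      also have "\<dots> = G \<zeta>" using in_b t by (simp add: G_def t_def algebra_simps)
      finally show ?thesis .
    next
      case False
      then have "laplacian W \<zeta> = 0" using lap0 by blast
      moreover have "G \<zeta> \<ge> 0" using B R by (simp add: G_def indicator_def)
      ultimately show ?thesis by simp
    qed
    show "norm (L n \<zeta> * laplacian W \<zeta>) \<le> G \<zeta>" using main[OF Lb] by (simp add: abs_mult)
    show "norm (ln (norm (\<zeta> - z)) * laplacian W \<zeta>) \<le> G \<zeta>" using main[OF lb] by (simp add: abs_mult t_def)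
  qed
  have [measurable]: "L n \<in> borel_measurable borel" for n unfolding L_def by measurable
  show int: "integrable lborel (\<lambda>\<zeta>. ln (norm (\<zeta> - z)) * laplacian W \<zeta>)"
  proof (rule Bochner_Integration.integrable_bound[OF Gint])
    show "AE \<zeta> in lborel. norm (ln (norm (\<zeta> - z)) * laplacian W \<zeta>) \<le> norm (G \<zeta>)"
      using ne by eventually_elim (rule order_trans[OF bnd(2)], auto)
  qed measurable
  have lim1: "(\<lambda>n. LBINT \<zeta>. L n \<zeta> * laplacian W \<zeta>) \<longlonglongrightarrow> (LBINT \<zeta>. ln (norm (\<zeta> - z)) * laplacian W \<zeta>)"
  proof (rule integral_dominated_convergence[where w = G])
    show "AE \<zeta> in lborel. (\<lambda>n. L n \<zeta> * laplacian W \<zeta>) \<longlonglongrightarrow> ln (norm (\<zeta> - z)) * laplacian W \<zeta>"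
      using ne
    proof eventually_elim
      fix \<zeta> assume nz: "\<zeta> \<noteq> z"
      have "(\<lambda>n. ln ((norm (\<zeta> - z))\<^sup>2 + \<epsilon> n) / 2) \<longlonglongrightarrow> ln ((norm (\<zeta> - z))\<^sup>2 + 0) / 2"
        using nz by (intro tendsto_intros elim) auto
      also have "ln ((norm (\<zeta> - z))\<^sup>2 + 0) / 2 = ln (norm (\<zeta> - z))" using nz by (simp add: ln_realpow)
      finally show "(\<lambda>n. L n \<zeta> * laplacian W \<zeta>) \<longlonglongrightarrow> ln (norm (\<zeta> - z)) * laplacian W \<zeta>"
        unfolding L_def by (intro tendsto_mult tendsto_const)
    qed
    show "AE \<zeta> in lborel. norm (L n \<zeta> * laplacian W \<zeta>) \<le> G \<zeta>" for n
      using ne by eventually_elim (rule bnd(1))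
  qed (simp_all add: Gint)
  define P where "P \<eta> = 2 / (1 + (norm (\<eta>::complex))\<^sup>2)\<^sup>2" for \<eta>
  have Ppos: "P \<eta> \<ge> 0" for \<eta> by (simp add: P_def)
  have [measurable]: "P \<in> borel_measurable borel" unfolding P_def by measurable
  have Pint: "integrable lborel P" and Pval: "(LBINT \<eta>. P \<eta>) = 2 * pi"
  proof -
    have n: "(\<integral>\<^sup>+\<eta>. ennreal (P \<eta>) \<partial>lborel) = ennreal (2 * pi)" unfolding P_def by (rule nn_integral_poisson_weight)
    show i: "integrable lborel P" by (rule integrableI_nonneg) (auto simp: n Ppos)
    show "(LBINT \<eta>. P \<eta>) = 2 * pi" using n nn_integral_eq_integral[OF i] Ppos by (simp add: integral_nonneg_AE)
  qed
  \<comment> \<open>Substituting \<zeta> = z + s \<eta> with s^2 = \<epsilon> turns the Laplacian of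
    the kernel into the fixed weight \<open>P\<close> and moves the parameter into the argument of
    W.\<close>
  have val: "(LBINT \<zeta>. L n \<zeta> * laplacian W \<zeta>) = (LBINT \<eta>. W (z + (1 / real (Suc n)) *\<^sub>R \<eta>) * P \<eta>)" for n
  proof -
    define s where "s = 1 / real (Suc n)"
    have s: "s > 0" "\<epsilon> n = s\<^sup>2" by (auto simp: s_def \<epsilon>_def)
    have "(LBINT \<zeta>. L n \<zeta> * laplacian W \<zeta>) = (LBINT \<zeta>. W \<zeta> * (2 * \<epsilon> n / ((norm (\<zeta> - z))\<^sup>2 + \<epsilon> n)\<^sup>2))"
      unfolding L_def by (rule integral_log_kernel_laplacian[OF W K e(1)])
    also have "\<dots> = s\<^sup>2 * (LBINT \<eta>. W (z + s *\<^sub>R \<eta>) * (2 * \<epsilon> n / ((norm (z + s *\<^sub>R \<eta> - z))\<^sup>2 + \<epsilon> n)\<^sup>2))"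
      using s by (intro lborel_integral_affine_complex) auto
    also have "\<dots> = (LBINT \<eta>. s\<^sup>2 * (W (z + s *\<^sub>R \<eta>) * (2 * \<epsilon> n / ((norm (z + s *\<^sub>R \<eta> - z))\<^sup>2 + \<epsilon> n)\<^sup>2)))"
      by (rule integral_mult_right_zero[symmetric])
    also have "\<dots> = (LBINT \<eta>. W (z + s *\<^sub>R \<eta>) * P \<eta>)"
    proof (rule Bochner_Integration.integral_cong[OF HOL.refl])
      fix \<eta>
      have "(norm (z + s *\<^sub>R \<eta> - z))\<^sup>2 + \<epsilon> n = s\<^sup>2 * (1 + (norm \<eta>)\<^sup>2)"
        using s by (simp add: power_mult_distrib algebra_simps)
      then have h: "s\<^sup>2 * (2 * \<epsilon> n / ((norm (z + s *\<^sub>R \<eta> - z))\<^sup>2 + \<epsilon> n)\<^sup>2) = P \<eta>"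
        using s by (simp add: P_def power_mult_distrib power2_eq_square)
      show "s\<^sup>2 * (W (z + s *\<^sub>R \<eta>) * (2 * \<epsilon> n / ((norm (z + s *\<^sub>R \<eta> - z))\<^sup>2 + \<epsilon> n)\<^sup>2)) = W (z + s *\<^sub>R \<eta>) * P \<eta>"
        unfolding h[symmetric] by (rule mult.left_commute)
    qed
    finally show ?thesis by (simp add: s_def)
  qed
  have lim2: "(\<lambda>n. LBINT \<eta>. W (z + (1 / real (Suc n)) *\<^sub>R \<eta>) * P \<eta>) \<longlonglongrightarrow> (LBINT \<eta>. W z * P \<eta>)"
  proof (rule integral_dominated_convergence[where w = "\<lambda>\<eta>. BW * P \<eta>"])
    show "AE \<eta> in lborel. (\<lambda>n. W (z + (1 / real (Suc n)) *\<^sub>R \<eta>) * P \<eta>) \<longlonglongrightarrow> W z * P \<eta>"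
    proof (intro AE_I2 tendsto_mult tendsto_const)
      fix \<eta>
      have "(\<lambda>n. z + (1 / real (Suc n)) *\<^sub>R \<eta>) \<longlonglongrightarrow> z + 0 *\<^sub>R \<eta>"
        by (intro tendsto_intros s0)
      then have "(\<lambda>n. z + (1 / real (Suc n)) *\<^sub>R \<eta>) \<longlonglongrightarrow> z" by simp
      moreover have "isCont W z" using Wd(3) by (simp add: continuous_on_eq_continuous_at)
      ultimately show "(\<lambda>n. W (z + (1 / real (Suc n)) *\<^sub>R \<eta>)) \<longlonglongrightarrow> W z"
        by (rule isCont_tendsto_compose[rotated])
    qed
    show "AE \<eta> in lborel. norm (W (z + (1 / real (Suc n)) *\<^sub>R \<eta>) * P \<eta>) \<le> BW * P \<eta>" for n
      using BW Ppos by (intro AE_I2) (simp add: abs_mult mult_right_mono)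
  qed (simp_all add: Pint)
  have "(LBINT \<zeta>. ln (norm (\<zeta> - z)) * laplacian W \<zeta>) = (LBINT \<eta>. W z * P \<eta>)"
    using LIMSEQ_unique[OF lim1[unfolded val] lim2] .
  then show "(LBINT \<zeta>. ln (norm (\<zeta> - z)) * laplacian W \<zeta>) = 2 * pi * W z" by (simp add: Pval)
qed

subsection \<open>Bump functions and weak gradients\<close>

text \<open>The powers of t make the family closed under differentiation.\<close>
definition flat_exp :: "nat \<Rightarrow> real \<Rightarrow> real" where
  "flat_exp m t = (if t > 0 then exp (- 1 / t) / t ^ m else 0)"

text \<open>From exp (1/t) \<ge> (1 + 1/(n t))^n \<ge> (1/(n t))^n with n = m + 2: two powers of t
  survive the division by t^m. A quadratic bound is what makes the derivative at 0 exist and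
  vanish.\<close>

lemma flat_exp_le_square: "\<bar>flat_exp m t\<bar> \<le> real (m + 2) ^ (m + 2) * t\<^sup>2"
proof (cases "t > 0")
  case True
  let ?n = "m + 2"
  have "(1 / (t * real ?n)) ^ ?n \<le> (1 + (1 / t) / real ?n) ^ ?n"
    using True by (intro power_mono) auto
  also have "\<dots> \<le> exp (1 / t)"
  proof (rule exp_ge_one_plus_x_over_n_power_n)
    have "0 \<le> 1 / t" using True by simp
    then show "- real (m + 2) \<le> 1 / t" by linarith
  qed simp
  finally have "(1 / (t * real ?n)) ^ ?n \<le> exp (1 / t)" .
  then have "1 \<le> exp (1 / t) * (t * real ?n) ^ ?n"
    using True by (simp add: power_one_over divide_le_eq)
  then have "exp (- 1 / t) \<le> (t * real ?n) ^ ?n"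
    by (simp add: exp_minus field_simps)
  then have "exp (- 1 / t) / t ^ m \<le> (t * real ?n) ^ ?n / t ^ m"
    using True by (intro divide_right_mono) auto
  also have "(t * real ?n) ^ ?n = t ^ m * (real ?n ^ ?n * t\<^sup>2)"
    by (simp only: power_mult_distrib power_add mult_ac)
  also have "t ^ m * (real ?n ^ ?n * t\<^sup>2) / t ^ m = real ?n ^ ?n * t\<^sup>2"
    using True by simp
  finally show ?thesis using True by (simp add: flat_exp_def)
qed (simp add: flat_exp_def)

lemma flat_exp_deriv:
  "(flat_exp m has_real_derivative flat_exp (m + 2) t - real m * flat_exp (m + 1) t) (at t)"
proof -
  consider "t > 0" | "t < 0" | "t = 0" by linarith
  then show ?thesis
  proof cases
    case 1
    have "((\<lambda>t. exp (- 1 / t) / t ^ m) has_real_derivative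
        (exp (- 1 / t) * (1 / t\<^sup>2) * t ^ m - exp (- 1 / t) * (real m * t ^ (m - 1))) / (t ^ m * t ^ m)) (at t)"
      using 1 by (auto intro!: derivative_eq_intros simp: power2_eq_square)
    also have "(exp (- 1 / t) * (1 / t\<^sup>2) * t ^ m - exp (- 1 / t) * (real m * t ^ (m - 1))) / (t ^ m * t ^ m)
        = flat_exp (m + 2) t - real m * flat_exp (m + 1) t"
      using 1 by (cases m) (simp_all add: flat_exp_def field_simps power2_eq_square)
    finally have d: "((\<lambda>t. exp (- 1 / t) / t ^ m) has_real_derivative flat_exp (m + 2) t - real m * flat_exp (m + 1) t) (at t)" .
    show ?thesis
      by (rule has_field_derivative_transform_within_open[OF d, of "{0<..}"]) (use 1 in \<open>auto simp: flat_exp_def\<close>)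
  next
    case 2
    have "((\<lambda>t. 0) has_real_derivative flat_exp (m + 2) t - real m * flat_exp (m + 1) t) (at t)"
      using 2 by (simp add: flat_exp_def)
    then show ?thesis
      by (rule has_field_derivative_transform_within_open[of _ _ _ "{..<0}"]) (use 2 in \<open>auto simp: flat_exp_def\<close>)
  next
    case 3
    have "((\<lambda>h. (flat_exp m (0 + h) - flat_exp m 0) / h) \<longlongrightarrow> 0) (at 0)"
    proof (rule Lim_null_comparison)
      have "norm ((flat_exp m (0 + h) - flat_exp m 0) / h) \<le> real (m + 2) ^ (m + 2) * \<bar>h\<bar>" if "h \<noteq> 0" for h
      proof -
        have "\<bar>flat_exp m h\<bar> / \<bar>h\<bar> \<le> real (m + 2) ^ (m + 2) * h\<^sup>2 / \<bar>h\<bar>"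
          by (intro divide_right_mono flat_exp_le_square) auto
        also have "\<dots> = real (m + 2) ^ (m + 2) * \<bar>h\<bar>"
          using that by (simp add: power2_eq_square) (simp add: abs_if)
        finally show ?thesis by (simp add: flat_exp_def[of m 0])
      qed
      then show "\<forall>\<^sub>F h in at 0. norm ((flat_exp m (0 + h) - flat_exp m 0) / h) \<le> real (m + 2) ^ (m + 2) * \<bar>h\<bar>"
        by (auto simp: eventually_at_filter)
      have "((\<lambda>h. real (m + 2) ^ (m + 2) * \<bar>h\<bar>) \<longlongrightarrow> real (m + 2) ^ (m + 2) * \<bar>0\<bar>) (at (0::real))"
        by (intro tendsto_intros)
      then show "((\<lambda>h. real (m + 2) ^ (m + 2) * \<bar>h\<bar>) \<longlongrightarrow> 0) (at (0::real))" by simp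
    qed
    then show ?thesis using 3 by (simp add: DERIV_def flat_exp_def[of _ 0])
  qed
qed

lemma Ck_on_flat_exp: "Ck_on k UNIV (flat_exp m)"
proof (induction k arbitrary: m)
  case 0
  show ?case using flat_exp_deriv[of m] by (auto intro!: DERIV_isCont continuous_at_imp_continuous_on)
next
  case (Suc k)
  have d: "(flat_exp m has_derivative (\<lambda>v. v * (flat_exp (m + 2) t - real m * flat_exp (m + 1) t))) (at t)" for t
    using flat_exp_deriv[of m t] by (simp add: has_field_derivative_def mult.commute[of _ "flat_exp _ _ - _"])
  have eq: "frechet_derivative (flat_exp m) (at t) v = v * flat_exp (m + 2) t + (v * - real m) * flat_exp (m + 1) t" for t v
    using fun_cong[OF frechet_derivative_at[OF d], of v, symmetric] by (simp add: algebra_simps)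
  have "Ck_on k UNIV (\<lambda>t. v * flat_exp (m + 2) t + (v * - real m) * flat_exp (m + 1) t)" for v
    by (intro Ck_on_add Ck_on_mult Ck_on_const Suc.IH) auto
  then show ?case unfolding Ck_on.simps eq using d differentiable_def by blast
qed

text \<open>Each factor is positive exactly on one side of an edge of the box (for n > 0), and the
  factor n stretches its argument, so that the functions tend pointwise to the indicator of the open
  box. All of them are smooth and bounded by 1.\<close>

definition bump :: "complex \<Rightarrow> complex \<Rightarrow> nat \<Rightarrow> complex \<Rightarrow> real" where
  "bump p q n z = flat_exp 0 (real n * Re z - real n * Re p) * flat_exp 0 (real n * Re q - real n * Re z) *
     (flat_exp 0 (real n * Im z - real n * Im p) * flat_exp 0 (real n * Im q - real n * Im z))"

lemma smooth_on_bump: "smooth_on UNIV (bump p q n)"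
proof -
  have "Ck_on k UNIV (\<lambda>z. a * Re z + b)" "Ck_on k UNIV (\<lambda>z. a * Im z + b)" for a b k
    by (intro Ck_on_add Ck_on_mult Ck_on_const Ck_on_bounded_linear bounded_linear_Re bounded_linear_Im open_UNIV)+
  from Ck_on_compose_real[OF open_UNIV Ck_on_flat_exp this(1)] Ck_on_compose_real[OF open_UNIV Ck_on_flat_exp this(2)]
  have c: "Ck_on k UNIV (\<lambda>z. flat_exp 0 (a * Re z + b))" "Ck_on k UNIV (\<lambda>z. flat_exp 0 (a * Im z + b))" for a b k
    by auto
  have "Ck_on k UNIV (bump p q n)" for k
    unfolding bump_def[abs_def]
    using c[of k "real n" "- real n * Re p"] c[of k "- real n" "real n * Re q"]
      c[of k "real n" "- real n * Im p"] c[of k "- real n" "real n * Im q"]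
    by (intro Ck_on_mult open_UNIV) (simp_all add: algebra_simps)
  then show ?thesis by (simp add: smooth_on_def)
qed

lemma bump_bounds: "0 \<le> bump p q n z" "bump p q n z \<le> 1"
proof -
  have "0 \<le> flat_exp 0 t \<and> flat_exp 0 t \<le> 1" for t by (simp add: flat_exp_def)
  then show "0 \<le> bump p q n z" "bump p q n z \<le> 1"
    unfolding bump_def by (auto intro!: mult_nonneg_nonneg mult_le_one)
qed

lemma bump_eq_0:
  assumes "z \<notin> box p q" shows "bump p q n z = 0"
proof -
  have "Re z \<le> Re p \<or> Re z \<ge> Re q \<or> Im z \<le> Im p \<or> Im z \<ge> Im q"
    using assms by (auto simp: in_box_complex_iff)
  then have "real n * Re z \<le> real n * Re p \<or> real n * Re z \<ge> real n * Re q \<or>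
      real n * Im z \<le> real n * Im p \<or> real n * Im z \<ge> real n * Im q"
    by (auto intro: mult_left_mono)
  then show ?thesis by (auto simp: bump_def flat_exp_def)
qed

lemma bump_tendsto:
  assumes "z \<in> box p q" shows "(\<lambda>n. bump p q n z) \<longlonglongrightarrow> 1"
proof -
  have f: "(\<lambda>n. flat_exp 0 (real n * s - real n * t)) \<longlonglongrightarrow> 1" if "t < s" for s t
  proof -
    have st: "s - t > 0" using that by simp
    have "filterlim (\<lambda>n. (s - t) * real n) at_top sequentially"
      by (rule filterlim_tendsto_pos_mult_at_top[OF tendsto_const st filterlim_real_sequentially])
    then have "(\<lambda>n. - 1 / ((s - t) * real n)) \<longlonglongrightarrow> 0"
      by (intro tendsto_divide_0[OF tendsto_const] filterlim_at_top_imp_at_infinity)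
    then have "(\<lambda>n. exp (- 1 / ((s - t) * real n))) \<longlonglongrightarrow> exp 0" by (rule tendsto_exp)
    moreover have "\<forall>\<^sub>F n in sequentially. exp (- 1 / ((s - t) * real n)) = flat_exp 0 (real n * s - real n * t)"
      using eventually_gt_at_top[of 0]
    proof eventually_elim
      fix n :: nat assume "n > 0"
      then have "real n * s - real n * t > 0" using st by simp
      then show "exp (- 1 / ((s - t) * real n)) = flat_exp 0 (real n * s - real n * t)"
        by (simp add: flat_exp_def algebra_simps)
    qed
    ultimately have "(\<lambda>n. flat_exp 0 (real n * s - real n * t)) \<longlonglongrightarrow> exp 0"
      by (rule Lim_transform_eventually)
    then show ?thesis by simp
  qed
  have "(\<lambda>n. bump p q n z) \<longlonglongrightarrow> 1 * 1 * (1 * 1)"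
    unfolding bump_def using assms by (intro tendsto_mult f) (auto simp: in_box_complex_iff)
  then show ?thesis by simp
qed

lemma test_function_bump: "cbox p q \<subseteq> \<Omega> \<Longrightarrow> test_function \<Omega> (bump p q n)"
proof -
  assume sub: "cbox p q \<subseteq> \<Omega>"
  have "bump p q n z = 0" if "z \<notin> cbox p q" for z
    using that box_subset_cbox[of p q] by (intro bump_eq_0) auto
  then show ?thesis unfolding test_function_def
    by (intro conjI exI[of _ "cbox p q"] smooth_on_bump compact_cbox sub allI impI)
qed

text \<open>Fundamental lemma of the calculus of variations. The bumps make the integral over every
  box vanish, Lebesgue differentiation gives H = 0 off a null set in each box, and countably many
  boxes cover \<Omega>.\<close>

lemma AE_eq_0_if_test_integrals_eq_0:
  fixes H :: "complex \<Rightarrow> real"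
  assumes \<Omega>: "open \<Omega>" and int: "\<And>K. compact K \<Longrightarrow> K \<subseteq> \<Omega> \<Longrightarrow> H absolutely_integrable_on K"
    and zero: "\<And>\<psi>. test_function \<Omega> \<psi> \<Longrightarrow> (\<integral>z. H z * \<psi> z \<partial>lebesgue_on \<Omega>) = 0"
  shows "AE z in lebesgue_on \<Omega>. H z = 0"
proof -
  have oL: "\<Omega> \<in> sets lebesgue" using \<Omega> by (intro sets_completionI_sets) simp
  have int0: "integral (cbox p q) H = 0" if sub: "cbox p q \<subseteq> \<Omega>" for p q
  proof -
    have a: "H absolutely_integrable_on cbox p q" using int[OF compact_cbox sub] .
    then have ab: "H absolutely_integrable_on box p q"
      by (rule set_integrable_subset[OF _ fmeasurableD[OF lmeasurable_box] box_subset_cbox])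
    have ib: "integrable lebesgue (\<lambda>z. indicator (box p q) z *\<^sub>R H z)" using ab by (simp add: set_integrable_def)
    have seq: "(LINT z|lebesgue. (indicator (box p q) z *\<^sub>R H z) * bump p q n z) = 0" for n
    proof -
      have "(LINT z|lebesgue. (indicator (box p q) z *\<^sub>R H z) * bump p q n z) = (LINT z|lebesgue. indicator \<Omega> z *\<^sub>R (H z * bump p q n z))"
      proof (rule Bochner_Integration.integral_cong[OF HOL.refl])
        fix z
        show "(indicator (box p q) z *\<^sub>R H z) * bump p q n z = indicator \<Omega> z *\<^sub>R (H z * bump p q n z)"
        proof (cases "z \<in> box p q")
          case True
          then have "z \<in> \<Omega>" using sub box_subset_cbox[of p q] by auto
          then show ?thesis using True by simp
        qed (simp add: bump_eq_0)
      qed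
      also have "\<dots> = (\<integral>z. H z * bump p q n z \<partial>lebesgue_on \<Omega>)"
        using oL by (subst integral_restrict_space) simp_all
      also have "\<dots> = 0" using zero[OF test_function_bump[OF sub]] .
      finally show ?thesis .
    qed
    have "(\<lambda>n. LINT z|lebesgue. (indicator (box p q) z *\<^sub>R H z) * bump p q n z) \<longlonglongrightarrow> (LINT z|lebesgue. indicator (box p q) z *\<^sub>R H z)"
    proof (rule integral_dominated_convergence[where w = "\<lambda>z. \<bar>indicator (box p q) z *\<^sub>R H z\<bar>"])
      show hm: "(\<lambda>z. indicator (box p q) z *\<^sub>R H z) \<in> borel_measurable lebesgue" using ib by auto
      have "bump p q n \<in> borel_measurable borel" for n
        using Ck_on_2_D(3)[OF smooth_on_imp_Ck_on[OF smooth_on_bump]] borel_measurable_continuous_onI by blast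
      then have "bump p q n \<in> borel_measurable lebesgue" for n
        by (intro measurable_completion) simp
      then show "(\<lambda>z. (indicator (box p q) z *\<^sub>R H z) * bump p q n z) \<in> borel_measurable lebesgue" for n
        using hm by (intro borel_measurable_times) 
      show "integrable lebesgue (\<lambda>z. \<bar>indicator (box p q) z *\<^sub>R H z\<bar>)" using ib by (rule integrable_abs)
      show "AE z in lebesgue. (\<lambda>n. (indicator (box p q) z *\<^sub>R H z) * bump p q n z) \<longlonglongrightarrow> indicator (box p q) z *\<^sub>R H z"
      proof (rule AE_I2)
        fix z
        show "(\<lambda>n. (indicator (box p q) z *\<^sub>R H z) * bump p q n z) \<longlonglongrightarrow> indicator (box p q) z *\<^sub>R H z"
        proof (cases "z \<in> box p q")
          case True
          show ?thesis using tendsto_mult[OF tendsto_const bump_tendsto[OF True], of "indicator (box p q) z *\<^sub>R H z"] by simp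
        qed simp
      qed
      show "AE z in lebesgue. norm ((indicator (box p q) z *\<^sub>R H z) * bump p q n z) \<le> \<bar>indicator (box p q) z *\<^sub>R H z\<bar>" for n
        using bump_bounds[of p q n] by (intro AE_I2) (simp add: abs_mult mult_left_le)
    qed
    then have "(LINT z|lebesgue. indicator (box p q) z *\<^sub>R H z) = 0" unfolding seq by (simp add: LIMSEQ_const_iff)
    then have "integral (box p q) H = 0"
      using set_lebesgue_integral_eq_integral(2)[OF ab] by (simp add: set_lebesgue_integral_def)
    then show ?thesis by (simp add: integral_open_interval)
  qed
  have neg: "negligible {z \<in> cbox a b. H z \<noteq> 0}" if sub: "cbox a b \<subseteq> \<Omega>" for a b
  proof -
    define f where "f z = (if z \<in> cbox a b then H z else 0)" for z
    have "H integrable_on cbox a b" using int[OF compact_cbox sub] set_lebesgue_integral_eq_integral(1) by blast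
    then have "f integrable_on UNIV" unfolding f_def by (simp add: integrable_restrict_UNIV)
    then have "f integrable_on cbox c d" for c d using integrable_on_subcbox by blast
    \<comment> \<open>Lebesgue differentiation along squares that have x as their lower left
      corner.\<close>
    then obtain N where N: "negligible N"
      "\<And>x e. \<lbrakk>x \<notin> N; 0 < e\<rbrakk> \<Longrightarrow> \<exists>d>0. \<forall>h. 0 < h \<and> h < d \<longrightarrow> norm (integral (cbox x (x + h *\<^sub>R One)) f /\<^sub>R h ^ DIM(complex) - f x) < e"
      using integrable_ccontinuous_explicit[of f] by blast
    have "H x = 0" if x: "x \<in> box a b" "x \<notin> N" for x
    proof (rule ccontr)
      assume "H x \<noteq> 0"
      then have "norm (f x) > 0" using x box_subset_cbox[of a b] by (auto simp: f_def)
      from N(2)[OF x(2) this] obtain d where d: "d > 0"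
        "\<And>h. 0 < h \<Longrightarrow> h < d \<Longrightarrow> norm (integral (cbox x (x + h *\<^sub>R One)) f /\<^sub>R h ^ DIM(complex) - f x) < norm (f x)"
        by blast
      \<comment> \<open>Small enough for the differentiation theorem and for the square with corner
        x to stay inside the closed box, where its integral is already known to be 0.\<close>
      define h where "h = min (d / 2) (min (Re b - Re x) (Im b - Im x))"
      have xb: "Re a < Re x" "Re x < Re b" "Im a < Im x" "Im x < Im b"
        using x(1) by (auto simp: in_box_complex_iff)
      have h: "h > 0" "h < d" "h \<le> Re b - Re x" "h \<le> Im b - Im x" using xb d(1) by (auto simp: h_def)
      have One: "(One::complex) = 1 + \<i>" by (simp add: Basis_complex_def)
      have s: "cbox x (x + h *\<^sub>R One) \<subseteq> cbox a b"
        using xb h unfolding One by (auto simp: in_cbox_complex_iff)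
      have "integral (cbox x (x + h *\<^sub>R One)) f = integral (cbox x (x + h *\<^sub>R One)) H"
        using s by (intro Henstock_Kurzweil_Integration.integral_cong) (auto simp: f_def)
      also have "\<dots> = 0" using s sub by (intro int0) auto
      finally show False using d(2)[OF h(1,2)] by simp
    qed
    then have "{z \<in> cbox a b. H z \<noteq> 0} \<subseteq> N \<union> (cbox a b - box a b)" by auto
    then show ?thesis
      by (rule negligible_subset[OF negligible_Un[OF N(1) negligible_frontier_interval]])
  qed
  obtain \<D> where D: "countable \<D>" "\<D> \<subseteq> Pow \<Omega>" "\<And>X. X \<in> \<D> \<Longrightarrow> \<exists>a b. X = cbox a b" "\<Union>\<D> = \<Omega>"
    by (rule open_countable_Union_open_cbox[OF \<Omega>]) (rule that)
  have n1: "negligible {z \<in> X. H z \<noteq> 0}" if "X \<in> \<D>" for X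
    using D(2) D(3)[OF that] that neg by auto
  have "negligible (\<Union>X\<in>\<D>. {z \<in> X. H z \<noteq> 0})"
    using D(1) n1 by (intro negligible_countable_Union countable_image) auto
  moreover have "{z \<in> \<Omega>. H z \<noteq> 0} = (\<Union>X\<in>\<D>. {z \<in> X. H z \<noteq> 0})" using D(4) by auto
  ultimately have "negligible {z \<in> \<Omega>. H z \<noteq> 0}" by simp
  then have n: "{z \<in> \<Omega>. H z \<noteq> 0} \<in> null_sets lebesgue" by (simp add: negligible_iff_null_sets)
  have "AE z in lebesgue. z \<in> \<Omega> \<longrightarrow> H z = 0" by (rule AE_I'[OF n]) auto
  then show ?thesis using oL by (simp add: AE_restrict_space_iff)
qed

text \<open>The integrals in \<open>has_weak_grad\<close> are 0 by default if the integrand is not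
  integrable, so adding or subtracting two such identities requires this integrability.\<close>

lemma integrable_mult_compact_support:
  fixes h \<psi> :: "complex \<Rightarrow> real"
  assumes \<Omega>: "open \<Omega>" and h: "h absolutely_integrable_on K"
    and K: "compact K" "K \<subseteq> \<Omega>" and \<psi>: "continuous_on UNIV \<psi>" "\<And>z. z \<notin> K \<Longrightarrow> \<psi> z = 0"
  shows "integrable (lebesgue_on \<Omega>) (\<lambda>z. h z * \<psi> z)"
proof -
  have oL: "\<Omega> \<in> sets lebesgue" using \<Omega> by (intro sets_completionI_sets) simp
  obtain B where B: "B \<ge> 0" "\<And>z. \<bar>\<psi> z\<bar> \<le> B" using continuous_compact_support_bounded[OF \<psi>(1) K(1) \<psi>(2)] by blast
  have hi: "integrable lebesgue (\<lambda>z. indicator K z *\<^sub>R h z)" using h by (simp add: set_integrable_def)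
  have m: "\<psi> \<in> borel_measurable lebesgue"
    by (intro measurable_completion) (simp add: borel_measurable_continuous_onI[OF \<psi>(1)])
  have "integrable lebesgue (\<lambda>z. (indicator K z *\<^sub>R h z) * \<psi> z)"
  proof (rule Bochner_Integration.integrable_bound)
    show "integrable lebesgue (\<lambda>z. (indicator K z *\<^sub>R h z) * B)" using hi by (rule integrable_mult_left)
    show "(\<lambda>z. (indicator K z *\<^sub>R h z) * \<psi> z) \<in> borel_measurable lebesgue"
      using hi m by (intro borel_measurable_times) auto
    show "AE z in lebesgue. norm ((indicator K z *\<^sub>R h z) * \<psi> z) \<le> norm ((indicator K z *\<^sub>R h z) * B)"
      using B by (intro AE_I2) (auto simp: abs_mult intro!: mult_left_mono)
  qed
  moreover have "(\<lambda>z. (indicator K z *\<^sub>R h z) * \<psi> z) = (\<lambda>z. indicator \<Omega> z *\<^sub>R (h z * \<psi> z))"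
  proof
    fix z
    show "(indicator K z *\<^sub>R h z) * \<psi> z = indicator \<Omega> z *\<^sub>R (h z * \<psi> z)"
      using K(2) \<psi>(2)[of z] by (cases "z \<in> K") auto
  qed
  ultimately show ?thesis using oL by (simp add: integrable_restrict_space)
qed

lemma test_function_D:
  assumes "test_function \<Omega> \<psi>"
  obtains K where "compact K" "K \<subseteq> \<Omega>" "\<And>z. z \<notin> K \<Longrightarrow> \<psi> z = 0" "\<And>v z. z \<notin> K \<Longrightarrow> pderiv_dir v \<psi> z = 0"
    "Ck_on 2 UNIV \<psi>"
proof -
  obtain K where K: "compact K" "K \<subseteq> \<Omega>" "\<And>z. z \<notin> K \<Longrightarrow> \<psi> z = 0"
    using assms unfolding test_function_def by blast
  have oK: "open (- K)" using K(1) compact_imp_closed by auto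
  have z: "pderiv_dir v \<psi> z = 0" if "z \<notin> K" for v z
    using pderiv_dir_transform(2)[of "- K" z "\<lambda>_. 0" \<psi> v] that K oK by (simp add: pderiv_dir_def frechet_derivative_const)
  show ?thesis using that[OF K z] assms smooth_on_imp_Ck_on unfolding test_function_def by blast
qed

lemma absolutely_integrable_inner:
  fixes G :: "complex \<Rightarrow> complex"
  assumes "G absolutely_integrable_on K" shows "(\<lambda>z. G z \<bullet> v) absolutely_integrable_on K"
proof -
  have "integrable lebesgue (\<lambda>z. (indicator K z *\<^sub>R G z) \<bullet> v)"
    using assms by (intro integrable_inner_left) (simp add: set_integrable_def)
  then show ?thesis by (simp add: set_integrable_def)
qed

text \<open>\<open>weak_grad\<close> picks some weak gradient by choice. Uniqueness up to null sets
  is what allows its norm to be computed from a known one.\<close>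

lemma has_weak_grad_unique:
  assumes \<Omega>: "open \<Omega>" and 1: "has_weak_grad \<Omega> f G1" and 2: "has_weak_grad \<Omega> f G2"
  shows "AE z in lebesgue_on \<Omega>. G1 z = G2 z"
proof -
  have ai: "G1 absolutely_integrable_on K" "G2 absolutely_integrable_on K" if "compact K" "K \<subseteq> \<Omega>" for K
    using 1 2 that unfolding has_weak_grad_def by auto
  have v: "AE z in lebesgue_on \<Omega>. (G1 z - G2 z) \<bullet> v = 0" if v: "v \<in> Basis" for v
  proof (rule AE_eq_0_if_test_integrals_eq_0[OF \<Omega>])
    fix K :: "complex set" assume K: "compact K" "K \<subseteq> \<Omega>"
    show "(\<lambda>z. (G1 z - G2 z) \<bullet> v) absolutely_integrable_on K"
      using ai[OF K] by (intro absolutely_integrable_inner set_integral_diff(1))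
  next
    fix \<psi> assume t: "test_function \<Omega> \<psi>"
    obtain K where K: "compact K" "K \<subseteq> \<Omega>" "\<And>z. z \<notin> K \<Longrightarrow> \<psi> z = 0" "Ck_on 2 UNIV \<psi>"
      using test_function_D[OF t] by metis
    have i: "integrable (lebesgue_on \<Omega>) (\<lambda>z. (G1 z \<bullet> v) * \<psi> z)" "integrable (lebesgue_on \<Omega>) (\<lambda>z. (G2 z \<bullet> v) * \<psi> z)"
      using ai[OF K(1,2)] K by (auto intro!: integrable_mult_compact_support[OF \<Omega> _ K(1,2)] absolutely_integrable_inner Ck_on_2_D)
    have "(\<integral>z. (G1 z \<bullet> v) * \<psi> z \<partial>lebesgue_on \<Omega>) = (\<integral>z. (G2 z \<bullet> v) * \<psi> z \<partial>lebesgue_on \<Omega>)"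
    proof -
      have "(\<integral>z. f z * pderiv_dir v \<psi> z \<partial>lebesgue_on \<Omega>) = - (\<integral>z. (G1 z \<bullet> v) * \<psi> z \<partial>lebesgue_on \<Omega>)"
        using 1 t v unfolding has_weak_grad_def by blast
      moreover have "(\<integral>z. f z * pderiv_dir v \<psi> z \<partial>lebesgue_on \<Omega>) = - (\<integral>z. (G2 z \<bullet> v) * \<psi> z \<partial>lebesgue_on \<Omega>)"
        using 2 t v unfolding has_weak_grad_def by blast
      ultimately show ?thesis by linarith
    qed
    then show "(\<integral>z. (G1 z - G2 z) \<bullet> v * \<psi> z \<partial>lebesgue_on \<Omega>) = 0"
      using i by (simp add: inner_diff_left left_diff_distrib Bochner_Integration.integral_diff)
  qed
  have "AE z in lebesgue_on \<Omega>. \<forall>v\<in>Basis. (G1 z - G2 z) \<bullet> v = 0"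
    using v by (subst AE_ball_countable) (auto simp: countable_finite)
  then show ?thesis
    by eventually_elim (metis euclidean_all_zero_iff right_minus_eq)
qed

lemma AE_weak_grad_eq:
  assumes "open \<Omega>" "has_weak_grad \<Omega> f G"
  shows "AE z in lebesgue_on \<Omega>. weak_grad \<Omega> f z = G z"
  using has_weak_grad_unique[OF assms(1) _ assms(2)] someI[of "has_weak_grad \<Omega> f" G] assms(2)
  unfolding weak_grad_def by blast

lemma absolutely_integrable_continuous_compact:
  fixes f :: "complex \<Rightarrow> 'b::euclidean_space"
  assumes "compact K" "continuous_on K f"
  shows "f absolutely_integrable_on K"
proof -
  have i: "integrable lborel (\<lambda>z. indicator K z *\<^sub>R f z)"
    using borel_integrable_compact[OF assms] by (simp add: set_integrable_def)
  then have "(\<lambda>z. indicator K z *\<^sub>R f z) \<in> borel_measurable lborel" by (rule borel_measurable_integrable)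
  from integrable_completion[OF this] i show ?thesis by (simp add: set_integrable_def)
qed

text \<open>Integration by parts: the product f \<psi> has compact support in \<Omega>, so the
  integral of its derivative is 0, and the product rule splits it into the two sides of the
  definition.\<close>

lemma has_weak_grad_grad:
  fixes f :: "complex \<Rightarrow> real"
  assumes \<Omega>: "open \<Omega>" and f: "Ck_on 2 \<Omega> f"
  shows "has_weak_grad \<Omega> f (grad f)"
  unfolding has_weak_grad_def
proof (intro conjI allI impI ballI)
  note fd = Ck_on_2_D[OF f]
  have gc: "continuous_on \<Omega> (grad f)" by (intro continuous_on_grad fd)
  fix K assume "compact K \<and> K \<subseteq> \<Omega>"
  then show "f absolutely_integrable_on K" "grad f absolutely_integrable_on K"
    using fd(3) gc continuous_on_subset by (blast intro: absolutely_integrable_continuous_compact)+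
next
  note fd = Ck_on_2_D[OF f]
  have gc: "continuous_on \<Omega> (grad f)" by (intro continuous_on_grad fd)
  fix \<psi> :: "complex \<Rightarrow> real" and v :: complex assume t: "test_function \<Omega> \<psi>" and v: "v \<in> Basis"
  obtain K where K: "compact K" "K \<subseteq> \<Omega>" "\<And>z. z \<notin> K \<Longrightarrow> \<psi> z = 0" "\<And>v z. z \<notin> K \<Longrightarrow> pderiv_dir v \<psi> z = 0"
    "Ck_on 2 UNIV \<psi>"
    using test_function_D[OF t] by metis
  note pd = Ck_on_2_D[OF K(5), simplified]
  define V where "V z = f z * \<psi> z" for z
  have Vd: "V differentiable (at z)" if "z \<in> \<Omega>" for z
    unfolding V_def by (intro differentiable_mult fd pd that)
  have Vp: "pderiv_dir v V z = f z * pderiv_dir v \<psi> z + (grad f z \<bullet> v) * \<psi> z" if "z \<in> \<Omega>" for z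
    unfolding V_def using pderiv_dir_mult[OF fd(1)[OF that] pd(1)] grad_inner[OF fd(1)[OF that]] by simp
  have Vc: "continuous_on \<Omega> (pderiv_dir v V)"
  proof (subst continuous_on_cong[OF HOL.refl Vp])
    show "continuous_on \<Omega> (\<lambda>z. f z * pderiv_dir v \<psi> z + (grad f z \<bullet> v) * \<psi> z)"
      by (intro continuous_intros fd gc continuous_on_subset[OF pd(3)] continuous_on_subset[OF pd(4)]) auto
  qed
  have V0: "V z = 0" if "z \<notin> K" for z using K(3)[OF that] by (simp add: V_def)
  note I = integral_pderiv_dir_eq_0_on[OF \<Omega> Vd Vc K(1,2) V0]
  have oL: "\<Omega> \<in> sets lebesgue" using \<Omega> by (intro sets_completionI_sets) simp
  have i1: "integrable (lebesgue_on \<Omega>) (\<lambda>z. f z * pderiv_dir v \<psi> z)"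
    by (rule integrable_mult_compact_support[OF \<Omega> _ K(1,2) pd(4) K(4)])
      (intro absolutely_integrable_continuous_compact K continuous_on_subset[OF fd(3)])
  have i2: "integrable (lebesgue_on \<Omega>) (\<lambda>z. (grad f z \<bullet> v) * \<psi> z)"
    by (rule integrable_mult_compact_support[OF \<Omega> _ K(1,2) pd(3) K(3)])
      (intro absolutely_integrable_inner absolutely_integrable_continuous_compact K continuous_on_subset[OF gc])
  have "(\<integral>z. f z * pderiv_dir v \<psi> z \<partial>lebesgue_on \<Omega>) + (\<integral>z. (grad f z \<bullet> v) * \<psi> z \<partial>lebesgue_on \<Omega>)
    = (\<integral>z. f z * pderiv_dir v \<psi> z + (grad f z \<bullet> v) * \<psi> z \<partial>lebesgue_on \<Omega>)"
    using i1 i2 by (rule Bochner_Integration.integral_add[symmetric])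
  also have "\<dots> = (LINT z|lebesgue. indicator \<Omega> z *\<^sub>R (f z * pderiv_dir v \<psi> z + (grad f z \<bullet> v) * \<psi> z))"
    using oL by (subst integral_restrict_space) simp_all
  also have "\<dots> = (LINT z|lebesgue. pderiv_dir v V z)"
  proof (rule Bochner_Integration.integral_cong[OF HOL.refl])
    fix z
    show "indicator \<Omega> z *\<^sub>R (f z * pderiv_dir v \<psi> z + (grad f z \<bullet> v) * \<psi> z) = pderiv_dir v V z"
    proof (cases "z \<in> \<Omega>")
      case True
      then show ?thesis using Vp[OF True] by simp
    next
      case False
      then have "pderiv_dir v V z = 0" using I(3) K(2) by blast
      then show ?thesis using False by simp
    qed
  qed
  also have "\<dots> = (LBINT z. pderiv_dir v V z)"
    by (rule integral_completion) (use I(1) in simp)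
  also have "\<dots> = 0" by (rule I(2))
  finally show "(\<integral>z. f z * pderiv_dir v \<psi> z \<partial>lebesgue_on \<Omega>) = - (\<integral>z. (grad f z \<bullet> v) * \<psi> z \<partial>lebesgue_on \<Omega>)"
    by linarith
qed

section \<open>Membership and norms in L^p on discs\<close>

lemma Lp_memI:
  fixes f :: "complex \<Rightarrow> 'b::euclidean_space"
  assumes "f \<in> borel_measurable (lebesgue_on \<Omega>)" "(\<integral>\<^sup>+z. ennreal (norm (f z) powr p) \<partial>lebesgue_on \<Omega>) < \<infinity>"
  shows "f \<in> Lp p \<Omega>"
  unfolding Lp_def using assms by (auto intro!: integrableI_bounded)

lemma Lp_memD:
  assumes "f \<in> Lp p \<Omega>"
  shows "f \<in> borel_measurable (lebesgue_on \<Omega>)" "(\<integral>\<^sup>+z. ennreal (norm (f z) powr p) \<partial>lebesgue_on \<Omega>) < \<infinity>"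
proof -
  show "f \<in> borel_measurable (lebesgue_on \<Omega>)" using assms by (simp add: Lp_def)
  have "integrable (lebesgue_on \<Omega>) (\<lambda>z. norm (f z) powr p)" using assms by (simp add: Lp_def)
  from integrableD(2)[OF this]
  show "(\<integral>\<^sup>+z. ennreal (norm (f z) powr p) \<partial>lebesgue_on \<Omega>) < \<infinity>" by (simp add: less_top)
qed

lemma Lp_diff:
  fixes f g :: "complex \<Rightarrow> 'b::euclidean_space"
  assumes "p > 0" "f \<in> Lp p \<Omega>" "g \<in> Lp p \<Omega>"
  shows "(\<lambda>z. f z - g z) \<in> Lp p \<Omega>"
proof (rule Lp_memI)
  note m [measurable] = Lp_memD(1)[OF assms(2)] Lp_memD(1)[OF assms(3)]
  show "(\<lambda>z. f z - g z) \<in> borel_measurable (lebesgue_on \<Omega>)" by simp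
  have "(\<integral>\<^sup>+z. ennreal (norm (f z - g z) powr p) \<partial>lebesgue_on \<Omega>)
    \<le> (\<integral>\<^sup>+z. ennreal (2 powr p) * (ennreal (norm (f z) powr p) + ennreal (norm (g z) powr p)) \<partial>lebesgue_on \<Omega>)"
    using assms(1) by (intro nn_integral_mono) (simp add: ennreal_leI norm_diff_powr_le flip: ennreal_plus ennreal_mult)
  also have "\<dots> = ennreal (2 powr p) * ((\<integral>\<^sup>+z. ennreal (norm (f z) powr p) \<partial>lebesgue_on \<Omega>) + (\<integral>\<^sup>+z. ennreal (norm (g z) powr p) \<partial>lebesgue_on \<Omega>))"
    by (simp add: nn_integral_cmult nn_integral_add)
  also have "\<dots> < \<infinity>" using Lp_memD(2)[OF assms(2)] Lp_memD(2)[OF assms(3)] by (simp add: ennreal_mult_less_top)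
  finally show "(\<integral>\<^sup>+z. ennreal (norm (f z - g z) powr p) \<partial>lebesgue_on \<Omega>) < \<infinity>" .
qed

lemma Lp_limit_mem:
  fixes f :: "nat \<Rightarrow> complex \<Rightarrow> 'b::euclidean_space"
  assumes p: "p > 0" and f: "\<And>k. f k \<in> Lp p \<Omega>" and F [measurable]: "F \<in> borel_measurable (lebesgue_on \<Omega>)"
    and c: "(\<lambda>k. \<integral>\<^sup>+z. ennreal (norm (f k z - F z) powr p) \<partial>lebesgue_on \<Omega>) \<longlonglongrightarrow> 0"
  shows "F \<in> Lp p \<Omega>"
proof -
  have "\<forall>\<^sub>F k in sequentially. (\<integral>\<^sup>+z. ennreal (norm (f k z - F z) powr p) \<partial>lebesgue_on \<Omega>) < 1"
    using order_tendstoD(2)[OF c, of 1] by simp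
  then obtain k where k: "(\<integral>\<^sup>+z. ennreal (norm (f k z - F z) powr p) \<partial>lebesgue_on \<Omega>) < 1"
    by (auto simp: eventually_sequentially)
  note [measurable] = Lp_memD(1)[OF f]
  have "(\<lambda>z. f k z - F z) \<in> Lp p \<Omega>"
    using k by (intro Lp_memI) (auto intro: order.strict_trans)
  from Lp_diff[OF p f[of k] this] show ?thesis by simp
qed

lemma Lp_norm_tendsto_0:
  fixes f :: "nat \<Rightarrow> complex \<Rightarrow> 'b::euclidean_space"
  assumes p: "p > 0" and f [measurable]: "\<And>k. f k \<in> borel_measurable (lebesgue_on \<Omega>)"
    and c: "(\<lambda>k. \<integral>\<^sup>+z. ennreal (norm (f k z) powr p) \<partial>lebesgue_on \<Omega>) \<longlonglongrightarrow> 0"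
  shows "(\<lambda>k. Lp_norm p \<Omega> (f k)) \<longlonglongrightarrow> 0"
proof -
  have "(\<lambda>k. enn2real (\<integral>\<^sup>+z. ennreal (norm (f k z) powr p) \<partial>lebesgue_on \<Omega>)) \<longlonglongrightarrow> 0"
    using tendsto_enn2real[of _ 0] c by simp
  moreover have "enn2real (\<integral>\<^sup>+z. ennreal (norm (f k z) powr p) \<partial>lebesgue_on \<Omega>) = (\<integral>z. norm (f k z) powr p \<partial>lebesgue_on \<Omega>)" for k
    by (rule integral_eq_nn_integral[symmetric]) auto
  ultimately have "(\<lambda>k. \<integral>z. norm (f k z) powr p \<partial>lebesgue_on \<Omega>) \<longlonglongrightarrow> 0" by simp
  from tendsto_powr'[OF this tendsto_const[of "1 / p"]] p show ?thesis
    unfolding Lp_norm_def by simp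
qed

text \<open>No measurability is asked of f because it will be a \<open>weak_grad\<close>, known only
  up to null sets; it follows from that of g since the Lebesgue measure is complete.\<close>

lemma Lp_norm_cong_AE:
  fixes f g :: "complex \<Rightarrow> 'b::euclidean_space"
  assumes "AE z in lebesgue_on \<Omega>. f z = g z" "g \<in> borel_measurable (lebesgue_on \<Omega>)" "\<Omega> \<in> sets lebesgue"
  shows "Lp_norm p \<Omega> f = Lp_norm p \<Omega> g"
proof -
  have f: "f \<in> borel_measurable (lebesgue_on \<Omega>)"
  proof -
    have "AE z in lebesgue. z \<in> \<Omega> \<longrightarrow> f z = g z" using assms(1,3) by (simp add: AE_restrict_space_iff)
    then have "AE z in lebesgue. indicator \<Omega> z *\<^sub>R g z = indicator \<Omega> z *\<^sub>R f z"
      by eventually_elim (auto simp: indicator_def)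
    moreover have "(\<lambda>z. indicator \<Omega> z *\<^sub>R g z) \<in> borel_measurable lebesgue"
      using assms(2,3) by (simp add: borel_measurable_restrict_space_iff)
    ultimately have "(\<lambda>z. indicator \<Omega> z *\<^sub>R f z) \<in> borel_measurable lebesgue"
      by (rule borel_measurable_AE[rotated])
    then show ?thesis using assms(3) by (simp add: borel_measurable_restrict_space_iff)
  qed
  have "(\<integral>z. norm (f z) powr p \<partial>lebesgue_on \<Omega>) = (\<integral>z. norm (g z) powr p \<partial>lebesgue_on \<Omega>)"
    using f assms by (intro integral_cong_AE) auto
  then show ?thesis by (simp add: Lp_norm_def)
qed

lemma disc_sets_lebesgue: "disc r \<in> sets lebesgue"
  by (intro sets_completionI_sets) simp

lemma continuous_on_imp_measurable_disc:
  fixes f :: "complex \<Rightarrow> 'b::euclidean_space"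
  assumes "continuous_on (disc 1) f" "r \<le> 1"
  shows "f \<in> borel_measurable (lebesgue_on (disc r))"
proof -
  have "continuous_on (disc r) f" using continuous_on_subset[OF assms(1) subset_ball[OF assms(2)]] .
  then have "(\<lambda>z. indicator (disc r) z *\<^sub>R f z) \<in> borel_measurable borel"
    by (intro borel_measurable_continuous_on_indicator) auto
  then have "(\<lambda>z. indicator (disc r) z *\<^sub>R f z) \<in> borel_measurable lebesgue"
    by (intro measurable_completion) simp
  then show ?thesis using disc_sets_lebesgue by (simp add: borel_measurable_restrict_space_iff)
qed

lemma nn_integral_lebesgue_on_disc:
  "(\<integral>\<^sup>+z. f z \<partial>lebesgue_on (disc r)) = (\<integral>\<^sup>+z\<in>disc r. f z \<partial>lborel)"
  using disc_sets_lebesgue by (simp add: nn_integral_restrict_space nn_integral_completion)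

lemma emeasure_lebesgue_on_disc: "emeasure (lebesgue_on (disc r)) (space (lebesgue_on (disc r))) < \<infinity>"
proof -
  have "emeasure lebesgue (disc r) < \<infinity>"
    using emeasure_lborel_ball_finite[of "0::complex" r] by simp
  then show ?thesis using disc_sets_lebesgue by (simp add: emeasure_restrict_space space_restrict_space)
qed

lemma continuous_on_disc_bounded:
  fixes f :: "complex \<Rightarrow> 'b::euclidean_space"
  assumes "continuous_on (disc 1) f" "r < 1"
  obtains B where "B \<ge> 0" "\<And>z. z \<in> disc r \<Longrightarrow> norm (f z) \<le> B"
proof -
  have "continuous_on (cball 0 r) f" using assms by (auto intro!: continuous_on_subset[OF assms(1)])
  then have "compact (f ` cball 0 r)" using compact_cball by (rule compact_continuous_image)
  then obtain B where B: "\<forall>x\<in>f ` cball 0 r. norm x \<le> B" using compact_imp_bounded bounded_iff by metis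
  have "norm (f z) \<le> max B 0" if "z \<in> disc r" for z
  proof -
    have "f z \<in> f ` cball 0 r" using that by (intro imageI) simp
    from bspec[OF B this] show ?thesis by simp
  qed
  then show ?thesis using that[of "max B 0"] by auto
qed

lemma continuous_on_imp_Lp_disc:
  fixes f :: "complex \<Rightarrow> 'b::euclidean_space"
  assumes "continuous_on (disc 1) f" "r < 1" "p > 0"
  shows "f \<in> Lp p (disc r)"
proof (rule Lp_memI)
  show "f \<in> borel_measurable (lebesgue_on (disc r))" using assms by (intro continuous_on_imp_measurable_disc) auto
  obtain B where B: "B \<ge> 0" "\<And>z. z \<in> disc r \<Longrightarrow> norm (f z) \<le> B"
    using continuous_on_disc_bounded[OF assms(1,2)] by blast
  have "(\<integral>\<^sup>+z. ennreal (norm (f z) powr p) \<partial>lebesgue_on (disc r)) \<le> (\<integral>\<^sup>+z. ennreal (B powr p) \<partial>lebesgue_on (disc r))"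
    using B assms(3) by (intro nn_integral_mono ennreal_leI powr_mono2) (auto simp: space_restrict_space)
  also have "\<dots> = ennreal (B powr p) * emeasure (lebesgue_on (disc r)) (space (lebesgue_on (disc r)))"
    by (rule nn_integral_const)
  also have "\<dots> < \<infinity>" using emeasure_lebesgue_on_disc by (simp add: ennreal_mult_less_top)
  finally show "(\<integral>\<^sup>+z. ennreal (norm (f z) powr p) \<partial>lebesgue_on (disc r)) < \<infinity>" .
qed

section \<open>From strong to weak convergence in W^{1,p}\<close>

lemma Lp_1_imp_integrable:
  fixes f :: "complex \<Rightarrow> 'b::euclidean_space"
  assumes "f \<in> Lp 1 \<Omega>" shows "integrable (lebesgue_on \<Omega>) f"
  using Lp_memD[OF assms] by (intro integrableI_bounded) auto

lemma tendsto_L1_mult_bounded: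
  fixes f :: "nat \<Rightarrow> 'a \<Rightarrow> real"
  assumes f: "\<And>k. integrable M (f k)" and F: "integrable M F" and b [measurable]: "b \<in> borel_measurable M"
    and B: "\<And>x. \<bar>b x\<bar> \<le> B"
    and c: "(\<lambda>k. \<integral>\<^sup>+x. ennreal \<bar>f k x - F x\<bar> \<partial>M) \<longlonglongrightarrow> 0"
  shows "(\<lambda>k. \<integral>x. f k x * b x \<partial>M) \<longlonglongrightarrow> (\<integral>x. F x * b x \<partial>M)"
proof (rule tendsto_L1_int)
  have B0: "B \<ge> 0" using B[of undefined] by linarith
  have i: "integrable M (\<lambda>x. h x * b x)" if h: "integrable M h" for h :: "'a \<Rightarrow> real"
  proof (rule Bochner_Integration.integrable_bound)
    show "integrable M (\<lambda>x. h x * B)" using h by (rule integrable_mult_left)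
    show "(\<lambda>x. h x * b x) \<in> borel_measurable M" using h by simp
    show "AE x in M. norm (h x * b x) \<le> norm (h x * B)"
      using B B0 by (intro AE_I2) (auto simp: abs_mult intro!: mult_left_mono)
  qed
  show "integrable M (\<lambda>x. f k x * b x)" for k by (rule i[OF f])
  show "integrable M (\<lambda>x. F x * b x)" by (rule i[OF F])
  have [measurable]: "f k \<in> borel_measurable M" "F \<in> borel_measurable M" for k using f F by auto
  have le: "(\<integral>\<^sup>+x. ennreal (norm (f k x * b x - F x * b x)) \<partial>M) \<le> ennreal B * (\<integral>\<^sup>+x. ennreal \<bar>f k x - F x\<bar> \<partial>M)" for k
  proof -
    have "(\<integral>\<^sup>+x. ennreal (norm (f k x * b x - F x * b x)) \<partial>M) \<le> (\<integral>\<^sup>+x. ennreal B * ennreal \<bar>f k x - F x\<bar> \<partial>M)"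
    proof (rule nn_integral_mono)
      fix x
      have "norm (f k x * b x - F x * b x) = \<bar>b x\<bar> * \<bar>f k x - F x\<bar>"
      proof -
        have "f k x * b x - F x * b x = b x * (f k x - F x)" by (simp add: algebra_simps)
        then show ?thesis by (simp add: abs_mult)
      qed
      also have "\<dots> \<le> B * \<bar>f k x - F x\<bar>" by (intro mult_right_mono B) auto
      finally show "ennreal (norm (f k x * b x - F x * b x)) \<le> ennreal B * ennreal \<bar>f k x - F x\<bar>"
        using B0 by (simp add: ennreal_leI flip: ennreal_mult)
    qed
    also have "\<dots> = ennreal B * (\<integral>\<^sup>+x. ennreal \<bar>f k x - F x\<bar> \<partial>M)" by (rule nn_integral_cmult) simp
    finally show ?thesis .
  qed
  have "(\<lambda>k. ennreal B * (\<integral>\<^sup>+x. ennreal \<bar>f k x - F x\<bar> \<partial>M)) \<longlonglongrightarrow> ennreal B * 0"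
    by (intro ennreal_tendsto_cmult c) simp
  then have h0: "(\<lambda>k. ennreal B * (\<integral>\<^sup>+x. ennreal \<bar>f k x - F x\<bar> \<partial>M)) \<longlonglongrightarrow> 0" by simp
  show "(\<lambda>k. \<integral>\<^sup>+x. ennreal (norm (f k x * b x - F x * b x)) \<partial>M) \<longlonglongrightarrow> 0"
  proof (rule tendsto_sandwich[OF _ _ tendsto_const h0])
    show "\<forall>\<^sub>F k in sequentially. 0 \<le> (\<integral>\<^sup>+x. ennreal (norm (f k x * b x - F x * b x)) \<partial>M)"
      by (rule always_eventually) (rule allI, rule zero_le)
    show "\<forall>\<^sub>F k in sequentially. (\<integral>\<^sup>+x. ennreal (norm (f k x * b x - F x * b x)) \<partial>M)
      \<le> ennreal B * (\<integral>\<^sup>+x. ennreal \<bar>f k x - F x\<bar> \<partial>M)"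
      by (rule always_eventually) (rule allI, rule le)
  qed
qed

text \<open>A functional is additive only on members of the space, so f k is split as (f k - F) + F
  with both summands in W^{1,p}; the first is sent to 0 by boundedness.\<close>

lemma W1p_functional_tendsto:
  assumes \<Phi>: "W1p_functional p \<Omega> \<Phi>" and mem: "\<And>k. (\<lambda>z. f k z - F z) \<in> W1p p \<Omega>" "F \<in> W1p p \<Omega>"
    and c: "(\<lambda>k. W1p_norm p \<Omega> (\<lambda>z. f k z - F z)) \<longlonglongrightarrow> 0"
  shows "(\<lambda>k. \<Phi> (f k)) \<longlonglongrightarrow> \<Phi> F"
proof -
  obtain C where C: "\<And>h. h \<in> W1p p \<Omega> \<Longrightarrow> \<bar>\<Phi> h\<bar> \<le> C * W1p_norm p \<Omega> h"
    using \<Phi> unfolding W1p_functional_def by blast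
  have eq: "\<Phi> (f k) = \<Phi> (\<lambda>z. f k z - F z) + \<Phi> F" for k
  proof -
    have "\<Phi> (\<lambda>z. (f k z - F z) + F z) = \<Phi> (\<lambda>z. f k z - F z) + \<Phi> F"
    proof -
      have "\<forall>f\<in>W1p p \<Omega>. \<forall>h\<in>W1p p \<Omega>. \<Phi> (\<lambda>z. f z + h z) = \<Phi> f + \<Phi> h"
        using \<Phi> unfolding W1p_functional_def by blast
      from bspec[OF bspec[OF this mem(1)] mem(2)] show ?thesis .
    qed
    then show ?thesis by simp
  qed
  have "(\<lambda>k. C * W1p_norm p \<Omega> (\<lambda>z. f k z - F z)) \<longlonglongrightarrow> C * 0" by (intro tendsto_intros c)
  then have h0: "(\<lambda>k. C * W1p_norm p \<Omega> (\<lambda>z. f k z - F z)) \<longlonglongrightarrow> 0" by simp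
  have "(\<lambda>k. \<Phi> (\<lambda>z. f k z - F z)) \<longlonglongrightarrow> 0"
    by (rule Lim_null_comparison[OF _ h0]) (simp add: C[OF mem(1)])
  then have "(\<lambda>k. \<Phi> (\<lambda>z. f k z - F z) + \<Phi> F) \<longlonglongrightarrow> 0 + \<Phi> F" by (intro tendsto_intros)
  then show ?thesis unfolding eq by simp
qed

text \<open>Two exponents are at work: convergence in L^1 passes to the limit in the identities with
  test functions and so identifies G as the weak gradient of F, while convergence in L^p makes the
  Sobolev norm of the difference tend to 0.\<close>

lemma strong_imp_W1p_converges_weakly:
  fixes f :: "nat \<Rightarrow> complex \<Rightarrow> real"
  assumes r: "r < 1" and p: "1 < p" and f: "\<And>k. Ck_on 2 (disc 1) (f k)"
    and F: "F \<in> borel_measurable (lebesgue_on (disc r))" and G: "G \<in> borel_measurable (lebesgue_on (disc r))"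
    and cF: "\<And>q. q \<in> {1, p} \<Longrightarrow> (\<lambda>k. \<integral>\<^sup>+z. ennreal (norm (f k z - F z) powr q) \<partial>lebesgue_on (disc r)) \<longlonglongrightarrow> 0"
    and cG: "\<And>q. q \<in> {1, p} \<Longrightarrow> (\<lambda>k. \<integral>\<^sup>+z. ennreal (norm (grad (f k) z - G z) powr q) \<partial>lebesgue_on (disc r)) \<longlonglongrightarrow> 0"
  shows "W1p_converges_weakly p (disc r) f F"
proof -
  let ?\<Omega> = "disc r"
  note fd = Ck_on_2_D[OF f]
  have gc: "continuous_on (disc 1) (grad (f k))" for k by (intro continuous_on_grad fd)
  have fL: "f k \<in> Lp q ?\<Omega>" "grad (f k) \<in> Lp q ?\<Omega>" if "q > 0" for k q
    using that r gc fd by (auto intro: continuous_on_imp_Lp_disc)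
  have FL: "F \<in> Lp q ?\<Omega>" "G \<in> Lp q ?\<Omega>" if "q \<in> {1, p}" for q
    using p that by (auto intro!: Lp_limit_mem[OF _ fL(1) F cF] Lp_limit_mem[OF _ fL(2) G cG])
  have wf: "has_weak_grad ?\<Omega> (f k) (grad (f k))" for k
  proof (rule has_weak_grad_grad)
    show "Ck_on 2 (disc r) (f k)" using r by (intro Ck_on_subset[OF f] subset_ball) simp
  qed simp
  have ai: "h absolutely_integrable_on K" if "h \<in> Lp 1 ?\<Omega>" "compact K" "K \<subseteq> ?\<Omega>" for h :: "complex \<Rightarrow> 'c::euclidean_space" and K
  proof -
    have "integrable lebesgue (\<lambda>z. indicator ?\<Omega> z *\<^sub>R h z)"
      using Lp_1_imp_integrable[OF that(1)] disc_sets_lebesgue by (simp add: integrable_restrict_space)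
    then have "h absolutely_integrable_on ?\<Omega>" by (simp add: set_integrable_def)
    then show ?thesis
      by (rule set_integrable_subset) (use that in \<open>auto intro: fmeasurableD lmeasurable_compact\<close>)
  qed
  have wF: "has_weak_grad ?\<Omega> F G"
    unfolding has_weak_grad_def
  proof (intro conjI allI impI ballI)
    fix K assume "compact K \<and> K \<subseteq> ?\<Omega>"
    then show "F absolutely_integrable_on K" "G absolutely_integrable_on K"
      using ai FL[of 1] by auto
  next
    fix \<psi> :: "complex \<Rightarrow> real" and v :: complex assume t: "test_function ?\<Omega> \<psi>" and v: "v \<in> Basis"
    obtain K where K: "compact K" "K \<subseteq> ?\<Omega>" "\<And>z. z \<notin> K \<Longrightarrow> \<psi> z = 0" "\<And>v z. z \<notin> K \<Longrightarrow> pderiv_dir v \<psi> z = 0"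
      "Ck_on 2 UNIV \<psi>"
      using test_function_D[OF t] by metis
    note pd = Ck_on_2_D[OF K(5), simplified]
    obtain B1 where B1: "\<And>z. \<bar>\<psi> z\<bar> \<le> B1" using continuous_compact_support_bounded[OF pd(3) K(1,3)] by blast
    obtain B2 where B2: "\<And>z. \<bar>pderiv_dir v \<psi> z\<bar> \<le> B2" using continuous_compact_support_bounded[OF pd(4) K(1,4)] by blast
    have r1: "r \<le> 1" using r by simp
    have m: "\<psi> \<in> borel_measurable (lebesgue_on ?\<Omega>)" "pderiv_dir v \<psi> \<in> borel_measurable (lebesgue_on ?\<Omega>)"
      using pd(3) pd(4)[of v] r1 by (auto intro!: continuous_on_imp_measurable_disc intro: continuous_on_subset)
    have L1: "(\<lambda>k. \<integral>z. f k z * pderiv_dir v \<psi> z \<partial>lebesgue_on ?\<Omega>) \<longlonglongrightarrow> (\<integral>z. F z * pderiv_dir v \<psi> z \<partial>lebesgue_on ?\<Omega>)"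
      using cF[of 1] by (intro tendsto_L1_mult_bounded[OF _ _ m(2) B2] Lp_1_imp_integrable fL FL) auto
    have L2: "(\<lambda>k. \<integral>z. (grad (f k) z \<bullet> v) * \<psi> z \<partial>lebesgue_on ?\<Omega>) \<longlonglongrightarrow> (\<integral>z. (G z \<bullet> v) * \<psi> z \<partial>lebesgue_on ?\<Omega>)"
    proof (rule tendsto_L1_mult_bounded[OF _ _ m(1) B1])
      show "integrable (lebesgue_on ?\<Omega>) (\<lambda>z. grad (f k) z \<bullet> v)" for k
        using Lp_1_imp_integrable[OF fL(2)[of 1 k]] by (intro integrable_inner_left) simp
      show "integrable (lebesgue_on ?\<Omega>) (\<lambda>z. G z \<bullet> v)"
        using Lp_1_imp_integrable[OF FL(2)[of 1]] by (intro integrable_inner_left) simp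
      show "(\<lambda>k. \<integral>\<^sup>+z. ennreal \<bar>grad (f k) z \<bullet> v - G z \<bullet> v\<bar> \<partial>lebesgue_on ?\<Omega>) \<longlonglongrightarrow> 0"
      proof (rule tendsto_sandwich[OF _ _ tendsto_const])
        show "(\<lambda>k. \<integral>\<^sup>+z. ennreal (norm (grad (f k) z - G z) powr 1) \<partial>lebesgue_on ?\<Omega>) \<longlonglongrightarrow> 0" using cG by blast
        have "\<bar>a \<bullet> v - b \<bullet> v\<bar> \<le> norm (a - b)" for a b :: complex
          using Basis_le_norm[OF v, of "a - b"] by (simp add: inner_diff_left)
        then show "\<forall>\<^sub>F k in sequentially. (\<integral>\<^sup>+z. ennreal \<bar>grad (f k) z \<bullet> v - G z \<bullet> v\<bar> \<partial>lebesgue_on ?\<Omega>)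
          \<le> (\<integral>\<^sup>+z. ennreal (norm (grad (f k) z - G z) powr 1) \<partial>lebesgue_on ?\<Omega>)"
          by (intro always_eventually allI nn_integral_mono ennreal_leI) auto
        show "\<forall>\<^sub>F k in sequentially. 0 \<le> (\<integral>\<^sup>+z. ennreal \<bar>grad (f k) z \<bullet> v - G z \<bullet> v\<bar> \<partial>lebesgue_on ?\<Omega>)" by simp
      qed
    qed
    have "(\<lambda>k. - (\<integral>z. (grad (f k) z \<bullet> v) * \<psi> z \<partial>lebesgue_on ?\<Omega>)) \<longlonglongrightarrow> (\<integral>z. F z * pderiv_dir v \<psi> z \<partial>lebesgue_on ?\<Omega>)"
    proof -
      have "(\<integral>z. f k z * pderiv_dir v \<psi> z \<partial>lebesgue_on ?\<Omega>) = - (\<integral>z. (grad (f k) z \<bullet> v) * \<psi> z \<partial>lebesgue_on ?\<Omega>)" for k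
        using wf t v unfolding has_weak_grad_def by blast
      then show ?thesis using L1 by simp
    qed
    then show "(\<integral>z. F z * pderiv_dir v \<psi> z \<partial>lebesgue_on ?\<Omega>) = - (\<integral>z. (G z \<bullet> v) * \<psi> z \<partial>lebesgue_on ?\<Omega>)"
      using LIMSEQ_unique[OF _ tendsto_minus[OF L2]] by blast
  qed
  \<comment> \<open>F need not be differentiable, so the weak gradient of the difference comes from
    the linearity of the defining identity.\<close>
  have wd: "has_weak_grad ?\<Omega> (\<lambda>z. f k z - F z) (\<lambda>z. grad (f k) z - G z)" for k
    unfolding has_weak_grad_def
  proof (intro conjI allI impI ballI)
    fix K assume "compact K \<and> K \<subseteq> ?\<Omega>"
    then show "(\<lambda>z. f k z - F z) absolutely_integrable_on K" "(\<lambda>z. grad (f k) z - G z) absolutely_integrable_on K"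
      using wF wf[of k] unfolding has_weak_grad_def by (auto intro: set_integral_diff(1))
  next
    fix \<psi> :: "complex \<Rightarrow> real" and v :: complex assume t: "test_function ?\<Omega> \<psi>" and v: "v \<in> Basis"
    obtain K where K: "compact K" "K \<subseteq> ?\<Omega>" "\<And>z. z \<notin> K \<Longrightarrow> \<psi> z = 0" "\<And>v z. z \<notin> K \<Longrightarrow> pderiv_dir v \<psi> z = 0"
      "Ck_on 2 UNIV \<psi>"
      using test_function_D[OF t] by metis
    note pd = Ck_on_2_D[OF K(5), simplified]
    have a: "F absolutely_integrable_on K" "G absolutely_integrable_on K" "f k absolutely_integrable_on K" "grad (f k) absolutely_integrable_on K"
      using wF wf[of k] K unfolding has_weak_grad_def by auto
    have i: "integrable (lebesgue_on ?\<Omega>) (\<lambda>z. F z * pderiv_dir v \<psi> z)" "integrable (lebesgue_on ?\<Omega>) (\<lambda>z. f k z * pderiv_dir v \<psi> z)"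
      "integrable (lebesgue_on ?\<Omega>) (\<lambda>z. (G z \<bullet> v) * \<psi> z)" "integrable (lebesgue_on ?\<Omega>) (\<lambda>z. (grad (f k) z \<bullet> v) * \<psi> z)"
      using K a by (auto intro!: integrable_mult_compact_support[OF _ _ K(1,2)] pd absolutely_integrable_inner)
    have "(\<integral>z. F z * pderiv_dir v \<psi> z \<partial>lebesgue_on ?\<Omega>) = - (\<integral>z. (G z \<bullet> v) * \<psi> z \<partial>lebesgue_on ?\<Omega>)"
      "(\<integral>z. f k z * pderiv_dir v \<psi> z \<partial>lebesgue_on ?\<Omega>) = - (\<integral>z. (grad (f k) z \<bullet> v) * \<psi> z \<partial>lebesgue_on ?\<Omega>)"
      using wF wf[of k] t v unfolding has_weak_grad_def by blast+
    then show "(\<integral>z. (f k z - F z) * pderiv_dir v \<psi> z \<partial>lebesgue_on ?\<Omega>) = - (\<integral>z. ((grad (f k) z - G z) \<bullet> v) * \<psi> z \<partial>lebesgue_on ?\<Omega>)"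
      using i by (simp add: inner_diff_left left_diff_distrib Bochner_Integration.integral_diff)
  qed
  have dL: "(\<lambda>z. f k z - F z) \<in> Lp p ?\<Omega>" "(\<lambda>z. grad (f k) z - G z) \<in> Lp p ?\<Omega>" for k
    using p FL[of p] fL[of p k] by (auto intro: Lp_diff)
  have n: "(\<lambda>k. W1p_norm p ?\<Omega> (\<lambda>z. f k z - F z)) \<longlonglongrightarrow> 0"
  proof -
    have eq: "Lp_norm p ?\<Omega> (weak_grad ?\<Omega> (\<lambda>z. f k z - F z)) = Lp_norm p ?\<Omega> (\<lambda>z. grad (f k) z - G z)" for k
      by (rule Lp_norm_cong_AE[OF AE_weak_grad_eq[OF _ wd] Lp_memD(1)[OF dL(2)] disc_sets_lebesgue]) simp
    have 1: "(\<lambda>k. Lp_norm p ?\<Omega> (\<lambda>z. f k z - F z)) \<longlonglongrightarrow> 0" "(\<lambda>k. Lp_norm p ?\<Omega> (\<lambda>z. grad (f k) z - G z)) \<longlonglongrightarrow> 0"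
      using p Lp_memD(1)[OF dL(1)] Lp_memD(1)[OF dL(2)] by (auto intro!: Lp_norm_tendsto_0 cF cG)
    have "(\<lambda>k. ((Lp_norm p ?\<Omega> (\<lambda>z. f k z - F z)) powr p + (Lp_norm p ?\<Omega> (\<lambda>z. grad (f k) z - G z)) powr p) powr (1 / p)) \<longlonglongrightarrow> (0 powr p + 0 powr p) powr (1 / p)"
      using p by (intro tendsto_powr' tendsto_add 1 tendsto_const) (auto simp: Lp_norm_def)
    then show ?thesis unfolding W1p_norm_def eq by simp
  qed
  have mem: "F \<in> W1p p ?\<Omega>" "f k \<in> W1p p ?\<Omega>" "(\<lambda>z. f k z - F z) \<in> W1p p ?\<Omega>" for k
    unfolding W1p_def using wF wf[of k] wd[of k] FL[of p] fL[of p k] dL[of k] p by auto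
  show ?thesis unfolding W1p_converges_weakly_def
    using mem W1p_functional_tendsto[OF _ mem(3) mem(1) n] by blast
qed

section \<open>Gluing of functions and smooth cut-offs\<close>

lemma Ck_on_open_Un:
  assumes "open S" "open T" "Ck_on k S f" "Ck_on k T f"
  shows "Ck_on k (S \<union> T) f"
  using assms(3,4)
proof (induction k arbitrary: f)
  case 0
  then show ?case using continuous_on_open_Un[OF assms(1,2)] by simp
next
  case (Suc k)
  then show ?case by auto
qed

lemma flat_exp_0_mono: "s \<le> t \<Longrightarrow> flat_exp 0 s \<le> flat_exp 0 t"
  by (auto simp: flat_exp_def field_simps)

text \<open>With h the flat exponential, s is at least 1 on the inner disc and at most 0 outside the
  outer one. There h (s) is at least c = h (1), respectively 0, so c - h (s) is non-positive,
  respectively equal to c. Applying h once more and dividing by h (c) gives exactly 0, respectively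
  1, which \<open>\<phi>\<close> reverses.\<close>

lemma cutoff_exists:
  assumes "0 < R" "R < R'"
  obtains \<phi> :: "complex \<Rightarrow> real" where "Ck_on 2 UNIV \<phi>" "\<And>z. z \<in> cball 0 R \<Longrightarrow> \<phi> z = 1"
    "\<And>z. z \<notin> cball 0 R' \<Longrightarrow> \<phi> z = 0" "\<And>z. 0 \<le> \<phi> z" "\<And>z. \<phi> z \<le> 1"
proof -
  define h where "h = flat_exp 0"
  define c where "c = h 1"
  define d where "d = R'\<^sup>2 - R\<^sup>2"
  define s where "s z = (R'\<^sup>2 - ((Re z)\<^sup>2 + (Im z)\<^sup>2)) / d" for z
  define \<phi> where "\<phi> z = 1 - h (c - h (s z)) / h c" for z
  have mono: "h x \<le> h y" if "x \<le> y" for x y unfolding h_def using that by (rule flat_exp_0_mono)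
  have h0: "h x = 0" if "x \<le> 0" for x using that by (simp add: h_def flat_exp_def)
  have hp: "h x > 0" if "x > 0" for x using that by (simp add: h_def flat_exp_def)
  have hn: "h x \<ge> 0" for x by (simp add: h_def flat_exp_def)
  have cp: "c > 0" "h c > 0" using hp by (auto simp: c_def)
  have dp: "d > 0" unfolding d_def using assms by (simp add: power_strict_mono)
  have hk: "Ck_on 2 UNIV h" unfolding h_def by (rule Ck_on_flat_exp)
  have sk: "Ck_on 2 UNIV s"
  proof -
    have "Ck_on 2 UNIV (\<lambda>z. R'\<^sup>2 * (1 / d) + (- (1 / d)) * (Re z * Re z + Im z * Im z))"
      by (intro Ck_on_add Ck_on_mult Ck_on_const Ck_on_bounded_linear bounded_linear_Re bounded_linear_Im open_UNIV)
    moreover have "(\<lambda>z. R'\<^sup>2 * (1 / d) + (- (1 / d)) * (Re z * Re z + Im z * Im z)) = s"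
      by (simp add: s_def power2_eq_square diff_divide_distrib fun_eq_iff)
    ultimately show ?thesis by simp
  qed
  have "Ck_on 2 UNIV (\<lambda>z. c + (-1) * h (s z))"
    by (intro Ck_on_add Ck_on_mult Ck_on_const Ck_on_compose_real[OF open_UNIV hk sk] open_UNIV) auto
  from Ck_on_compose_real[OF open_UNIV hk this]
  have "Ck_on 2 UNIV (\<lambda>z. 1 + (- (1 / h c)) * h (c + (-1) * h (s z)))"
    by (intro Ck_on_add Ck_on_mult Ck_on_const open_UNIV) auto
  moreover have "(\<lambda>z. 1 + (- (1 / h c)) * h (c + (-1) * h (s z))) = \<phi>"
    by (simp add: \<phi>_def fun_eq_iff)
  ultimately have 1: "Ck_on 2 UNIV \<phi>" by simp
  have sq: "(Re z)\<^sup>2 + (Im z)\<^sup>2 = (norm z)\<^sup>2" for z by (simp add: cmod_power2)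
  have 2: "\<phi> z = 1" if "z \<in> cball 0 R" for z
  proof -
    have "(norm z)\<^sup>2 \<le> R\<^sup>2" using that by (intro power_mono) auto
    then have "s z \<ge> 1" using dp by (simp add: s_def sq le_divide_eq) (simp add: d_def)
    then have "c \<le> h (s z)" unfolding c_def by (rule mono)
    then show ?thesis by (simp add: \<phi>_def h0)
  qed
  have 3: "\<phi> z = 0" if "z \<notin> cball 0 R'" for z
  proof -
    have "R'\<^sup>2 \<le> (norm z)\<^sup>2" using that assms by (intro power_mono) auto
    then have "s z \<le> 0" using dp by (simp add: s_def sq divide_le_0_iff)
    then show ?thesis using cp by (simp add: \<phi>_def h0)
  qed
  have 4: "0 \<le> \<phi> z" for z
    using mono[of "c - h (s z)" c] hn[of "s z"] cp by (simp add: \<phi>_def)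
  have 5: "\<phi> z \<le> 1" for z using hn cp by (simp add: \<phi>_def)
  show ?thesis by (rule that[OF 1 2 3 4 5])
qed

subsection \<open>Exponential integrability\<close>

text \<open>Jensen's inequality for the probability measure obtained from N / \<tau> by placing the
  missing mass at a point where Y is 0; that mass contributes at most the summand 1. The proof uses
  the tangent of exp at the mean y / \<tau>, so the total mass of N may be anything up to
  \<tau>.\<close>

lemma exp_average_le:
  fixes Y :: "'a \<Rightarrow> real"
  assumes [measurable]: "Y \<in> borel_measurable N" and Y: "\<And>x. 0 \<le> Y x"
    and \<tau>: "\<tau> > 0" "emeasure N (space N) \<le> ennreal \<tau>"
    and y: "(\<integral>\<^sup>+x. ennreal (Y x) \<partial>N) = ennreal y" "y \<ge> 0"
  shows "ennreal (exp (y / \<tau>)) \<le> 1 + ennreal (1 / \<tau>) * (\<integral>\<^sup>+x. ennreal (exp (Y x)) \<partial>N)"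
proof (cases "(\<integral>\<^sup>+x. ennreal (exp (Y x)) \<partial>N)")
  case top
  then show ?thesis using \<tau>(1) by (simp add: ennreal_mult_top)
next
  case (real I)
  define \<mu> where "\<mu> = y / \<tau>"
  have \<mu>: "\<mu> \<ge> 0" "y = \<tau> * \<mu>" using \<tau> y by (auto simp: \<mu>_def)
  obtain m where m: "emeasure N (space N) = ennreal m" "m \<ge> 0" "m \<le> \<tau>"
    using \<tau> by (cases "emeasure N (space N)") (auto simp: top_unique)
  have "ennreal (exp \<mu> * (m + y)) = (\<integral>\<^sup>+x. ennreal (exp \<mu>) * (1 + ennreal (Y x)) \<partial>N)"
    using m y by (simp add: nn_integral_cmult nn_integral_add ennreal_mult)
  also have "\<dots> \<le> (\<integral>\<^sup>+x. ennreal (exp (Y x)) + ennreal (exp \<mu> * \<mu>) \<partial>N)"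
  proof (rule nn_integral_mono)
    fix x
    have "exp \<mu> * (1 + (Y x - \<mu>)) \<le> exp \<mu> * exp (Y x - \<mu>)"
      by (intro mult_left_mono exp_ge_add_one_self) auto
    then have "exp \<mu> * (1 + Y x) \<le> exp (Y x) + exp \<mu> * \<mu>"
      by (simp add: algebra_simps flip: exp_add)
    then have "ennreal (exp \<mu> * (1 + Y x)) \<le> ennreal (exp (Y x) + exp \<mu> * \<mu>)" by (rule ennreal_leI)
    then show "ennreal (exp \<mu>) * (1 + ennreal (Y x)) \<le> ennreal (exp (Y x)) + ennreal (exp \<mu> * \<mu>)"
      using Y[of x] \<mu> by (simp add: ennreal_mult)
  qed
  also have "\<dots> = ennreal (I + exp \<mu> * \<mu> * m)"
    using real m \<mu> by (simp add: nn_integral_add ennreal_mult)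
  finally have "exp \<mu> * (m + y) \<le> I + exp \<mu> * \<mu> * m"
    using real m \<mu> y(2) by (subst (asm) ennreal_le_iff) auto
  then have 1: "exp \<mu> * (m * (1 - \<mu>) + \<tau> * \<mu>) \<le> I" by (simp add: \<mu>(2) algebra_simps)
  have "exp \<mu> * (1 - \<mu>) \<le> exp \<mu> * exp (- \<mu>)"
    using exp_ge_add_one_self[of "- \<mu>"] by (intro mult_left_mono) auto
  then have e: "exp \<mu> * (1 - \<mu>) \<le> 1" by (simp flip: exp_add)
  \<comment> \<open>The contribution of the missing mass \<tau> - m: the tangent at the mean has the
    value exp \<mu> (1 - \<mu>) at 0, which is at most exp 0.\<close>
  have "(\<tau> - m) * (exp \<mu> * (1 - \<mu>)) \<le> (\<tau> - m) * 1" using e m by (intro mult_left_mono) auto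
  then have "\<tau> * (exp \<mu> - 1) \<le> exp \<mu> * (m * (1 - \<mu>) + \<tau> * \<mu>)" using m by (simp add: algebra_simps)
  then have "\<tau> * (exp \<mu> - 1) \<le> I" using 1 by linarith
  then have "exp \<mu> \<le> 1 + 1 / \<tau> * I" using \<tau>(1) by (simp add: field_simps)
  then have "ennreal (exp \<mu>) \<le> ennreal (1 + 1 / \<tau> * I)" by (rule ennreal_leI)
  also have "\<dots> = 1 + ennreal (1 / \<tau>) * ennreal I" using real \<tau>(1) by (simp flip: ennreal_mult)
  finally show ?thesis using real by (simp add: \<mu>_def)
qed

lemma laplacian_mult:
  fixes \<phi> w :: "complex \<Rightarrow> real"
  assumes S: "open S" "z \<in> S" and \<phi>: "Ck_on 2 S \<phi>" and w: "Ck_on 2 S w"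
  shows "laplacian (\<lambda>z. \<phi> z * w z) z = \<phi> z * laplacian w z + 2 * (grad \<phi> z \<bullet> grad w z) + laplacian \<phi> z * w z"
proof -
  note pd = Ck_on_2_D[OF \<phi>] and wd = Ck_on_2_D[OF w]
  have p: "pderiv_dir v (pderiv_dir v (\<lambda>z. \<phi> z * w z)) z =
    \<phi> z * pderiv_dir v (pderiv_dir v w) z + 2 * (pderiv_dir v \<phi> z * pderiv_dir v w z) + pderiv_dir v (pderiv_dir v \<phi>) z * w z" for v
  proof -
    have d: "(\<lambda>z. \<phi> z * pderiv_dir v w z) differentiable (at z)" "(\<lambda>z. pderiv_dir v \<phi> z * w z) differentiable (at z)"
      by (intro differentiable_mult pd wd S)+
    have "pderiv_dir v (pderiv_dir v (\<lambda>z. \<phi> z * w z)) z = pderiv_dir v (\<lambda>z. \<phi> z * pderiv_dir v w z + pderiv_dir v \<phi> z * w z) z"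
    proof (rule pderiv_dir_transform(2)[OF S])
      show "(\<lambda>z. \<phi> z * pderiv_dir v w z + pderiv_dir v \<phi> z * w z) differentiable (at z)"
        by (intro differentiable_add d)
      fix y assume "y \<in> S"
      then show "\<phi> y * pderiv_dir v w y + pderiv_dir v \<phi> y * w y = pderiv_dir v (\<lambda>z. \<phi> z * w z) y"
        by (intro pderiv_dir_mult[symmetric] pd wd)
    qed
    also have "\<dots> = \<phi> z * pderiv_dir v (pderiv_dir v w) z + 2 * (pderiv_dir v \<phi> z * pderiv_dir v w z) + pderiv_dir v (pderiv_dir v \<phi>) z * w z"
      unfolding pderiv_dir_add[OF d] using pd wd S by (simp add: pderiv_dir_mult)
    finally show ?thesis .
  qed
  have g: "grad \<phi> z \<bullet> grad w z = pderiv_dir 1 \<phi> z * pderiv_dir 1 w z + pderiv_dir \<i> \<phi> z * pderiv_dir \<i> w z"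
    by (simp add: grad_def inner_complex_def)
  show ?thesis unfolding laplacian_def p g by (simp add: algebra_simps)
qed

text \<open>Points of the unit disc have distance at most 2. The constant 4 = 2^2 makes the kernel
  ln (4 / t) non-negative there and large enough to dominate the logarithm with either sign.\<close>

lemma abs_ln_le_ln_4:
  fixes t :: real assumes "0 < t" "t \<le> 2" shows "\<bar>ln t\<bar> \<le> ln (4 / t)"
proof -
  have "ln (4 / t) = ln 4 - ln t" using assms by (simp add: ln_div)
  moreover have "2 * ln t \<le> ln 4"
  proof -
    have "2 * ln t = ln (t\<^sup>2)" using assms by (simp add: ln_realpow)
    also have "\<dots> \<le> ln 4" using assms power_mono[of t 2 2] by (subst ln_le_cancel_iff) auto
    finally show ?thesis .
  qed
  moreover have "ln (4::real) \<ge> 0" by simp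
  ultimately show ?thesis by linarith
qed

lemma cutoff_derivs:
  fixes \<phi> :: "complex \<Rightarrow> real"
  assumes k: "Ck_on 2 UNIV \<phi>" and z0: "\<And>z. z \<notin> cball 0 R' \<Longrightarrow> \<phi> z = 0" and o1: "\<And>z. z \<in> cball 0 R \<Longrightarrow> \<phi> z = 1"
  obtains B where "B \<ge> 0" "\<And>z. norm (grad \<phi> z) \<le> B" "\<And>z. \<bar>laplacian \<phi> z\<bar> \<le> B"
    "\<And>z. z \<notin> cball 0 R' \<Longrightarrow> grad \<phi> z = 0 \<and> laplacian \<phi> z = 0"
    "\<And>z. z \<in> disc R \<Longrightarrow> grad \<phi> z = 0 \<and> laplacian \<phi> z = 0"
proof -
  note pd = Ck_on_2_D[OF k, simplified]
  have const: "grad \<phi> z = 0 \<and> laplacian \<phi> z = 0" if S: "open S" "z \<in> S" "\<And>y. y \<in> S \<Longrightarrow> \<phi> y = c" for S z c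
  proof -
    have 1: "pderiv_dir v \<phi> y = 0" if "y \<in> S" for v y
    proof -
      have "pderiv_dir v \<phi> y = pderiv_dir v (\<lambda>_. c) y"
        by (rule pderiv_dir_transform(2)[OF S(1) that]) (simp_all add: S(3))
      then show ?thesis by (simp add: pderiv_dir_def frechet_derivative_const)
    qed
    have "pderiv_dir v (pderiv_dir v \<phi>) z = pderiv_dir v (\<lambda>_. 0) z" for v
      by (rule pderiv_dir_transform(2)[OF S(1,2)]) (simp_all add: 1)
    then have "pderiv_dir v (pderiv_dir v \<phi>) z = 0" for v by (simp add: pderiv_dir_def frechet_derivative_const)
    then show ?thesis using 1[OF S(2)] by (simp add: grad_def laplacian_def Complex_eq_0)
  qed
  have out: "grad \<phi> z = 0 \<and> laplacian \<phi> z = 0" if "z \<notin> cball 0 R'" for z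
    using const[of "- cball 0 R'" z 0] that z0 by auto
  have ins: "grad \<phi> z = 0 \<and> laplacian \<phi> z = 0" if "z \<in> disc R" for z
    using const[of "disc R" z 1] that o1 by auto
  have cg: "continuous_on UNIV (\<lambda>z. norm (grad \<phi> z))" by (intro continuous_intros continuous_on_grad pd)
  have cl: "continuous_on UNIV (laplacian \<phi>)" unfolding laplacian_def[abs_def] by (intro continuous_intros pd)
  obtain B1 where B1: "B1 \<ge> 0" "\<And>z. \<bar>norm (grad \<phi> z)\<bar> \<le> B1"
    using continuous_compact_support_bounded[OF cg compact_cball[of 0 R']] out by auto
  obtain B2 where B2: "B2 \<ge> 0" "\<And>z. \<bar>laplacian \<phi> z\<bar> \<le> B2"
    using continuous_compact_support_bounded[OF cl compact_cball[of 0 R']] out by auto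
  show ?thesis
  proof (rule that[of "B1 + B2"])
    show "norm (grad \<phi> z) \<le> B1 + B2" for z using B1(2)[of z] B2(1) by simp
    show "\<bar>laplacian \<phi> z\<bar> \<le> B1 + B2" for z using B2(2)[of z] B1(1) by simp
  qed (use B1(1) B2(1) out ins in auto)
qed

text \<open>The Laplacian of the cut-off function \<phi> w is \<phi> times that of w plus terms that
  live in an annulus at positive distance from z, where the logarithm is bounded. The Laplacian of w
  thus enters with coefficient exactly 1, which preserves the sharp exponent 4 pi / \<tau>; L
  depends on the radii only.\<close>

lemma potential_bound:
  assumes r: "0 < r" "r < \<rho>" "\<rho> \<le> 1"
  shows "\<exists>L\<ge>0. \<forall>w. Ck_on 2 (disc 1) w \<longrightarrow> (\<forall>z\<in>disc r.
    ennreal (2 * pi * \<bar>w z\<bar>) \<le> (\<integral>\<^sup>+\<zeta>\<in>disc 1. ennreal (ln (4 / norm (\<zeta> - z)) * \<bar>laplacian w \<zeta>\<bar>) \<partial>lborel)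
      + ennreal L * ((\<integral>\<^sup>+\<zeta>\<in>disc \<rho>. ennreal \<bar>w \<zeta>\<bar> \<partial>lborel) + (\<integral>\<^sup>+\<zeta>\<in>disc \<rho>. ennreal (norm (grad w \<zeta>)) \<partial>lborel)))"
proof -
  define R where "R = r + (\<rho> - r) / 3"
  define R' where "R' = r + 2 * (\<rho> - r) / 3"
  have R: "r < R" "R < R'" "R' < \<rho>" "0 < R" using r by (auto simp: R_def R'_def field_simps)
  obtain \<phi> :: "complex \<Rightarrow> real" where \<phi>: "Ck_on 2 UNIV \<phi>" "\<And>z. z \<in> cball 0 R \<Longrightarrow> \<phi> z = 1"
    "\<And>z. z \<notin> cball 0 R' \<Longrightarrow> \<phi> z = 0" "\<And>z. 0 \<le> \<phi> z" "\<And>z. \<phi> z \<le> 1"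
    by (rule cutoff_exists[OF R(4,2)]) (rule that)
  obtain B where B: "B \<ge> 0" "\<And>z. norm (grad \<phi> z) \<le> B" "\<And>z. \<bar>laplacian \<phi> z\<bar> \<le> B"
    "\<And>z. z \<notin> cball 0 R' \<Longrightarrow> grad \<phi> z = 0 \<and> laplacian \<phi> z = 0"
    "\<And>z. z \<in> disc R \<Longrightarrow> grad \<phi> z = 0 \<and> laplacian \<phi> z = 0"
    by (rule cutoff_derivs[of \<phi> R' R, OF \<phi>(1)], erule \<phi>(3), erule \<phi>(2), rule that)
  \<comment> \<open>Bound for |ln t| by t + 1/t on the annulus, where R - r \<le> t \<le> 2.\<close>
  define \<Lambda> where "\<Lambda> = 2 + 1 / (R - r)"
  have \<Lambda>: "\<Lambda> \<ge> 0" using R by (simp add: \<Lambda>_def)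
  define L where "L = \<Lambda> * (2 * B)"
  have L: "L \<ge> 0" using \<Lambda> B by (simp add: L_def)
  have main: "ennreal (2 * pi * \<bar>w z\<bar>) \<le> (\<integral>\<^sup>+\<zeta>\<in>disc 1. ennreal (ln (4 / norm (\<zeta> - z)) * \<bar>laplacian w \<zeta>\<bar>) \<partial>lborel)
      + ennreal L * ((\<integral>\<^sup>+\<zeta>\<in>disc \<rho>. ennreal \<bar>w \<zeta>\<bar> \<partial>lborel) + (\<integral>\<^sup>+\<zeta>\<in>disc \<rho>. ennreal (norm (grad w \<zeta>)) \<partial>lborel))"
    if w: "Ck_on 2 (disc 1) w" and z: "z \<in> disc r" for w z
  proof -
    note wd = Ck_on_2_D[OF w]
    define W where "W \<zeta> = \<phi> \<zeta> * w \<zeta>" for \<zeta>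
    have W0: "W \<zeta> = 0" if "\<zeta> \<notin> cball 0 R'" for \<zeta> using \<phi>(3)[OF that] by (simp add: W_def)
    have \<phi>D: "Ck_on 2 (disc 1) \<phi>" by (rule Ck_on_subset[OF \<phi>(1)]) simp
    have WC: "Ck_on 2 UNIV W"
    proof -
      have a: "Ck_on 2 (disc 1) W" unfolding W_def by (rule Ck_on_mult[OF open_ball \<phi>D w])
      have b: "Ck_on 2 (- cball 0 R') W"
        by (rule Ck_on_transform[OF _ Ck_on_const[of _ _ 0]]) (use W0 in auto)
      have "disc 1 \<union> - cball 0 R' = UNIV" using R r by (auto simp: not_le)
      then show ?thesis using Ck_on_open_Un[OF open_ball _ a b] by auto
    qed
    have lapW: "laplacian W \<zeta> = \<phi> \<zeta> * laplacian w \<zeta> + 2 * (grad \<phi> \<zeta> \<bullet> grad w \<zeta>) + laplacian \<phi> \<zeta> * w \<zeta>" if "\<zeta> \<in> disc 1" for \<zeta>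
      unfolding W_def by (rule laplacian_mult[OF open_ball that \<phi>D w])
    have lapW0: "laplacian W \<zeta> = 0" if "\<zeta> \<notin> cball 0 R'" for \<zeta>
    proof -
      have o: "open (- cball 0 R' :: complex set)" by auto
      have 1: "pderiv_dir v W y = 0" if "y \<notin> cball 0 R'" for v y
        using pderiv_dir_transform(2)[of "- cball 0 R'" y "\<lambda>_. 0" W v] that W0 o by (simp add: pderiv_dir_def frechet_derivative_const)
      have "pderiv_dir v (pderiv_dir v W) \<zeta> = 0" for v
        using pderiv_dir_transform(2)[of "- cball 0 R'" \<zeta> "\<lambda>_. 0" "pderiv_dir v W" v] that 1 o by (simp add: pderiv_dir_def frechet_derivative_const)
      then show ?thesis by (simp add: laplacian_def)
    qed
    have zR: "W z = w z" using z R \<phi>(2)[of z] by (simp add: W_def)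
    have rep: "(LBINT \<zeta>. ln (norm (\<zeta> - z)) * laplacian W \<zeta>) = 2 * pi * w z"
      unfolding zR[symmetric] by (rule newtonian_representation(2)[OF WC compact_cball W0])
    have repi: "integrable lborel (\<lambda>\<zeta>. ln (norm (\<zeta> - z)) * laplacian W \<zeta>)"
      by (rule newtonian_representation(1)[OF WC compact_cball W0])
    have m1 [measurable]: "(\<lambda>\<zeta>. ennreal (ln (4 / norm (\<zeta> - z)) * \<bar>laplacian w \<zeta>\<bar>) * indicator (disc 1) \<zeta>) \<in> borel_measurable borel"
    proof -
      have "continuous_on (disc 1) (laplacian w)" unfolding laplacian_def[abs_def] by (intro continuous_intros wd)
      then have "(\<lambda>\<zeta>. indicator (disc 1) \<zeta> *\<^sub>R laplacian w \<zeta>) \<in> borel_measurable borel"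
        by (intro borel_measurable_continuous_on_indicator) auto
      then have "(\<lambda>\<zeta>. ennreal (ln (4 / norm (\<zeta> - z)) * \<bar>indicator (disc 1) \<zeta> *\<^sub>R laplacian w \<zeta>\<bar>)) \<in> borel_measurable borel"
        by measurable
      also have "(\<lambda>\<zeta>. ennreal (ln (4 / norm (\<zeta> - z)) * \<bar>indicator (disc 1) \<zeta> *\<^sub>R laplacian w \<zeta>\<bar>))
        = (\<lambda>\<zeta>. ennreal (ln (4 / norm (\<zeta> - z)) * \<bar>laplacian w \<zeta>\<bar>) * indicator (disc 1) \<zeta>)"
        by (auto simp: indicator_def fun_eq_iff)
      finally show ?thesis .
    qed
    have m2 [measurable]: "(\<lambda>\<zeta>. ennreal \<bar>w \<zeta>\<bar> * indicator (disc \<rho>) \<zeta>) \<in> borel_measurable borel"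
    proof -
      have "(\<lambda>\<zeta>. indicator (disc \<rho>) \<zeta> *\<^sub>R w \<zeta>) \<in> borel_measurable borel"
        using r by (intro borel_measurable_continuous_on_indicator continuous_on_subset[OF wd(3)] subset_ball) auto
      then have "(\<lambda>\<zeta>. ennreal \<bar>indicator (disc \<rho>) \<zeta> *\<^sub>R w \<zeta>\<bar>) \<in> borel_measurable borel" by measurable
      also have "(\<lambda>\<zeta>. ennreal \<bar>indicator (disc \<rho>) \<zeta> *\<^sub>R w \<zeta>\<bar>) = (\<lambda>\<zeta>. ennreal \<bar>w \<zeta>\<bar> * indicator (disc \<rho>) \<zeta>)"
        by (auto simp: indicator_def fun_eq_iff)
      finally show ?thesis .
    qed
    have m3 [measurable]: "(\<lambda>\<zeta>. ennreal (norm (grad w \<zeta>)) * indicator (disc \<rho>) \<zeta>) \<in> borel_measurable borel"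
    proof -
      have "(\<lambda>\<zeta>. indicator (disc \<rho>) \<zeta> *\<^sub>R grad w \<zeta>) \<in> borel_measurable borel"
        using r by (intro borel_measurable_continuous_on_indicator continuous_on_subset[OF continuous_on_grad[OF wd(4) wd(4)]] subset_ball) auto
      then have "(\<lambda>\<zeta>. ennreal (norm (indicator (disc \<rho>) \<zeta> *\<^sub>R grad w \<zeta>))) \<in> borel_measurable borel" by measurable
      also have "(\<lambda>\<zeta>. ennreal (norm (indicator (disc \<rho>) \<zeta> *\<^sub>R grad w \<zeta>))) = (\<lambda>\<zeta>. ennreal (norm (grad w \<zeta>)) * indicator (disc \<rho>) \<zeta>)"
        by (auto simp: indicator_def fun_eq_iff)
      finally show ?thesis .
    qed
    have pt: "ennreal (norm (ln (norm (\<zeta> - z)) * laplacian W \<zeta>)) \<le>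
       ennreal (ln (4 / norm (\<zeta> - z)) * \<bar>laplacian w \<zeta>\<bar>) * indicator (disc 1) \<zeta>
       + ennreal L * (ennreal \<bar>w \<zeta>\<bar> * indicator (disc \<rho>) \<zeta> + ennreal (norm (grad w \<zeta>)) * indicator (disc \<rho>) \<zeta>)" for \<zeta>
    proof (cases "\<zeta> \<in> cball 0 R'")
      case False
      then show ?thesis using lapW0[OF False] by simp
    next
      case True
      then have in1: "\<zeta> \<in> disc 1" and inr: "\<zeta> \<in> disc \<rho>" using R r by auto
      define t where "t = norm (\<zeta> - z)"
      have t2: "t \<le> 2" using norm_triangle_ineq4[of \<zeta> z] in1 z r unfolding t_def by simp
      \<comment> \<open>At t = 0 both sides are 0, because \<open>4 / 0 = 0\<close> and
        \<open>ln 0 = 0\<close>.\<close>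
      have l4: "\<bar>ln t\<bar> \<le> ln (4 / t)"
      proof (cases "t = 0")
        case False
        then show ?thesis using t2 by (intro abs_ln_le_ln_4) (auto simp: t_def)
      qed simp
      \<comment> \<open>The terms with derivatives of the cut-off; they vanish on the disc of radius
        R.\<close>
      define E where "E = 2 * (grad \<phi> \<zeta> \<bullet> grad w \<zeta>) + laplacian \<phi> \<zeta> * w \<zeta>"
      have Eb: "\<bar>E\<bar> \<le> 2 * B * (\<bar>w \<zeta>\<bar> + norm (grad w \<zeta>))"
      proof -
        have "\<bar>grad \<phi> \<zeta> \<bullet> grad w \<zeta>\<bar> \<le> B * norm (grad w \<zeta>)"
          using Cauchy_Schwarz_ineq2[of "grad \<phi> \<zeta>" "grad w \<zeta>"] mult_right_mono[OF B(2)[of \<zeta>], of "norm (grad w \<zeta>)"] by simp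
        moreover have "\<bar>laplacian \<phi> \<zeta> * w \<zeta>\<bar> \<le> B * \<bar>w \<zeta>\<bar>"
          using mult_right_mono[OF B(3)[of \<zeta>], of "\<bar>w \<zeta>\<bar>"] by (simp add: abs_mult)
        moreover have "B * \<bar>w \<zeta>\<bar> \<ge> 0" using B(1) by simp
        ultimately show ?thesis unfolding E_def by (simp add: distrib_left)
      qed
      have lE: "\<bar>ln t\<bar> * \<bar>E\<bar> \<le> L * (\<bar>w \<zeta>\<bar> + norm (grad w \<zeta>))"
      proof (cases "\<zeta> \<in> disc R")
        case True
        then have "E = 0" using B(5)[OF True] by (simp add: E_def)
        then show ?thesis using L by simp
      next
        case False
        then have tR: "R - r \<le> t" using norm_triangle_ineq2[of \<zeta> z] z unfolding t_def by simp
        then have tp: "t > 0" using R by linarith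
        have "1 / t \<le> 1 / (R - r)" using tR R tp by (intro divide_left_mono) auto
        then have "\<bar>ln t\<bar> \<le> \<Lambda>" using abs_ln_le[OF tp] t2 by (simp add: \<Lambda>_def)
        then have "\<bar>ln t\<bar> * \<bar>E\<bar> \<le> \<Lambda> * (2 * B * (\<bar>w \<zeta>\<bar> + norm (grad w \<zeta>)))"
          using Eb \<Lambda> by (intro mult_mono) auto
        then show ?thesis by (simp add: L_def mult.assoc)
      qed
      have "norm (ln t * laplacian W \<zeta>) \<le> \<bar>ln t\<bar> * (\<bar>\<phi> \<zeta> * laplacian w \<zeta>\<bar> + \<bar>E\<bar>)"
      proof -
        have "laplacian W \<zeta> = \<phi> \<zeta> * laplacian w \<zeta> + E" using lapW[OF in1] by (simp add: E_def)
        then have "\<bar>laplacian W \<zeta>\<bar> \<le> \<bar>\<phi> \<zeta> * laplacian w \<zeta>\<bar> + \<bar>E\<bar>" by simp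
        then show ?thesis by (simp add: abs_mult mult_left_mono)
      qed
      also have "\<dots> = \<bar>ln t\<bar> * \<bar>\<phi> \<zeta> * laplacian w \<zeta>\<bar> + \<bar>ln t\<bar> * \<bar>E\<bar>" by (rule distrib_left)
      also have "\<dots> \<le> ln (4 / t) * \<bar>laplacian w \<zeta>\<bar> + L * (\<bar>w \<zeta>\<bar> + norm (grad w \<zeta>))"
      proof (intro add_mono lE mult_mono l4)
        show "\<bar>\<phi> \<zeta> * laplacian w \<zeta>\<bar> \<le> \<bar>laplacian w \<zeta>\<bar>"
          using \<phi>(4,5)[of \<zeta>] by (simp add: abs_mult mult_left_le_one_le)
      qed (use l4 in auto)
      finally have "ennreal (norm (ln t * laplacian W \<zeta>)) \<le> ennreal (ln (4 / t) * \<bar>laplacian w \<zeta>\<bar> + L * (\<bar>w \<zeta>\<bar> + norm (grad w \<zeta>)))"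
        by (rule ennreal_leI)
      also have "\<dots> = ennreal (ln (4 / t) * \<bar>laplacian w \<zeta>\<bar>) + ennreal L * (ennreal \<bar>w \<zeta>\<bar> + ennreal (norm (grad w \<zeta>)))"
      proof -
        have "0 \<le> ln (4 / t) * \<bar>laplacian w \<zeta>\<bar>" using l4 by (intro mult_nonneg_nonneg) auto
        then show ?thesis using L by (simp add: ennreal_mult)
      qed
      finally show ?thesis using in1 inr by (simp add: t_def)
    qed
    have "ennreal (2 * pi * \<bar>w z\<bar>) = ennreal (norm (LBINT \<zeta>. ln (norm (\<zeta> - z)) * laplacian W \<zeta>))"
      unfolding rep by (simp add: abs_mult)
    also have "\<dots> \<le> (\<integral>\<^sup>+\<zeta>. ennreal (norm (ln (norm (\<zeta> - z)) * laplacian W \<zeta>)) \<partial>lborel)"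
      by (rule integral_norm_bound_ennreal[OF repi])
    also have "\<dots> \<le> (\<integral>\<^sup>+\<zeta>. ennreal (ln (4 / norm (\<zeta> - z)) * \<bar>laplacian w \<zeta>\<bar>) * indicator (disc 1) \<zeta>
       + ennreal L * (ennreal \<bar>w \<zeta>\<bar> * indicator (disc \<rho>) \<zeta> + ennreal (norm (grad w \<zeta>)) * indicator (disc \<rho>) \<zeta>) \<partial>lborel)"
      by (intro nn_integral_mono pt)
    also have "\<dots> = (\<integral>\<^sup>+\<zeta>\<in>disc 1. ennreal (ln (4 / norm (\<zeta> - z)) * \<bar>laplacian w \<zeta>\<bar>) \<partial>lborel)
      + ennreal L * ((\<integral>\<^sup>+\<zeta>\<in>disc \<rho>. ennreal \<bar>w \<zeta>\<bar> \<partial>lborel) + (\<integral>\<^sup>+\<zeta>\<in>disc \<rho>. ennreal (norm (grad w \<zeta>)) \<partial>lborel))"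
      by (subst nn_integral_add) (simp_all add: nn_integral_cmult nn_integral_add)
    finally show ?thesis .
  qed
  show ?thesis using L main by blast
qed

lemma borel_measurable_indicator_disc:
  fixes f :: "complex \<Rightarrow> 'b::euclidean_space"
  assumes "continuous_on (disc 1) f" "r \<le> 1"
  shows "(\<lambda>z. indicator (disc r) z *\<^sub>R f z) \<in> borel_measurable borel"
  using continuous_on_subset[OF assms(1) subset_ball[OF assms(2)]]
  by (intro borel_measurable_continuous_on_indicator) auto

text \<open>Exponentiating the potential bound and averaging over the measure |Laplacian of w| turns
  the logarithm into |z - \<zeta>|^(-a) with a = q \<tau> / (2 pi). Integrating over z first, this
  kernel is uniformly integrable exactly when a < 2, that is q < 4 pi / \<tau>.\<close>

lemma exponential_integrability:
  assumes r: "0 < r" "r < \<rho>" "\<rho> \<le> 1" and \<tau>: "\<tau> > 0" and q: "q > 0" "q < 4 * pi / \<tau>" and A: "A \<ge> 0"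
  shows "\<exists>K\<ge>0. \<forall>w. Ck_on 2 (disc 1) w \<longrightarrow>
    (\<integral>\<^sup>+\<zeta>\<in>disc 1. ennreal \<bar>laplacian w \<zeta>\<bar> \<partial>lborel) \<le> ennreal \<tau> \<longrightarrow>
    (\<integral>\<^sup>+\<zeta>\<in>disc \<rho>. ennreal \<bar>w \<zeta>\<bar> \<partial>lborel) \<le> ennreal A \<longrightarrow>
    (\<integral>\<^sup>+\<zeta>\<in>disc \<rho>. ennreal (norm (grad w \<zeta>)) \<partial>lborel) \<le> ennreal A \<longrightarrow>
    (\<integral>\<^sup>+z\<in>disc r. ennreal (exp (q * \<bar>w z\<bar>)) \<partial>lborel) \<le> ennreal K"
proof -
  obtain L where L: "L \<ge> 0" and pot: "\<And>w z. Ck_on 2 (disc 1) w \<Longrightarrow> z \<in> disc r \<Longrightarrow>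
    ennreal (2 * pi * \<bar>w z\<bar>) \<le> (\<integral>\<^sup>+\<zeta>\<in>disc 1. ennreal (ln (4 / norm (\<zeta> - z)) * \<bar>laplacian w \<zeta>\<bar>) \<partial>lborel)
      + ennreal L * ((\<integral>\<^sup>+\<zeta>\<in>disc \<rho>. ennreal \<bar>w \<zeta>\<bar> \<partial>lborel) + (\<integral>\<^sup>+\<zeta>\<in>disc \<rho>. ennreal (norm (grad w \<zeta>)) \<partial>lborel))"
    using potential_bound[OF r] by auto
  define c0 where "c0 = L * (2 * A)"
  have c0: "c0 \<ge> 0" using L A by (simp add: c0_def)
  define a where "a = q * \<tau> / (2 * pi)"
  have a: "0 < a" "a < 2" using q \<tau> by (auto simp: a_def field_simps)
  obtain K1 where K1: "K1 \<ge> 0" "\<And>\<zeta>. (\<integral>\<^sup>+z\<in>ball (\<zeta>::complex) 2. ennreal ((1 / norm (z - \<zeta>)) powr a) \<partial>lborel) \<le> ennreal K1"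
    using nn_integral_inverse_norm_powr[OF a, of 2] by auto
  define K where "K = exp (q * c0 / (2 * pi)) * (2 * pi + 4 powr a * K1)"
  have "(\<integral>\<^sup>+z\<in>disc r. ennreal (exp (q * \<bar>w z\<bar>)) \<partial>lborel) \<le> ennreal K"
    if w: "Ck_on 2 (disc 1) w" and lap: "(\<integral>\<^sup>+\<zeta>\<in>disc 1. ennreal \<bar>laplacian w \<zeta>\<bar> \<partial>lborel) \<le> ennreal \<tau>"
      and A1: "(\<integral>\<^sup>+\<zeta>\<in>disc \<rho>. ennreal \<bar>w \<zeta>\<bar> \<partial>lborel) \<le> ennreal A"
      and A2: "(\<integral>\<^sup>+\<zeta>\<in>disc \<rho>. ennreal (norm (grad w \<zeta>)) \<partial>lborel) \<le> ennreal A" for w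
  proof -
    note wd = Ck_on_2_D[OF w]
    define g where "g \<zeta> = \<bar>indicator (disc 1) \<zeta> *\<^sub>R laplacian w \<zeta>\<bar>" for \<zeta>
    have "continuous_on (disc 1) (laplacian w)" unfolding laplacian_def[abs_def] by (intro continuous_intros wd)
    then have [measurable]: "(\<lambda>\<zeta>. indicator (disc 1) \<zeta> *\<^sub>R laplacian w \<zeta>) \<in> borel_measurable borel"
      by (rule borel_measurable_indicator_disc) simp
    have g [measurable]: "g \<in> borel_measurable borel" unfolding g_def by measurable
    have gi: "ennreal (g \<zeta>) = ennreal \<bar>laplacian w \<zeta>\<bar> * indicator (disc 1) \<zeta>" for \<zeta> by (simp add: g_def indicator_def)
    define N where "N = density lborel (\<lambda>\<zeta>. ennreal (g \<zeta>))"
    have sN: "space N = UNIV" "sets N = sets borel" by (simp_all add: N_def)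
    have mN: "emeasure N (space N) \<le> ennreal \<tau>"
    proof -
      have "emeasure N (space N) = (\<integral>\<^sup>+\<zeta>. ennreal (g \<zeta>) \<partial>lborel)"
        unfolding N_def by (subst emeasure_density) simp_all
      then show ?thesis using lap by (simp add: gi)
    qed
    have Nint: "(\<integral>\<^sup>+\<zeta>. h \<zeta> \<partial>N) = (\<integral>\<^sup>+\<zeta>. ennreal (g \<zeta>) * h \<zeta> \<partial>lborel)" if "h \<in> borel_measurable borel" for h
      unfolding N_def using that by (subst nn_integral_density) auto
    \<comment> \<open>\<open>exp_average_le\<close> needs a non-negative function on the whole
      plane. The maximum is inactive on the unit disc, outside of which N has no mass.\<close>
    define Y where "Y z \<zeta> = max 0 (a * ln (4 / norm (\<zeta> - z)))" for z \<zeta> :: complex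
    have Ym [measurable]: "Y z \<in> borel_measurable borel" for z unfolding Y_def by measurable
    have lnp: "ln (4 / norm (\<zeta> - z)) \<ge> 0" if "z \<in> disc r" "\<zeta> \<in> disc 1" for z \<zeta> :: complex
    proof (cases "\<zeta> = z")
      case False
      have "norm (\<zeta> - z) \<le> 4" using norm_triangle_ineq4[of \<zeta> z] that r by simp
      then show ?thesis using False by simp
    qed simp
    have pw: "ennreal (exp (q * \<bar>w z\<bar>)) \<le> ennreal (exp (q * c0 / (2 * pi))) *
        (2 + ennreal (1 / \<tau>) * (\<integral>\<^sup>+\<zeta>. ennreal (g \<zeta>) * ennreal ((4 / norm (\<zeta> - z)) powr a) \<partial>lborel))"
      if z: "z \<in> disc r" for z
    proof -
      \<comment> \<open>The 1 covers the points where Y is 0: those far from z, and z itself, where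
        the quotient and the logarithm are 0 by convention.\<close>
      have e1: "ennreal (exp (Y z \<zeta>)) \<le> 1 + ennreal ((4 / norm (\<zeta> - z)) powr a)" for \<zeta>
      proof (cases "\<zeta> = z \<or> Y z \<zeta> = 0")
        case True
        then have "exp (Y z \<zeta>) = 1" by (auto simp: Y_def)
        then show ?thesis by simp
      next
        case False
        then have "exp (Y z \<zeta>) = (4 / norm (\<zeta> - z)) powr a" by (auto simp: Y_def max_def powr_def split: if_splits)
        then show ?thesis by simp
      qed
      have I1: "(\<integral>\<^sup>+\<zeta>. ennreal (exp (Y z \<zeta>)) \<partial>N) \<le> ennreal \<tau> + (\<integral>\<^sup>+\<zeta>. ennreal (g \<zeta>) * ennreal ((4 / norm (\<zeta> - z)) powr a) \<partial>lborel)"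
      proof -
        have "(\<integral>\<^sup>+\<zeta>. ennreal (exp (Y z \<zeta>)) \<partial>N) \<le> (\<integral>\<^sup>+\<zeta>. 1 + ennreal ((4 / norm (\<zeta> - z)) powr a) \<partial>N)"
          by (intro nn_integral_mono e1)
        also have "\<dots> = emeasure N (space N) + (\<integral>\<^sup>+\<zeta>. ennreal ((4 / norm (\<zeta> - z)) powr a) \<partial>N)"
          by (subst nn_integral_add) (simp_all add: sN measurable_cong_sets[OF sN(2) HOL.refl])
        also have "\<dots> \<le> ennreal \<tau> + (\<integral>\<^sup>+\<zeta>. ennreal (g \<zeta>) * ennreal ((4 / norm (\<zeta> - z)) powr a) \<partial>lborel)"
          by (intro add_mono mN) (simp add: Nint)
        finally show ?thesis .
      qed
      have b: "2 + ennreal (1 / \<tau>) * X = 1 + ennreal (1 / \<tau>) * (ennreal \<tau> + X)" for X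
      proof -
        have "ennreal (1 / \<tau>) * ennreal \<tau> = 1" using \<tau> by (simp flip: ennreal_mult)
        then show ?thesis by (simp add: distrib_left flip: add.assoc)
      qed
      define y where "y = (\<integral>\<^sup>+\<zeta>. ennreal (Y z \<zeta>) \<partial>N)"
      have yeq: "y = ennreal a * (\<integral>\<^sup>+\<zeta>\<in>disc 1. ennreal (ln (4 / norm (\<zeta> - z)) * \<bar>laplacian w \<zeta>\<bar>) \<partial>lborel)"
      proof -
        have "y = (\<integral>\<^sup>+\<zeta>. ennreal (g \<zeta>) * ennreal (Y z \<zeta>) \<partial>lborel)" unfolding y_def by (rule Nint) simp
        also have "\<dots> = (\<integral>\<^sup>+\<zeta>. ennreal a * (ennreal (max 0 (ln (4 / norm (\<zeta> - z)))) * ennreal (g \<zeta>)) \<partial>lborel)"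
        proof (rule nn_integral_cong)
          fix \<zeta>
          have "Y z \<zeta> = a * max 0 (ln (4 / norm (\<zeta> - z)))" using a by (simp add: Y_def max_def mult_le_0_iff zero_le_mult_iff)
          then show "ennreal (g \<zeta>) * ennreal (Y z \<zeta>) = ennreal a * (ennreal (max 0 (ln (4 / norm (\<zeta> - z)))) * ennreal (g \<zeta>))"
            using a by (simp add: ennreal_mult mult_ac)
        qed
        also have "\<dots> = ennreal a * (\<integral>\<^sup>+\<zeta>. ennreal (max 0 (ln (4 / norm (\<zeta> - z)))) * ennreal (g \<zeta>) \<partial>lborel)"
          by (rule nn_integral_cmult) measurable
        also have "(\<integral>\<^sup>+\<zeta>. ennreal (max 0 (ln (4 / norm (\<zeta> - z)))) * ennreal (g \<zeta>) \<partial>lborel)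
          = (\<integral>\<^sup>+\<zeta>\<in>disc 1. ennreal (ln (4 / norm (\<zeta> - z)) * \<bar>laplacian w \<zeta>\<bar>) \<partial>lborel)"
        proof (rule nn_integral_cong)
          fix \<zeta>
          show "ennreal (max 0 (ln (4 / norm (\<zeta> - z)))) * ennreal (g \<zeta>) = ennreal (ln (4 / norm (\<zeta> - z)) * \<bar>laplacian w \<zeta>\<bar>) * indicator (disc 1) \<zeta>"
          proof (cases "\<zeta> \<in> disc 1")
            case True
            then show ?thesis using lnp[OF z True] by (simp add: g_def max_def ennreal_mult)
          next
            case False
            then show ?thesis by (simp add: g_def)
          qed
        qed
        finally show ?thesis .
      qed
      show ?thesis
      \<comment> \<open>If the exponential integral is infinite at z, so is the right side of the
        claim; otherwise Y \<le> exp Y makes the mean of Y a real number to which Jensen's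
        inequality applies.\<close>
      proof (cases "(\<integral>\<^sup>+\<zeta>. ennreal (exp (Y z \<zeta>)) \<partial>N) = \<infinity>")
        case True
        then have "(\<integral>\<^sup>+\<zeta>. ennreal (g \<zeta>) * ennreal ((4 / norm (\<zeta> - z)) powr a) \<partial>lborel) = \<infinity>"
          using I1 by (simp add: top_unique)
        then show ?thesis using \<tau> by (simp add: ennreal_mult_top)
      next
        case False
        have "y \<le> (\<integral>\<^sup>+\<zeta>. ennreal (exp (Y z \<zeta>)) \<partial>N)"
          unfolding y_def using exp_ge_add_one_self by (intro nn_integral_mono ennreal_leI) (smt (verit))
        then have "y \<noteq> \<infinity>" using False by (auto simp: top_unique)
        then obtain y' where y': "y = ennreal y'" "y' \<ge> 0" by (cases y) auto
        have e: "ennreal (exp (y' / \<tau>)) \<le> 1 + ennreal (1 / \<tau>) * (\<integral>\<^sup>+\<zeta>. ennreal (exp (Y z \<zeta>)) \<partial>N)"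
        proof (rule exp_average_le[OF _ _ \<tau> mN])
          show "Y z \<in> borel_measurable N" by (simp add: measurable_cong_sets[OF sN(2) HOL.refl])
          show "0 \<le> Y z \<zeta>" for \<zeta> by (simp add: Y_def)
          show "(\<integral>\<^sup>+\<zeta>. ennreal (Y z \<zeta>) \<partial>N) = ennreal y'" using y' by (simp add: y_def)
        qed (rule y'(2))
        have "ennreal (2 * pi * \<bar>w z\<bar>) * ennreal a \<le> ennreal (y' + c0 * a)"
        proof -
          have "ennreal (2 * pi * \<bar>w z\<bar>) \<le> (\<integral>\<^sup>+\<zeta>\<in>disc 1. ennreal (ln (4 / norm (\<zeta> - z)) * \<bar>laplacian w \<zeta>\<bar>) \<partial>lborel) + ennreal L * (ennreal A + ennreal A)"
            using pot[OF w z] by (rule order_trans) (intro add_mono mult_left_mono A1 A2 order_refl, simp)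
          also have "ennreal L * (ennreal A + ennreal A) = ennreal c0" using L A by (simp add: c0_def flip: ennreal_plus ennreal_mult)
          finally have "ennreal (2 * pi * \<bar>w z\<bar>) * ennreal a \<le> ((\<integral>\<^sup>+\<zeta>\<in>disc 1. ennreal (ln (4 / norm (\<zeta> - z)) * \<bar>laplacian w \<zeta>\<bar>) \<partial>lborel) + ennreal c0) * ennreal a"
            by (rule mult_right_mono) simp
          also have "\<dots> = y + ennreal c0 * ennreal a" by (simp add: yeq distrib_left mult.commute)
          also have "\<dots> = ennreal (y' + c0 * a)" using y' c0 a by (simp add: ennreal_mult)
          finally show ?thesis .
        qed
        then have "ennreal (2 * pi * \<bar>w z\<bar> * a) \<le> ennreal (y' + c0 * a)" using a by (simp add: ennreal_mult)
        then have "2 * pi * \<bar>w z\<bar> * a \<le> y' + c0 * a" using y' c0 a by (subst (asm) ennreal_le_iff) auto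
        then have "q * \<bar>w z\<bar> * \<tau> \<le> y' + q * c0 / (2 * pi) * \<tau>" by (simp add: a_def field_simps)
        then have "q * \<bar>w z\<bar> \<le> q * c0 / (2 * pi) + y' / \<tau>" using \<tau> by (simp add: field_simps)
        then have "exp (q * \<bar>w z\<bar>) \<le> exp (q * c0 / (2 * pi)) * exp (y' / \<tau>)" by (simp flip: exp_add)
        then have "ennreal (exp (q * \<bar>w z\<bar>)) \<le> ennreal (exp (q * c0 / (2 * pi))) * ennreal (exp (y' / \<tau>))"
          by (simp add: ennreal_leI flip: ennreal_mult)
        also have "\<dots> \<le> ennreal (exp (q * c0 / (2 * pi))) * (1 + ennreal (1 / \<tau>) * (\<integral>\<^sup>+\<zeta>. ennreal (exp (Y z \<zeta>)) \<partial>N))"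
          by (intro mult_left_mono e) simp
        also have "\<dots> \<le> ennreal (exp (q * c0 / (2 * pi))) *
          (2 + ennreal (1 / \<tau>) * (\<integral>\<^sup>+\<zeta>. ennreal (g \<zeta>) * ennreal ((4 / norm (\<zeta> - z)) powr a) \<partial>lborel))"
          unfolding b by (intro mult_left_mono add_mono I1 order_refl) auto
        finally show ?thesis .
      qed
    qed
    have ind [measurable]: "disc r \<in> sets borel" by simp
    \<comment> \<open>After Fubini the inner integral over z is bounded uniformly in \<zeta>,
      because the disc of radius r lies in the ball of radius 2 about each \<zeta> in the unit
      disc.\<close>
    have F: "(\<integral>\<^sup>+z\<in>disc r. (\<integral>\<^sup>+\<zeta>. ennreal (g \<zeta>) * ennreal ((4 / norm (\<zeta> - z)) powr a) \<partial>lborel) \<partial>lborel) \<le> ennreal (\<tau> * (4 powr a * K1))"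
    proof -
      have "(\<integral>\<^sup>+z\<in>disc r. (\<integral>\<^sup>+\<zeta>. ennreal (g \<zeta>) * ennreal ((4 / norm (\<zeta> - z)) powr a) \<partial>lborel) \<partial>lborel)
        = (\<integral>\<^sup>+z. (\<integral>\<^sup>+\<zeta>. ennreal (g \<zeta>) * ennreal ((4 / norm (\<zeta> - z)) powr a) * indicator (disc r) z \<partial>lborel) \<partial>lborel)"
        by (intro nn_integral_cong nn_integral_multc[symmetric]) measurable
      also have "\<dots> = (\<integral>\<^sup>+\<zeta>. (\<integral>\<^sup>+z. ennreal (g \<zeta>) * ennreal ((4 / norm (\<zeta> - z)) powr a) * indicator (disc r) z \<partial>lborel) \<partial>lborel)"
        by (rule lborel_pair.Fubini') measurable
      also have "\<dots> \<le> (\<integral>\<^sup>+\<zeta>. ennreal (g \<zeta>) * ennreal (4 powr a * K1) \<partial>lborel)"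
      proof (rule nn_integral_mono)
        fix \<zeta> :: complex
        show "(\<integral>\<^sup>+z. ennreal (g \<zeta>) * ennreal ((4 / norm (\<zeta> - z)) powr a) * indicator (disc r) z \<partial>lborel) \<le> ennreal (g \<zeta>) * ennreal (4 powr a * K1)"
        proof (cases "\<zeta> \<in> disc 1")
          case False
          then have "g \<zeta> = 0" by (simp add: g_def)
          then show ?thesis by simp
        next
          case True
          have "(\<integral>\<^sup>+z. ennreal (g \<zeta>) * ennreal ((4 / norm (\<zeta> - z)) powr a) * indicator (disc r) z \<partial>lborel)
            \<le> (\<integral>\<^sup>+z. (ennreal (g \<zeta>) * ennreal (4 powr a)) * (ennreal ((1 / norm (z - \<zeta>)) powr a) * indicator (ball \<zeta> 2) z) \<partial>lborel)"
          proof (rule nn_integral_mono)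
            fix z
            show "ennreal (g \<zeta>) * ennreal ((4 / norm (\<zeta> - z)) powr a) * indicator (disc r) z
              \<le> (ennreal (g \<zeta>) * ennreal (4 powr a)) * (ennreal ((1 / norm (z - \<zeta>)) powr a) * indicator (ball \<zeta> 2) z)"
            proof (cases "z \<in> disc r")
              case zr: True
              have "z \<in> ball \<zeta> 2" using norm_triangle_ineq4[of \<zeta> z] True zr r by (simp add: dist_norm)
              moreover have "(4 / norm (\<zeta> - z)) powr a = 4 powr a * (1 / norm (z - \<zeta>)) powr a"
                by (simp add: powr_divide norm_minus_commute)
              ultimately show ?thesis using zr by (simp add: ennreal_mult mult_ac)
            qed simp
          qed
          also have "\<dots> = (ennreal (g \<zeta>) * ennreal (4 powr a)) * (\<integral>\<^sup>+z\<in>ball \<zeta> 2. ennreal ((1 / norm (z - \<zeta>)) powr a) \<partial>lborel)"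
          proof (rule nn_integral_cmult)
            have [measurable]: "ball \<zeta> 2 \<in> sets borel" by simp
            show "(\<lambda>z. ennreal ((1 / norm (z - \<zeta>)) powr a) * indicator (ball \<zeta> 2) z) \<in> borel_measurable lborel" by measurable
          qed
          also have "\<dots> \<le> (ennreal (g \<zeta>) * ennreal (4 powr a)) * ennreal K1" by (intro mult_left_mono K1) simp
          finally show ?thesis using K1 by (simp add: ennreal_mult mult.assoc)
        qed
      qed
      also have "\<dots> = (\<integral>\<^sup>+\<zeta>. ennreal (g \<zeta>) \<partial>lborel) * ennreal (4 powr a * K1)" by (rule nn_integral_multc) simp
      also have "\<dots> \<le> ennreal \<tau> * ennreal (4 powr a * K1)" using lap by (intro mult_right_mono) (simp_all add: gi)
      also have "\<dots> = ennreal (\<tau> * (4 powr a * K1))" using \<tau> K1 by (simp add: ennreal_mult)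
      finally show ?thesis .
    qed
    have inner_m [measurable]: "(\<lambda>z. \<integral>\<^sup>+\<zeta>. ennreal (g \<zeta>) * ennreal ((4 / norm (\<zeta> - z)) powr a) \<partial>lborel) \<in> borel_measurable borel"
      by measurable
    have "(\<integral>\<^sup>+z\<in>disc r. ennreal (exp (q * \<bar>w z\<bar>)) \<partial>lborel)
      \<le> (\<integral>\<^sup>+z. ennreal (exp (q * c0 / (2 * pi))) * (2 * indicator (disc r) z + ennreal (1 / \<tau>) *
         ((\<integral>\<^sup>+\<zeta>. ennreal (g \<zeta>) * ennreal ((4 / norm (\<zeta> - z)) powr a) \<partial>lborel) * indicator (disc r) z)) \<partial>lborel)"
      using pw by (intro nn_integral_mono) (auto simp: indicator_def)
    also have "\<dots> = ennreal (exp (q * c0 / (2 * pi))) * (2 * emeasure lborel (disc r) + ennreal (1 / \<tau>) *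
         (\<integral>\<^sup>+z\<in>disc r. (\<integral>\<^sup>+\<zeta>. ennreal (g \<zeta>) * ennreal ((4 / norm (\<zeta> - z)) powr a) \<partial>lborel) \<partial>lborel))"
      by (simp add: nn_integral_cmult nn_integral_add nn_integral_cmult_indicator)
    also have "\<dots> \<le> ennreal (exp (q * c0 / (2 * pi))) * (2 * ennreal pi + ennreal (1 / \<tau>) * ennreal (\<tau> * (4 powr a * K1)))"
    proof (intro mult_left_mono add_mono F)
      have "pi * r\<^sup>2 \<le> pi * 1" using r by (intro mult_left_mono power_le_one) auto
      then show "emeasure lborel (disc r) \<le> ennreal pi" using r by (simp add: emeasure_disc_complex ennreal_leI)
    qed auto
    also have "\<dots> = ennreal K"
    proof -
      have "ennreal (1 / \<tau>) * ennreal (\<tau> * (4 powr a * K1)) = ennreal (4 powr a * K1)"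
        using \<tau> K1 by (simp flip: ennreal_mult)
      moreover have "2 * ennreal pi = ennreal (2 * pi)" by (simp add: ennreal_mult)
      moreover have "ennreal K = ennreal (exp (q * c0 / (2 * pi))) * (ennreal (2 * pi) + ennreal (4 powr a * K1))"
      proof -
        have p: "0 \<le> 2 * pi" "0 \<le> 4 powr a * K1" using K1 by auto
        show ?thesis unfolding K_def by (simp only: ennreal_mult'[OF exp_ge_zero] ennreal_plus[OF p])
      qed
      ultimately show ?thesis by (simp only:)
    qed
    finally show ?thesis .
  qed
  moreover have "K \<ge> 0" using K1 by (simp add: K_def)
  ultimately show ?thesis by blast
qed

subsection \<open>Strong convergence of gradients\<close>

text \<open>The truncation is bounded by 2 \<delta>, while the Laplacian and the gradient are
  bounded in L^1; hence the energy is of order \<delta>, with a constant that depends neither on f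
  nor on \<delta>. Where |f| \<le> \<delta> the weight is at least 1/2, so the gradient is square
  integrable there with a small integral.\<close>

lemma energy_estimate:
  assumes r: "0 < r" "r < \<rho>" "\<rho> \<le> 1" and \<tau>: "\<tau> \<ge> 0" and A: "A \<ge> 0"
  shows "\<exists>C\<ge>0. \<forall>f \<delta>. Ck_on 2 (disc 1) f \<longrightarrow> \<delta> > 0 \<longrightarrow>
    (\<integral>\<^sup>+\<zeta>\<in>disc 1. ennreal \<bar>laplacian f \<zeta>\<bar> \<partial>lborel) \<le> ennreal \<tau> \<longrightarrow>
    (\<integral>\<^sup>+\<zeta>\<in>disc \<rho>. ennreal (norm (grad f \<zeta>)) \<partial>lborel) \<le> ennreal A \<longrightarrow>
    (\<integral>\<^sup>+\<zeta>\<in>disc r. ennreal ((norm (grad f \<zeta>))\<^sup>2 / (1 + (f \<zeta> / \<delta>)\<^sup>2)) \<partial>lborel) \<le> ennreal (C * \<delta>)"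
proof -
  define R' where "R' = (r + \<rho>) / 2"
  have R: "r < R'" "R' < \<rho>" using r by (auto simp: R'_def)
  obtain \<phi> :: "complex \<Rightarrow> real" where \<phi>: "Ck_on 2 UNIV \<phi>" "\<And>z. z \<in> cball 0 r \<Longrightarrow> \<phi> z = 1"
    "\<And>z. z \<notin> cball 0 R' \<Longrightarrow> \<phi> z = 0" "\<And>z. 0 \<le> \<phi> z" "\<And>z. \<phi> z \<le> 1"
    by (rule cutoff_exists[OF r(1) R(1)]) (rule that)
  obtain B where B: "B \<ge> 0" "\<And>z. norm (grad \<phi> z) \<le> B" "\<And>z. \<bar>laplacian \<phi> z\<bar> \<le> B"
    "\<And>z. z \<notin> cball 0 R' \<Longrightarrow> grad \<phi> z = 0 \<and> laplacian \<phi> z = 0"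
    "\<And>z. z \<in> disc r \<Longrightarrow> grad \<phi> z = 0 \<and> laplacian \<phi> z = 0"
    by (rule cutoff_derivs[of \<phi> R' r, OF \<phi>(1)], erule \<phi>(3), erule \<phi>(2), rule that)
  define C where "C = 2 * (\<tau> + B * A)"
  note pd = Ck_on_2_D[OF \<phi>(1), simplified]
  have cbr: "cball 0 R' \<subseteq> disc 1" "cball 0 R' \<subseteq> disc \<rho>" using R r by auto
  have "(\<integral>\<^sup>+\<zeta>\<in>disc r. ennreal ((norm (grad f \<zeta>))\<^sup>2 / (1 + (f \<zeta> / \<delta>)\<^sup>2)) \<partial>lborel) \<le> ennreal (C * \<delta>)"
    if f: "Ck_on 2 (disc 1) f" and \<delta>: "\<delta> > 0"
      and lap: "(\<integral>\<^sup>+\<zeta>\<in>disc 1. ennreal \<bar>laplacian f \<zeta>\<bar> \<partial>lborel) \<le> ennreal \<tau>"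
      and gr: "(\<integral>\<^sup>+\<zeta>\<in>disc \<rho>. ennreal (norm (grad f \<zeta>)) \<partial>lborel) \<le> ennreal A" for f and \<delta> :: real
  proof -
    note fd = Ck_on_2_D[OF f]
    \<comment> \<open>The divergence of \<phi> T(f) grad f integrates to 0; |T| is of size \<delta> and T' = 1 / (1 + (s/\<delta>)^2).\<close>
    define T where "T s = \<delta> * arctan (s / \<delta>)" for s
    have Td: "(T has_real_derivative 1 / (1 + (s / \<delta>)\<^sup>2)) (at s)" for s
      unfolding T_def using \<delta> by (auto intro!: derivative_eq_intros simp: divide_inverse)
    have Tb: "\<bar>T s\<bar> \<le> 2 * \<delta>" for s
    proof -
      have "\<bar>arctan (s / \<delta>)\<bar> \<le> 2" using arctan_bounded[of "s / \<delta>"] pi_less_4 by (simp add: abs_le_iff)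
      then show ?thesis using \<delta> by (simp add: T_def abs_mult)
    qed
    have Tc: "continuous_on UNIV T" using Td by (auto intro!: continuous_at_imp_continuous_on DERIV_isCont)
    define V where "V v z = \<phi> z * (T (f z) * pderiv_dir v f z)" for v z
    have dT: "(\<lambda>z. T (f z)) differentiable (at z)"
      "pderiv_dir v (\<lambda>z. T (f z)) z = 1 / (1 + (f z / \<delta>)\<^sup>2) * pderiv_dir v f z" if "z \<in> disc 1" for z v
      using pderiv_dir_compose_real[OF fd(1)[OF that] Td] by auto
    have Vd: "V v differentiable (at z)" if "z \<in> disc 1" for v z
      unfolding V_def by (intro differentiable_mult pd dT fd that)
    have Vp: "pderiv_dir v (V v) z = \<phi> z * (1 / (1 + (f z / \<delta>)\<^sup>2) * (pderiv_dir v f z)\<^sup>2)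
        + (\<phi> z * T (f z) * pderiv_dir v (pderiv_dir v f) z + T (f z) * (pderiv_dir v \<phi> z * pderiv_dir v f z))" if "z \<in> disc 1" for v z
    proof -
      have "pderiv_dir v (V v) z = \<phi> z * pderiv_dir v (\<lambda>z. T (f z) * pderiv_dir v f z) z + pderiv_dir v \<phi> z * (T (f z) * pderiv_dir v f z)"
        unfolding V_def by (intro pderiv_dir_mult differentiable_mult pd dT fd that)
      also have "pderiv_dir v (\<lambda>z. T (f z) * pderiv_dir v f z) z = T (f z) * pderiv_dir v (pderiv_dir v f) z + pderiv_dir v (\<lambda>z. T (f z)) z * pderiv_dir v f z"
        by (intro pderiv_dir_mult dT fd that)
      finally show ?thesis using dT(2)[OF that] by (simp add: algebra_simps power2_eq_square)
    qed
    have cTf: "continuous_on (disc 1) (\<lambda>z. T (f z))" by (intro continuous_on_compose2[OF Tc fd(3)]) auto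
    have ne: "1 + (s / \<delta>)\<^sup>2 \<noteq> 0" for s by (metis add_pos_nonneg less_numeral_extra(3) zero_le_power2 zero_less_one)
    have Vc: "continuous_on (disc 1) (pderiv_dir v (V v))" for v
    proof (subst continuous_on_cong[OF HOL.refl Vp])
      show "continuous_on (disc 1) (\<lambda>z. \<phi> z * (1 / (1 + (f z / \<delta>)\<^sup>2) * (pderiv_dir v f z)\<^sup>2)
        + (\<phi> z * T (f z) * pderiv_dir v (pderiv_dir v f) z + T (f z) * (pderiv_dir v \<phi> z * pderiv_dir v f z)))"
        using \<delta> ne by (intro continuous_intros fd cTf continuous_on_subset[OF pd(3)] continuous_on_subset[OF pd(4)]) auto
    qed
    have V0: "V v z = 0" if "z \<notin> cball 0 R'" for v z using \<phi>(3)[OF that] by (simp add: V_def)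
    note I = integral_pderiv_dir_eq_0_on[OF open_ball Vd Vc compact_cball cbr(1) V0]
    \<comment> \<open>The divergence of the field splits into the localised energy density
      \<open>P\<close> and the remainder \<open>Q\<close>, which is linear in the truncation. As
      their sum integrates to 0, the energy is bounded by the integral of |Q|.\<close>
    define P where "P z = (if z \<in> disc 1 then \<phi> z * (1 / (1 + (f z / \<delta>)\<^sup>2) * (norm (grad f z))\<^sup>2) else 0)" for z
    define Q where "Q z = (if z \<in> disc 1 then \<phi> z * T (f z) * laplacian f z + T (f z) * (grad \<phi> z \<bullet> grad f z) else 0)" for z
    have PQ: "pderiv_dir 1 (V 1) z + pderiv_dir \<i> (V \<i>) z = P z + Q z" for z
    proof (cases "z \<in> disc 1")
      case True
      have n: "(norm (grad f z))\<^sup>2 = (pderiv_dir 1 f z)\<^sup>2 + (pderiv_dir \<i> f z)\<^sup>2" by (simp add: grad_def cmod_power2)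
      have g: "grad \<phi> z \<bullet> grad f z = pderiv_dir 1 \<phi> z * pderiv_dir 1 f z + pderiv_dir \<i> \<phi> z * pderiv_dir \<i> f z"
        by (simp add: grad_def inner_complex_def)
      show ?thesis using True unfolding Vp[OF True] P_def Q_def n g laplacian_def by (simp add: algebra_simps)
    next
      case False
      then have "z \<notin> cball 0 R'" using cbr by blast
      then show ?thesis using I(3) False by (simp add: P_def Q_def)
    qed
    have Pc: "continuous_on (cball 0 R') P" and Qc: "continuous_on (cball 0 R') Q"
    proof -
      have cl: "continuous_on (disc 1) (laplacian f)" unfolding laplacian_def[abs_def] by (intro continuous_intros fd)
      have cg: "continuous_on (disc 1) (grad f)" "continuous_on UNIV (grad \<phi>)" by (intro continuous_on_grad fd pd)+
      have "continuous_on (disc 1) (\<lambda>z. \<phi> z * (1 / (1 + (f z / \<delta>)\<^sup>2) * (norm (grad f z))\<^sup>2))"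
        using \<delta> ne by (intro continuous_intros fd cg continuous_on_subset[OF pd(3)]) auto
      then have "continuous_on (disc 1) P" by (rule continuous_on_eq) (simp add: P_def)
      then show "continuous_on (cball 0 R') P" using cbr(1) by (rule continuous_on_subset)
      have "continuous_on (disc 1) (\<lambda>z. \<phi> z * T (f z) * laplacian f z + T (f z) * (grad \<phi> z \<bullet> grad f z))"
        by (intro continuous_intros fd cTf cg(1) cl continuous_on_subset[OF cg(2)] continuous_on_subset[OF pd(3)]) auto
      then have "continuous_on (disc 1) Q" by (rule continuous_on_eq) (simp add: Q_def)
      then show "continuous_on (cball 0 R') Q" using cbr(1) by (rule continuous_on_subset)
    qed
    have Pi: "integrable lborel P"
      by (rule integrable_continuous_compact_support[OF Pc compact_cball]) (use \<phi>(3) in \<open>simp add: P_def\<close>)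
    have Qi: "integrable lborel Q"
      by (rule integrable_continuous_compact_support[OF Qc compact_cball]) (use \<phi>(3) B(4) in \<open>simp add: Q_def\<close>)
    have "(LBINT z. P z) + (LBINT z. Q z) = (LBINT z. pderiv_dir 1 (V 1) z + pderiv_dir \<i> (V \<i>) z)"
      unfolding PQ using Pi Qi by simp
    also have "\<dots> = 0" using I(1,2) by simp
    finally have PQ0: "(LBINT z. P z) = - (LBINT z. Q z)" by linarith
    have [measurable]: "(\<lambda>\<zeta>. ennreal \<bar>laplacian f \<zeta>\<bar> * indicator (disc 1) \<zeta>) \<in> borel_measurable borel"
    proof -
      have "continuous_on (disc 1) (laplacian f)" unfolding laplacian_def[abs_def] by (intro continuous_intros fd)
      then have [measurable]: "(\<lambda>\<zeta>. indicator (disc 1) \<zeta> *\<^sub>R laplacian f \<zeta>) \<in> borel_measurable borel"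
        by (rule borel_measurable_indicator_disc) simp
      have "(\<lambda>\<zeta>. ennreal \<bar>indicator (disc 1) \<zeta> *\<^sub>R laplacian f \<zeta>\<bar>) \<in> borel_measurable borel" by measurable
      also have "(\<lambda>\<zeta>. ennreal \<bar>indicator (disc 1) \<zeta> *\<^sub>R laplacian f \<zeta>\<bar>) = (\<lambda>\<zeta>. ennreal \<bar>laplacian f \<zeta>\<bar> * indicator (disc 1) \<zeta>)"
        by (auto simp: indicator_def fun_eq_iff)
      finally show ?thesis .
    qed
    have [measurable]: "(\<lambda>\<zeta>. ennreal (norm (grad f \<zeta>)) * indicator (disc \<rho>) \<zeta>) \<in> borel_measurable borel"
    proof -
      have [measurable]: "(\<lambda>\<zeta>. indicator (disc \<rho>) \<zeta> *\<^sub>R grad f \<zeta>) \<in> borel_measurable borel"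
        using r by (intro borel_measurable_indicator_disc continuous_on_grad fd)
      have "(\<lambda>\<zeta>. ennreal (norm (indicator (disc \<rho>) \<zeta> *\<^sub>R grad f \<zeta>))) \<in> borel_measurable borel" by measurable
      also have "(\<lambda>\<zeta>. ennreal (norm (indicator (disc \<rho>) \<zeta> *\<^sub>R grad f \<zeta>))) = (\<lambda>\<zeta>. ennreal (norm (grad f \<zeta>)) * indicator (disc \<rho>) \<zeta>)"
        by (auto simp: indicator_def fun_eq_iff)
      finally show ?thesis .
    qed
    have Qb: "ennreal \<bar>Q z\<bar> \<le> ennreal (2 * \<delta>) * (ennreal \<bar>laplacian f z\<bar> * indicator (disc 1) z)
       + ennreal (2 * \<delta> * B) * (ennreal (norm (grad f z)) * indicator (disc \<rho>) z)" for z
    proof (cases "z \<in> cball 0 R'")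
      case False
      then have "Q z = 0" using \<phi>(3)[OF False] B(4)[OF False] by (simp add: Q_def)
      then show ?thesis by simp
    next
      case True
      then have z: "z \<in> disc 1" "z \<in> disc \<rho>" using cbr by auto
      have 1: "\<bar>\<phi> z * T (f z) * laplacian f z\<bar> \<le> 2 * \<delta> * \<bar>laplacian f z\<bar>"
      proof -
        have "\<bar>\<phi> z\<bar> * \<bar>T (f z)\<bar> \<le> 1 * (2 * \<delta>)" using \<phi>(4,5)[of z] Tb by (intro mult_mono) auto
        then show ?thesis by (simp add: abs_mult mult_right_mono)
      qed
      have 2: "\<bar>T (f z) * (grad \<phi> z \<bullet> grad f z)\<bar> \<le> 2 * \<delta> * B * norm (grad f z)"
      proof -
        have "\<bar>grad \<phi> z \<bullet> grad f z\<bar> \<le> B * norm (grad f z)"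
          using Cauchy_Schwarz_ineq2[of "grad \<phi> z" "grad f z"] mult_right_mono[OF B(2)[of z], of "norm (grad f z)"] by simp
        then have "\<bar>T (f z)\<bar> * \<bar>grad \<phi> z \<bullet> grad f z\<bar> \<le> (2 * \<delta>) * (B * norm (grad f z))"
          using Tb \<delta> by (intro mult_mono) auto
        then show ?thesis by (simp add: abs_mult)
      qed
      have "\<bar>Q z\<bar> \<le> 2 * \<delta> * \<bar>laplacian f z\<bar> + 2 * \<delta> * B * norm (grad f z)"
        using 1 2 z by (simp add: Q_def)
      then have "ennreal \<bar>Q z\<bar> \<le> ennreal (2 * \<delta> * \<bar>laplacian f z\<bar> + 2 * \<delta> * B * norm (grad f z))" by (rule ennreal_leI)
      then show ?thesis using z \<delta> B(1) by (simp add: ennreal_mult)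
    qed
    have "(\<integral>\<^sup>+\<zeta>\<in>disc r. ennreal ((norm (grad f \<zeta>))\<^sup>2 / (1 + (f \<zeta> / \<delta>)\<^sup>2)) \<partial>lborel) \<le> (\<integral>\<^sup>+z. ennreal (P z) \<partial>lborel)"
    proof (rule nn_integral_mono)
      fix z
      show "ennreal ((norm (grad f z))\<^sup>2 / (1 + (f z / \<delta>)\<^sup>2)) * indicator (disc r) z \<le> ennreal (P z)"
      proof (cases "z \<in> disc r")
        case True
        then have "z \<in> disc 1" "\<phi> z = 1" using r \<phi>(2) by auto
        then show ?thesis using True by (simp add: P_def)
      qed simp
    qed
    also have "\<dots> = ennreal (LBINT z. P z)"
      by (rule nn_integral_eq_integral[OF Pi]) (use \<phi>(4) in \<open>auto simp: P_def intro!: AE_I2\<close>)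
    also have "\<dots> \<le> ennreal (norm (LBINT z. Q z))" unfolding PQ0 by (intro ennreal_leI) simp
    also have "\<dots> \<le> (\<integral>\<^sup>+z. ennreal (norm (Q z)) \<partial>lborel)" by (rule integral_norm_bound_ennreal[OF Qi])
    also have "\<dots> \<le> (\<integral>\<^sup>+z. ennreal (2 * \<delta>) * (ennreal \<bar>laplacian f z\<bar> * indicator (disc 1) z)
       + ennreal (2 * \<delta> * B) * (ennreal (norm (grad f z)) * indicator (disc \<rho>) z) \<partial>lborel)"
      using Qb by (intro nn_integral_mono) simp
    also have "\<dots> = ennreal (2 * \<delta>) * (\<integral>\<^sup>+\<zeta>\<in>disc 1. ennreal \<bar>laplacian f \<zeta>\<bar> \<partial>lborel)
        + ennreal (2 * \<delta> * B) * (\<integral>\<^sup>+\<zeta>\<in>disc \<rho>. ennreal (norm (grad f \<zeta>)) \<partial>lborel)"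
      by (simp add: nn_integral_add nn_integral_cmult)
    also have "\<dots> \<le> ennreal (2 * \<delta>) * ennreal \<tau> + ennreal (2 * \<delta> * B) * ennreal A"
      by (intro add_mono mult_left_mono lap gr) auto
    also have "\<dots> = ennreal (C * \<delta>)"
      using \<delta> \<tau> A B(1) by (simp add: C_def algebra_simps flip: ennreal_mult ennreal_plus)
    finally show ?thesis .
  qed
  moreover have "C \<ge> 0" using \<tau> A B(1) by (simp add: C_def)
  ultimately show ?thesis by blast
qed

text \<open>Four regimes of the pair (|grad f|, f): a small gradient is paid by the area; where |f|
  \<le> \<delta> the energy estimate applies; where |f| > \<delta> and the gradient is at most M,
  the L^1 norm of f pays as in Markov's inequality; a gradient above M is paid by the higher
  integrability with exponent 3/2. Thus L^1 convergence of functions forces that of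
  gradients.\<close>

lemma gradient_L1_bound:
  assumes r: "0 < r" "r < \<rho>" "\<rho> \<le> 1" and \<tau>: "\<tau> \<ge> 0" and A: "A \<ge> 0" and S: "S \<ge> 0" and e: "e > 0"
  shows "\<exists>\<eta>>0. \<forall>f. Ck_on 2 (disc 1) f \<longrightarrow>
    (\<integral>\<^sup>+\<zeta>\<in>disc 1. ennreal \<bar>laplacian f \<zeta>\<bar> \<partial>lborel) \<le> ennreal \<tau> \<longrightarrow>
    (\<integral>\<^sup>+\<zeta>\<in>disc \<rho>. ennreal (norm (grad f \<zeta>)) \<partial>lborel) \<le> ennreal A \<longrightarrow>
    (\<integral>\<^sup>+\<zeta>\<in>disc r. ennreal (norm (grad f \<zeta>) powr (3/2)) \<partial>lborel) \<le> ennreal S \<longrightarrow>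
    (\<integral>\<^sup>+\<zeta>\<in>disc r. ennreal \<bar>f \<zeta>\<bar> \<partial>lborel) \<le> ennreal \<eta> \<longrightarrow>
    (\<integral>\<^sup>+\<zeta>\<in>disc r. ennreal (norm (grad f \<zeta>)) \<partial>lborel) \<le> ennreal e"
proof -
  obtain C where C: "C \<ge> 0" and en: "\<And>f \<delta>. Ck_on 2 (disc 1) f \<Longrightarrow> \<delta> > 0 \<Longrightarrow>
    (\<integral>\<^sup>+\<zeta>\<in>disc 1. ennreal \<bar>laplacian f \<zeta>\<bar> \<partial>lborel) \<le> ennreal \<tau> \<Longrightarrow>
    (\<integral>\<^sup>+\<zeta>\<in>disc \<rho>. ennreal (norm (grad f \<zeta>)) \<partial>lborel) \<le> ennreal A \<Longrightarrow>
    (\<integral>\<^sup>+\<zeta>\<in>disc r. ennreal ((norm (grad f \<zeta>))\<^sup>2 / (1 + (f \<zeta> / \<delta>)\<^sup>2)) \<partial>lborel) \<le> ennreal (C * \<delta>)"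
    using energy_estimate[OF r \<tau> A] by auto
  \<comment> \<open>Each of the four terms receives e / 4. The area of the disc is below 4, which
    gives \<open>s\<close>; \<open>\<delta>\<close> makes (2 / s) C \<delta> at most e / 4, where D
    = C + 1 avoids a division by 0; \<open>b\<close> handles the exponent 3/2 and determines the
    height M with b times the root of M equal to 1; \<open>\<eta>\<close> is fixed last.\<close>
  define s where "s = e / 16"
  define D where "D = C + 1"
  have D: "D > 0" "C \<le> D" using C by (auto simp: D_def)
  define \<delta> where "\<delta> = s * (e / (8 * D))"
  define b where "b = e / (4 * (S + 1))"
  define M where "M = 1 / b\<^sup>2"
  define \<eta> where "\<eta> = e * \<delta> / (4 * M)"
  have pos: "s > 0" "\<delta> > 0" "b > 0" "M > 0" "\<eta> > 0" using e C S D by (simp_all add: s_def \<delta>_def b_def M_def \<eta>_def)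
  have pw: "x \<le> s + 2 / s * (x\<^sup>2 / (1 + (y / \<delta>)\<^sup>2)) + M / \<delta> * \<bar>y\<bar> + b * x powr (3/2)" if x: "x \<ge> 0" for x y :: real
  proof -
    have t: "0 \<le> 2 / s * (x\<^sup>2 / (1 + (y / \<delta>)\<^sup>2))" "0 \<le> M / \<delta> * \<bar>y\<bar>" "0 \<le> b * x powr (3/2)"
      using pos by simp_all
    consider "x \<le> s" | "x > s" "\<bar>y\<bar> \<le> \<delta>" | "\<bar>y\<bar> > \<delta>" "x \<le> M" | "x > M" by linarith
    then show ?thesis
    proof cases
      case 1
      then show ?thesis using t by linarith
    next
      case 2
      have "\<bar>y / \<delta>\<bar> \<le> 1" using 2 pos by (simp add: abs_divide)
      then have "(y / \<delta>)\<^sup>2 \<le> 1" by (simp only: abs_square_le_1)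
      then have d: "1 + (y / \<delta>)\<^sup>2 \<le> 2" "1 + (y / \<delta>)\<^sup>2 > 0" by (simp, simp add: add_pos_nonneg)
      have "x\<^sup>2 / 2 \<le> x\<^sup>2 / (1 + (y / \<delta>)\<^sup>2)" using d by (intro divide_left_mono) auto
      then have "2 / s * (x\<^sup>2 / 2) \<le> 2 / s * (x\<^sup>2 / (1 + (y / \<delta>)\<^sup>2))" using pos by (intro mult_left_mono) auto
      moreover have "x \<le> 2 / s * (x\<^sup>2 / 2)" using 2 pos x by (simp add: field_simps power2_eq_square)
      ultimately show ?thesis using t pos by linarith
    next
      case 3
      have "M \<le> M / \<delta> * \<bar>y\<bar>" using 3 pos by (simp add: field_simps)
      then show ?thesis using 3 t pos by linarith
    next
      case 4
      have xp: "x > 0" using 4 pos by linarith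
      have "1 \<le> b * x powr (1/2)"
      proof -
        have "1 / b = M powr (1/2)" using pos by (simp add: M_def powr_half_sqrt real_sqrt_divide)
        also have "\<dots> \<le> x powr (1/2)" using 4 pos by (intro powr_mono2) auto
        finally show ?thesis using pos by (simp add: field_simps)
      qed
      then have "x * 1 \<le> x * (b * x powr (1/2))" using xp by (intro mult_left_mono) auto
      also have "\<dots> = b * x powr (3/2)"
      proof -
        have "x powr (3/2) = x powr (1 + 1/2)" by simp
        also have "\<dots> = x powr 1 * x powr (1/2)" by (rule powr_add)
        finally show ?thesis using xp by simp
      qed
      finally have "x \<le> b * x powr (3/2)" by simp
      then show ?thesis using t pos by linarith
    qed
  qed
  have "(\<integral>\<^sup>+\<zeta>\<in>disc r. ennreal (norm (grad f \<zeta>)) \<partial>lborel) \<le> ennreal e"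
    if f: "Ck_on 2 (disc 1) f" and lap: "(\<integral>\<^sup>+\<zeta>\<in>disc 1. ennreal \<bar>laplacian f \<zeta>\<bar> \<partial>lborel) \<le> ennreal \<tau>"
      and gr: "(\<integral>\<^sup>+\<zeta>\<in>disc \<rho>. ennreal (norm (grad f \<zeta>)) \<partial>lborel) \<le> ennreal A"
      and g3: "(\<integral>\<^sup>+\<zeta>\<in>disc r. ennreal (norm (grad f \<zeta>) powr (3/2)) \<partial>lborel) \<le> ennreal S"
      and f1: "(\<integral>\<^sup>+\<zeta>\<in>disc r. ennreal \<bar>f \<zeta>\<bar> \<partial>lborel) \<le> ennreal \<eta>" for f
  proof -
    note fd = Ck_on_2_D[OF f]
    have r1: "r \<le> 1" using r by simp
    define gg where "gg \<zeta> = indicator (disc r) \<zeta> *\<^sub>R grad f \<zeta>" for \<zeta>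
    define ff where "ff \<zeta> = indicator (disc r) \<zeta> *\<^sub>R f \<zeta>" for \<zeta>
    have [measurable]: "gg \<in> borel_measurable borel" "ff \<in> borel_measurable borel" "disc r \<in> sets borel"
      unfolding gg_def ff_def
      by (rule borel_measurable_indicator_disc[OF _ r1], intro continuous_on_grad fd,
          rule borel_measurable_indicator_disc[OF _ r1], intro fd, simp)
    have i: "(\<integral>\<^sup>+\<zeta>\<in>disc r. h (f \<zeta>) (grad f \<zeta>) \<partial>lborel) = (\<integral>\<^sup>+\<zeta>\<in>disc r. h (ff \<zeta>) (gg \<zeta>) \<partial>lborel)" for h :: "real \<Rightarrow> complex \<Rightarrow> ennreal"
      by (intro nn_integral_cong) (auto simp: ff_def gg_def indicator_def)
    note en1 = en[OF f pos(2) lap gr]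
    have "(\<integral>\<^sup>+\<zeta>\<in>disc r. ennreal (norm (grad f \<zeta>)) \<partial>lborel) \<le>
      (\<integral>\<^sup>+\<zeta>. ennreal s * indicator (disc r) \<zeta>
       + ennreal (2 / s) * (ennreal ((norm (gg \<zeta>))\<^sup>2 / (1 + (ff \<zeta> / \<delta>)\<^sup>2)) * indicator (disc r) \<zeta>)
       + ennreal (M / \<delta>) * (ennreal \<bar>ff \<zeta>\<bar> * indicator (disc r) \<zeta>)
       + ennreal b * (ennreal (norm (gg \<zeta>) powr (3/2)) * indicator (disc r) \<zeta>) \<partial>lborel)"
    proof (rule nn_integral_mono)
      fix \<zeta>
      show "ennreal (norm (grad f \<zeta>)) * indicator (disc r) \<zeta> \<le> ennreal s * indicator (disc r) \<zeta>
       + ennreal (2 / s) * (ennreal ((norm (gg \<zeta>))\<^sup>2 / (1 + (ff \<zeta> / \<delta>)\<^sup>2)) * indicator (disc r) \<zeta>)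
       + ennreal (M / \<delta>) * (ennreal \<bar>ff \<zeta>\<bar> * indicator (disc r) \<zeta>)
       + ennreal b * (ennreal (norm (gg \<zeta>) powr (3/2)) * indicator (disc r) \<zeta>)"
      proof (cases "\<zeta> \<in> disc r")
        case True
        have e: "gg \<zeta> = grad f \<zeta>" using True by (simp add: gg_def)
        have "ennreal (norm (gg \<zeta>)) \<le> ennreal (s + 2 / s * ((norm (gg \<zeta>))\<^sup>2 / (1 + (ff \<zeta> / \<delta>)\<^sup>2)) + M / \<delta> * \<bar>ff \<zeta>\<bar> + b * norm (gg \<zeta>) powr (3/2))"
          by (intro ennreal_leI pw) simp
        also have "\<dots> = ennreal s + ennreal (2 / s) * ennreal ((norm (gg \<zeta>))\<^sup>2 / (1 + (ff \<zeta> / \<delta>)\<^sup>2)) + ennreal (M / \<delta>) * ennreal \<bar>ff \<zeta>\<bar> + ennreal b * ennreal (norm (gg \<zeta>) powr (3/2))"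
          using pos by (subst ennreal_mult[symmetric], simp, simp)+ (simp flip: ennreal_plus)
        finally show ?thesis using True e by simp
      qed simp
    qed
    also have "\<dots> = ennreal s * emeasure lborel (disc r)
       + ennreal (2 / s) * (\<integral>\<^sup>+\<zeta>\<in>disc r. ennreal ((norm (gg \<zeta>))\<^sup>2 / (1 + (ff \<zeta> / \<delta>)\<^sup>2)) \<partial>lborel)
       + ennreal (M / \<delta>) * (\<integral>\<^sup>+\<zeta>\<in>disc r. ennreal \<bar>ff \<zeta>\<bar> \<partial>lborel)
       + ennreal b * (\<integral>\<^sup>+\<zeta>\<in>disc r. ennreal (norm (gg \<zeta>) powr (3/2)) \<partial>lborel)"
      by (simp add: nn_integral_add nn_integral_cmult nn_integral_cmult_indicator)
    also have "\<dots> \<le> ennreal s * ennreal 4 + ennreal (2 / s) * ennreal (C * \<delta>) + ennreal (M / \<delta>) * ennreal \<eta> + ennreal b * ennreal S"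
    proof (intro add_mono mult_left_mono)
      have "pi * r\<^sup>2 \<le> 4 * 1" using r pi_less_4 by (intro mult_mono power_le_one) auto
      then show "emeasure lborel (disc r) \<le> ennreal 4" using r by (simp only: emeasure_disc_complex ennreal_leI less_imp_le)
      show "(\<integral>\<^sup>+\<zeta>\<in>disc r. ennreal ((norm (gg \<zeta>))\<^sup>2 / (1 + (ff \<zeta> / \<delta>)\<^sup>2)) \<partial>lborel) \<le> ennreal (C * \<delta>)"
        using en1 i[of "\<lambda>y x. ennreal ((norm x)\<^sup>2 / (1 + (y / \<delta>)\<^sup>2))"] by simp
      show "(\<integral>\<^sup>+\<zeta>\<in>disc r. ennreal \<bar>ff \<zeta>\<bar> \<partial>lborel) \<le> ennreal \<eta>"
        using f1 i[of "\<lambda>y x. ennreal \<bar>y\<bar>"] by simp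
      show "(\<integral>\<^sup>+\<zeta>\<in>disc r. ennreal (norm (gg \<zeta>) powr (3/2)) \<partial>lborel) \<le> ennreal S"
        using g3 i[of "\<lambda>y x. ennreal (norm x powr (3/2))"] by simp
    qed auto
    also have "\<dots> = ennreal (s * 4 + 2 / s * (C * \<delta>) + M / \<delta> * \<eta> + b * S)"
      using pos C S by (subst ennreal_mult[symmetric], simp, simp)+ (simp flip: ennreal_plus)
    also have "\<dots> \<le> ennreal e"
    proof (rule ennreal_leI)
      have "s * 4 = e / 4" by (simp add: s_def)
      moreover have "2 / s * (C * \<delta>) \<le> e / 4"
      proof -
        have "2 / s * (C * \<delta>) = e / 4 * (C / D)" using pos(1) D by (simp add: \<delta>_def)
        also have "\<dots> \<le> e / 4 * 1" using e D by (intro mult_left_mono) auto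
        finally show ?thesis by simp
      qed
      moreover have "M / \<delta> * \<eta> = e / 4" using pos by (simp add: \<eta>_def)
      moreover have "b * S \<le> e / 4"
      proof -
        have "b * S = e / 4 * (S / (S + 1))" by (simp add: b_def)
        also have "\<dots> \<le> e / 4 * 1" using e S by (intro mult_left_mono) auto
        finally show ?thesis by simp
      qed
      ultimately show "s * 4 + 2 / s * (C * \<delta>) + M / \<delta> * \<eta> + b * S \<le> e" by linarith
    qed
    finally show ?thesis .
  qed
  then show ?thesis using pos(5) by blast
qed

lemma Ck_on_diff:
  fixes f g :: "'a::real_normed_vector \<Rightarrow> real"
  assumes "open S" "Ck_on k S f" "Ck_on k S g" shows "Ck_on k S (\<lambda>z. f z - g z)"
proof -
  have "Ck_on k S (\<lambda>z. f z + (-1) * g z)"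
    by (intro Ck_on_add Ck_on_mult Ck_on_const assms)
  then show ?thesis by simp
qed

lemma
  fixes f g :: "complex \<Rightarrow> real"
  assumes S: "open S" "z \<in> S" and f: "Ck_on 2 S f" and g: "Ck_on 2 S g"
  shows grad_diff: "grad (\<lambda>z. f z - g z) z = grad f z - grad g z"
    and laplacian_diff: "laplacian (\<lambda>z. f z - g z) z = laplacian f z - laplacian g z"
proof -
  note fd = Ck_on_2_D[OF f] and gd = Ck_on_2_D[OF g]
  have 1: "pderiv_dir v (\<lambda>z. f z - g z) y = pderiv_dir v f y - pderiv_dir v g y" if "y \<in> S" for y v
    by (intro pderiv_dir_diff fd gd that)
  have 2: "pderiv_dir v (pderiv_dir v (\<lambda>z. f z - g z)) z = pderiv_dir v (pderiv_dir v f) z - pderiv_dir v (pderiv_dir v g) z" for v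
  proof -
    have "pderiv_dir v (pderiv_dir v (\<lambda>z. f z - g z)) z = pderiv_dir v (\<lambda>y. pderiv_dir v f y - pderiv_dir v g y) z"
      by (rule pderiv_dir_transform(2)[OF S]) (simp_all add: 1 fd gd S)
    also have "\<dots> = pderiv_dir v (pderiv_dir v f) z - pderiv_dir v (pderiv_dir v g) z"
      by (intro pderiv_dir_diff fd gd S)
    finally show ?thesis .
  qed
  show "grad (\<lambda>z. f z - g z) z = grad f z - grad g z" by (simp add: grad_def 1 S complex_eq_iff)
  show "laplacian (\<lambda>z. f z - g z) z = laplacian f z - laplacian g z" by (simp add: laplacian_def 2)
qed

subsection \<open>Rellich compactness\<close>

text \<open>Squares of side 1/n cut with the disc. Floors make them half open, so that for n > 0 the
  cells with a given n are disjoint and cover the disc. The index is a countable type, as the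
  diagonal argument requires.\<close>

definition grid_cell :: "nat \<times> int \<times> int \<Rightarrow> real \<Rightarrow> complex set" where
  "grid_cell = (\<lambda>(n, i, j) r. {z \<in> disc r. \<lfloor>real n * Re z\<rfloor> = i \<and> \<lfloor>real n * Im z\<rfloor> = j})"

lemma grid_cell_subset: "grid_cell p r \<subseteq> disc r"
  by (cases p) (auto simp: grid_cell_def)

lemma grid_cell_measurable [measurable]: "grid_cell p r \<in> sets borel"
proof -
  obtain n i j where p: "p = (n, i, j)" by (cases p)
  have "grid_cell p r = disc r \<inter> {z. \<lfloor>real n * Re z\<rfloor> = i} \<inter> {z. \<lfloor>real n * Im z\<rfloor> = j}"
    by (auto simp: grid_cell_def p)
  moreover have "{z. \<lfloor>real n * Re z\<rfloor> = i} \<in> sets borel" "{z. \<lfloor>real n * Im z\<rfloor> = j} \<in> sets borel"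
    by measurable
  ultimately show ?thesis by auto
qed

lemma grid_cell_convex: "convex (grid_cell p r)"
proof -
  obtain n i j where p: "p = (n, i, j)" by (cases p)
  have e: "grid_cell p r = disc r \<inter> (\<lambda>z. real n * Re z) -` {of_int i..<of_int i + 1} \<inter> (\<lambda>z. real n * Im z) -` {of_int j..<of_int j + 1}"
    by (auto simp: grid_cell_def p floor_eq_iff)
  have "linear (\<lambda>z. real n * Re z)" "linear (\<lambda>z. real n * Im z)"
    by (auto intro!: linearI simp: algebra_simps)
  then show ?thesis unfolding e by (intro convex_Int convex_ball convex_linear_vimage) (auto simp: is_interval_convex_1[symmetric] is_interval_def)
qed

lemma grid_cell_diameter:
  assumes "n > 0" "x \<in> grid_cell (n, i, j) r" "y \<in> grid_cell (n, i, j) r"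
  shows "norm (x - y) \<le> 2 / real n"
proof -
  have "\<bar>real n * Re x - real n * Re y\<bar> \<le> 1" "\<bar>real n * Im x - real n * Im y\<bar> \<le> 1"
    using assms(2,3) by (auto simp: grid_cell_def floor_eq_iff abs_le_iff)
  then have "real n * \<bar>Re x - Re y\<bar> \<le> 1" "real n * \<bar>Im x - Im y\<bar> \<le> 1"
    by (simp_all add: abs_mult flip: right_diff_distrib)
  then have "\<bar>Re x - Re y\<bar> \<le> 1 / real n" "\<bar>Im x - Im y\<bar> \<le> 1 / real n"
    using assms(1) by (simp_all add: field_simps)
  then show ?thesis using cmod_le[of "x - y"] by simp
qed

lemma indicator_disc_eq_sum_grid:
  assumes "n > 0" "r \<le> 1"
  shows "(indicator (disc r) z :: ennreal) = (\<Sum>(i, j)\<in>{- int n..int n} \<times> {- int n..int n}. indicator (grid_cell (n, i, j) r) z)"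
proof (cases "z \<in> disc r")
  case False
  then have "indicator (grid_cell p r) z = (0::ennreal)" for p using grid_cell_subset[of p r] by (auto simp: indicator_def)
  then show ?thesis using False by (simp add: case_prod_beta)
next
  case True
  define c where "c = (\<lfloor>real n * Re z\<rfloor>, \<lfloor>real n * Im z\<rfloor>)"
  have b: "\<bar>x\<bar> \<le> 1 \<Longrightarrow> \<lfloor>real n * x\<rfloor> \<in> {- int n..int n}" for x
  proof -
    assume "\<bar>x\<bar> \<le> 1"
    then have "real n * x \<le> real n * 1" "real n * (-1) \<le> real n * x"
      by (intro mult_left_mono; simp add: abs_le_iff)+
    then have "real n * x \<le> of_int (int n)" "of_int (- int n) \<le> real n * x" by simp_all
    then show ?thesis by (auto simp: le_floor_iff) (metis floor_mono floor_of_int of_int_of_nat_eq)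
  qed
  have "norm z \<le> 1" using True assms by simp
  then have "\<bar>Re z\<bar> \<le> 1" "\<bar>Im z\<bar> \<le> 1" using abs_Re_le_cmod[of z] abs_Im_le_cmod[of z] by linarith+
  then have c: "c \<in> {- int n..int n} \<times> {- int n..int n}" unfolding c_def using b by blast
  have "(case p of (i, j) \<Rightarrow> indicator (grid_cell (n, i, j) r) z) = (if p = c then 1 else 0 :: ennreal)" for p
    using True by (cases p) (auto simp: grid_cell_def c_def indicator_def)
  then have "(\<Sum>(i, j)\<in>{- int n..int n} \<times> {- int n..int n}. indicator (grid_cell (n, i, j) r) z) = (\<Sum>p\<in>{- int n..int n} \<times> {- int n..int n}. if p = c then 1 else 0 :: ennreal)"
    by simp
  also have "\<dots> = 1" using c by simp
  finally show ?thesis using True by simp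
qed

text \<open>Integrating f y - f x over y writes |\<Omega>| f x as the total integral minus an error,
  and integrating over x bounds the error by the two-point Poincare inequality. The factor
  |\<Omega>| cancels, so the constant depends on the diameter only; this matters because cells at
  the boundary of the disc can be arbitrarily thin. A null set is treated separately.\<close>

lemma L1_bound_by_mean:
  fixes f :: "complex \<Rightarrow> real"
  assumes f: "Ck_on 2 (disc 1) f" and r: "r < 1" and \<Omega>: "\<Omega> \<subseteq> disc r" "convex \<Omega>" and [measurable]: "\<Omega> \<in> sets borel"
    and d: "\<And>x y. x \<in> \<Omega> \<Longrightarrow> y \<in> \<Omega> \<Longrightarrow> norm (x - y) \<le> d"
  shows "(\<integral>\<^sup>+z\<in>\<Omega>. ennreal \<bar>f z\<bar> \<partial>lborel) \<le> ennreal \<bar>LBINT z:\<Omega>. f z\<bar> + ennreal (4 * d) * (\<integral>\<^sup>+z\<in>\<Omega>. ennreal (norm (grad f z)) \<partial>lborel)"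
proof -
  note fd = Ck_on_2_D[OF f]
  have r1: "disc r \<subseteq> disc 1" using r by (intro subset_ball) simp
  have fin: "emeasure lborel \<Omega> < \<infinity>"
    using emeasure_mono[OF \<Omega>(1), of lborel] emeasure_lborel_ball_finite[of "0::complex" r] by (auto intro: le_less_trans)
  obtain m where m: "emeasure lborel \<Omega> = ennreal m" "m \<ge> 0" using fin by (cases "emeasure lborel \<Omega>") auto
  obtain B where B: "B \<ge> 0" "\<And>z. z \<in> disc r \<Longrightarrow> norm (f z) \<le> B" using continuous_on_disc_bounded[OF fd(3) r] by blast
  define F where "F z = indicator \<Omega> z *\<^sub>R f z" for z
  have Fm [measurable]: "F \<in> borel_measurable borel"
    unfolding F_def by (rule borel_measurable_continuous_on_indicator) (use continuous_on_subset[OF fd(3)] \<Omega> r1 in auto)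
  have iOm: "integrable lborel (\<lambda>z. indicator \<Omega> z *\<^sub>R (c::real))" for c using fin by (intro integrable_scaleR_left) (simp add: integrable_indicator_iff)
  have Fi: "integrable lborel F"
  proof (rule Bochner_Integration.integrable_bound[OF iOm[of B]])
    show "AE z in lborel. norm (F z) \<le> norm (indicator \<Omega> z *\<^sub>R B)"
      using B \<Omega> by (intro AE_I2) (auto simp: F_def indicator_def)
  qed simp
  define I where "I = (LBINT z. F z)"
  have I: "(LBINT z:\<Omega>. f z) = I" by (simp add: I_def F_def set_lebesgue_integral_def)
  have pt: "ennreal (m * \<bar>f x\<bar>) \<le> ennreal \<bar>I\<bar> + (\<integral>\<^sup>+y\<in>\<Omega>. ennreal \<bar>f y - f x\<bar> \<partial>lborel)" if x: "x \<in> \<Omega>" for x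
  proof -
    have i2: "integrable lborel (\<lambda>y. F y - indicator \<Omega> y *\<^sub>R f x)" by (intro Bochner_Integration.integrable_diff Fi iOm)
    have "(LBINT y. F y - indicator \<Omega> y *\<^sub>R f x) = I - m * f x"
      using m by (subst Bochner_Integration.integral_diff[OF Fi iOm]) (simp add: I_def measure_def)
    then have "m * \<bar>f x\<bar> \<le> \<bar>I\<bar> + \<bar>LBINT y. F y - indicator \<Omega> y *\<^sub>R f x\<bar>"
      using m(2) abs_triangle_ineq4[of I "LBINT y. F y - indicator \<Omega> y *\<^sub>R f x"] by (simp add: abs_mult)
    then have "ennreal (m * \<bar>f x\<bar>) \<le> ennreal (\<bar>I\<bar> + \<bar>LBINT y. F y - indicator \<Omega> y *\<^sub>R f x\<bar>)" by (rule ennreal_leI)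
    also have "\<dots> = ennreal \<bar>I\<bar> + ennreal \<bar>LBINT y. F y - indicator \<Omega> y *\<^sub>R f x\<bar>" by simp
    also have "\<dots> \<le> ennreal \<bar>I\<bar> + (\<integral>\<^sup>+y. ennreal (norm (F y - indicator \<Omega> y *\<^sub>R f x)) \<partial>lborel)"
      using integral_norm_bound_ennreal[OF i2] by (intro add_mono) auto
    also have "(\<integral>\<^sup>+y. ennreal (norm (F y - indicator \<Omega> y *\<^sub>R f x)) \<partial>lborel) = (\<integral>\<^sup>+y\<in>\<Omega>. ennreal \<bar>f y - f x\<bar> \<partial>lborel)"
      by (intro nn_integral_cong) (auto simp: F_def indicator_def)
    finally show ?thesis .
  qed
  show ?thesis
  proof (cases "m = 0")
    case True
    then have "\<Omega> \<in> null_sets lborel" using m by (auto simp: null_sets_def)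
    then have "AE z in lborel. z \<notin> \<Omega>" by (rule AE_not_in)
    then have "(\<integral>\<^sup>+z\<in>\<Omega>. ennreal \<bar>f z\<bar> \<partial>lborel) = (\<integral>\<^sup>+z. 0 \<partial>(lborel :: complex measure))"
      by (intro nn_integral_cong_AE, eventually_elim) auto
    then show ?thesis by simp
  next
    case False
    then have mp: "m > 0" using m by simp
    have "ennreal m * (\<integral>\<^sup>+z\<in>\<Omega>. ennreal \<bar>f z\<bar> \<partial>lborel) = (\<integral>\<^sup>+z. ennreal (m * \<bar>F z\<bar>) \<partial>lborel)"
    proof -
      have "(\<integral>\<^sup>+z\<in>\<Omega>. ennreal \<bar>f z\<bar> \<partial>lborel) = (\<integral>\<^sup>+z. ennreal \<bar>F z\<bar> \<partial>lborel)"
        by (intro nn_integral_cong) (auto simp: F_def indicator_def)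
      then show ?thesis using m(2) by (simp add: nn_integral_cmult ennreal_mult)
    qed
    also have "\<dots> \<le> (\<integral>\<^sup>+x. ennreal \<bar>I\<bar> * indicator \<Omega> x + (\<integral>\<^sup>+y. ennreal \<bar>F y - F x\<bar> * indicator \<Omega> y \<partial>lborel) * indicator \<Omega> x \<partial>lborel)"
    proof (rule nn_integral_mono)
      fix x
      show "ennreal (m * \<bar>F x\<bar>) \<le> ennreal \<bar>I\<bar> * indicator \<Omega> x + (\<integral>\<^sup>+y. ennreal \<bar>F y - F x\<bar> * indicator \<Omega> y \<partial>lborel) * indicator \<Omega> x"
      proof (cases "x \<in> \<Omega>")
        case True
        have "(\<integral>\<^sup>+y\<in>\<Omega>. ennreal \<bar>f y - f x\<bar> \<partial>lborel) = (\<integral>\<^sup>+y. ennreal \<bar>F y - F x\<bar> * indicator \<Omega> y \<partial>lborel)"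
          using True by (intro nn_integral_cong) (auto simp: F_def indicator_def)
        then show ?thesis using pt[OF True] True by (simp add: F_def)
      qed (simp add: F_def)
    qed
    also have "\<dots> = ennreal \<bar>I\<bar> * emeasure lborel \<Omega> + (\<integral>\<^sup>+x. (\<integral>\<^sup>+y. ennreal \<bar>F y - F x\<bar> * indicator \<Omega> y \<partial>lborel) * indicator \<Omega> x \<partial>lborel)"
      by (subst nn_integral_add) (simp_all add: nn_integral_cmult_indicator)
    also have "(\<integral>\<^sup>+x. (\<integral>\<^sup>+y. ennreal \<bar>F y - F x\<bar> * indicator \<Omega> y \<partial>lborel) * indicator \<Omega> x \<partial>lborel)
       = (\<integral>\<^sup>+x\<in>\<Omega>. (\<integral>\<^sup>+y\<in>\<Omega>. ennreal \<bar>f y - f x\<bar> \<partial>lborel) \<partial>lborel)"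
    proof (rule nn_integral_cong)
      fix x
      show "(\<integral>\<^sup>+y. ennreal \<bar>F y - F x\<bar> * indicator \<Omega> y \<partial>lborel) * indicator \<Omega> x = (\<integral>\<^sup>+y\<in>\<Omega>. ennreal \<bar>f y - f x\<bar> \<partial>lborel) * indicator \<Omega> x"
      proof (cases "x \<in> \<Omega>")
        case True
        then have "(\<integral>\<^sup>+y\<in>\<Omega>. ennreal \<bar>f y - f x\<bar> \<partial>lborel) = (\<integral>\<^sup>+y. ennreal \<bar>F y - F x\<bar> * indicator \<Omega> y \<partial>lborel)"
          by (intro nn_integral_cong) (auto simp: F_def indicator_def)
        then show ?thesis by simp
      qed simp
    qed
    also have "\<dots> \<le> ennreal (4 * d) * emeasure lborel \<Omega> * (\<integral>\<^sup>+z\<in>\<Omega>. ennreal (norm (grad f z)) \<partial>lborel)"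
    proof (rule Poincare_convex)
      show "f differentiable (at z)" if "z \<in> \<Omega>" for z using fd(1) that \<Omega> r1 by auto
      show "continuous_on \<Omega> (grad f)" using \<Omega> r1 by (intro continuous_on_subset[OF continuous_on_grad[OF fd(4) fd(4)]]) auto
    qed (use \<Omega> d in auto)
    finally have "ennreal m * (\<integral>\<^sup>+z\<in>\<Omega>. ennreal \<bar>f z\<bar> \<partial>lborel) \<le> ennreal m * (ennreal \<bar>I\<bar> + ennreal (4 * d) * (\<integral>\<^sup>+z\<in>\<Omega>. ennreal (norm (grad f z)) \<partial>lborel))"
      by (simp add: m distrib_left mult_ac add_left_mono)
    then have "(\<integral>\<^sup>+z\<in>\<Omega>. ennreal \<bar>f z\<bar> \<partial>lborel) \<le> ennreal \<bar>I\<bar> + ennreal (4 * d) * (\<integral>\<^sup>+z\<in>\<Omega>. ennreal (norm (grad f z)) \<partial>lborel)"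
      using mp by (subst (asm) ennreal_mult_le_mult_iff) auto
    then show ?thesis by (simp add: I)
  qed
qed

lemma set_integral_bounds:
  fixes f :: "complex \<Rightarrow> real"
  assumes f: "Ck_on 2 (disc 1) f" and r: "r < 1" and \<Omega>: "\<Omega> \<subseteq> disc r" and [measurable]: "\<Omega> \<in> sets borel"
  shows "set_integrable lborel \<Omega> f" "ennreal \<bar>LBINT z:\<Omega>. f z\<bar> \<le> (\<integral>\<^sup>+z\<in>disc r. ennreal \<bar>f z\<bar> \<partial>lborel)"
proof -
  note fd = Ck_on_2_D[OF f]
  have fin: "emeasure lborel \<Omega> < \<infinity>"
    using emeasure_mono[OF \<Omega>(1), of lborel] emeasure_lborel_ball_finite[of "0::complex" r] by (auto intro: le_less_trans)
  obtain B where B: "B \<ge> 0" "\<And>z. z \<in> disc r \<Longrightarrow> norm (f z) \<le> B" using continuous_on_disc_bounded[OF fd(3) r] by blast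
  have r1: "disc r \<subseteq> disc 1" using r by (intro subset_ball) simp
  have Fm: "(\<lambda>z. indicator \<Omega> z *\<^sub>R f z) \<in> borel_measurable lborel"
    using borel_measurable_continuous_on_indicator[of \<Omega> f] continuous_on_subset[OF fd(3)] \<Omega> r1 by auto
  show i: "set_integrable lborel \<Omega> f" unfolding set_integrable_def
  proof (rule Bochner_Integration.integrable_bound)
    show "integrable lborel (\<lambda>z. indicator \<Omega> z *\<^sub>R B)" using fin by (intro integrable_scaleR_left) (simp add: integrable_indicator_iff)
    show "AE z in lborel. norm (indicator \<Omega> z *\<^sub>R f z) \<le> norm (indicator \<Omega> z *\<^sub>R B)"
      using B \<Omega> by (intro AE_I2) (auto simp: indicator_def)
  qed (rule Fm)
  have "ennreal \<bar>LBINT z:\<Omega>. f z\<bar> \<le> (\<integral>\<^sup>+z. ennreal (norm (indicator \<Omega> z *\<^sub>R f z)) \<partial>lborel)"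
    using integral_norm_bound_ennreal[OF i[unfolded set_integrable_def]] by (simp add: set_lebesgue_integral_def)
  also have "\<dots> \<le> (\<integral>\<^sup>+z\<in>disc r. ennreal \<bar>f z\<bar> \<partial>lborel)"
    using \<Omega> by (intro nn_integral_mono) (auto simp: indicator_def)
  finally show "ennreal \<bar>LBINT z:\<Omega>. f z\<bar> \<le> (\<integral>\<^sup>+z\<in>disc r. ennreal \<bar>f z\<bar> \<partial>lborel)" .
qed

text \<open>Sum of the previous bound over the cells of diameter at most 2 / n. The gradient term
  carries the factor 8 / n, so up to a small error the L^1 norm is governed by finitely many
  numbers; this is the source of compactness.\<close>

lemma L1_bound_by_grid_means:
  fixes f :: "complex \<Rightarrow> real"
  assumes f: "Ck_on 2 (disc 1) f" and r: "r < 1" and n: "n > 0"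
  shows "(\<integral>\<^sup>+z\<in>disc r. ennreal \<bar>f z\<bar> \<partial>lborel) \<le>
    (\<Sum>(i, j)\<in>{- int n..int n} \<times> {- int n..int n}. ennreal \<bar>LBINT z:grid_cell (n, i, j) r. f z\<bar>)
    + ennreal (8 / real n) * (\<integral>\<^sup>+z\<in>disc r. ennreal (norm (grad f z)) \<partial>lborel)"
proof -
  note fd = Ck_on_2_D[OF f]
  let ?J = "{- int n..int n} \<times> {- int n..int n}"
  have r1: "r \<le> 1" using r by simp
  have split: "(\<integral>\<^sup>+z\<in>disc r. ennreal (h z) \<partial>lborel) = (\<Sum>(i, j)\<in>?J. (\<integral>\<^sup>+z\<in>grid_cell (n, i, j) r. ennreal (h z) \<partial>lborel))"
    if h: "continuous_on (disc 1) h" "\<And>z. h z \<ge> 0" for h :: "complex \<Rightarrow> real"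
  proof -
    have m [measurable]: "(\<lambda>z. indicator (disc r) z *\<^sub>R h z) \<in> borel_measurable borel"
      by (rule borel_measurable_indicator_disc[OF h(1) r1])
    have mm: "(\<lambda>z. ennreal (h z) * indicator (grid_cell (n, i, j) r) z) \<in> borel_measurable lborel" for i j
    proof -
      have "(\<lambda>z. ennreal (indicator (disc r) z *\<^sub>R h z) * indicator (grid_cell (n, i, j) r) z) \<in> borel_measurable lborel"
        by measurable
      also have "(\<lambda>z. ennreal (indicator (disc r) z *\<^sub>R h z) * indicator (grid_cell (n, i, j) r) z) = (\<lambda>z. ennreal (h z) * indicator (grid_cell (n, i, j) r) z)"
        using grid_cell_subset[of "(n, i, j)" r] by (auto simp: indicator_def fun_eq_iff)
      finally show ?thesis .
    qed
    have "(\<integral>\<^sup>+z\<in>disc r. ennreal (h z) \<partial>lborel) = (\<integral>\<^sup>+z. (\<Sum>(i, j)\<in>?J. ennreal (h z) * indicator (grid_cell (n, i, j) r) z) \<partial>lborel)"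
      unfolding indicator_disc_eq_sum_grid[OF n r1] by (simp add: sum_distrib_left case_prod_beta)
    also have "\<dots> = (\<Sum>(i, j)\<in>?J. (\<integral>\<^sup>+z\<in>grid_cell (n, i, j) r. ennreal (h z) \<partial>lborel))"
      unfolding case_prod_beta by (rule nn_integral_sum) (use mm in auto)
    finally show ?thesis .
  qed
  have "(\<integral>\<^sup>+z\<in>disc r. ennreal \<bar>f z\<bar> \<partial>lborel) = (\<Sum>(i, j)\<in>?J. (\<integral>\<^sup>+z\<in>grid_cell (n, i, j) r. ennreal \<bar>f z\<bar> \<partial>lborel))"
    by (rule split) (auto intro!: continuous_intros fd)
  also have "\<dots> \<le> (\<Sum>(i, j)\<in>?J. ennreal \<bar>LBINT z:grid_cell (n, i, j) r. f z\<bar> + ennreal (8 / real n) * (\<integral>\<^sup>+z\<in>grid_cell (n, i, j) r. ennreal (norm (grad f z)) \<partial>lborel))"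
  proof (rule sum_mono, clarify)
    fix i j
    show "(\<integral>\<^sup>+z\<in>grid_cell (n, i, j) r. ennreal \<bar>f z\<bar> \<partial>lborel) \<le> ennreal \<bar>LBINT z:grid_cell (n, i, j) r. f z\<bar> + ennreal (8 / real n) * (\<integral>\<^sup>+z\<in>grid_cell (n, i, j) r. ennreal (norm (grad f z)) \<partial>lborel)"
    proof -
      have "(\<integral>\<^sup>+z\<in>grid_cell (n, i, j) r. ennreal \<bar>f z\<bar> \<partial>lborel) \<le> ennreal \<bar>LBINT z:grid_cell (n, i, j) r. f z\<bar> + ennreal (4 * (2 / real n)) * (\<integral>\<^sup>+z\<in>grid_cell (n, i, j) r. ennreal (norm (grad f z)) \<partial>lborel)"
        by (rule L1_bound_by_mean[OF f r grid_cell_subset grid_cell_convex grid_cell_measurable grid_cell_diameter[OF n]])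
      then show ?thesis by simp
    qed
  qed
  also have "\<dots> = (\<Sum>(i, j)\<in>?J. ennreal \<bar>LBINT z:grid_cell (n, i, j) r. f z\<bar>) + ennreal (8 / real n) * (\<Sum>(i, j)\<in>?J. (\<integral>\<^sup>+z\<in>grid_cell (n, i, j) r. ennreal (norm (grad f z)) \<partial>lborel))"
    by (simp add: case_prod_beta sum.distrib sum_distrib_left)
  also have "(\<Sum>(i, j)\<in>?J. (\<integral>\<^sup>+z\<in>grid_cell (n, i, j) r. ennreal (norm (grad f z)) \<partial>lborel)) = (\<integral>\<^sup>+z\<in>disc r. ennreal (norm (grad f z)) \<partial>lborel)"
    by (rule split[symmetric]) (auto intro!: continuous_intros continuous_on_grad fd)
  finally show ?thesis .
qed

lemma diagonal_convergent_subseq_countable: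
  fixes a :: "'i::countable \<Rightarrow> nat \<Rightarrow> real" and b :: "nat \<Rightarrow> real"
  assumes "\<And>i. bounded (range (a i))" "bounded (range b)"
  obtains \<sigma> :: "nat \<Rightarrow> nat" where "strict_mono \<sigma>" "\<And>i. convergent (\<lambda>k. a i (\<sigma> k))" "convergent (\<lambda>k. b (\<sigma> k))"
proof -
  \<comment> \<open>The extra sequence takes index 0, so that one diagonal argument serves it
    together with the enumerated family.\<close>
  define F where "F m = (case m of 0 \<Rightarrow> b | Suc m \<Rightarrow> a (from_nat m))" for m
  have "bounded (range (F m))" for m using assms by (simp add: F_def split: nat.split)
  then obtain \<sigma> :: "nat \<Rightarrow> nat" where \<sigma>: "strict_mono \<sigma>" "\<And>m. convergent (\<lambda>k. F m (\<sigma> k))"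
    by (rule diagonal_convergent_subseq) (rule that)
  have "convergent (\<lambda>k. a i (\<sigma> k))" for i using \<sigma>(2)[of "Suc (to_nat i)"] by (simp add: F_def)
  moreover have "convergent (\<lambda>k. b (\<sigma> k))" using \<sigma>(2)[of 0] by (simp add: F_def)
  ultimately show ?thesis using that \<sigma>(1) by blast
qed

text \<open>The cells of all grids on countably many discs that exhaust the unit disc form a
  countable family. A single subsequence makes all their integrals converge and is therefore Cauchy
  in L^1 on every disc of radius r < 1.\<close>

lemma Rellich_diagonal:
  fixes w :: "nat \<Rightarrow> complex \<Rightarrow> real" and b :: "nat \<Rightarrow> real"
  assumes w: "\<And>k. Ck_on 2 (disc 1) (w k)" and b: "bounded (range b)"
    and bd: "\<And>r. 0 < r \<Longrightarrow> r < 1 \<Longrightarrow> \<exists>A\<ge>0. \<forall>k. (\<integral>\<^sup>+z\<in>disc r. ennreal \<bar>w k z\<bar> \<partial>lborel) \<le> ennreal A \<and>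
      (\<integral>\<^sup>+z\<in>disc r. ennreal (norm (grad (w k) z)) \<partial>lborel) \<le> ennreal A"
  obtains \<sigma> :: "nat \<Rightarrow> nat" where "strict_mono \<sigma>" "convergent (\<lambda>k. b (\<sigma> k))"
    "\<And>r e. 0 < r \<Longrightarrow> r < 1 \<Longrightarrow> e > 0 \<Longrightarrow> \<exists>N. \<forall>i\<ge>N. \<forall>j\<ge>N.
      (\<integral>\<^sup>+z\<in>disc r. ennreal \<bar>w (\<sigma> i) z - w (\<sigma> j) z\<bar> \<partial>lborel) \<le> ennreal e"
proof -
  \<comment> \<open>The shift by 2 keeps every radius strictly between 0 and 1.\<close>
  define rad where "rad l = 1 - 1 / real (l + 2)" for l :: nat
  have rad: "0 < rad l" "rad l < 1" for l by (auto simp: rad_def field_simps)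
  define a where "a = (\<lambda>(p, l) k. LBINT z:grid_cell p (rad l). w k z)"
  have ba: "bounded (range (a x))" for x
  proof -
    obtain p l where x: "x = (p, l)" by (cases x)
    obtain A where A: "A \<ge> 0" "\<And>k. (\<integral>\<^sup>+z\<in>disc (rad l). ennreal \<bar>w k z\<bar> \<partial>lborel) \<le> ennreal A"
      using bd[OF rad] by blast
    have "\<bar>a x k\<bar> \<le> A" for k
    proof -
      have "ennreal \<bar>a x k\<bar> \<le> ennreal A"
        using set_integral_bounds(2)[OF w rad(2) grid_cell_subset grid_cell_measurable, of p l k] A(2)[of k]
        by (simp add: a_def x)
      then show ?thesis using A(1) by (simp add: ennreal_le_iff)
    qed
    then show ?thesis by (auto simp: bounded_iff)
  qed
  obtain \<sigma> :: "nat \<Rightarrow> nat" where \<sigma>: "strict_mono \<sigma>" "\<And>x. convergent (\<lambda>k. a x (\<sigma> k))" "convergent (\<lambda>k. b (\<sigma> k))"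
    by (rule diagonal_convergent_subseq_countable[OF ba b]) (rule that)
  have "\<exists>N. \<forall>i\<ge>N. \<forall>j\<ge>N. (\<integral>\<^sup>+z\<in>disc r. ennreal \<bar>w (\<sigma> i) z - w (\<sigma> j) z\<bar> \<partial>lborel) \<le> ennreal e"
    if r: "0 < r" "r < 1" and e: "e > 0" for r e
  proof -
    obtain l where l: "r \<le> rad l"
    proof -
      obtain l where "inverse (real (Suc l)) < 1 - r" using reals_Archimedean[of "1 - r"] r by auto
      then have "1 / real (l + 1) < 1 - r" by (simp add: inverse_eq_divide add.commute)
      moreover have "1 / real (l + 2) \<le> 1 / real (l + 1)" by (intro divide_left_mono) auto
      ultimately have "r \<le> rad l" by (simp add: rad_def)
      then show ?thesis by (rule that)
    qed
    obtain A where A: "A \<ge> 0" "\<And>k. (\<integral>\<^sup>+z\<in>disc (rad l). ennreal (norm (grad (w k) z)) \<partial>lborel) \<le> ennreal A"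
      using bd[OF rad] by blast
    \<comment> \<open>The gradient of a difference has L^1 norm at most 2 A, so this n makes the
      gradient term (8 / n) 2 A at most e / 2. The other half of e is shared by the \<open>c\<close>
      cells of this grid.\<close>
    obtain n :: nat where n: "n > 0" "32 * (A + 1) / e < real n"
    proof -
      obtain n where "32 * (A + 1) / e < real n" using reals_Archimedean2 by blast
      moreover have "32 * (A + 1) / e > 0" using A e by simp
      ultimately have "n > 0" "32 * (A + 1) / e < real n" by (auto intro: gr0I)
      then show ?thesis by (rule that)
    qed
    have small: "8 / real n * (2 * A) \<le> e / 2"
    proof -
      have "32 * (A + 1) < e * real n" using n e by (simp add: field_simps)
      then have "32 * A \<le> e * real n" by simp
      then show ?thesis using n by (simp add: field_simps)
    qed
    let ?J = "{- int n..int n} \<times> {- int n..int n}"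
    define c where "c = real (card ?J)"
    have c: "c > 0" unfolding c_def by (simp add: card_cartesian_product)
    have "\<exists>N. \<forall>i\<ge>N. \<forall>j\<ge>N. \<bar>a ((n, p), rad') (\<sigma> i) - a ((n, p), rad') (\<sigma> j)\<bar> < e / (2 * c)" for p rad'
    proof -
      have "Cauchy (\<lambda>k. a ((n, p), rad') (\<sigma> k))" using \<sigma>(2) Cauchy_convergent_iff by blast
      moreover have "e / (2 * c) > 0" using e c by simp
      ultimately show ?thesis unfolding Cauchy_def dist_real_def by blast
    qed
    then have ex: "\<forall>p. \<exists>N. \<forall>i\<ge>N. \<forall>j\<ge>N. \<bar>a ((n, p), l) (\<sigma> i) - a ((n, p), l) (\<sigma> j)\<bar> < e / (2 * c)" by blast
    from choice[OF ex] obtain Nf where Nf0: "\<forall>p. \<forall>i\<ge>Nf p. \<forall>j\<ge>Nf p. \<bar>a ((n, p), l) (\<sigma> i) - a ((n, p), l) (\<sigma> j)\<bar> < e / (2 * c)" ..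
    have Nf: "\<bar>a ((n, p), l) (\<sigma> i) - a ((n, p), l) (\<sigma> j)\<bar> < e / (2 * c)" if "Nf p \<le> i" "Nf p \<le> j" for p i j
      using Nf0 that by blast
    define N where "N = Max (Nf ` ?J)"
    have NN: "Nf p \<le> N" if "p \<in> ?J" for p unfolding N_def using that by (intro Max_ge) auto
    have "(\<integral>\<^sup>+z\<in>disc r. ennreal \<bar>w (\<sigma> i) z - w (\<sigma> j) z\<bar> \<partial>lborel) \<le> ennreal e" if ij: "i \<ge> N" "j \<ge> N" for i j
    proof -
      define f where "f z = w (\<sigma> i) z - w (\<sigma> j) z" for z
      have f: "Ck_on 2 (disc 1) f" unfolding f_def by (intro Ck_on_diff w open_ball)
      have "(\<integral>\<^sup>+z\<in>disc r. ennreal \<bar>f z\<bar> \<partial>lborel) \<le> (\<integral>\<^sup>+z\<in>disc (rad l). ennreal \<bar>f z\<bar> \<partial>lborel)"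
        using l by (intro nn_integral_mono) (auto simp: indicator_def)
      also have "\<dots> \<le> (\<Sum>(x, y)\<in>?J. ennreal \<bar>LBINT z:grid_cell (n, x, y) (rad l). f z\<bar>)
          + ennreal (8 / real n) * (\<integral>\<^sup>+z\<in>disc (rad l). ennreal (norm (grad f z)) \<partial>lborel)"
        by (rule L1_bound_by_grid_means[OF f rad(2) n(1)])
      also have "\<dots> \<le> (\<Sum>(x, y)\<in>?J. ennreal (e / (2 * c))) + ennreal (8 / real n) * ennreal (2 * A)"
      proof (intro add_mono sum_mono mult_left_mono)
        fix p assume p: "p \<in> ?J"
        obtain x y where xy: "p = (x, y)" by (cases p)
        have "(LBINT z:grid_cell (n, x, y) (rad l). f z) = a ((n, p), l) (\<sigma> i) - a ((n, p), l) (\<sigma> j)"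
          unfolding f_def a_def xy case_prod_conv
          by (intro set_integral_diff(2) set_integral_bounds(1)[OF w rad(2) grid_cell_subset grid_cell_measurable])
        then have "\<bar>LBINT z:grid_cell (n, x, y) (rad l). f z\<bar> \<le> e / (2 * c)"
          using Nf[of p i j] NN[OF p] ij by simp
        then show "(case p of (x, y) \<Rightarrow> ennreal \<bar>LBINT z:grid_cell (n, x, y) (rad l). f z\<bar>) \<le> (case p of (x, y) \<Rightarrow> ennreal (e / (2 * c)))"
          by (simp add: xy ennreal_leI)
      next
        have gm: "(\<lambda>z. ennreal (norm (grad (w k) z)) * indicator (disc (rad l)) z) \<in> borel_measurable borel" for k
        proof -
          note wd = Ck_on_2_D[OF w]
          have [measurable]: "(\<lambda>\<zeta>. indicator (disc (rad l)) \<zeta> *\<^sub>R grad (w k) \<zeta>) \<in> borel_measurable borel"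
            by (rule borel_measurable_indicator_disc[OF continuous_on_grad[OF wd(4) wd(4)] less_imp_le[OF rad(2)]])
          have "(\<lambda>\<zeta>. ennreal (norm (indicator (disc (rad l)) \<zeta> *\<^sub>R grad (w k) \<zeta>))) \<in> borel_measurable borel" by measurable
          also have "(\<lambda>\<zeta>. ennreal (norm (indicator (disc (rad l)) \<zeta> *\<^sub>R grad (w k) \<zeta>))) = (\<lambda>\<zeta>. ennreal (norm (grad (w k) \<zeta>)) * indicator (disc (rad l)) \<zeta>)"
            by (auto simp: indicator_def fun_eq_iff)
          finally show ?thesis .
        qed
        have "(\<integral>\<^sup>+z\<in>disc (rad l). ennreal (norm (grad f z)) \<partial>lborel) \<le>
          (\<integral>\<^sup>+z. ennreal (norm (grad (w (\<sigma> i)) z)) * indicator (disc (rad l)) z + ennreal (norm (grad (w (\<sigma> j)) z)) * indicator (disc (rad l)) z \<partial>lborel)"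
        proof (rule nn_integral_mono)
          fix z
          show "ennreal (norm (grad f z)) * indicator (disc (rad l)) z \<le> ennreal (norm (grad (w (\<sigma> i)) z)) * indicator (disc (rad l)) z + ennreal (norm (grad (w (\<sigma> j)) z)) * indicator (disc (rad l)) z"
          proof (cases "z \<in> disc (rad l)")
            case True
            then have "z \<in> disc 1" using rad(2)[of l] by simp
            then have "norm (grad f z) \<le> norm (grad (w (\<sigma> i)) z) + norm (grad (w (\<sigma> j)) z)"
              unfolding f_def by (subst grad_diff[OF open_ball _ w w]) (auto intro: norm_triangle_ineq4)
            then have "ennreal (norm (grad f z)) \<le> ennreal (norm (grad (w (\<sigma> i)) z) + norm (grad (w (\<sigma> j)) z))" by (rule ennreal_leI)
            then show ?thesis using True by simp
          qed simp
        qed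
        also have "\<dots> = (\<integral>\<^sup>+z\<in>disc (rad l). ennreal (norm (grad (w (\<sigma> i)) z)) \<partial>lborel) + (\<integral>\<^sup>+z\<in>disc (rad l). ennreal (norm (grad (w (\<sigma> j)) z)) \<partial>lborel)"
          by (rule nn_integral_add) (simp_all add: gm)
        also have "\<dots> \<le> ennreal A + ennreal A" by (intro add_mono A)
        also have "\<dots> = ennreal (2 * A)" using A(1) by (simp flip: ennreal_plus)
        finally show "(\<integral>\<^sup>+z\<in>disc (rad l). ennreal (norm (grad f z)) \<partial>lborel) \<le> ennreal (2 * A)" .
      qed auto
      also have "(\<Sum>(x, y)\<in>?J. ennreal (e / (2 * c))) = ennreal (e / 2)"
      proof -
        have "(\<Sum>(x, y)\<in>?J. ennreal (e / (2 * c))) = ennreal c * ennreal (e / (2 * c))"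
          unfolding c_def case_prod_beta by (simp add: ennreal_of_nat_eq_real_of_nat)
        also have "\<dots> = ennreal (e / 2)" using c e by (simp flip: ennreal_mult)
        finally show ?thesis .
      qed
      also have "ennreal (e / 2) + ennreal (8 / real n) * ennreal (2 * A) \<le> ennreal (e / 2) + ennreal (e / 2)"
      proof -
        have "ennreal (8 / real n) * ennreal (2 * A) = ennreal (8 / real n * (2 * A))"
          using A(1) by (intro ennreal_mult[symmetric]) auto
        also have "\<dots> \<le> ennreal (e / 2)" by (rule ennreal_leI[OF small])
        finally show ?thesis by (rule add_left_mono)
      qed
      also have "\<dots> = ennreal e" using e by (simp flip: ennreal_plus)
      finally show ?thesis by (simp add: f_def)
    qed
    then show ?thesis by blast
  qed
  from that[OF \<sigma>(1,3) this] show ?thesis .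
qed

subsection \<open>Rescaling of conformal metrics\<close>

text \<open>The conformal factors of the curvature and of the area cancel. The curvature hypothesis
  thus becomes an L^1 bound for the Laplacian, the form in which everything else uses it.\<close>

lemma nn_integral_conf_curv:
  assumes u: "Ck_on 2 (disc 1) u"
  shows "(\<integral>\<^sup>+z. ennreal \<bar>conf_curv u z\<bar> \<partial>conf_area u) = (\<integral>\<^sup>+z\<in>disc 1. ennreal \<bar>laplacian u z\<bar> \<partial>lborel)"
proof -
  note ud = Ck_on_2_D[OF u]
  have cl: "continuous_on (disc 1) (laplacian u)" unfolding laplacian_def[abs_def] by (intro continuous_intros ud)
  have [measurable]: "u \<in> borel_measurable (lebesgue_on (disc 1))" "laplacian u \<in> borel_measurable (lebesgue_on (disc 1))"
    by (rule continuous_on_imp_measurable_disc; use ud(3) cl in simp)+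
  have [measurable]: "conf_curv u \<in> borel_measurable (lebesgue_on (disc 1))"
    unfolding conf_curv_def[abs_def] by measurable
  have "(\<integral>\<^sup>+z. ennreal \<bar>conf_curv u z\<bar> \<partial>conf_area u) = (\<integral>\<^sup>+z. ennreal (exp (2 * u z)) * ennreal \<bar>conf_curv u z\<bar> \<partial>lebesgue_on (disc 1))"
    unfolding conf_area_def by (rule nn_integral_density) measurable
  also have "\<dots> = (\<integral>\<^sup>+z. ennreal \<bar>laplacian u z\<bar> \<partial>lebesgue_on (disc 1))"
  proof (rule nn_integral_cong)
    fix z
    have "exp (2 * u z) * \<bar>conf_curv u z\<bar> = (exp (2 * u z) * exp (- 2 * u z)) * \<bar>laplacian u z\<bar>"
      by (simp add: conf_curv_def abs_mult)
    also have "exp (2 * u z) * exp (- 2 * u z) = 1" by (simp flip: exp_add)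
    finally show "ennreal (exp (2 * u z)) * ennreal \<bar>conf_curv u z\<bar> = ennreal \<bar>laplacian u z\<bar>"
      by (simp flip: ennreal_mult)
  qed
  finally show ?thesis by (simp add: nn_integral_lebesgue_on_disc)
qed

lemma affine_ball_iff:
  fixes z :: complex
  assumes "s > 0" shows "a + s *\<^sub>R z \<in> ball a (s * r) \<longleftrightarrow> z \<in> disc r"
  using assms by (simp add: dist_norm)

lemma affine_image_disc:
  fixes a :: complex
  assumes "s > 0" shows "(\<lambda>z. a + s *\<^sub>R z) ` disc 1 = ball a s"
proof (rule set_eqI)
  fix y
  define z0 where "z0 = (1 / s) *\<^sub>R (y - a)"
  have e: "y = a + s *\<^sub>R z0" using assms by (simp add: z0_def)
  have "y \<in> (\<lambda>z. a + s *\<^sub>R z) ` disc 1" if "y \<in> ball a s"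
  proof (rule image_eqI[where f = "\<lambda>z. a + s *\<^sub>R z", OF e])
    show "z0 \<in> disc 1" using affine_ball_iff[OF assms, of a z0 1] that by (simp only: e[symmetric] mult_1_right)
  qed
  moreover have "y \<in> ball a s" if yi: "y \<in> (\<lambda>z. a + s *\<^sub>R z) ` disc 1"
  proof -
    obtain z where z: "y = a + s *\<^sub>R z" "z \<in> disc 1" using yi by blast
    show ?thesis using affine_ball_iff[OF assms, of a z 1] z(2) unfolding z(1) by (simp only: mult_1_right)
  qed
  ultimately show "y \<in> (\<lambda>z. a + s *\<^sub>R z) ` disc 1 \<longleftrightarrow> y \<in> ball a s" by blast
qed

context
  fixes u :: "complex \<Rightarrow> real" and a :: complex and s :: real
  assumes s: "s > 0" and sub: "ball a s \<subseteq> disc 1"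
begin

text \<open>Conformal factor of the pullback of the metric under z -> a + s z: the derivative of
  this map multiplies the metric by s^2, which the summand ln s accounts for.\<close>

definition rescaled :: "complex \<Rightarrow> real" where "rescaled z = u (a + s *\<^sub>R z) + ln s"

lemma affine_in_disc: "z \<in> disc 1 \<Longrightarrow> a + s *\<^sub>R z \<in> disc 1"
  using affine_ball_iff[OF s, of a z 1] sub by auto

lemma smooth_on_rescaled:
  assumes "smooth_on (disc 1) u" shows "smooth_on (disc 1) rescaled"
  unfolding smooth_on_def
proof
  fix k
  have "Ck_on k (disc 1) (\<lambda>z. u (a + s *\<^sub>R z))"
    by (rule Ck_on_affine[OF open_ball]) (use assms affine_in_disc in \<open>auto simp: smooth_on_def simp del: mem_ball\<close>)
  then show "Ck_on k (disc 1) rescaled"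
    unfolding rescaled_def[abs_def] by (intro Ck_on_add Ck_on_const open_ball)
qed

lemma pderiv_rescaled:
  assumes "Ck_on 2 (disc 1) u" "z \<in> disc 1"
  shows "pderiv_dir v rescaled z = s * pderiv_dir v u (a + s *\<^sub>R z)"
    "grad rescaled z = s *\<^sub>R grad u (a + s *\<^sub>R z)" "laplacian rescaled z = s\<^sup>2 * laplacian u (a + s *\<^sub>R z)"
proof -
  note ud = Ck_on_2_D[OF assms(1)]
  have d: "(\<lambda>z. u (a + s *\<^sub>R z)) differentiable (at z)" if "z \<in> disc 1" for z
  proof -
    have "((\<lambda>x. u (a + s *\<^sub>R x)) has_derivative (\<lambda>v. pderiv_dir (s *\<^sub>R v) u (a + s *\<^sub>R z))) (at z)"
      by (rule has_derivative_compose[of "\<lambda>x. a + s *\<^sub>R x"])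
        (use has_derivative_pderiv_dir ud(1) affine_in_disc[OF that] in \<open>auto intro!: derivative_eq_intros simp del: mem_ball\<close>)
    then show ?thesis using differentiable_def by blast
  qed
  have p: "pderiv_dir v rescaled z = s * pderiv_dir v u (a + s *\<^sub>R z)" if "z \<in> disc 1" for v z
  proof -
    have "pderiv_dir v rescaled z = pderiv_dir v (\<lambda>z. u (a + s *\<^sub>R z)) z + pderiv_dir v (\<lambda>_. ln s) z"
      unfolding rescaled_def[abs_def] by (rule pderiv_dir_add[OF d[OF that]]) simp
    also have "\<dots> = s * pderiv_dir v u (a + s *\<^sub>R z)"
      using pderiv_dir_affine(2)[OF ud(1)[OF affine_in_disc[OF that]], of v]
      by (simp add: pderiv_dir_def[of v "\<lambda>_. ln s"] frechet_derivative_const)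
    finally show ?thesis .
  qed
  show "pderiv_dir v rescaled z = s * pderiv_dir v u (a + s *\<^sub>R z)" by (rule p[OF assms(2)])
  show "grad rescaled z = s *\<^sub>R grad u (a + s *\<^sub>R z)" by (simp add: grad_def p[OF assms(2)] complex_eq_iff)
  have pp: "pderiv_dir v (pderiv_dir v rescaled) z = s\<^sup>2 * pderiv_dir v (pderiv_dir v u) (a + s *\<^sub>R z)" for v
  proof -
    have d2: "(\<lambda>z. pderiv_dir v u (a + s *\<^sub>R z)) differentiable (at z)"
    proof -
      have "((\<lambda>x. pderiv_dir v u (a + s *\<^sub>R x)) has_derivative (\<lambda>w. pderiv_dir (s *\<^sub>R w) (pderiv_dir v u) (a + s *\<^sub>R z))) (at z)"
        by (rule has_derivative_compose[of "\<lambda>x. a + s *\<^sub>R x"])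
          (use has_derivative_pderiv_dir ud(2) affine_in_disc[OF assms(2)] in \<open>auto intro!: derivative_eq_intros simp del: mem_ball\<close>)
      then show ?thesis using differentiable_def by blast
    qed
    have "pderiv_dir v (pderiv_dir v rescaled) z = pderiv_dir v (\<lambda>z. s * pderiv_dir v u (a + s *\<^sub>R z)) z"
      by (rule pderiv_dir_transform(2)[OF open_ball assms(2)]) (simp_all add: p d2 del: mem_ball)
    also have "\<dots> = s * pderiv_dir v (\<lambda>z. pderiv_dir v u (a + s *\<^sub>R z)) z + pderiv_dir v (\<lambda>_. s) z * pderiv_dir v u (a + s *\<^sub>R z)"
      by (rule pderiv_dir_mult[OF _ d2]) simp
    also have "\<dots> = s\<^sup>2 * pderiv_dir v (pderiv_dir v u) (a + s *\<^sub>R z)"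
      using pderiv_dir_affine(2)[OF ud(2)[OF affine_in_disc[OF assms(2)]], of v v]
      by (simp add: pderiv_dir_def[of v "\<lambda>_. s"] frechet_derivative_const power2_eq_square)
    finally show ?thesis .
  qed
  show "laplacian rescaled z = s\<^sup>2 * laplacian u (a + s *\<^sub>R z)" by (simp add: laplacian_def pp distrib_left)
qed

text \<open>The factor s^2 of the Laplacian cancels the Jacobian, as total curvature is scale
  invariant in dimension two; the inequality comes from the restriction to the smaller ball.\<close>

lemma nn_integral_laplacian_rescaled:
  assumes u: "Ck_on 2 (disc 1) u"
  shows "(\<integral>\<^sup>+z\<in>disc 1. ennreal \<bar>laplacian rescaled z\<bar> \<partial>lborel) \<le> (\<integral>\<^sup>+z\<in>disc 1. ennreal \<bar>laplacian u z\<bar> \<partial>lborel)"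
proof -
  note ud = Ck_on_2_D[OF u]
  have cl: "continuous_on (ball a s) (laplacian u)"
    unfolding laplacian_def[abs_def] by (intro continuous_intros continuous_on_subset[OF ud(5) sub])
  define h where "h z = ennreal \<bar>indicator (ball a s) z *\<^sub>R laplacian u z\<bar>" for z
  have [measurable]: "(\<lambda>z. indicator (ball a s) z *\<^sub>R laplacian u z) \<in> borel_measurable borel"
    by (rule borel_measurable_continuous_on_indicator[OF _ cl]) simp
  have hm: "h \<in> borel_measurable borel" unfolding h_def by measurable
  have "(\<integral>\<^sup>+z\<in>disc 1. ennreal \<bar>laplacian rescaled z\<bar> \<partial>lborel) = (\<integral>\<^sup>+z. ennreal (s\<^sup>2) * h (a + s *\<^sub>R z) \<partial>lborel)"
  proof (rule nn_integral_cong)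
    fix z
    show "ennreal \<bar>laplacian rescaled z\<bar> * indicator (disc 1) z = ennreal (s\<^sup>2) * h (a + s *\<^sub>R z)"
    proof (cases "z \<in> disc 1")
      case True
      then have "a + s *\<^sub>R z \<in> ball a s" using affine_ball_iff[OF s, of a z 1] by simp
      then have h1: "h (a + s *\<^sub>R z) = ennreal \<bar>laplacian u (a + s *\<^sub>R z)\<bar>" by (simp add: h_def)
      have "\<bar>laplacian rescaled z\<bar> = s\<^sup>2 * \<bar>laplacian u (a + s *\<^sub>R z)\<bar>" by (simp only: pderiv_rescaled(3)[OF u True] abs_mult abs_power2)
      then show ?thesis using True h1 by (simp add: ennreal_mult)
    next
      case False
      then have "a + s *\<^sub>R z \<notin> ball a s" using affine_ball_iff[OF s, of a z 1] by simp
      then show ?thesis using False by (simp add: h_def)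
    qed
  qed
  also have "\<dots> = ennreal (s\<^sup>2) * (ennreal (1 / s\<^sup>2) * (\<integral>\<^sup>+z. h z \<partial>lborel))"
    using s hm by (subst nn_integral_cmult) (simp_all add: nn_integral_affine_complex)
  also have "\<dots> = (\<integral>\<^sup>+z. h z \<partial>lborel)"
  proof -
    have "ennreal (s\<^sup>2) * ennreal (1 / s\<^sup>2) = 1" using s by (simp flip: ennreal_mult)
    then show ?thesis by (simp flip: mult.assoc)
  qed
  also have "\<dots> \<le> (\<integral>\<^sup>+z\<in>disc 1. ennreal \<bar>laplacian u z\<bar> \<partial>lborel)"
    using sub by (intro nn_integral_mono) (auto simp: h_def indicator_def)
  finally show ?thesis .
qed

text \<open>The complete surface stays the same; the embedding is composed with z -> a + s z, which
  maps the unit disc homeomorphically onto an open ball inside it.\<close>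

lemma extends_to_complete_rescaled:
  assumes "extends_to_complete \<Lambda> u" shows "extends_to_complete \<Lambda> rescaled"
proof -
  obtain S :: "real surface" and f where S: "complete_surface S" "total_abs_curv S \<le> ennreal \<Lambda>" and f: "isometric_embedding u S f"
    using assms unfolding extends_to_complete_def by blast
  define A where "A z = a + s *\<^sub>R z" for z
  have emb: "embedding_map (top_of_set (disc 1)) (stop S) f" and op: "openin (stop S) (f ` disc 1)"
    using f unfolding isometric_embedding_def by auto
  have img: "A ` disc 1 = ball a s" using affine_image_disc[OF s] unfolding A_def .
  have embA: "embedding_map (top_of_set (disc 1)) (top_of_set (disc 1)) A"
  proof -
    have "homeomorphic_maps (top_of_set (disc 1)) (top_of_set (ball a s)) A (\<lambda>y. (1 / s) *\<^sub>R (y - a))"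
      unfolding homeomorphic_maps_def
    proof (intro conjI ballI)
      show "continuous_map (top_of_set (disc 1)) (top_of_set (ball a s)) A"
        using img by (auto simp: continuous_map_in_subtopology A_def simp del: mem_ball intro!: continuous_intros)
      have "(1 / s) *\<^sub>R (y - a) \<in> disc 1" if "y \<in> ball a s" for y
        using that affine_ball_iff[OF s, of a "(1 / s) *\<^sub>R (y - a)" 1] s by simp
      then show "continuous_map (top_of_set (ball a s)) (top_of_set (disc 1)) (\<lambda>y. (1 / s) *\<^sub>R (y - a))"
        by (auto simp: continuous_map_in_subtopology simp del: mem_ball intro!: continuous_intros)
    qed (use s in \<open>auto simp: A_def\<close>)
    then have "homeomorphic_map (top_of_set (disc 1)) (top_of_set (ball a s)) A" by (rule homeomorphic_maps_imp_map)
    moreover have "subtopology (top_of_set (disc 1)) (ball a s) = top_of_set (ball a s)"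
      using sub by (simp add: subtopology_subtopology Int_absorb1)
    ultimately show ?thesis unfolding embedding_map_def by (simp add: img)
  qed
  have emb': "embedding_map (top_of_set (disc 1)) (stop S) (f \<circ> A)" by (rule embedding_map_compose[OF embA emb])
  have op': "openin (stop S) ((f \<circ> A) ` disc 1)"
  proof -
    have "homeomorphic_map (top_of_set (disc 1)) (subtopology (stop S) (f ` disc 1)) f"
      using emb by (simp add: embedding_map_def)
    then have "open_map (top_of_set (disc 1)) (subtopology (stop S) (f ` disc 1)) f" by (rule homeomorphic_imp_open_map)
    moreover have "openin (top_of_set (disc 1)) (ball a s)" using sub by (simp add: openin_open_eq)
    ultimately have "openin (subtopology (stop S) (f ` disc 1)) (f ` ball a s)" unfolding open_map_def by blast
    then have "openin (stop S) (f ` ball a s)" using op openin_trans_full by blast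
    then show ?thesis unfolding image_comp[symmetric] img .
  qed
  have cont: "continuous_map (top_of_set (disc 1)) (stop S) (f \<circ> A)"
    by (rule continuous_map_into_fulltopology[OF homeomorphic_imp_continuous_map[OF emb'[unfolded embedding_map_def]]])
  have "isometric_embedding rescaled S (f \<circ> A)"
    unfolding isometric_embedding_def
  proof (intro conjI emb' op' ballI, clarify, intro conjI ballI allI)
    fix U \<phi> assume c: "(U, \<phi>) \<in> atlas S"
    have oU: "openin (stop S) U"
    proof -
      have "\<forall>(U, \<phi>)\<in>atlas S. openin (stop S) U \<and> open (\<phi> ` U) \<and>
        homeomorphic_map (subtopology (stop S) U) (top_of_set (\<phi> ` U)) \<phi> \<and> riem_metric_on (\<phi> ` U) (metric S (U, \<phi>))"
        using S(1) unfolding complete_surface_def riemannian_surface_def by (elim conjE)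
      from bspec[OF this c] show ?thesis by simp
    qed
    have fU: "smooth_on (disc 1 \<inter> f -` U) (\<phi> \<circ> f)"
      and fm: "\<And>z v w. z \<in> disc 1 \<inter> f -` U \<Longrightarrow> conf u z v w = metric S (U, \<phi>) (\<phi> (f z)) (pderiv_dir v (\<phi> \<circ> f) z) (pderiv_dir w (\<phi> \<circ> f) z)"
      using f c unfolding isometric_embedding_def by auto
    \<comment> \<open>\<open>Ck_on_affine\<close> needs an open domain; it comes from the continuity
      of the embedding and the openness of chart domains.\<close>
    have oV: "open (disc 1 \<inter> (f \<circ> A) -` U)"
    proof -
      have "openin (top_of_set (disc 1)) {x \<in> topspace (top_of_set (disc 1)). (f \<circ> A) x \<in> U}"
        by (rule openin_continuous_map_preimage[OF cont oU])
      moreover have "{x \<in> topspace (top_of_set (disc 1)). (f \<circ> A) x \<in> U} = disc 1 \<inter> (f \<circ> A) -` U" by auto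
      ultimately show ?thesis using openin_open_trans[OF _ open_ball] by metis
    qed
    have AV: "A ` (disc 1 \<inter> (f \<circ> A) -` U) \<subseteq> disc 1 \<inter> f -` U"
      using affine_in_disc by (auto simp: A_def simp del: mem_ball)
    have eq: "\<phi> \<circ> (f \<circ> A) = (\<lambda>z. (\<phi> \<circ> f) (a + s *\<^sub>R z))" by (auto simp: A_def)
    show "smooth_on (disc 1 \<inter> (f \<circ> A) -` U) (\<phi> \<circ> (f \<circ> A))"
      unfolding eq smooth_on_def
    proof
      fix k
      have "Ck_on k (disc 1 \<inter> f -` U) (\<phi> \<circ> f)" using fU unfolding smooth_on_def by blast
      then show "Ck_on k (disc 1 \<inter> (f \<circ> A) -` U) (\<lambda>z. (\<phi> \<circ> f) (a + s *\<^sub>R z))"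
        using AV unfolding A_def[abs_def] by (rule Ck_on_affine[OF oV[unfolded A_def[abs_def]]])
    qed
    fix z v w assume z: "z \<in> disc 1 \<inter> (f \<circ> A) -` U"
    have Az: "A z \<in> disc 1 \<inter> f -` U" using AV z by blast
    have d: "(\<phi> \<circ> f) differentiable (at (a + s *\<^sub>R z))"
    proof -
      have "Ck_on (Suc 0) (disc 1 \<inter> f -` U) (\<phi> \<circ> f)" using fU by (simp add: smooth_on_def del: Ck_on.simps)
      then show ?thesis using Az unfolding A_def by simp
    qed
    have pd: "pderiv_dir v (\<phi> \<circ> (f \<circ> A)) z = pderiv_dir (s *\<^sub>R v) (\<phi> \<circ> f) (A z)" for v
      unfolding eq A_def by (rule pderiv_dir_affine(1)[OF d])
    \<comment> \<open>The two factors s on the vectors are exactly exp (2 ln s), so the isometry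
      condition at A z for the scaled vectors is the one required at z.\<close>
    have "conf rescaled z v w = conf u (A z) (s *\<^sub>R v) (s *\<^sub>R w)"
    proof -
      have "exp (2 * rescaled z) = exp (2 * u (A z)) * (exp (ln s) * exp (ln s))"
        unfolding rescaled_def A_def exp_add[symmetric] by (simp add: algebra_simps)
      then show ?thesis using s by (simp add: conf_def)
    qed
    then show "conf rescaled z v w = metric S (U, \<phi>) (\<phi> ((f \<circ> A) z)) (pderiv_dir v (\<phi> \<circ> (f \<circ> A)) z) (pderiv_dir w (\<phi> \<circ> (f \<circ> A)) z)"
      unfolding pd using fm[OF Az] by simp
  qed
  then show ?thesis unfolding extends_to_complete_def using S by blast
qed

text \<open>The weak L^2 norm of a gradient is scale invariant: the level t becomes s t, and areas
  are divided by s^2. The bound on the half disc is therefore a bound with the same C on the ball of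
  half radius about a.\<close>

lemma weak_L2_rescaled:
  assumes u: "Ck_on 2 (disc 1) u" and w: "weak_L2_norm (disc (1/2)) (grad rescaled) < ereal C" and t: "t > 0"
  shows "C \<ge> 0" "emeasure lborel {z \<in> ball a (s * (1/2)). t < norm (grad u z)} \<le> ennreal (C\<^sup>2 / t\<^sup>2)"
proof -
  note ud = Ck_on_2_D[OF u]
  define E where "E = {z \<in> ball a (s * (1/2)). t < norm (grad u z)}"
  define E' where "E' = {z \<in> disc (1/2). s * t < norm (grad rescaled z)}"
  have sub2: "ball a (s * (1/2)) \<subseteq> disc 1" using sub s subset_ball[of "s * (1/2)" s a] by auto
  have "open E"
  proof -
    have "continuous_on (ball a (s * (1/2))) (\<lambda>z. norm (grad u z))"
      by (intro continuous_intros continuous_on_subset[OF continuous_on_grad[OF ud(4) ud(4)] sub2])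
    then have "open (ball a (s * (1/2)) \<inter> (\<lambda>z. norm (grad u z)) -` {t<..})"
      using continuous_on_open_vimage[OF open_ball] by (metis Int_commute open_greaterThan)
    moreover have "E = ball a (s * (1/2)) \<inter> (\<lambda>z. norm (grad u z)) -` {t<..}" by (auto simp: E_def)
    ultimately show ?thesis by simp
  qed
  then have Em [measurable]: "E \<in> sets borel" by simp
  have iff: "z \<in> E' \<longleftrightarrow> a + s *\<^sub>R z \<in> E" for z
  proof (cases "z \<in> disc (1/2)")
    case True
    then have z1: "z \<in> disc 1" by simp
    have "a + s *\<^sub>R z \<in> ball a (s * (1/2))" using True affine_ball_iff[OF s] by blast
    then show ?thesis using True s unfolding E'_def E_def by (simp add: pderiv_rescaled(2)[OF u z1] del: mem_ball)
  next
    case False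
    then have "a + s *\<^sub>R z \<notin> ball a (s * (1/2))" using affine_ball_iff[OF s] by blast
    then show ?thesis using False by (simp add: E'_def E_def del: mem_ball)
  qed
  have E'm: "E' \<in> sets borel"
  proof -
    have "E' = (\<lambda>z. a + s *\<^sub>R z) -` E \<inter> space borel" using iff by auto
    also have "\<dots> \<in> sets borel" by (rule measurable_sets[of _ borel borel]) (auto simp: Em)
    finally show ?thesis .
  qed
  have eE': "emeasure lborel E' = ennreal (1 / s\<^sup>2) * emeasure lborel E"
  proof -
    have "emeasure lborel E' = (\<integral>\<^sup>+z. indicator E' z \<partial>lborel)" using E'm by simp
    also have "\<dots> = (\<integral>\<^sup>+z. indicator E (a + s *\<^sub>R z) \<partial>lborel)" by (intro nn_integral_cong) (simp add: indicator_def iff)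
    also have "\<dots> = ennreal (1 / s\<^sup>2) * (\<integral>\<^sup>+z. indicator E z \<partial>lborel)"
      using s by (intro nn_integral_affine_complex) auto
    finally show ?thesis by simp
  qed
  have finE: "emeasure lborel E < \<infinity>"
    by (rule le_less_trans[OF emeasure_mono emeasure_lborel_ball_finite[of a "s * (1/2)"]]) (auto simp: E_def)
  define m where "m = measure lborel E"
  have m: "emeasure lborel E = ennreal m" "m \<ge> 0" using finE by (auto simp: m_def emeasure_eq_ennreal_measure)
  have mE': "measure lebesgue E' = m / s\<^sup>2"
  proof -
    have "emeasure lborel E' = ennreal (m / s\<^sup>2)" unfolding eE' m(1) using m(2) by (simp flip: ennreal_mult)
    then show ?thesis using E'm m(2) by (simp add: measure_def)
  qed
  have "ereal (s * t * sqrt (measure lebesgue E')) \<le> weak_L2_norm (disc (1/2)) (grad rescaled)"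
    unfolding weak_L2_norm_def E'_def by (rule SUP_upper) (use s t in simp)
  then have "ereal (s * t * sqrt (measure lebesgue E')) < ereal C" using w by (rule le_less_trans)
  then have lt: "s * t * sqrt (m / s\<^sup>2) < C" by (simp add: mE')
  have "0 \<le> s * t * sqrt (m / s\<^sup>2)" using s t m by simp
  then show C: "C \<ge> 0" using lt by linarith
  have "s * t * sqrt (m / s\<^sup>2) = t * sqrt m" using s by (simp add: real_sqrt_divide)
  then have "t * sqrt m \<le> C" using lt by linarith
  then have "(t * sqrt m)\<^sup>2 \<le> C\<^sup>2" using t m by (intro power_mono) auto
  then have "m \<le> C\<^sup>2 / t\<^sup>2" using t m by (simp add: power_mult_distrib field_simps)
  then show "emeasure lborel {z \<in> ball a (s * (1/2)). t < norm (grad u z)} \<le> ennreal (C\<^sup>2 / t\<^sup>2)"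
    unfolding E_def[symmetric] m(1) by (rule ennreal_leI)
qed

end

text \<open>Finitely many half balls cover the disc of radius r. On each of them the rescaled
  estimate gives a weak L^2 bound and thereby an L^p bound for p < 2. Their number depends on r
  only, so the constant is uniform in u.\<close>

lemma gradient_Lp_bound:
  assumes eps: "eps_regularity \<Lambda> \<epsilon>" and r: "0 < r" "r < 1" and p: "0 < p" "p < 2"
  shows "\<exists>K\<ge>0. \<forall>u. smooth_on (disc 1) u \<longrightarrow> extends_to_complete \<Lambda> u \<longrightarrow>
    (\<integral>\<^sup>+z\<in>disc 1. ennreal \<bar>laplacian u z\<bar> \<partial>lborel) \<le> ennreal \<epsilon> \<longrightarrow>
    (\<integral>\<^sup>+z\<in>disc r. ennreal (norm (grad u z) powr p) \<partial>lborel) \<le> ennreal K"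
proof -
  have "\<forall>p. 1 < p \<and> p < 2 \<longrightarrow> (\<exists>C. \<forall>u. smooth_on (disc 1) u \<and> extends_to_complete \<Lambda> u \<and>
        (\<integral>\<^sup>+z. ennreal \<bar>conf_curv u z\<bar> \<partial>conf_area u) \<le> ennreal \<epsilon> \<longrightarrow>
          weak_L2_norm (disc (1/2)) (grad u) < ereal C \<and>
          W1p_norm p (disc (1/2)) u \<le> C * (1 + \<bar>ln (measure (conf_area u) (disc (1/2)))\<bar>))"
    using eps unfolding eps_regularity_def by (elim conjE)
  \<comment> \<open>The weak L^2 bound does not involve the exponent, so one admissible value
    delivers it.\<close>
  from this[rule_format, of "3/2"]
  obtain C where C: "\<And>u. smooth_on (disc 1) u \<Longrightarrow> extends_to_complete \<Lambda> u \<Longrightarrow>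
        (\<integral>\<^sup>+z. ennreal \<bar>conf_curv u z\<bar> \<partial>conf_area u) \<le> ennreal \<epsilon> \<Longrightarrow>
          weak_L2_norm (disc (1/2)) (grad u) < ereal C" by auto
  \<comment> \<open>Balls of radius s about points of the closed disc of radius r stay inside the
    unit disc, as the rescaling demands.\<close>
  define s where "s = 1 - r"
  have s: "s > 0" "s \<le> 1" using r by (auto simp: s_def)
  define K0 where "K0 = pi + C\<^sup>2 * 2 powr p / (1 - 2 powr (p - 2))"
  have q: "2 powr (p - 2) < (1::real)" using p by (simp add: powr_less_one)
  have K0: "K0 \<ge> 0" using q by (simp add: K0_def)
  have sub: "ball a s \<subseteq> disc 1" if "a \<in> cball 0 r" for a :: complex
  proof
    fix z assume "z \<in> ball a s"
    then show "z \<in> disc 1" using that norm_triangle_ineq2[of z a] by (simp add: s_def dist_norm norm_minus_commute)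
  qed
  \<comment> \<open>The closed disc is used for its compactness; the balls of half radius are those
    on which the rescaled estimate speaks.\<close>
  obtain T where T: "T \<subseteq> cball (0::complex) r" "finite T" "cball 0 r \<subseteq> (\<Union>a\<in>T. ball a (s * (1/2)))"
  proof (rule compactE_image[OF compact_cball[of "0::complex" r], of "cball 0 r" "\<lambda>a. ball a (s * (1/2))"])
    show "cball 0 r \<subseteq> (\<Union>c\<in>cball 0 r. ball c (s * (1/2)))" using s by auto
  qed auto
  define K where "K = real (card T) * K0"
  have "(\<integral>\<^sup>+z\<in>disc r. ennreal (norm (grad u z) powr p) \<partial>lborel) \<le> ennreal K"
    if u: "smooth_on (disc 1) u" and ext: "extends_to_complete \<Lambda> u"
      and lap: "(\<integral>\<^sup>+z\<in>disc 1. ennreal \<bar>laplacian u z\<bar> \<partial>lborel) \<le> ennreal \<epsilon>" for u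
  proof -
    have uk: "Ck_on 2 (disc 1) u" using u by (rule smooth_on_imp_Ck_on)
    note ud = Ck_on_2_D[OF uk]
    have one: "(\<integral>\<^sup>+z\<in>ball a (s * (1/2)). ennreal (norm (grad u z) powr p) \<partial>lborel) \<le> ennreal K0"
      and meas: "(\<lambda>z. ennreal (norm (grad u z) powr p) * indicator (ball a (s * (1/2))) z) \<in> borel_measurable borel" if a: "a \<in> cball 0 r" for a
    proof -
      let ?B = "ball a (s * (1/2))"
      have sB: "?B \<subseteq> disc 1" using sub[OF a] subset_ball[of "s * (1/2)" s a] s by auto
      have gm: "(\<lambda>z. indicator ?B z *\<^sub>R grad u z) \<in> borel_measurable borel"
        by (rule borel_measurable_continuous_on_indicator[OF _ continuous_on_subset[OF continuous_on_grad[OF ud(4) ud(4)] sB]]) simp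
      have "(\<lambda>z. ennreal (norm (indicator ?B z *\<^sub>R grad u z) powr p)) \<in> borel_measurable borel" using gm by measurable
      also have "(\<lambda>z. ennreal (norm (indicator ?B z *\<^sub>R grad u z) powr p)) = (\<lambda>z. ennreal (norm (grad u z) powr p) * indicator ?B z)"
        by (auto simp: indicator_def fun_eq_iff)
      finally show "(\<lambda>z. ennreal (norm (grad u z) powr p) * indicator ?B z) \<in> borel_measurable borel" .
      have w: "weak_L2_norm (disc (1/2)) (grad (rescaled u a s)) < ereal C"
      proof (rule C)
        show sm: "smooth_on (disc 1) (rescaled u a s)" by (rule smooth_on_rescaled[OF s(1) sub[OF a] u])
        show "extends_to_complete \<Lambda> (rescaled u a s)" by (rule extends_to_complete_rescaled[OF s(1) sub[OF a] ext])
        show "(\<integral>\<^sup>+z. ennreal \<bar>conf_curv (rescaled u a s) z\<bar> \<partial>conf_area (rescaled u a s)) \<le> ennreal \<epsilon>"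
          unfolding nn_integral_conf_curv[OF smooth_on_imp_Ck_on[OF sm]]
          using nn_integral_laplacian_rescaled[OF s(1) sub[OF a] uk] lap by (rule order_trans)
      qed
      have gN: "(\<lambda>z. norm (grad u z)) \<in> borel_measurable (restrict_space lborel ?B)"
      proof -
        have "grad u \<in> borel_measurable (restrict_space borel ?B)"
          using gm by (simp add: borel_measurable_restrict_space_iff)
        then have [measurable]: "grad u \<in> borel_measurable (restrict_space lborel ?B)"
          by (simp cong: measurable_cong_sets add: sets_restrict_space)
        show ?thesis by measurable
      qed
      have "(\<integral>\<^sup>+z\<in>?B. ennreal (norm (grad u z) powr p) \<partial>lborel) = (\<integral>\<^sup>+z. ennreal (norm (grad u z) powr p) \<partial>restrict_space lborel ?B)"
        by (subst nn_integral_restrict_space) auto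
      also have "\<dots> \<le> emeasure (restrict_space lborel ?B) (space (restrict_space lborel ?B)) + ennreal (C\<^sup>2 * 2 powr p / (1 - 2 powr (p - 2)))"
      proof (rule weak_L2_imp_Lp_bound[OF gN _ p])
        fix n
        have sp: "{x \<in> space (restrict_space lborel ?B). 2 ^ n < norm (grad u x)} = {z \<in> ?B. 2 ^ n < norm (grad u z)}"
          by (auto simp: space_restrict_space)
        have "emeasure (restrict_space lborel ?B) {z \<in> ?B. 2 ^ n < norm (grad u z)} = emeasure lborel {z \<in> ?B. 2 ^ n < norm (grad u z)}"
          by (rule emeasure_restrict_space) auto
        also have "\<dots> \<le> ennreal (C\<^sup>2 / (2 ^ n)\<^sup>2)"
          by (rule weak_L2_rescaled(2)[OF s(1) sub[OF a] uk w]) simp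
        also have "(2 ^ n)\<^sup>2 = (4::real) ^ n" by (simp add: power2_eq_square flip: power_mult_distrib)
        finally show "emeasure (restrict_space lborel ?B) {x \<in> space (restrict_space lborel ?B). 2 ^ n < norm (grad u x)} \<le> ennreal (C\<^sup>2 / 4 ^ n)"
          unfolding sp .
      qed auto
      also have "emeasure (restrict_space lborel ?B) (space (restrict_space lborel ?B)) \<le> ennreal pi"
      proof -
        have "emeasure (restrict_space lborel ?B) (space (restrict_space lborel ?B)) = ennreal (pi * (s * (1/2))\<^sup>2)"
          using s by (simp add: emeasure_restrict_space space_restrict_space emeasure_disc_complex)
        also have "\<dots> \<le> ennreal (pi * 1)" using s by (intro ennreal_leI mult_left_mono power_le_one) auto
        finally show ?thesis by simp
      qed
      also have "ennreal pi + ennreal (C\<^sup>2 * 2 powr p / (1 - 2 powr (p - 2))) = ennreal K0"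
        unfolding K0_def using q by (intro ennreal_plus[symmetric]) auto
      finally show "(\<integral>\<^sup>+z\<in>?B. ennreal (norm (grad u z) powr p) \<partial>lborel) \<le> ennreal K0" by (simp add: add_right_mono)
    qed
    have "(\<integral>\<^sup>+z\<in>disc r. ennreal (norm (grad u z) powr p) \<partial>lborel) \<le> (\<integral>\<^sup>+z. (\<Sum>a\<in>T. ennreal (norm (grad u z) powr p) * indicator (ball a (s * (1/2))) z) \<partial>lborel)"
    proof (rule nn_integral_mono)
      fix z
      show "ennreal (norm (grad u z) powr p) * indicator (disc r) z \<le> (\<Sum>a\<in>T. ennreal (norm (grad u z) powr p) * indicator (ball a (s * (1/2))) z)"
      proof (cases "z \<in> disc r")
        case True
        then have "z \<in> cball 0 r" by simp
        then obtain a where a: "a \<in> T" "z \<in> ball a (s * (1/2))" using T(3) by blast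
        then have "ennreal (norm (grad u z) powr p) * indicator (disc r) z = ennreal (norm (grad u z) powr p) * indicator (ball a (s * (1/2))) z"
          using True by (simp only: indicator_simps)
        also have "\<dots> \<le> (\<Sum>a\<in>T. ennreal (norm (grad u z) powr p) * indicator (ball a (s * (1/2))) z)"
          by (rule member_le_sum[OF a(1)]) (use T in auto)
        finally show ?thesis .
      qed simp
    qed
    also have "\<dots> = (\<Sum>a\<in>T. (\<integral>\<^sup>+z\<in>ball a (s * (1/2)). ennreal (norm (grad u z) powr p) \<partial>lborel))"
      by (rule nn_integral_sum) (use meas T(1) in auto)
    also have "\<dots> \<le> (\<Sum>a\<in>T. ennreal K0)" using one T(1) by (intro sum_mono) blast
    also have "\<dots> = ennreal K" using K0 by (simp add: K_def ennreal_of_nat_eq_real_of_nat ennreal_mult)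
    finally show ?thesis .
  qed
  moreover have "K \<ge> 0" using K0 by (simp add: K_def)
  ultimately show ?thesis by blast
qed

subsection \<open>Diameter\<close>

text \<open>The weight is the splitting parameter of the diameter estimate as a function of the
  position t on the curve. The exponent -3/4 exceeds -1, so the singularities at both ends are
  integrable.\<close>

lemma nn_integral_beta_weight:
  "\<exists>b\<ge>0. (\<integral>\<^sup>+t\<in>{0..1}. ennreal ((t * (1 - t)) powr (- 3 / 4)) \<partial>lborel) = ennreal b"
proof -
  have "((\<lambda>t. t powr (1/4 - 1) * (1 - t) powr (1/4 - 1)) has_integral Beta (1/4) (1/4)) {0..1::real}"
    by (rule has_integral_Beta_real) auto
  then have "((\<lambda>t. (t * (1 - t)) powr (- 3 / 4)) has_integral Beta (1/4) (1/4)) {0..1::real}"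
    by (rule has_integral_eq[rotated]) (auto simp: powr_mult)
  then have h: "((\<lambda>t. if t \<in> {0..1} then (t * (1 - t)) powr (- 3 / 4) else 0) has_integral Beta (1/4) (1/4)) (UNIV :: real set)"
    by (simp only: has_integral_restrict_UNIV)
  have b: "Beta (1/4) (1/4) \<ge> (0::real)" using h by (rule has_integral_nonneg) auto
  have m: "(\<lambda>t::real. if t \<in> {0..1} then (t * (1 - t)) powr (- 3 / 4) else 0) \<in> borel_measurable borel" by measurable
  have "(\<integral>\<^sup>+t. ennreal (if t \<in> {0..1} then (t * (1 - t)) powr (- 3 / 4) else 0) \<partial>lborel) = ennreal (Beta (1/4) (1/4))"
    by (rule nn_integral_has_integral_lborel[OF m _ h]) auto
  moreover have "(\<integral>\<^sup>+t\<in>{0..1}. ennreal ((t * (1 - t)) powr (- 3 / 4)) \<partial>lborel) = (\<integral>\<^sup>+t. ennreal (if t \<in> {0..1} then (t * (1 - t)) powr (- 3 / 4) else 0) \<partial>lborel)"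
    by (intro nn_integral_cong) (auto simp: indicator_def)
  ultimately show ?thesis using b by auto
qed

text \<open>Points x and y are joined by the parabolas (1 - t) x + t y + t (1 - t) \<xi>, and the
  length is averaged over \<xi> in a small disc: a single curve may run through large values of the
  factor, but their mean over the family is controlled by an area integral. The constant c only
  multiplies lengths by exp c, so D does not depend on it.\<close>

lemma conf_diam_bound:
  assumes r: "0 < r" "r < \<rho>" "\<rho> \<le> 1" and K: "K \<ge> 0"
  shows "\<exists>D\<ge>0. \<forall>w c. Ck_on 2 (disc 1) w \<longrightarrow> (\<integral>\<^sup>+z\<in>disc \<rho>. ennreal (exp (3 * \<bar>w z\<bar>)) \<partial>lborel) \<le> ennreal K \<longrightarrow>
    conf_diam (\<lambda>z. w z + c) (disc r) \<le> ennreal (exp c * D)"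
proof -
  obtain b where b: "b \<ge> 0" "(\<integral>\<^sup>+t\<in>{0..1}. ennreal ((t * (1 - t)) powr (- 3 / 4)) \<partial>lborel) = ennreal b"
    using nn_integral_beta_weight by blast
  define \<kappa> where "\<kappa> = \<rho> - r"
  have \<kappa>: "\<kappa> > 0" "\<kappa> \<le> 1" using r by (auto simp: \<kappa>_def)
  \<comment> \<open>Bound for the total over the disc of parameters, divided by the area of that
    disc; the extra 1 makes the contradiction in the averaging argument strict. In D = 3 L the
    factor 3 bounds the Euclidean speed of the curves.\<close>
  define L where "L = (b * (pi + K) + 1) / (pi * \<kappa>\<^sup>2)"
  have L: "L \<ge> 0" using b K by (simp add: L_def)
  define D where "D = 3 * L"
  have main: "conf_dist (\<lambda>z. w z + c) x y \<le> ennreal (exp c * D)"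
    if w: "Ck_on 2 (disc 1) w" and wK: "(\<integral>\<^sup>+z\<in>disc \<rho>. ennreal (exp (3 * \<bar>w z\<bar>)) \<partial>lborel) \<le> ennreal K"
      and x: "x \<in> disc r" and y: "y \<in> disc r" for w c x y
  proof -
    note wd = Ck_on_2_D[OF w]
    define E where "E z = indicator (disc \<rho>) z *\<^sub>R exp (w z)" for z
    have E [measurable]: "E \<in> borel_measurable borel" unfolding E_def
      using r by (intro borel_measurable_indicator_disc) (auto intro!: continuous_intros wd)
    have E0: "E z \<ge> 0" for z by (simp add: E_def)
    define P where "P t = (1 - t) *\<^sub>R x + t *\<^sub>R y" for t
    define \<gamma> where "\<gamma> \<xi> t = P t + (t * (1 - t)) *\<^sub>R \<xi>" for \<xi> t
    have Pr: "norm (P t) < r" if "t \<in> {0..1}" for t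
    proof -
      have "(1 - t) *\<^sub>R x + t *\<^sub>R y \<in> disc r"
        using convexD_alt[OF convex_ball x y, of t] that by auto
      then show ?thesis by (simp add: P_def)
    qed
    \<comment> \<open>Because t (1 - t) \<le> 1, a parameter of size below \<rho> - r cannot push
      the curve out of the disc on which the exponential integral is bounded.\<close>
    have \<gamma>in: "\<gamma> \<xi> t \<in> disc \<rho>" if "\<xi> \<in> disc \<kappa>" "t \<in> {0..1}" for \<xi> t
    proof -
      have "t * (1 - t) \<le> 1" "0 \<le> t * (1 - t)" using that(2) mult_le_one[of t "1 - t"] by auto
      then have "norm ((t * (1 - t)) *\<^sub>R \<xi>) \<le> 1 * norm \<xi>"
        unfolding norm_scaleR by (intro mult_right_mono) simp_all
      then have "norm (\<gamma> \<xi> t) < r + \<kappa>"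
        using norm_triangle_ineq[of "P t" "(t * (1 - t)) *\<^sub>R \<xi>"] Pr[OF that(2)] that(1) by (simp add: \<gamma>_def)
      then show ?thesis by (simp add: \<kappa>_def)
    qed
    define g where "g \<xi> = (\<integral>\<^sup>+t\<in>{0..1}. ennreal (E (\<gamma> \<xi> t)) \<partial>lborel)" for \<xi>
    have gm [measurable]: "g \<in> borel_measurable borel"
      unfolding g_def \<gamma>_def P_def by measurable
    have [measurable]: "disc \<kappa> \<in> sets borel" by simp
    \<comment> \<open>For fixed t the map from \<xi> to the point of the curve is a dilation by t (1
      - t) about P t. Its Jacobian degenerates at both ends of the curve, and the cubic
      integrability has to compensate for that.\<close>
    have slice: "(\<integral>\<^sup>+\<xi>\<in>disc \<kappa>. ennreal (E (\<gamma> \<xi> t)) \<partial>lborel) \<le> ennreal ((t * (1 - t)) powr (- 3 / 4)) * ennreal (pi + K)"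
      if t: "0 < t" "t < 1" for t
    proof -
      define \<tau> where "\<tau> = t * (1 - t)"
      have \<tau>: "0 < \<tau>" "\<tau> \<le> 1" using t mult_le_one[of t "1 - t"] by (auto simp: \<tau>_def)
      \<comment> \<open>In the splitting e \<le> s + e^3 / s^2 the change of variables costs a factor 1 / \<tau>^2; with this s
        both terms are integrable in t.\<close>
      define s where "s = \<tau> powr (- 3 / 4)"
      have s: "s > 0" using \<tau> by (simp add: s_def)
      have s2: "1 / s\<^sup>2 * (1 / \<tau>\<^sup>2) \<le> s"
      proof -
        have "1 / s\<^sup>2 * (1 / \<tau>\<^sup>2) = \<tau> powr (3/2) * \<tau> powr (- 2)"
        proof -
          have "s\<^sup>2 = \<tau> powr (- 3 / 2)" unfolding s_def power2_eq_square by (simp flip: powr_add)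
          moreover have "\<tau>\<^sup>2 = \<tau> powr 2" using \<tau> by simp
          ultimately show ?thesis using \<tau> by (simp add: powr_minus_divide)
        qed
        also have "\<dots> = \<tau> powr (- 1 / 2)" by (simp flip: powr_add)
        also have "\<dots> \<le> s" unfolding s_def using \<tau> by (intro powr_mono') auto
        finally show ?thesis .
      qed
      have young: "e \<le> s + 1 / s\<^sup>2 * e ^ 3" if "e \<ge> 0" for e
      proof (cases "e \<le> s")
        case True
        then show ?thesis using s that by (simp add: add_increasing2)
      next
        case False
        then have "s\<^sup>2 \<le> e\<^sup>2" using s by (intro power_mono) auto
        then have "s\<^sup>2 * e \<le> e\<^sup>2 * e" using that by (rule mult_right_mono)
        then have "e \<le> 1 / s\<^sup>2 * e ^ 3" using s by (simp add: field_simps power2_eq_square power3_eq_cube)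
        then show ?thesis using s by linarith
      qed
      have "(\<integral>\<^sup>+\<xi>\<in>disc \<kappa>. ennreal (E (\<gamma> \<xi> t)) \<partial>lborel)
        \<le> (\<integral>\<^sup>+\<xi>. ennreal s * indicator (disc \<kappa>) \<xi> + ennreal (1 / s\<^sup>2) * ennreal (E (P t + \<tau> *\<^sub>R \<xi>) ^ 3) \<partial>lborel)"
      proof (rule nn_integral_mono)
        fix \<xi>
        have "ennreal (E (\<gamma> \<xi> t)) \<le> ennreal (s + 1 / s\<^sup>2 * E (\<gamma> \<xi> t) ^ 3)" by (intro ennreal_leI young E0)
        also have "\<dots> = ennreal s + ennreal (1 / s\<^sup>2) * ennreal (E (P t + \<tau> *\<^sub>R \<xi>) ^ 3)"
        proof -
          have p: "0 \<le> 1 / s\<^sup>2 * E (\<gamma> \<xi> t) ^ 3" using E0 by simp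
          have h: "0 \<le> 1 / s\<^sup>2" by simp
          have eq: "\<gamma> \<xi> t = P t + \<tau> *\<^sub>R \<xi>" by (simp add: \<gamma>_def \<tau>_def)
          show ?thesis unfolding ennreal_plus[OF less_imp_le[OF s] p] unfolding ennreal_mult'[OF h] eq ..
        qed
        finally show "ennreal (E (\<gamma> \<xi> t)) * indicator (disc \<kappa>) \<xi> \<le> ennreal s * indicator (disc \<kappa>) \<xi> + ennreal (1 / s\<^sup>2) * ennreal (E (P t + \<tau> *\<^sub>R \<xi>) ^ 3)"
          by (auto simp: indicator_def)
      qed
      also have "\<dots> = ennreal s * emeasure lborel (disc \<kappa>) + ennreal (1 / s\<^sup>2) * (\<integral>\<^sup>+\<xi>. ennreal (E (P t + \<tau> *\<^sub>R \<xi>) ^ 3) \<partial>lborel)"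
        by (subst nn_integral_add) (simp_all add: nn_integral_cmult nn_integral_cmult_indicator)
      also have "(\<integral>\<^sup>+\<xi>. ennreal (E (P t + \<tau> *\<^sub>R \<xi>) ^ 3) \<partial>lborel) = ennreal (1 / \<tau>\<^sup>2) * (\<integral>\<^sup>+z. ennreal (E z ^ 3) \<partial>lborel)"
        by (rule nn_integral_affine_complex) (use \<tau> in auto)
      also have "ennreal s * emeasure lborel (disc \<kappa>) + ennreal (1 / s\<^sup>2) * (ennreal (1 / \<tau>\<^sup>2) * (\<integral>\<^sup>+z. ennreal (E z ^ 3) \<partial>lborel))
        \<le> ennreal s * ennreal pi + ennreal s * ennreal K"
      proof (rule add_mono)
        have "pi * \<kappa>\<^sup>2 \<le> pi * 1" using \<kappa> by (intro mult_left_mono power_le_one) auto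
        then have "emeasure lborel (disc \<kappa>) \<le> ennreal pi" using \<kappa> by (simp add: emeasure_disc_complex ennreal_leI)
        then show "ennreal s * emeasure lborel (disc \<kappa>) \<le> ennreal s * ennreal pi" by (rule mult_left_mono) simp
        have "(\<integral>\<^sup>+z. ennreal (E z ^ 3) \<partial>lborel) \<le> (\<integral>\<^sup>+z\<in>disc \<rho>. ennreal (exp (3 * \<bar>w z\<bar>)) \<partial>lborel)"
        proof (rule nn_integral_mono)
          fix z
          have "exp (w z) ^ 3 = exp (3 * w z)" by (simp flip: exp_of_nat_mult)
          also have "\<dots> \<le> exp (3 * \<bar>w z\<bar>)" by simp
          finally show "ennreal (E z ^ 3) \<le> ennreal (exp (3 * \<bar>w z\<bar>)) * indicator (disc \<rho>) z"
            by (auto simp: E_def indicator_def intro!: ennreal_leI)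
        qed
        also have "\<dots> \<le> ennreal K" by (rule wK)
        finally have "(\<integral>\<^sup>+z. ennreal (E z ^ 3) \<partial>lborel) \<le> ennreal K" .
        then have "ennreal (1 / s\<^sup>2 * (1 / \<tau>\<^sup>2)) * (\<integral>\<^sup>+z. ennreal (E z ^ 3) \<partial>lborel) \<le> ennreal s * ennreal K"
          using s2 by (intro mult_mono ennreal_leI) auto
        moreover have "ennreal (1 / s\<^sup>2 * (1 / \<tau>\<^sup>2)) = ennreal (1 / s\<^sup>2) * ennreal (1 / \<tau>\<^sup>2)" by (rule ennreal_mult) auto
        ultimately show "ennreal (1 / s\<^sup>2) * (ennreal (1 / \<tau>\<^sup>2) * (\<integral>\<^sup>+z. ennreal (E z ^ 3) \<partial>lborel)) \<le> ennreal s * ennreal K"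
          by (simp add: mult.assoc)
      qed
      also have "\<dots> = ennreal s * ennreal (pi + K)" using K by (simp add: distrib_left)
      finally show ?thesis by (simp add: s_def \<tau>_def)
    qed
    have avg: "(\<integral>\<^sup>+\<xi>\<in>disc \<kappa>. g \<xi> \<partial>lborel) \<le> ennreal (b * (pi + K))"
    proof -
      have "(\<integral>\<^sup>+\<xi>\<in>disc \<kappa>. g \<xi> \<partial>lborel) = (\<integral>\<^sup>+\<xi>. (\<integral>\<^sup>+t. ennreal (E (\<gamma> \<xi> t)) * indicator {0..1} t * indicator (disc \<kappa>) \<xi> \<partial>lborel) \<partial>lborel)"
        unfolding g_def \<gamma>_def P_def by (intro nn_integral_cong nn_integral_multc[symmetric]) measurable
      also have "\<dots> = (\<integral>\<^sup>+t. (\<integral>\<^sup>+\<xi>. ennreal (E (\<gamma> \<xi> t)) * indicator {0..1} t * indicator (disc \<kappa>) \<xi> \<partial>lborel) \<partial>lborel)"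
        unfolding \<gamma>_def P_def by (rule lborel_pair.Fubini'[symmetric]) measurable
      also have "\<dots> \<le> (\<integral>\<^sup>+t. (ennreal ((t * (1 - t)) powr (- 3 / 4)) * indicator {0..1} t) * ennreal (pi + K) \<partial>lborel)"
      proof (rule nn_integral_mono_AE)
        \<comment> \<open>At the end points the dilation factor is 0 and no substitution is
          possible.\<close>
        have "AE t in lborel. t \<noteq> 0 \<and> t \<noteq> (1::real)"
          using AE_lborel_singleton[of "0::real"] AE_lborel_singleton[of "1::real"] by eventually_elim simp
        then show "AE t in lborel. (\<integral>\<^sup>+\<xi>. ennreal (E (\<gamma> \<xi> t)) * indicator {0..1} t * indicator (disc \<kappa>) \<xi> \<partial>lborel)
          \<le> (ennreal ((t * (1 - t)) powr (- 3 / 4)) * indicator {0..1} t) * ennreal (pi + K)"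
        proof eventually_elim
          fix t :: real assume t: "t \<noteq> 0 \<and> t \<noteq> 1"
          show "(\<integral>\<^sup>+\<xi>. ennreal (E (\<gamma> \<xi> t)) * indicator {0..1} t * indicator (disc \<kappa>) \<xi> \<partial>lborel)
            \<le> (ennreal ((t * (1 - t)) powr (- 3 / 4)) * indicator {0..1} t) * ennreal (pi + K)"
          proof (cases "t \<in> {0..1}")
            case True
            then have "0 < t" "t < 1" using t by auto
            from slice[OF this] show ?thesis using True by simp
          qed simp
        qed
      qed
      also have "\<dots> = (\<integral>\<^sup>+t\<in>{0..1}. ennreal ((t * (1 - t)) powr (- 3 / 4)) \<partial>lborel) * ennreal (pi + K)"
        by (rule nn_integral_multc) measurable
      also have "\<dots> = ennreal (b * (pi + K))"
        unfolding b(2) using b(1) K by (intro ennreal_mult[symmetric]) auto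
      finally show ?thesis .
    qed
    \<comment> \<open>If every curve were longer than L, the integral over the parameters would
      exceed its bound.\<close>
    have "\<exists>\<xi>\<in>disc \<kappa>. g \<xi> \<le> ennreal L"
    proof (rule ccontr)
      assume "\<not> ?thesis"
      then have gt: "ennreal L \<le> g \<xi>" if "\<xi> \<in> disc \<kappa>" for \<xi> using that by (meson linear)
      have "ennreal L * emeasure lborel (disc \<kappa>) = (\<integral>\<^sup>+\<xi>. ennreal L * indicator (disc \<kappa>) \<xi> \<partial>lborel)"
        by (rule nn_integral_cmult_indicator[symmetric]) simp
      also have "\<dots> \<le> (\<integral>\<^sup>+\<xi>\<in>disc \<kappa>. g \<xi> \<partial>lborel)"
        using gt by (intro nn_integral_mono) (simp add: indicator_def)
      also note avg
      also have "ennreal L * emeasure lborel (disc \<kappa>) = ennreal (b * (pi + K) + 1)"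
      proof -
        have "ennreal L * emeasure lborel (disc \<kappa>) = ennreal (L * (pi * \<kappa>\<^sup>2))"
          using L \<kappa> by (simp add: emeasure_disc_complex ennreal_mult)
        then show ?thesis using \<kappa> by (simp add: L_def)
      qed
      finally show False using b K by (subst (asm) ennreal_le_iff) auto
    qed
    then obtain \<xi> where \<xi>: "\<xi> \<in> disc \<kappa>" "g \<xi> \<le> ennreal L" by blast
    define \<gamma>' where "\<gamma>' t = (y - x) + (1 - 2 * t) *\<^sub>R \<xi>" for t
    have der: "(\<gamma> \<xi> has_vector_derivative \<gamma>' t) (at t)" for t
      unfolding \<gamma>_def[abs_def] P_def \<gamma>'_def by (auto intro!: derivative_eq_intros simp: algebra_simps)
    have vp: "valid_path (\<gamma> \<xi>)"
      unfolding valid_path_def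
    proof (rule C1_differentiable_imp_piecewise)
      show "\<gamma> \<xi> C1_differentiable_on {0..1}" unfolding C1_differentiable_on_def
        using der by (intro exI[of _ \<gamma>']) (auto simp: \<gamma>'_def intro!: continuous_intros)
    qed
    have pim: "path_image (\<gamma> \<xi>) \<subseteq> disc 1"
    proof -
      have "disc \<rho> \<subseteq> disc 1" using r by (intro subset_ball)
      then show ?thesis unfolding path_image_def using \<gamma>in[OF \<xi>(1)] by blast
    qed
    have st: "pathstart (\<gamma> \<xi>) = x" "pathfinish (\<gamma> \<xi>) = y" by (simp_all add: pathstart_def pathfinish_def \<gamma>_def P_def)
    have g': "norm (\<gamma>' t) \<le> 3" if "t \<in> {0..1}" for t
    proof -
      have "norm (y - x) \<le> 2" using norm_triangle_ineq4[of y x] x y r by simp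
      moreover have "norm ((1 - 2 * t) *\<^sub>R \<xi>) \<le> 1 * 1"
        unfolding norm_scaleR using that \<xi>(1) \<kappa> by (intro mult_mono) auto
      ultimately show ?thesis unfolding \<gamma>'_def using norm_triangle_ineq[of "y - x" "(1 - 2 * t) *\<^sub>R \<xi>"] by linarith
    qed
    have "glength (conf (\<lambda>z. w z + c)) (\<gamma> \<xi>) \<le> (\<integral>\<^sup>+t. ennreal (3 * exp c) * (ennreal (E (\<gamma> \<xi> t)) * indicator {0..1} t) \<partial>lborel)"
      unfolding glength_def
    proof (rule nn_integral_mono)
      fix t
      show "ennreal (sqrt (conf (\<lambda>z. w z + c) (\<gamma> \<xi> t) (vector_derivative (\<gamma> \<xi>) (at t)) (vector_derivative (\<gamma> \<xi>) (at t)))) * indicator {0..1} t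
        \<le> ennreal (3 * exp c) * (ennreal (E (\<gamma> \<xi> t)) * indicator {0..1} t)"
      proof (cases "t \<in> {0..1}")
        case True
        have vd: "vector_derivative (\<gamma> \<xi>) (at t) = \<gamma>' t" using der by (rule vector_derivative_at)
        have "sqrt (conf (\<lambda>z. w z + c) (\<gamma> \<xi> t) (\<gamma>' t) (\<gamma>' t)) = exp (w (\<gamma> \<xi> t) + c) * norm (\<gamma>' t)"
        proof -
          have "conf (\<lambda>z. w z + c) (\<gamma> \<xi> t) (\<gamma>' t) (\<gamma>' t) = (exp (w (\<gamma> \<xi> t) + c) * norm (\<gamma>' t))\<^sup>2"
            by (simp add: conf_def power_mult_distrib power2_norm_eq_inner flip: exp_double)
          then show ?thesis by simp
        qed
        also have "\<dots> \<le> exp (w (\<gamma> \<xi> t) + c) * 3" by (intro mult_left_mono g'[OF True]) simp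
        also have "\<dots> = (3 * exp c) * E (\<gamma> \<xi> t)" using \<gamma>in[OF \<xi>(1) True] by (simp add: E_def exp_add)
        finally have "ennreal (sqrt (conf (\<lambda>z. w z + c) (\<gamma> \<xi> t) (\<gamma>' t) (\<gamma>' t))) \<le> ennreal ((3 * exp c) * E (\<gamma> \<xi> t))" by (rule ennreal_leI)
        also have "\<dots> = ennreal (3 * exp c) * ennreal (E (\<gamma> \<xi> t))" using E0 by (intro ennreal_mult) auto
        finally show ?thesis using True vd by simp
      qed simp
    qed
    also have "\<dots> = ennreal (3 * exp c) * g \<xi>"
      unfolding g_def \<gamma>_def P_def by (rule nn_integral_cmult) measurable
    also have "\<dots> \<le> ennreal (3 * exp c) * ennreal L" by (intro mult_left_mono \<xi>) simp
    also have "\<dots> = ennreal (3 * exp c * L)" using L by (intro ennreal_mult[symmetric]) auto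
    also have "3 * exp c * L = exp c * D" by (simp add: D_def)
    finally have len: "glength (conf (\<lambda>z. w z + c)) (\<gamma> \<xi>) \<le> ennreal (exp c * D)" .
    have "conf_dist (\<lambda>z. w z + c) x y \<le> glength (conf (\<lambda>z. w z + c)) (\<gamma> \<xi>)"
      unfolding conf_dist_def by (rule Inf_lower) (use vp pim st in blast)
    then show ?thesis using len by (rule order_trans)
  qed
  have "conf_diam (\<lambda>z. w z + c) (disc r) \<le> ennreal (exp c * D)"
    if "Ck_on 2 (disc 1) w" "(\<integral>\<^sup>+z\<in>disc \<rho>. ennreal (exp (3 * \<bar>w z\<bar>)) \<partial>lborel) \<le> ennreal K" for w c
    unfolding conf_diam_def by (intro SUP_least main that)
  moreover have "D \<ge> 0" using L by (simp add: D_def)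
  ultimately show ?thesis by blast
qed

subsection \<open>Limits along the subsequence\<close>

text \<open>The mean is taken over the fixed disc of radius 1/2, so that the subtracted constant
  does not change with R. Poincare on the disc of radius R gives 8 for the deviation from its own
  mean; passing to the mean over the half disc costs at most 4 times as much again, since the ratio
  of the areas is at most 4. Hence 40 = 8 (1 + 4).\<close>

lemma L1_bound_minus_mean:
  fixes f :: "complex \<Rightarrow> real"
  assumes f: "Ck_on 2 (disc 1) f" and R: "1/2 \<le> R" "R < 1"
  defines "c \<equiv> (LBINT z:disc (1/2). f z) / (pi / 4)"
  shows "(\<integral>\<^sup>+z\<in>disc R. ennreal \<bar>f z - c\<bar> \<partial>lborel) \<le> ennreal 40 * (\<integral>\<^sup>+z\<in>disc R. ennreal (norm (grad f z)) \<partial>lborel)"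
proof -
  define n where "n = pi * R\<^sup>2"
  have n: "n > 0" "n \<le> pi" using R by (auto simp: n_def power_le_one)
  define cR where "cR = (LBINT z:disc R. f z) / n"
  define h where "h z = f z - cR" for z
  have kC: "Ck_on 2 (disc 1) (\<lambda>_. cR)" by (rule Ck_on_const)
  have hC: "Ck_on 2 (disc 1) h" unfolding h_def by (rule Ck_on_diff[OF open_ball f kC])
  have gh: "grad h z = grad f z" if "z \<in> disc 1" for z
  proof -
    have "grad (\<lambda>_. cR) z = 0" by (simp add: grad_def pderiv_dir_def frechet_derivative_const Complex_eq_0)
    then show ?thesis unfolding h_def using grad_diff[OF open_ball that f kC] by simp
  qed
  have dm: "disc R \<in> sets borel" "disc (1/2) \<in> sets borel" by simp_all
  note [measurable] = dm(1)
  have s12: "disc (1/2) \<subseteq> disc R" using R by (intro subset_ball) simp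
  have mR: "measure lborel (disc R) = n" "measure lborel (disc (1/2)) = pi / 4"
    using R emeasure_disc_complex[of R 0] emeasure_disc_complex[of "1/2" 0] by (simp_all add: measure_def n_def power2_eq_square)
  have ic: "set_integrable lborel A (\<lambda>_. cR)" "(LBINT z:A. cR) = measure lborel A * cR" if "A \<in> sets borel" "A \<subseteq> disc R" for A
  proof -
    have "emeasure lborel A < \<infinity>"
      using emeasure_mono[OF that(2), of lborel] emeasure_lborel_ball_finite[of "0::complex" R] by (auto intro: le_less_trans)
    then show "set_integrable lborel A (\<lambda>_. cR)" "(LBINT z:A. cR) = measure lborel A * cR"
      using that(1) by (simp_all add: set_integrable_def set_lebesgue_integral_def integrable_indicator_iff)
  qed
  have mean: "(LBINT z:A. h z) = (LBINT z:A. f z) - measure lborel A * cR" if "A \<in> sets borel" "A \<subseteq> disc R" for A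
    unfolding h_def using set_integral_diff(2)[OF set_integral_bounds(1)[OF f R(2) that(2,1)] ic(1)[OF that]] ic(2)[OF that] by simp
  have "(LBINT z:disc R. h z) = 0" using mean[OF dm(1)] n by (simp add: mR cR_def)
  moreover have "(\<integral>\<^sup>+z\<in>disc R. ennreal \<bar>h z\<bar> \<partial>lborel) \<le> ennreal \<bar>LBINT z:disc R. h z\<bar> + ennreal (4 * 2) * (\<integral>\<^sup>+z\<in>disc R. ennreal (norm (grad h z)) \<partial>lborel)"
  proof (rule L1_bound_by_mean[OF hC R(2) order_refl convex_ball dm(1)])
    fix x y :: complex assume "x \<in> disc R" "y \<in> disc R"
    then show "norm (x - y) \<le> 2" using norm_triangle_ineq4[of x y] R by simp
  qed
  ultimately have "(\<integral>\<^sup>+z\<in>disc R. ennreal \<bar>h z\<bar> \<partial>lborel) \<le> ennreal 8 * (\<integral>\<^sup>+z\<in>disc R. ennreal (norm (grad h z)) \<partial>lborel)" by simp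
  also have "(\<integral>\<^sup>+z\<in>disc R. ennreal (norm (grad h z)) \<partial>lborel) = (\<integral>\<^sup>+z\<in>disc R. ennreal (norm (grad f z)) \<partial>lborel)"
    using R by (intro nn_integral_cong) (auto simp: indicator_def gh)
  finally have H: "(\<integral>\<^sup>+z\<in>disc R. ennreal \<bar>h z\<bar> \<partial>lborel) \<le> ennreal 8 * (\<integral>\<^sup>+z\<in>disc R. ennreal (norm (grad f z)) \<partial>lborel)" .
  let ?H = "\<integral>\<^sup>+z\<in>disc R. ennreal \<bar>h z\<bar> \<partial>lborel"
  have "(LBINT z:disc (1/2). h z) = pi / 4 * (c - cR)"
    using mean[OF dm(2) s12] by (simp add: mR c_def algebra_simps)
  then have e: "\<bar>LBINT z:disc (1/2). h z\<bar> = pi / 4 * \<bar>c - cR\<bar>" by (simp only: abs_mult) simp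
  have "ennreal (pi / 4 * \<bar>c - cR\<bar>) \<le> ?H"
    using set_integral_bounds(2)[OF hC R(2) s12 dm(2)] unfolding e .
  then have cc: "ennreal (n * \<bar>c - cR\<bar>) \<le> ennreal 4 * ?H"
  proof -
    assume a: "ennreal (pi / 4 * \<bar>c - cR\<bar>) \<le> ?H"
    have "n * \<bar>c - cR\<bar> \<le> 4 * (pi / 4 * \<bar>c - cR\<bar>)" using n by (simp add: mult_right_mono)
    then have "ennreal (n * \<bar>c - cR\<bar>) \<le> ennreal (4 * (pi / 4 * \<bar>c - cR\<bar>))" by (rule ennreal_leI)
    also have "\<dots> = ennreal 4 * ennreal (pi / 4 * \<bar>c - cR\<bar>)" by (rule ennreal_mult) auto
    also have "\<dots> \<le> ennreal 4 * ?H" using a by (rule mult_left_mono) simp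
    finally show ?thesis .
  qed
  have [measurable]: "(\<lambda>z. ennreal \<bar>h z\<bar> * indicator (disc R) z) \<in> borel_measurable lborel"
  proof -
    have [measurable]: "(\<lambda>z. indicator (disc R) z *\<^sub>R h z) \<in> borel_measurable borel"
      using R by (intro borel_measurable_indicator_disc Ck_on_2_D(3)[OF hC]) auto
    have "(\<lambda>z. ennreal \<bar>indicator (disc R) z *\<^sub>R h z\<bar>) \<in> borel_measurable lborel" by measurable
    also have "(\<lambda>z. ennreal \<bar>indicator (disc R) z *\<^sub>R h z\<bar>) = (\<lambda>z. ennreal \<bar>h z\<bar> * indicator (disc R) z)"
      by (auto simp: indicator_def fun_eq_iff)
    finally show ?thesis .
  qed
  have "(\<integral>\<^sup>+z\<in>disc R. ennreal \<bar>f z - c\<bar> \<partial>lborel) \<le> (\<integral>\<^sup>+z. ennreal \<bar>h z\<bar> * indicator (disc R) z + ennreal \<bar>c - cR\<bar> * indicator (disc R) z \<partial>lborel)"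
  proof (rule nn_integral_mono)
    fix z
    have "\<bar>f z - c\<bar> \<le> \<bar>h z\<bar> + \<bar>c - cR\<bar>" by (simp add: h_def)
    then have "ennreal \<bar>f z - c\<bar> \<le> ennreal (\<bar>h z\<bar> + \<bar>c - cR\<bar>)" by (rule ennreal_leI)
    then show "ennreal \<bar>f z - c\<bar> * indicator (disc R) z \<le> ennreal \<bar>h z\<bar> * indicator (disc R) z + ennreal \<bar>c - cR\<bar> * indicator (disc R) z"
      by (simp add: indicator_def)
  qed
  also have "\<dots> = ?H + ennreal \<bar>c - cR\<bar> * emeasure lborel (disc R)"
    by (subst nn_integral_add) (simp_all add: nn_integral_cmult_indicator)
  also have "ennreal \<bar>c - cR\<bar> * emeasure lborel (disc R) = ennreal (n * \<bar>c - cR\<bar>)"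
    using R by (simp add: emeasure_disc_complex n_def mult.commute flip: ennreal_mult)
  also have "?H + ennreal (n * \<bar>c - cR\<bar>) \<le> ?H + ennreal 4 * ?H" by (intro add_left_mono cc)
  also have "\<dots> = ennreal 5 * ?H"
  proof -
    have "ennreal 5 = 1 + ennreal 4" by simp
    then show ?thesis by (simp only: distrib_right mult_1)
  qed
  also have "\<dots> \<le> ennreal 5 * (ennreal 8 * (\<integral>\<^sup>+z\<in>disc R. ennreal (norm (grad f z)) \<partial>lborel))" by (intro mult_left_mono H) simp
  also have "\<dots> = ennreal 40 * (\<integral>\<^sup>+z\<in>disc R. ennreal (norm (grad f z)) \<partial>lborel)"
  proof -
    have "ennreal 5 * ennreal 8 = ennreal 40" by simp
    then show ?thesis by (simp only: mult.assoc[symmetric])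
  qed
  finally show ?thesis .
qed

lemma cube_le_exp: "0 \<le> t \<Longrightarrow> t powr 3 \<le> 27 * exp (t :: real)"
proof -
  assume t: "0 \<le> t"
  have "t / 3 \<le> exp (t / 3)" using exp_ge_add_one_self[of "t / 3"] by linarith
  then have "(t / 3) ^ 3 \<le> exp (t / 3) ^ 3" using t by (intro power_mono) auto
  also have "\<dots> = exp t" by (simp flip: exp_of_nat_mult)
  finally show ?thesis using t by (simp add: powr_numeral power_divide)
qed

text \<open>Functions are bounded in L^3 and gradients in L^s with s = (p + 2) / 2 strictly between
  p and 2, so L^1 convergence upgrades to L^p for both. The convergent shift d allows the same lemma
  to be used with and without restoring the means.\<close>

lemma W1p_limit_exists:
  fixes w :: "nat \<Rightarrow> complex \<Rightarrow> real"
  assumes r: "0 < r" "r < 1" and p: "1 < p" "p < 2" and w: "\<And>k. Ck_on 2 (disc 1) (w k)"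
    and L1: "\<And>e. e > 0 \<Longrightarrow> \<exists>N. \<forall>i\<ge>N. \<forall>j\<ge>N. (\<integral>\<^sup>+z\<in>disc r. ennreal \<bar>w i z - w j z\<bar> \<partial>lborel) \<le> ennreal e"
    and G1: "\<And>e. e > 0 \<Longrightarrow> \<exists>N. \<forall>i\<ge>N. \<forall>j\<ge>N. (\<integral>\<^sup>+z\<in>disc r. ennreal (norm (grad (w i) z - grad (w j) z)) \<partial>lborel) \<le> ennreal e"
    and E: "K \<ge> 0" "\<And>k. (\<integral>\<^sup>+z\<in>disc r. ennreal (exp (3 * \<bar>w k z\<bar>)) \<partial>lborel) \<le> ennreal K"
    and S: "\<And>k. (\<integral>\<^sup>+z\<in>disc r. ennreal (norm (grad (w k) z) powr ((p + 2) / 2)) \<partial>lborel) \<le> ennreal S"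
    and d: "convergent d"
  shows "\<exists>v. W1p_converges_weakly p (disc r) (\<lambda>k z. w k z + d k) v"
proof -
  let ?M = "lebesgue_on (disc r)"
  note wd = Ck_on_2_D[OF w]
  have r1: "r \<le> 1" using r by simp
  have gc: "continuous_on (disc 1) (grad (w k))" for k by (intro continuous_on_grad wd)
  obtain B where B: "B \<ge> 0" "\<And>k. \<bar>d k\<bar> \<le> B"
  proof -
    obtain B where "\<forall>x\<in>range d. norm x \<le> B" using cauchy_imp_bounded[OF convergent_Cauchy[OF d]] bounded_iff by metis
    then have "\<bar>d k\<bar> \<le> max B 0" for k by (auto simp: le_max_iff_disj)
    then show ?thesis using that[of "max B 0"] by simp
  qed
  define f where "f k z = w k z + d k" for k z
  have fC: "Ck_on 2 (disc 1) (f k)" for k unfolding f_def by (intro Ck_on_add w Ck_on_const open_ball)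
  have gf: "grad (f k) z = grad (w k) z" if "z \<in> disc 1" for k z
  proof -
    have "pderiv_dir v (f k) z = pderiv_dir v (w k) z + pderiv_dir v (\<lambda>_. d k) z" for v
      unfolding f_def by (intro pderiv_dir_add wd that) simp
    then show ?thesis by (simp add: grad_def pderiv_dir_def[of _ "\<lambda>_. d k"] frechet_derivative_const)
  qed
  have fm [measurable]: "f k \<in> borel_measurable ?M" "grad (w k) \<in> borel_measurable ?M" "w k \<in> borel_measurable ?M" for k
    by (rule continuous_on_imp_measurable_disc[OF _ r1]; use Ck_on_2_D(3)[OF fC] gc wd(3) in simp)+
  \<comment> \<open>The third power is dominated by 27 times the exponential, and the bounded shift
    by the factor exp B.\<close>
  have fs: "(\<integral>\<^sup>+z. ennreal (norm (f k z) powr 3) \<partial>?M) \<le> ennreal (27 * exp B * K)" for k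
  proof -
    have "(\<integral>\<^sup>+z. ennreal (norm (f k z) powr 3) \<partial>?M) \<le> (\<integral>\<^sup>+z. ennreal (27 * exp B) * ennreal (exp (3 * \<bar>w k z\<bar>)) \<partial>?M)"
    proof (rule nn_integral_mono)
      fix z
      have "norm (f k z) powr 3 \<le> 27 * exp \<bar>f k z\<bar>" using cube_le_exp[of "\<bar>f k z\<bar>"] by simp
      also have "\<dots> \<le> 27 * exp (B + 3 * \<bar>w k z\<bar>)" using B(2)[of k] by (auto simp: f_def)
      finally show "ennreal (norm (f k z) powr 3) \<le> ennreal (27 * exp B) * ennreal (exp (3 * \<bar>w k z\<bar>))"
        by (simp add: ennreal_leI exp_add flip: ennreal_mult)
    qed
    also have "\<dots> = ennreal (27 * exp B) * (\<integral>\<^sup>+z. ennreal (exp (3 * \<bar>w k z\<bar>)) \<partial>?M)" by (rule nn_integral_cmult) measurable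
    also have "\<dots> \<le> ennreal (27 * exp B) * ennreal K" using E(2)[of k] by (intro mult_left_mono) (simp_all add: nn_integral_lebesgue_on_disc)
    also have "\<dots> = ennreal (27 * exp B * K)" using E(1) by (intro ennreal_mult[symmetric]) auto
    finally show ?thesis .
  qed
  have fcau: "\<exists>N. \<forall>i\<ge>N. \<forall>j\<ge>N. (\<integral>\<^sup>+z. ennreal (norm (f i z - f j z)) \<partial>?M) \<le> ennreal e" if e: "e > 0" for e
  proof -
    obtain N1 where N1: "\<forall>i\<ge>N1. \<forall>j\<ge>N1. (\<integral>\<^sup>+z\<in>disc r. ennreal \<bar>w i z - w j z\<bar> \<partial>lborel) \<le> ennreal (e / 2)"
      using L1[of "e / 2"] e by auto
    have "Cauchy d" using d Cauchy_convergent_iff by blast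
    moreover have "e / 8 > 0" using e by simp
    ultimately obtain N2 where N2: "\<forall>i\<ge>N2. \<forall>j\<ge>N2. \<bar>d i - d j\<bar> < e / 8" unfolding Cauchy_def dist_real_def by blast
    have "(\<integral>\<^sup>+z. ennreal (norm (f i z - f j z)) \<partial>?M) \<le> ennreal e" if ij: "i \<ge> max N1 N2" "j \<ge> max N1 N2" for i j
    proof -
      have "(\<integral>\<^sup>+z. ennreal (norm (f i z - f j z)) \<partial>?M) \<le> (\<integral>\<^sup>+z. ennreal \<bar>w i z - w j z\<bar> + ennreal (e / 8) \<partial>?M)"
      proof (rule nn_integral_mono)
        fix z
        have "norm (f i z - f j z) \<le> \<bar>w i z - w j z\<bar> + e / 8"
        proof -
          have "\<bar>d i - d j\<bar> < e / 8" using N2 ij by simp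
          then show ?thesis unfolding f_def real_norm_def by linarith
        qed
        then have "ennreal (norm (f i z - f j z)) \<le> ennreal (\<bar>w i z - w j z\<bar> + e / 8)" by (rule ennreal_leI)
        then show "ennreal (norm (f i z - f j z)) \<le> ennreal \<bar>w i z - w j z\<bar> + ennreal (e / 8)" using e by simp
      qed
      also have "\<dots> = (\<integral>\<^sup>+z. ennreal \<bar>w i z - w j z\<bar> \<partial>?M) + ennreal (e / 8) * emeasure ?M (space ?M)"
        by (subst nn_integral_add) simp_all
      \<comment> \<open>The area of the disc is below 4, so the shifts, which differ by less than e
        / 8, contribute at most e / 2.\<close>
      also have "\<dots> \<le> ennreal (e / 2) + ennreal (e / 8) * ennreal 4"
      proof (intro add_mono mult_left_mono)
        show "(\<integral>\<^sup>+z. ennreal \<bar>w i z - w j z\<bar> \<partial>?M) \<le> ennreal (e / 2)"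
          using N1 ij by (simp add: nn_integral_lebesgue_on_disc)
        have "pi * r\<^sup>2 \<le> 4 * 1" using r pi_less_4 by (intro mult_mono power_le_one) auto
        then have "ennreal (pi * r\<^sup>2) \<le> ennreal 4" by (intro ennreal_leI) simp
        then show "emeasure ?M (space ?M) \<le> ennreal 4"
          using r disc_sets_lebesgue by (simp add: emeasure_restrict_space space_restrict_space emeasure_disc_complex del: ennreal_numeral)
      qed auto
      also have "\<dots> = ennreal e" using e by (simp flip: ennreal_mult ennreal_plus del: ennreal_numeral)
      finally show ?thesis .
    qed
    then show ?thesis by blast
  qed
  obtain F where F: "F \<in> borel_measurable ?M" "\<And>q. 0 < q \<Longrightarrow> q < 3 \<Longrightarrow> (\<lambda>k. \<integral>\<^sup>+z. ennreal (norm (f k z - F z) powr q) \<partial>?M) \<longlonglongrightarrow> 0"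
  proof (rule L1_Cauchy_imp_Lq_limit[OF fm(1) emeasure_lebesgue_on_disc _ fs fcau])
    fix H assume "H \<in> borel_measurable ?M" "\<And>q. 0 < q \<Longrightarrow> q < 3 \<Longrightarrow> (\<lambda>k. \<integral>\<^sup>+z. ennreal (norm (f k z - H z) powr q) \<partial>?M) \<longlonglongrightarrow> 0"
    then show thesis by (rule that)
  qed simp_all
  define s where "s = (p + 2) / 2"
  have s: "1 < s" "p < s" using p by (auto simp: s_def)
  have gs: "(\<integral>\<^sup>+z. ennreal (norm (grad (w k) z) powr s) \<partial>?M) \<le> ennreal S" for k
    using S[of k] by (simp add: nn_integral_lebesgue_on_disc s_def)
  have gcau: "\<exists>N. \<forall>i\<ge>N. \<forall>j\<ge>N. (\<integral>\<^sup>+z. ennreal (norm (grad (w i) z - grad (w j) z)) \<partial>?M) \<le> ennreal e" if "e > 0" for e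
    using G1[OF that] by (simp add: nn_integral_lebesgue_on_disc)
  obtain G where G: "G \<in> borel_measurable ?M" "\<And>q. 0 < q \<Longrightarrow> q < s \<Longrightarrow> (\<lambda>k. \<integral>\<^sup>+z. ennreal (norm (grad (w k) z - G z) powr q) \<partial>?M) \<longlonglongrightarrow> 0"
  proof (rule L1_Cauchy_imp_Lq_limit[OF fm(2) emeasure_lebesgue_on_disc s(1) gs gcau])
    fix H assume "H \<in> borel_measurable ?M" "\<And>q. 0 < q \<Longrightarrow> q < s \<Longrightarrow> (\<lambda>k. \<integral>\<^sup>+z. ennreal (norm (grad (w k) z - H z) powr q) \<partial>?M) \<longlonglongrightarrow> 0"
    then show thesis by (rule that)
  qed simp_all
  have "W1p_converges_weakly p (disc r) f F"
  proof (rule strong_imp_W1p_converges_weakly[OF r(2) p(1) fC F(1) G(1)])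
    fix q assume "q \<in> {1, p}"
    then have q: "0 < q" "q < 3" "q < s" using p s by auto
    show "(\<lambda>k. \<integral>\<^sup>+z. ennreal (norm (f k z - F z) powr q) \<partial>?M) \<longlonglongrightarrow> 0" by (rule F(2)[OF q(1,2)])
    have "(\<integral>\<^sup>+z. ennreal (norm (grad (f k) z - G z) powr q) \<partial>?M) = (\<integral>\<^sup>+z. ennreal (norm (grad (w k) z - G z) powr q) \<partial>?M)" for k
      using r by (intro nn_integral_cong) (simp add: gf space_restrict_space)
    then show "(\<lambda>k. \<integral>\<^sup>+z. ennreal (norm (grad (f k) z - G z) powr q) \<partial>?M) \<longlonglongrightarrow> 0" using G(2)[OF q(1,3)] by simp
  qed
  then show ?thesis unfolding f_def[abs_def] by blast
qed

text \<open>If the larger argument is at most M, exp is Lipschitz with constant exp M; otherwise the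
  larger exponential is at most exp (-2 M) times its own cube. A bound on third exponential moments
  therefore makes the second term small uniformly in the sequence, after which L^1 convergence
  handles the first.\<close>

lemma exp_diff_le:
  fixes a b :: real
  assumes "M \<ge> 0"
  shows "\<bar>exp a - exp b\<bar> \<le> exp M * \<bar>a - b\<bar> + exp (- 2 * M) * (exp (3 * \<bar>a\<bar>) + exp (3 * \<bar>b\<bar>))"
proof -
  have *: "\<bar>exp a - exp b\<bar> \<le> exp M * \<bar>a - b\<bar> + exp (- 2 * M) * (exp (3 * \<bar>a\<bar>) + exp (3 * \<bar>b\<bar>))" if ab: "a \<le> b" for a b :: real
  proof (cases "b \<le> M")
    case True
    have "exp b * (1 + (a - b)) \<le> exp b * exp (a - b)" by (intro mult_left_mono exp_ge_add_one_self) simp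
    then have "exp b - exp a \<le> exp b * (b - a)" by (simp add: algebra_simps flip: exp_add)
    also have "\<dots> \<le> exp M * (b - a)" using True ab by (intro mult_right_mono) auto
    finally have "\<bar>exp a - exp b\<bar> \<le> exp M * \<bar>a - b\<bar>" using ab by simp
    moreover have "0 \<le> exp (- 2 * M) * (exp (3 * \<bar>a\<bar>) + exp (3 * \<bar>b\<bar>))" by (simp add: add_nonneg_nonneg)
    ultimately show ?thesis by linarith
  next
    case False
    have "\<bar>exp a - exp b\<bar> \<le> exp b" using ab by simp
    also have "\<dots> \<le> exp (- 2 * M + 3 * \<bar>b\<bar>)" using False by simp
    also have "\<dots> = exp (- 2 * M) * exp (3 * \<bar>b\<bar>)" by (rule exp_add)
    also have "\<dots> \<le> exp (- 2 * M) * (exp (3 * \<bar>a\<bar>) + exp (3 * \<bar>b\<bar>))" by (intro mult_left_mono) auto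
    also have "\<dots> \<le> exp M * \<bar>a - b\<bar> + exp (- 2 * M) * (exp (3 * \<bar>a\<bar>) + exp (3 * \<bar>b\<bar>))" by simp
    finally show ?thesis .
  qed
  show ?thesis
  proof (cases "a \<le> b")
    case True
    then show ?thesis by (rule *)
  next
    case False
    then show ?thesis using *[of b a] by (simp add: abs_minus_commute add.commute)
  qed
qed

text \<open>The products are Cauchy in L^1 by \<open>exp_diff_le\<close> and bounded in L^s by the
  exponential moment of order s, which together give convergence for every q < s. The factor b
  stands for exp c_k and may tend to 0.\<close>

lemma Lp_converges_exp:
  fixes w :: "nat \<Rightarrow> complex \<Rightarrow> real" and b :: "nat \<Rightarrow> real"
  assumes r: "0 < r" "r < 1" and w: "\<And>k. continuous_on (disc 1) (w k)"
    and L1: "\<And>e. e > 0 \<Longrightarrow> \<exists>N. \<forall>i\<ge>N. \<forall>j\<ge>N. (\<integral>\<^sup>+z\<in>disc r. ennreal \<bar>w i z - w j z\<bar> \<partial>lborel) \<le> ennreal e"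
    and E: "K \<ge> 0" "\<And>k. (\<integral>\<^sup>+z\<in>disc r. ennreal (exp (3 * \<bar>w k z\<bar>)) \<partial>lborel) \<le> ennreal K"
    and s: "1 < s" and Es: "Ks \<ge> 0" "\<And>k. (\<integral>\<^sup>+z\<in>disc r. ennreal (exp (s * \<bar>w k z\<bar>)) \<partial>lborel) \<le> ennreal Ks"
    and q: "0 < q" "q < s" and b: "convergent b" "\<And>k. b k \<ge> 0"
  shows "\<exists>F. Lp_converges q (disc r) (\<lambda>k z. b k * exp (w k z)) F"
proof -
  let ?M = "lebesgue_on (disc r)"
  have r1: "r \<le> 1" using r by simp
  obtain B where B: "B > 0" "\<And>k. b k \<le> B"
  proof -
    obtain B where "\<forall>x\<in>range b. norm x \<le> B" using cauchy_imp_bounded[OF convergent_Cauchy[OF b(1)]] bounded_iff by metis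
    then have "\<bar>b k\<bar> \<le> B" for k by auto
    then have "b k \<le> \<bar>B\<bar> + 1" for k by (smt (verit))
    then show ?thesis using that[of "\<bar>B\<bar> + 1"] by simp
  qed
  define f where "f k z = b k * exp (w k z)" for k z
  have wm [measurable]: "w k \<in> borel_measurable ?M" for k by (rule continuous_on_imp_measurable_disc[OF w r1])
  have fm [measurable]: "f k \<in> borel_measurable ?M" for k unfolding f_def by measurable
  have fs: "(\<integral>\<^sup>+z. ennreal (norm (f k z) powr s) \<partial>?M) \<le> ennreal (B powr s * Ks)" for k
  proof -
    have "(\<integral>\<^sup>+z. ennreal (norm (f k z) powr s) \<partial>?M) \<le> (\<integral>\<^sup>+z. ennreal (B powr s) * ennreal (exp (s * \<bar>w k z\<bar>)) \<partial>?M)"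
    proof (rule nn_integral_mono)
      fix z
      have "norm (f k z) powr s \<le> (B * exp \<bar>w k z\<bar>) powr s"
        using b(2)[of k] B s by (intro powr_mono2) (auto simp: f_def abs_mult intro!: mult_mono)
      also have "\<dots> = B powr s * exp (s * \<bar>w k z\<bar>)" using B by (simp add: powr_mult exp_powr_real mult.commute)
      finally show "ennreal (norm (f k z) powr s) \<le> ennreal (B powr s) * ennreal (exp (s * \<bar>w k z\<bar>))"
        by (simp add: ennreal_leI flip: ennreal_mult)
    qed
    also have "\<dots> = ennreal (B powr s) * (\<integral>\<^sup>+z. ennreal (exp (s * \<bar>w k z\<bar>)) \<partial>?M)" by (rule nn_integral_cmult) measurable
    also have "\<dots> \<le> ennreal (B powr s) * ennreal Ks" using Es(2)[of k] by (intro mult_left_mono) (simp_all add: nn_integral_lebesgue_on_disc)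
    also have "\<dots> = ennreal (B powr s * Ks)" using Es(1) by (intro ennreal_mult[symmetric]) auto
    finally show ?thesis .
  qed
  have E': "(\<integral>\<^sup>+z. ennreal (exp (3 * \<bar>w k z\<bar>)) \<partial>?M) \<le> ennreal K" for k using E(2)[of k] by (simp add: nn_integral_lebesgue_on_disc)
  have fcau: "\<exists>N. \<forall>i\<ge>N. \<forall>j\<ge>N. (\<integral>\<^sup>+z. ennreal (norm (f i z - f j z)) \<partial>?M) \<le> ennreal e" if e: "e > 0" for e
  proof -
    \<comment> \<open>\<open>\<theta>\<close> is the desired value of exp (-2 M); the minimum with 1
      keeps M non-negative. The truncation height M is fixed here, before \<open>\<eta>\<close> and
      \<open>\<mu>\<close> are chosen; the tail, the Lipschitz part and the variation of b each cost
      at most e / 4.\<close>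
    define \<theta> where "\<theta> = min 1 (e / (8 * B * (K + 1)))"
    have \<theta>: "0 < \<theta>" "\<theta> \<le> 1" using e B E(1) by (auto simp: \<theta>_def)
    define M where "M = - ln \<theta> / 2"
    have M: "M \<ge> 0" "exp (- 2 * M) = \<theta>" using \<theta> by (auto simp: M_def)
    define \<eta> where "\<eta> = e / (4 * B * exp M)"
    have \<eta>: "\<eta> > 0" using e B by (simp add: \<eta>_def)
    obtain N1 where N1: "\<forall>i\<ge>N1. \<forall>j\<ge>N1. (\<integral>\<^sup>+z\<in>disc r. ennreal \<bar>w i z - w j z\<bar> \<partial>lborel) \<le> ennreal \<eta>" using L1[OF \<eta>] by blast
    define \<mu> where "\<mu> = e / (4 * (K + 1))"
    have \<mu>: "\<mu> > 0" using e E(1) by (simp add: \<mu>_def)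
    have "Cauchy b" using b(1) Cauchy_convergent_iff by blast
    then obtain N2 where N2: "\<forall>i\<ge>N2. \<forall>j\<ge>N2. \<bar>b i - b j\<bar> < \<mu>" using \<mu> unfolding Cauchy_def dist_real_def by blast
    have "(\<integral>\<^sup>+z. ennreal (norm (f i z - f j z)) \<partial>?M) \<le> ennreal e" if ij: "i \<ge> max N1 N2" "j \<ge> max N1 N2" for i j
    proof -
      have "(\<integral>\<^sup>+z. ennreal (norm (f i z - f j z)) \<partial>?M) \<le> (\<integral>\<^sup>+z. ennreal (B * exp M) * ennreal \<bar>w i z - w j z\<bar>
          + (ennreal (B * \<theta>) * (ennreal (exp (3 * \<bar>w i z\<bar>)) + ennreal (exp (3 * \<bar>w j z\<bar>))) + ennreal \<mu> * ennreal (exp (3 * \<bar>w j z\<bar>))) \<partial>?M)"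
      proof (rule nn_integral_mono)
        fix z
        have "f i z - f j z = b i * (exp (w i z) - exp (w j z)) + (b i - b j) * exp (w j z)" by (simp add: f_def algebra_simps)
        then have "norm (f i z - f j z) \<le> b i * \<bar>exp (w i z) - exp (w j z)\<bar> + \<bar>b i - b j\<bar> * exp (w j z)"
          using abs_triangle_ineq[of "b i * (exp (w i z) - exp (w j z))" "(b i - b j) * exp (w j z)"] b(2)[of i] by (simp add: abs_mult)
        also have "\<dots> \<le> B * (exp M * \<bar>w i z - w j z\<bar> + \<theta> * (exp (3 * \<bar>w i z\<bar>) + exp (3 * \<bar>w j z\<bar>))) + \<mu> * exp (3 * \<bar>w j z\<bar>)"
        proof (intro add_mono mult_mono)
          show "\<bar>exp (w i z) - exp (w j z)\<bar> \<le> exp M * \<bar>w i z - w j z\<bar> + \<theta> * (exp (3 * \<bar>w i z\<bar>) + exp (3 * \<bar>w j z\<bar>))"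
            using exp_diff_le[OF M(1), of "w i z" "w j z"] unfolding M(2) .
          show "\<bar>b i - b j\<bar> \<le> \<mu>" using N2 ij by (simp add: less_imp_le)
        qed (use B \<mu> in auto)
        finally have "ennreal (norm (f i z - f j z)) \<le> ennreal (B * (exp M * \<bar>w i z - w j z\<bar> + \<theta> * (exp (3 * \<bar>w i z\<bar>) + exp (3 * \<bar>w j z\<bar>))) + \<mu> * exp (3 * \<bar>w j z\<bar>))"
          by (rule ennreal_leI)
        also have "B * (exp M * \<bar>w i z - w j z\<bar> + \<theta> * (exp (3 * \<bar>w i z\<bar>) + exp (3 * \<bar>w j z\<bar>))) + \<mu> * exp (3 * \<bar>w j z\<bar>)
          = B * exp M * \<bar>w i z - w j z\<bar> + (B * \<theta> * (exp (3 * \<bar>w i z\<bar>) + exp (3 * \<bar>w j z\<bar>)) + \<mu> * exp (3 * \<bar>w j z\<bar>))"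
          by (simp add: algebra_simps)
        also have "ennreal \<dots> = ennreal (B * exp M) * ennreal \<bar>w i z - w j z\<bar>
          + (ennreal (B * \<theta>) * (ennreal (exp (3 * \<bar>w i z\<bar>)) + ennreal (exp (3 * \<bar>w j z\<bar>))) + ennreal \<mu> * ennreal (exp (3 * \<bar>w j z\<bar>)))"
        proof -
          have n: "0 \<le> B * exp M" "0 \<le> B * \<theta>" "0 \<le> \<mu>" "0 \<le> exp (3 * \<bar>w i z\<bar>)" "0 \<le> exp (3 * \<bar>w j z\<bar>)" "0 \<le> \<bar>w i z - w j z\<bar>"
            "0 \<le> exp (3 * \<bar>w i z\<bar>) + exp (3 * \<bar>w j z\<bar>)"
            using B \<theta> \<mu> by (auto simp: add_nonneg_nonneg)
          have n2: "0 \<le> B * exp M * \<bar>w i z - w j z\<bar>" "0 \<le> B * \<theta> * (exp (3 * \<bar>w i z\<bar>) + exp (3 * \<bar>w j z\<bar>))" "0 \<le> \<mu> * exp (3 * \<bar>w j z\<bar>)"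
            by (intro mult_nonneg_nonneg n)+
          show ?thesis
            by (simp only: ennreal_plus[OF n2(1) add_nonneg_nonneg[OF n2(2,3)]] ennreal_plus[OF n2(2,3)]
                ennreal_mult[OF n(1,6)] ennreal_mult[OF n(2,7)] ennreal_mult[OF n(3,5)] ennreal_plus[OF n(4,5)])
        qed
        finally show "ennreal (norm (f i z - f j z)) \<le> \<dots>" .
      qed
      also have "\<dots> = ennreal (B * exp M) * (\<integral>\<^sup>+z. ennreal \<bar>w i z - w j z\<bar> \<partial>?M)
          + (ennreal (B * \<theta>) * ((\<integral>\<^sup>+z. ennreal (exp (3 * \<bar>w i z\<bar>)) \<partial>?M) + (\<integral>\<^sup>+z. ennreal (exp (3 * \<bar>w j z\<bar>)) \<partial>?M)) + ennreal \<mu> * (\<integral>\<^sup>+z. ennreal (exp (3 * \<bar>w j z\<bar>)) \<partial>?M))"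
        by (simp add: nn_integral_add nn_integral_cmult)
      also have "\<dots> \<le> ennreal (B * exp M) * ennreal \<eta> + (ennreal (B * \<theta>) * (ennreal K + ennreal K) + ennreal \<mu> * ennreal K)"
        using N1 ij by (intro add_mono mult_left_mono E') (simp_all add: nn_integral_lebesgue_on_disc)
      also have "\<dots> = ennreal (B * exp M * \<eta> + (B * \<theta> * (K + K) + \<mu> * K))"
      proof -
        have n: "0 \<le> B * exp M" "0 \<le> B * \<theta>" "0 \<le> \<mu>" "0 \<le> \<eta>" "0 \<le> K + K" using B \<theta> \<mu> \<eta> E(1) by auto
        have n2: "0 \<le> B * exp M * \<eta>" "0 \<le> B * \<theta> * (K + K)" "0 \<le> \<mu> * K"
          by (rule mult_nonneg_nonneg[OF n(1,4)] mult_nonneg_nonneg[OF n(2,5)] mult_nonneg_nonneg[OF n(3) E(1)])+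
        show ?thesis
          by (simp only: ennreal_plus[OF n2(1) add_nonneg_nonneg[OF n2(2,3)]] ennreal_plus[OF n2(2,3)]
                ennreal_mult[OF n(1,4)] ennreal_mult[OF n(2,5)] ennreal_mult[OF n(3) E(1)] ennreal_plus[OF E(1) E(1)])
      qed
      also have "\<dots> \<le> ennreal e"
      proof (rule ennreal_leI)
        have 1: "B * exp M * \<eta> = e / 4" using B by (simp add: \<eta>_def)
        define K1 where "K1 = K + 1"
        have K1: "K1 > 0" "K \<le> K1" using E(1) by (auto simp: K1_def)
        have 2: "B * \<theta> * (K + K) \<le> e / 4"
        proof -
          have "\<theta> \<le> e / (8 * B * K1)" by (simp add: \<theta>_def K1_def)
          then have "\<theta> * (B * (K + K)) \<le> e / (8 * B * K1) * (B * (K1 + K1))"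
            using B E(1) K1 e by (intro mult_mono) auto
          also have "\<dots> = e / 4" using B K1 by (simp add: field_simps)
          finally show ?thesis by (simp add: mult_ac)
        qed
        have 3: "\<mu> * K \<le> e / 4"
        proof -
          have "\<mu> * K \<le> \<mu> * K1" using \<mu> K1 by (intro mult_left_mono) auto
          also have "\<dots> = e / 4" using K1 by (simp add: \<mu>_def K1_def[symmetric])
          finally show ?thesis .
        qed
        show "B * exp M * \<eta> + (B * \<theta> * (K + K) + \<mu> * K) \<le> e" using 1 2 3 e by linarith
      qed
      finally show ?thesis .
    qed
    then show ?thesis by blast
  qed
  obtain F where F: "F \<in> borel_measurable ?M" "\<And>q. 0 < q \<Longrightarrow> q < s \<Longrightarrow> (\<lambda>k. \<integral>\<^sup>+z. ennreal (norm (f k z - F z) powr q) \<partial>?M) \<longlonglongrightarrow> 0"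
  proof (rule L1_Cauchy_imp_Lq_limit[OF fm emeasure_lebesgue_on_disc s fs fcau])
    fix H assume "H \<in> borel_measurable ?M" "\<And>q. 0 < q \<Longrightarrow> q < s \<Longrightarrow> (\<lambda>k. \<integral>\<^sup>+z. ennreal (norm (f k z - H z) powr q) \<partial>?M) \<longlonglongrightarrow> 0"
    then show thesis by (rule that)
  qed simp_all
  have fL: "f k \<in> Lp q (disc r)" for k
    unfolding f_def by (rule continuous_on_imp_Lp_disc[OF _ r(2) q(1)]) (intro continuous_intros w)
  have "Lp_converges q (disc r) f F"
    unfolding Lp_converges_def
  proof (intro conjI allI fL)
    show "F \<in> Lp q (disc r)" by (rule Lp_limit_mem[OF q(1) fL F(1) F(2)[OF q]])
    show "(\<lambda>k. Lp_norm q (disc r) (\<lambda>z. f k z - F z)) \<longlonglongrightarrow> 0"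
      by (rule Lp_norm_tendsto_0[OF q(1)]) (use F(1) F(2)[OF q] in simp_all)
  qed
  then show ?thesis unfolding f_def[abs_def] by blast
qed

lemma nn_integral_exp_scaled_le:
  fixes w :: "complex \<Rightarrow> real"
  assumes w: "w \<in> borel_measurable (lebesgue_on (disc r))" and q: "q > 0" and b: "b \<ge> 0"
    and E: "K \<ge> 0" "(\<integral>\<^sup>+z\<in>disc r. ennreal (exp (q * \<bar>w z\<bar>)) \<partial>lborel) \<le> ennreal K"
  shows "(\<integral>\<^sup>+z. ennreal (norm (b * exp (w z)) powr q) \<partial>lebesgue_on (disc r)) \<le> ennreal (b powr q * K)"
proof -
  note [measurable] = w
  have "(\<integral>\<^sup>+z. ennreal (norm (b * exp (w z)) powr q) \<partial>lebesgue_on (disc r)) \<le> (\<integral>\<^sup>+z. ennreal (b powr q) * ennreal (exp (q * \<bar>w z\<bar>)) \<partial>lebesgue_on (disc r))"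
  proof (rule nn_integral_mono)
    fix z
    have "norm (b * exp (w z)) powr q = b powr q * exp (q * w z)" using b by (simp add: powr_mult exp_powr_real mult.commute abs_mult)
    also have "\<dots> \<le> b powr q * exp (q * \<bar>w z\<bar>)" using q by (intro mult_left_mono) auto
    finally show "ennreal (norm (b * exp (w z)) powr q) \<le> ennreal (b powr q) * ennreal (exp (q * \<bar>w z\<bar>))"
      by (simp add: ennreal_leI flip: ennreal_mult)
  qed
  also have "\<dots> = ennreal (b powr q) * (\<integral>\<^sup>+z. ennreal (exp (q * \<bar>w z\<bar>)) \<partial>lebesgue_on (disc r))" by (rule nn_integral_cmult) measurable
  also have "\<dots> \<le> ennreal (b powr q) * ennreal K" using E(2) by (intro mult_left_mono) (simp_all add: nn_integral_lebesgue_on_disc)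
  also have "\<dots> = ennreal (b powr q * K)" using E(1) by (intro ennreal_mult[symmetric]) auto
  finally show ?thesis .
qed

lemma tendsto_0_ennreal_le:
  fixes f :: "nat \<Rightarrow> ennreal" and g :: "nat \<Rightarrow> real"
  assumes "\<And>k. f k \<le> ennreal (g k)" "g \<longlonglongrightarrow> 0" shows "f \<longlonglongrightarrow> 0"
proof (rule tendsto_sandwich[OF _ _ tendsto_const])
  show "(\<lambda>k. ennreal (g k)) \<longlonglongrightarrow> 0" using tendsto_ennrealI[OF assms(2)] by simp
qed (simp_all add: assms)

lemma Lp_converges_exp_0:
  fixes w :: "nat \<Rightarrow> complex \<Rightarrow> real" and b :: "nat \<Rightarrow> real"
  assumes r: "0 < r" "r < 1" and w: "\<And>k. continuous_on (disc 1) (w k)" and q: "q > 0"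
    and E: "K \<ge> 0" "\<And>k. (\<integral>\<^sup>+z\<in>disc r. ennreal (exp (q * \<bar>w k z\<bar>)) \<partial>lborel) \<le> ennreal K"
    and b: "b \<longlonglongrightarrow> 0" "\<And>k. b k \<ge> 0"
  shows "Lp_converges q (disc r) (\<lambda>k z. b k * exp (w k z)) (\<lambda>_. 0)"
proof -
  have r1: "r \<le> 1" using r by simp
  have wm: "w k \<in> borel_measurable (lebesgue_on (disc r))" for k by (rule continuous_on_imp_measurable_disc[OF w r1])
  have fL: "(\<lambda>z. b k * exp (w k z)) \<in> Lp q (disc r)" for k
    by (rule continuous_on_imp_Lp_disc[OF _ r(2) q]) (intro continuous_intros w)
  have "(\<lambda>k. b k powr q * K) \<longlonglongrightarrow> 0 powr q * K" using q b by (intro tendsto_intros tendsto_powr') auto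
  then have g: "(\<lambda>k. b k powr q * K) \<longlonglongrightarrow> 0" by simp
  have c: "(\<lambda>k. \<integral>\<^sup>+z. ennreal (norm (b k * exp (w k z) - 0) powr q) \<partial>lebesgue_on (disc r)) \<longlonglongrightarrow> 0"
    by (rule tendsto_0_ennreal_le[OF _ g]) (simp only: diff_zero nn_integral_exp_scaled_le[OF wm q b(2) E])
  show ?thesis unfolding Lp_converges_def
  proof (intro conjI allI fL)
    show "(\<lambda>_. 0) \<in> Lp q (disc r)" using q by (intro continuous_on_imp_Lp_disc[OF _ r(2) q]) auto
    show "(\<lambda>k. Lp_norm q (disc r) (\<lambda>z. b k * exp (w k z) - 0)) \<longlonglongrightarrow> 0"
      by (rule Lp_norm_tendsto_0[OF q _ c]) (use wm in measurable)
  qed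
qed

section \<open>Normalisation by means, choice of the subsequence and the dichotomy\<close>

theorem corollary1p5:
  fixes \<Lambda> \<Lambda>\<^sub>2 \<tau> \<epsilon>\<^sub>0 :: real and u :: "nat \<Rightarrow> complex \<Rightarrow> real"
  assumes "\<Lambda> > 0" and "\<Lambda>\<^sub>2 > 0"
    and "eps_regularity \<Lambda> \<epsilon>\<^sub>0"
    and "\<And>k. smooth_on (disc 1) (u k)"
    and "\<And>k. extends_to_complete \<Lambda> (u k)"
    and "\<And>k. (\<integral>\<^sup>+z. ennreal \<bar>conf_curv (u k) z\<bar> \<partial>conf_area (u k)) < ennreal \<tau>"
    and "\<tau> \<le> \<epsilon>\<^sub>0"
    and "\<And>k. emeasure (conf_area (u k)) (disc 1) < ennreal \<Lambda>\<^sub>2"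
  shows "\<exists>\<sigma>::nat \<Rightarrow> nat. strict_mono \<sigma> \<and>
    (\<forall>r q. 0 < r \<and> r < 1 \<and> 0 < q \<and> q < 4 * pi / \<tau> \<longrightarrow>
       (\<exists>F. Lp_converges q (disc r) (\<lambda>k z. exp (u (\<sigma> k) z)) F)) \<and>
    (\<forall>r p. 0 < r \<and> r < 1 \<and> 1 < p \<and> p < 2 \<longrightarrow>
       (let alt_a = (\<exists>v. W1p_converges_weakly p (disc r) (\<lambda>k. u (\<sigma> k)) v);
            alt_b = ((\<forall>q. 0 < q \<and> q < 4 * pi / \<tau> \<longrightarrow>
                        Lp_converges q (disc r) (\<lambda>k z. exp (u (\<sigma> k) z)) (\<lambda>_. 0)) \<and>
                     (\<lambda>k. emeasure (conf_area (u (\<sigma> k))) (disc r)) \<longlonglongrightarrow> 0 \<and>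
                     (\<lambda>k. conf_diam (u (\<sigma> k)) (disc r)) \<longlonglongrightarrow> 0)
        in (alt_a \<or> alt_b) \<and>
           (alt_b \<longrightarrow> (\<exists>c :: nat \<Rightarrow> real. \<exists>v.
              W1p_converges_weakly p (disc r) (\<lambda>k z. u (\<sigma> k) z - c k) v))))"
proof -
  note eps = assms(3)
  have uC: "Ck_on 2 (disc 1) (u k)" for k using assms(4) by (rule smooth_on_imp_Ck_on)
  note ud = Ck_on_2_D[OF uC]
  \<comment> \<open>An integral is strictly below \<open>ennreal \<tau>\<close>, and a non-positive
    \<tau> would make that 0.\<close>
  have \<tau>: "\<tau> > 0"
  proof -
    have "0 < ennreal \<tau>" using assms(6)[of 0] by (rule le_less_trans[rotated]) simp
    then show ?thesis by simp
  qed
  \<comment> \<open>The upper bound 4/3 pi of the constant enters here; it makes third exponential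
    moments available.\<close>
  have \<tau>3: "3 < 4 * pi / \<tau>"
  proof -
    have "\<epsilon>\<^sub>0 < 4 / 3 * pi" using eps by (simp add: eps_regularity_def)
    then have "3 * \<tau> < 4 * pi" using assms(7) by simp
    then show ?thesis using \<tau> by (simp add: field_simps)
  qed
  have ulap: "(\<integral>\<^sup>+z\<in>disc 1. ennreal \<bar>laplacian (u k) z\<bar> \<partial>lborel) \<le> ennreal \<tau>" for k
    using assms(6)[of k] nn_integral_conf_curv[OF uC, of k] by simp
  then have ulap0: "(\<integral>\<^sup>+z\<in>disc 1. ennreal \<bar>laplacian (u k) z\<bar> \<partial>lborel) \<le> ennreal \<epsilon>\<^sub>0" for k
    using assms(7) by (meson ennreal_leI order_trans)
  have carea: "emeasure (conf_area (u k)) (disc r) = (\<integral>\<^sup>+z\<in>disc r. ennreal (exp (2 * u k z)) \<partial>lborel)" if r: "r \<le> 1" for k r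
  proof -
    have [measurable]: "u k \<in> borel_measurable (lebesgue_on (disc 1))" by (rule continuous_on_imp_measurable_disc[OF ud(3)]) simp
    have s: "disc r \<in> sets (lebesgue_on (disc 1))"
      using disc_sets_lebesgue r by (simp add: sets_restrict_space_iff subset_ball)
    have "emeasure (conf_area (u k)) (disc r) = (\<integral>\<^sup>+z. ennreal (exp (2 * u k z)) * indicator (disc r) z \<partial>lebesgue_on (disc 1))"
      unfolding conf_area_def by (rule emeasure_density) (use s in measurable)
    also have "\<dots> = (\<integral>\<^sup>+z. ennreal (exp (2 * u k z)) * indicator (disc r) z * indicator (disc 1) z \<partial>lborel)"
      by (simp add: nn_integral_lebesgue_on_disc)
    also have "\<dots> = (\<integral>\<^sup>+z\<in>disc r. ennreal (exp (2 * u k z)) \<partial>lborel)"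
      using r by (intro nn_integral_cong) (auto simp: indicator_def)
    finally show ?thesis .
  qed
  \<comment> \<open>The divisor is the area of the disc of radius 1/2.\<close>
  define c where "c k = (LBINT z:disc (1/2). u k z) / (pi / 4)" for k
  define w where "w k z = u k z - c k" for k z
  have uw: "u k z = w k z + c k" for k z by (simp add: w_def)
  have kC: "Ck_on 2 (disc 1) (\<lambda>_. c k)" for k by (rule Ck_on_const)
  have wC: "Ck_on 2 (disc 1) (w k)" for k unfolding w_def by (rule Ck_on_diff[OF open_ball uC kC])
  have wg: "grad (w k) z = grad (u k) z" and wl: "laplacian (w k) z = laplacian (u k) z" if "z \<in> disc 1" for k z
  proof -
    have c0: "pderiv_dir v (\<lambda>_. c k) = (\<lambda>_. 0)" for v by (simp add: pderiv_dir_def frechet_derivative_const fun_eq_iff)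
    have c1: "pderiv_dir v (\<lambda>_. 0 :: real) z = 0" for v z by (simp add: pderiv_dir_def frechet_derivative_const)
    show "grad (w k) z = grad (u k) z"
      unfolding w_def using grad_diff[OF open_ball that uC kC] by (simp add: grad_def[of "\<lambda>_. c k"] c0 Complex_eq_0)
    show "laplacian (w k) z = laplacian (u k) z"
      unfolding w_def using laplacian_diff[OF open_ball that uC kC] by (simp add: laplacian_def[of "\<lambda>_. c k"] c0 c1)
  qed
  have wlap: "(\<integral>\<^sup>+z\<in>disc 1. ennreal \<bar>laplacian (w k) z\<bar> \<partial>lborel) \<le> ennreal \<tau>" for k
  proof -
    have "(\<integral>\<^sup>+z\<in>disc 1. ennreal \<bar>laplacian (w k) z\<bar> \<partial>lborel) = (\<integral>\<^sup>+z\<in>disc 1. ennreal \<bar>laplacian (u k) z\<bar> \<partial>lborel)"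
      by (intro nn_integral_cong) (simp add: wl indicator_def)
    then show ?thesis using ulap by simp
  qed
  have gLp: "\<exists>S\<ge>0. \<forall>k. (\<integral>\<^sup>+z\<in>disc r. ennreal (norm (grad (w k) z) powr p) \<partial>lborel) \<le> ennreal S"
    if r: "0 < r" "r < 1" and p: "0 < p" "p < 2" for r p
  proof -
    obtain S where S: "S \<ge> 0" "\<And>k. (\<integral>\<^sup>+z\<in>disc r. ennreal (norm (grad (u k) z) powr p) \<partial>lborel) \<le> ennreal S"
      using gradient_Lp_bound[OF eps r p] assms(4,5) ulap0 by blast
    have "(\<integral>\<^sup>+z\<in>disc r. ennreal (norm (grad (w k) z) powr p) \<partial>lborel) = (\<integral>\<^sup>+z\<in>disc r. ennreal (norm (grad (u k) z) powr p) \<partial>lborel)" for k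
      using r by (intro nn_integral_cong) (simp add: wg indicator_def)
    then show ?thesis using S by auto
  qed
  have wbd: "\<exists>A\<ge>0. \<forall>k. (\<integral>\<^sup>+z\<in>disc r. ennreal \<bar>w k z\<bar> \<partial>lborel) \<le> ennreal A \<and>
      (\<integral>\<^sup>+z\<in>disc r. ennreal (norm (grad (w k) z)) \<partial>lborel) \<le> ennreal A" if r: "0 < r" "r < 1" for r
  proof -
    \<comment> \<open>R exceeds r and is at least 1/2, so the disc of radius R contains the one over
      which the means are taken.\<close>
    define R where "R = (1 + r) / 2"
    have R: "1/2 \<le> R" "r \<le> R" "0 < R" "R < 1" using r by (auto simp: R_def)
    obtain S where S: "S \<ge> 0" "\<And>k. (\<integral>\<^sup>+z\<in>disc R. ennreal (norm (grad (w k) z) powr 1) \<partial>lborel) \<le> ennreal S"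
      using gLp[OF R(3,4), of 1] by auto
    then have S1: "(\<integral>\<^sup>+z\<in>disc R. ennreal (norm (grad (w k) z)) \<partial>lborel) \<le> ennreal S" for k by simp
    have mono: "(\<integral>\<^sup>+z\<in>disc r. h z \<partial>lborel) \<le> (\<integral>\<^sup>+z\<in>disc R. h z \<partial>lborel)" for h :: "complex \<Rightarrow> ennreal"
      using R(2) by (intro nn_integral_mono) (auto simp: indicator_def)
    have "(\<integral>\<^sup>+z\<in>disc r. ennreal \<bar>w k z\<bar> \<partial>lborel) \<le> ennreal (40 * S)" for k
    proof -
      have "(\<integral>\<^sup>+z\<in>disc r. ennreal \<bar>w k z\<bar> \<partial>lborel) \<le> (\<integral>\<^sup>+z\<in>disc R. ennreal \<bar>u k z - c k\<bar> \<partial>lborel)"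
        unfolding w_def by (rule mono)
      also have "\<dots> \<le> ennreal 40 * (\<integral>\<^sup>+z\<in>disc R. ennreal (norm (grad (u k) z)) \<partial>lborel)"
        unfolding c_def by (rule L1_bound_minus_mean[OF uC R(1,4)])
      also have "(\<integral>\<^sup>+z\<in>disc R. ennreal (norm (grad (u k) z)) \<partial>lborel) = (\<integral>\<^sup>+z\<in>disc R. ennreal (norm (grad (w k) z)) \<partial>lborel)"
        using R by (intro nn_integral_cong) (simp add: wg indicator_def)
      also have "ennreal 40 * (\<integral>\<^sup>+z\<in>disc R. ennreal (norm (grad (w k) z)) \<partial>lborel) \<le> ennreal 40 * ennreal S"
        by (intro mult_left_mono S1) simp
      also have "\<dots> = ennreal (40 * S)" using S(1) by (intro ennreal_mult[symmetric]) auto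
      finally show ?thesis .
    qed
    moreover have "(\<integral>\<^sup>+z\<in>disc r. ennreal (norm (grad (w k) z)) \<partial>lborel) \<le> ennreal (40 * S)" for k
    proof -
      have "(\<integral>\<^sup>+z\<in>disc r. ennreal (norm (grad (w k) z)) \<partial>lborel) \<le> ennreal S" using mono S1 by (rule order_trans)
      also have "\<dots> \<le> ennreal (40 * S)" using S(1) by (intro ennreal_leI) simp
      finally show ?thesis .
    qed
    ultimately show ?thesis using S(1) by (intro exI[of _ "40 * S"]) auto
  qed
  \<comment> \<open>Integrating 2 u \<le> exp (2 u) over the half disc bounds c_k pi / 2 by the area
    of the metric, and pi / 2 \<ge> 1 handles the factor when c_k is non-negative.\<close>
  have cB: "c k \<le> \<Lambda>\<^sub>2" for k
  proof -
    have iu: "set_integrable lborel (disc (1/2)) (u k)"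
      by (rule set_integral_bounds(1)[OF uC, of "1/2"]) auto
    define E where "E z = indicator (disc (1/2)) z *\<^sub>R exp (2 * u k z)" for z
    have Em: "E \<in> borel_measurable borel" unfolding E_def
      by (rule borel_measurable_indicator_disc) (auto intro!: continuous_intros ud)
    have En: "(\<integral>\<^sup>+z. ennreal (E z) \<partial>lborel) \<le> ennreal \<Lambda>\<^sub>2"
    proof -
      have "(\<integral>\<^sup>+z. ennreal (E z) \<partial>lborel) \<le> (\<integral>\<^sup>+z\<in>disc 1. ennreal (exp (2 * u k z)) \<partial>lborel)"
        by (intro nn_integral_mono) (auto simp: E_def indicator_def)
      also have "\<dots> \<le> ennreal \<Lambda>\<^sub>2" using carea[of 1 k] assms(8)[of k] by simp
      finally show ?thesis .
    qed
    have Ei: "integrable lborel E"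
      by (rule integrableI_nonneg) (use Em En in \<open>auto simp: E_def intro: le_less_trans\<close>)
    have "ennreal (LBINT z. E z) \<le> ennreal \<Lambda>\<^sub>2"
    proof -
      have e: "(\<integral>\<^sup>+z. ennreal (E z) \<partial>lborel) = ennreal (LBINT z. E z)"
        by (rule nn_integral_eq_integral[OF Ei]) (simp add: E_def)
      show ?thesis using En unfolding e .
    qed
    then have EL: "(LBINT z. E z) \<le> \<Lambda>\<^sub>2" using assms(2) by (simp add: ennreal_le_iff)
    have "(LBINT z. 2 * (indicator (disc (1/2)) z *\<^sub>R u k z)) \<le> (LBINT z. E z)"
    proof (rule integral_mono[OF _ Ei])
      show "integrable lborel (\<lambda>z. 2 * (indicator (disc (1/2)) z *\<^sub>R u k z))"
        using iu unfolding set_integrable_def by (rule integrable_mult_right)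
      fix z
      have "2 * u k z \<le> exp (2 * u k z)" using exp_ge_add_one_self[of "2 * u k z"] by linarith
      then show "2 * (indicator (disc (1/2)) z *\<^sub>R u k z) \<le> E z" by (simp add: E_def indicator_def)
    qed
    then have "2 * (LBINT z:disc (1/2). u k z) \<le> \<Lambda>\<^sub>2" using EL by (simp add: set_lebesgue_integral_def)
    then have "2 * (c k * (pi / 4)) \<le> \<Lambda>\<^sub>2" by (simp add: c_def)
    moreover have "c k \<le> 2 * (c k * (pi / 4))" if "c k \<ge> 0"
    proof -
      have "c k * 1 \<le> c k * (pi / 2)" using that pi_ge_two by (intro mult_left_mono) auto
      then show ?thesis by (simp add: mult.commute)
    qed
    ultimately show ?thesis using assms(2) by (cases "c k \<ge> 0") auto
  qed
  \<comment> \<open>The means are bounded only from above; the exponentials are bounded on both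
    sides, so these are what the subsequence makes convergent.\<close>
  have bB: "bounded (range (\<lambda>k. exp (c k)))"
    using cB by (auto simp: bounded_iff intro!: exI[of _ "exp \<Lambda>\<^sub>2"])
  obtain \<sigma> :: "nat \<Rightarrow> nat" where \<sigma>: "strict_mono \<sigma>" and bc: "convergent (\<lambda>k. exp (c (\<sigma> k)))"
    and L1: "\<And>r e. 0 < r \<Longrightarrow> r < 1 \<Longrightarrow> e > 0 \<Longrightarrow> \<exists>N. \<forall>i\<ge>N. \<forall>j\<ge>N.
      (\<integral>\<^sup>+z\<in>disc r. ennreal \<bar>w (\<sigma> i) z - w (\<sigma> j) z\<bar> \<partial>lborel) \<le> ennreal e"
    by (rule Rellich_diagonal[OF wC bB wbd]) (assumption+, rule that)
  \<comment> \<open>The estimate needs L^1 bounds on a disc larger than that of radius r; the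
    midpoint between r and 1 provides one.\<close>
  have EXP: "\<exists>K\<ge>0. \<forall>k. (\<integral>\<^sup>+z\<in>disc r. ennreal (exp (q * \<bar>w k z\<bar>)) \<partial>lborel) \<le> ennreal K"
    if r: "0 < r" "r < 1" and q: "0 < q" "q < 4 * pi / \<tau>" for r q
  proof -
    define R where "R = (1 + r) / 2"
    have R: "r < R" "0 < R" "R < 1" using r by (auto simp: R_def)
    obtain A where A: "A \<ge> 0" "\<And>k. (\<integral>\<^sup>+z\<in>disc R. ennreal \<bar>w k z\<bar> \<partial>lborel) \<le> ennreal A"
      "\<And>k. (\<integral>\<^sup>+z\<in>disc R. ennreal (norm (grad (w k) z)) \<partial>lborel) \<le> ennreal A"
      using wbd[OF R(2,3)] by blast
    show ?thesis
      using exponential_integrability[OF r(1) R(1) less_imp_le[OF R(3)] \<tau> q A(1)] wC wlap A(2,3) by blast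
  qed
  have G1: "\<exists>N. \<forall>i\<ge>N. \<forall>j\<ge>N. (\<integral>\<^sup>+z\<in>disc r. ennreal (norm (grad (w (\<sigma> i)) z - grad (w (\<sigma> j)) z)) \<partial>lborel) \<le> ennreal e"
    if r: "0 < r" "r < 1" and e: "e > 0" for r e
  proof -
    define R where "R = (1 + r) / 2"
    have R: "r < R" "0 < R" "R < 1" using r by (auto simp: R_def)
    obtain A where A: "A \<ge> 0" "\<And>k. (\<integral>\<^sup>+z\<in>disc R. ennreal (norm (grad (w k) z) powr 1) \<partial>lborel) \<le> ennreal A"
      using gLp[OF R(2,3), of 1] by auto
    obtain S where S: "S \<ge> 0" "\<And>k. (\<integral>\<^sup>+z\<in>disc r. ennreal (norm (grad (w k) z) powr (3/2)) \<partial>lborel) \<le> ennreal S"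
      using gLp[OF r, of "3/2"] by auto
    \<comment> \<open>Bounds for the gradient of a difference, in the shape produced by
      \<open>norm_diff_powr_le\<close>. The Laplacian of a difference likewise has mass at most 2
      \<tau>.\<close>
    define A' where "A' = 2 powr 1 * (A + A)"
    define S' where "S' = 2 powr (3/2) * (S + S)"
    have AS: "A' \<ge> 0" "S' \<ge> 0" using A S by (auto simp: A'_def S'_def)
    obtain \<eta> where \<eta>: "\<eta> > 0" and key: "\<And>f. Ck_on 2 (disc 1) f \<Longrightarrow>
      (\<integral>\<^sup>+\<zeta>\<in>disc 1. ennreal \<bar>laplacian f \<zeta>\<bar> \<partial>lborel) \<le> ennreal (\<tau> + \<tau>) \<Longrightarrow>
      (\<integral>\<^sup>+\<zeta>\<in>disc R. ennreal (norm (grad f \<zeta>)) \<partial>lborel) \<le> ennreal A' \<Longrightarrow>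
      (\<integral>\<^sup>+\<zeta>\<in>disc r. ennreal (norm (grad f \<zeta>) powr (3/2)) \<partial>lborel) \<le> ennreal S' \<Longrightarrow>
      (\<integral>\<^sup>+\<zeta>\<in>disc r. ennreal \<bar>f \<zeta>\<bar> \<partial>lborel) \<le> ennreal \<eta> \<Longrightarrow>
      (\<integral>\<^sup>+\<zeta>\<in>disc r. ennreal (norm (grad f \<zeta>)) \<partial>lborel) \<le> ennreal e"
      using gradient_L1_bound[OF r(1) R(1) less_imp_le[OF R(3)] _ AS e, of "\<tau> + \<tau>"] \<tau> by auto
    obtain N where N: "\<forall>i\<ge>N. \<forall>j\<ge>N. (\<integral>\<^sup>+z\<in>disc r. ennreal \<bar>w (\<sigma> i) z - w (\<sigma> j) z\<bar> \<partial>lborel) \<le> ennreal \<eta>"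
      using L1[OF r \<eta>] by blast
    have gm: "(\<lambda>z. ennreal (norm (grad (w k) z) powr p) * indicator (disc \<rho>) z) \<in> borel_measurable lborel" if "\<rho> \<le> 1" for k p \<rho>
    proof -
      have [measurable]: "(\<lambda>z. indicator (disc \<rho>) z *\<^sub>R grad (w k) z) \<in> borel_measurable borel"
        by (rule borel_measurable_indicator_disc[OF continuous_on_grad[OF Ck_on_2_D(4)[OF wC] Ck_on_2_D(4)[OF wC]] that])
      have "(\<lambda>z. ennreal (norm (indicator (disc \<rho>) z *\<^sub>R grad (w k) z) powr p)) \<in> borel_measurable lborel" by measurable
      also have "(\<lambda>z. ennreal (norm (indicator (disc \<rho>) z *\<^sub>R grad (w k) z) powr p)) = (\<lambda>z. ennreal (norm (grad (w k) z) powr p) * indicator (disc \<rho>) z)"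
        by (auto simp: indicator_def fun_eq_iff)
      finally show ?thesis .
    qed
    have two: "(\<integral>\<^sup>+z\<in>disc \<rho>. ennreal (norm (grad (w i) z - grad (w j) z) powr p) \<partial>lborel) \<le> ennreal (2 powr p * (X + X))"
      if p: "p > 0" and \<rho>: "\<rho> \<le> 1" and X: "X \<ge> 0" "\<And>k. (\<integral>\<^sup>+z\<in>disc \<rho>. ennreal (norm (grad (w k) z) powr p) \<partial>lborel) \<le> ennreal X" for p \<rho> X i j
    proof -
      have "(\<integral>\<^sup>+z\<in>disc \<rho>. ennreal (norm (grad (w i) z - grad (w j) z) powr p) \<partial>lborel)
        \<le> (\<integral>\<^sup>+z. ennreal (2 powr p) * (ennreal (norm (grad (w i) z) powr p) * indicator (disc \<rho>) z + ennreal (norm (grad (w j) z) powr p) * indicator (disc \<rho>) z) \<partial>lborel)"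
      proof (rule nn_integral_mono)
        fix z
        have "ennreal (norm (grad (w i) z - grad (w j) z) powr p) \<le> ennreal (2 powr p * (norm (grad (w i) z) powr p + norm (grad (w j) z) powr p))"
          by (rule ennreal_leI[OF norm_diff_powr_le[OF p]])
        also have "\<dots> = ennreal (2 powr p) * (ennreal (norm (grad (w i) z) powr p) + ennreal (norm (grad (w j) z) powr p))"
          by (simp add: ennreal_mult)
        finally show "ennreal (norm (grad (w i) z - grad (w j) z) powr p) * indicator (disc \<rho>) z \<le>
          ennreal (2 powr p) * (ennreal (norm (grad (w i) z) powr p) * indicator (disc \<rho>) z + ennreal (norm (grad (w j) z) powr p) * indicator (disc \<rho>) z)"
          by (simp add: indicator_def)
      qed
      also have "\<dots> = ennreal (2 powr p) * ((\<integral>\<^sup>+z\<in>disc \<rho>. ennreal (norm (grad (w i) z) powr p) \<partial>lborel) + (\<integral>\<^sup>+z\<in>disc \<rho>. ennreal (norm (grad (w j) z) powr p) \<partial>lborel))"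
        using gm[OF \<rho>] by (simp add: nn_integral_cmult nn_integral_add)
      also have "\<dots> \<le> ennreal (2 powr p) * (ennreal X + ennreal X)" by (intro mult_left_mono add_mono X) simp
      also have "\<dots> = ennreal (2 powr p * (X + X))" using X(1) by (simp add: ennreal_mult flip: mult_2)
      finally show ?thesis .
    qed
    have "(\<integral>\<^sup>+z\<in>disc r. ennreal (norm (grad (w (\<sigma> i)) z - grad (w (\<sigma> j)) z)) \<partial>lborel) \<le> ennreal e" if ij: "i \<ge> N" "j \<ge> N" for i j
    proof -
      define f where "f z = w (\<sigma> i) z - w (\<sigma> j) z" for z
      have fC: "Ck_on 2 (disc 1) f" unfolding f_def by (rule Ck_on_diff[OF open_ball wC wC])
      have fg: "grad f z = grad (w (\<sigma> i)) z - grad (w (\<sigma> j)) z" and fl: "laplacian f z = laplacian (w (\<sigma> i)) z - laplacian (w (\<sigma> j)) z" if "z \<in> disc 1" for z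
        unfolding f_def by (rule grad_diff[OF open_ball that wC wC], rule laplacian_diff[OF open_ball that wC wC])
      have fg2: "(\<integral>\<^sup>+z\<in>disc \<rho>. h (grad f z) \<partial>lborel) = (\<integral>\<^sup>+z\<in>disc \<rho>. h (grad (w (\<sigma> i)) z - grad (w (\<sigma> j)) z) \<partial>lborel)" if "\<rho> \<le> 1" for \<rho> and h :: "complex \<Rightarrow> ennreal"
        using that by (intro nn_integral_cong) (simp add: fg indicator_def)
      have "(\<integral>\<^sup>+z\<in>disc r. ennreal (norm (grad f z)) \<partial>lborel) \<le> ennreal e"
      proof (rule key[OF fC])
        show "(\<integral>\<^sup>+z\<in>disc r. ennreal \<bar>f z\<bar> \<partial>lborel) \<le> ennreal \<eta>" using N ij by (simp add: f_def)
        show "(\<integral>\<^sup>+z\<in>disc R. ennreal (norm (grad f z)) \<partial>lborel) \<le> ennreal A'"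
          using two[of 1 R A "\<sigma> i" "\<sigma> j"] R A fg2[of R "\<lambda>x. ennreal (norm x)"] by (simp add: A'_def)
        show "(\<integral>\<^sup>+z\<in>disc r. ennreal (norm (grad f z) powr (3/2)) \<partial>lborel) \<le> ennreal S'"
          using two[of "3/2" r S "\<sigma> i" "\<sigma> j"] r S fg2[of r "\<lambda>x. ennreal (norm x powr (3/2))"] by (simp add: S'_def)
        have lm: "(\<lambda>z. ennreal \<bar>laplacian (w k) z\<bar> * indicator (disc 1) z) \<in> borel_measurable lborel" for k
        proof -
          have "continuous_on (disc 1) (laplacian (w k))"
            unfolding laplacian_def[abs_def] by (intro continuous_intros Ck_on_2_D(5)[OF wC])
          then have [measurable]: "(\<lambda>z. indicator (disc 1) z *\<^sub>R laplacian (w k) z) \<in> borel_measurable borel"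
            by (rule borel_measurable_indicator_disc) simp
          have "(\<lambda>z. ennreal \<bar>indicator (disc 1) z *\<^sub>R laplacian (w k) z\<bar>) \<in> borel_measurable lborel" by measurable
          also have "(\<lambda>z. ennreal \<bar>indicator (disc 1) z *\<^sub>R laplacian (w k) z\<bar>) = (\<lambda>z. ennreal \<bar>laplacian (w k) z\<bar> * indicator (disc 1) z)"
            by (auto simp: indicator_def fun_eq_iff)
          finally show ?thesis .
        qed
        have "(\<integral>\<^sup>+z\<in>disc 1. ennreal \<bar>laplacian f z\<bar> \<partial>lborel) \<le>
          (\<integral>\<^sup>+z. ennreal \<bar>laplacian (w (\<sigma> i)) z\<bar> * indicator (disc 1) z + ennreal \<bar>laplacian (w (\<sigma> j)) z\<bar> * indicator (disc 1) z \<partial>lborel)"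
        proof (rule nn_integral_mono)
          fix z
          show "ennreal \<bar>laplacian f z\<bar> * indicator (disc 1) z \<le> ennreal \<bar>laplacian (w (\<sigma> i)) z\<bar> * indicator (disc 1) z + ennreal \<bar>laplacian (w (\<sigma> j)) z\<bar> * indicator (disc 1) z"
          proof (cases "z \<in> disc 1")
            case True
            have "\<bar>laplacian f z\<bar> \<le> \<bar>laplacian (w (\<sigma> i)) z\<bar> + \<bar>laplacian (w (\<sigma> j)) z\<bar>" unfolding fl[OF True] by simp
            then have "ennreal \<bar>laplacian f z\<bar> \<le> ennreal (\<bar>laplacian (w (\<sigma> i)) z\<bar> + \<bar>laplacian (w (\<sigma> j)) z\<bar>)" by (rule ennreal_leI)
            then show ?thesis using True by simp
          qed simp
        qed
        also have "\<dots> = (\<integral>\<^sup>+z\<in>disc 1. ennreal \<bar>laplacian (w (\<sigma> i)) z\<bar> \<partial>lborel) + (\<integral>\<^sup>+z\<in>disc 1. ennreal \<bar>laplacian (w (\<sigma> j)) z\<bar> \<partial>lborel)"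
          by (rule nn_integral_add[OF lm lm])
        also have "\<dots> \<le> ennreal \<tau> + ennreal \<tau>" by (intro add_mono wlap)
        also have "\<dots> = ennreal (\<tau> + \<tau>)" using \<tau> by (intro ennreal_plus[symmetric]) auto
        finally show "(\<integral>\<^sup>+z\<in>disc 1. ennreal \<bar>laplacian f z\<bar> \<partial>lborel) \<le> ennreal (\<tau> + \<tau>)" .
      qed
      then show ?thesis using fg2[of r "\<lambda>x. ennreal (norm x)"] r by simp
    qed
    then show ?thesis by blast
  qed
  \<comment> \<open>With d equal to the means this yields alternative (a), with d = 0 the final
    claim about subtracted constants.\<close>
  have W: "\<exists>v. W1p_converges_weakly p (disc r) (\<lambda>k z. w (\<sigma> k) z + d k) v"
    if r: "0 < r" "r < 1" and p: "1 < p" "p < 2" and d: "convergent d" for r p d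
  proof -
    obtain K where K: "K \<ge> 0" "\<And>k. (\<integral>\<^sup>+z\<in>disc r. ennreal (exp (3 * \<bar>w k z\<bar>)) \<partial>lborel) \<le> ennreal K"
      using EXP[OF r, of 3] \<tau>3 by auto
    obtain S where S: "\<And>k. (\<integral>\<^sup>+z\<in>disc r. ennreal (norm (grad (w k) z) powr ((p + 2) / 2)) \<partial>lborel) \<le> ennreal S"
      using gLp[OF r, of "(p + 2) / 2"] p by auto
    show ?thesis
      by (rule W1p_limit_exists[OF r p wC L1[OF r] G1[OF r] K(1) K(2) S d])
  qed
  have eu: "exp (u k z) = exp (c k) * exp (w k z)" for k z by (simp add: uw exp_add)
  have wc: "continuous_on (disc 1) (w k)" for k by (rule Ck_on_2_D(3)[OF wC])
  have first: "\<exists>F. Lp_converges q (disc r) (\<lambda>k z. exp (u (\<sigma> k) z)) F"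
    if r: "0 < r" "r < 1" and q: "0 < q" "q < 4 * pi / \<tau>" for r q
  proof -
    \<comment> \<open>The exponent s must exceed q, to leave room for the interpolation; it is also
      taken above 3 and hence above 1.\<close>
    have "max q 3 < 4 * pi / \<tau>" using q \<tau>3 by simp
    then obtain s where "max q 3 < s" "s < 4 * pi / \<tau>" by (blast dest: dense)
    then have s: "q < s" "1 < s" "0 < s" "s < 4 * pi / \<tau>" by auto
    obtain K where K: "K \<ge> 0" "\<And>k. (\<integral>\<^sup>+z\<in>disc r. ennreal (exp (3 * \<bar>w k z\<bar>)) \<partial>lborel) \<le> ennreal K"
      using EXP[OF r, of 3] \<tau>3 by auto
    obtain Ks where Ks: "Ks \<ge> 0" "\<And>k. (\<integral>\<^sup>+z\<in>disc r. ennreal (exp (s * \<bar>w k z\<bar>)) \<partial>lborel) \<le> ennreal Ks"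
      using EXP[OF r s(3,4)] by auto
    show ?thesis unfolding eu
      by (rule Lp_converges_exp[OF r wc L1[OF r] K(1) K(2) s(2) Ks(1) Ks(2) q(1) s(1) bc]) simp_all
  qed
  obtain b where b: "(\<lambda>k. exp (c (\<sigma> k))) \<longlonglongrightarrow> b" using bc by (auto simp: convergent_def)
  have b0: "b \<ge> 0" by (rule LIMSEQ_le_const[OF b]) auto
  \<comment> \<open>A positive limit of exp c_k lets the logarithm pass to the limit, so the means
    converge and can be added back.\<close>
  have alt_a: "\<exists>v. W1p_converges_weakly p (disc r) (\<lambda>k. u (\<sigma> k)) v"
    if r: "0 < r" "r < 1" and p: "1 < p" "p < 2" and bp: "b > 0" for r p
  proof -
    have "(\<lambda>k. ln (exp (c (\<sigma> k)))) \<longlonglongrightarrow> ln b" using b bp by (intro tendsto_ln) auto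
    then have "convergent (\<lambda>k. c (\<sigma> k))" by (auto simp: convergent_def)
    moreover have "(\<lambda>k z. w (\<sigma> k) z + c (\<sigma> k)) = (\<lambda>k. u (\<sigma> k))" by (simp add: fun_eq_iff w_def)
    ultimately show ?thesis using W[OF r p, of "\<lambda>k. c (\<sigma> k)"] by simp
  qed
  \<comment> \<open>All three quantities are a power of exp c_k times a constant that depends on the
    normalised functions only: the moment of order q with power q, the area with power 2, the
    diameter with power 1.\<close>
  have alt_b: "(\<forall>q. 0 < q \<and> q < 4 * pi / \<tau> \<longrightarrow> Lp_converges q (disc r) (\<lambda>k z. exp (u (\<sigma> k) z)) (\<lambda>_. 0)) \<and>
      (\<lambda>k. emeasure (conf_area (u (\<sigma> k))) (disc r)) \<longlonglongrightarrow> 0 \<and> (\<lambda>k. conf_diam (u (\<sigma> k)) (disc r)) \<longlonglongrightarrow> 0"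
    if r: "0 < r" "r < 1" and b0: "b = 0" for r
  proof (intro conjI allI impI)
    have bl: "(\<lambda>k. exp (c (\<sigma> k))) \<longlonglongrightarrow> 0" using b b0 by simp
    fix q assume q: "0 < q \<and> q < 4 * pi / \<tau>"
    then obtain K where K: "K \<ge> 0" "\<And>k. (\<integral>\<^sup>+z\<in>disc r. ennreal (exp (q * \<bar>w k z\<bar>)) \<partial>lborel) \<le> ennreal K"
      using EXP[OF r, of q] by auto
    show "Lp_converges q (disc r) (\<lambda>k z. exp (u (\<sigma> k) z)) (\<lambda>_. 0)"
      unfolding eu by (rule Lp_converges_exp_0[OF r wc conjunct1[OF q] K(1) K(2) bl]) simp_all
  next
    have bl: "(\<lambda>k. exp (c (\<sigma> k))) \<longlonglongrightarrow> 0" using b b0 by simp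
    obtain K where K: "K \<ge> 0" "\<And>k. (\<integral>\<^sup>+z\<in>disc r. ennreal (exp (2 * \<bar>w k z\<bar>)) \<partial>lborel) \<le> ennreal K"
      using EXP[OF r, of 2] \<tau>3 by auto
    have r1: "r \<le> 1" using r by simp
    have "(\<lambda>k. exp (c (\<sigma> k)) powr 2 * K) \<longlonglongrightarrow> 0 powr 2 * K" using bl by (intro tendsto_intros tendsto_powr') auto
    then have g: "(\<lambda>k. exp (c (\<sigma> k)) powr 2 * K) \<longlonglongrightarrow> 0" by simp
    show "(\<lambda>k. emeasure (conf_area (u (\<sigma> k))) (disc r)) \<longlonglongrightarrow> 0"
    proof (rule tendsto_0_ennreal_le[OF _ g])
      fix k
      have "emeasure (conf_area (u (\<sigma> k))) (disc r) = (\<integral>\<^sup>+z. ennreal (norm (exp (c (\<sigma> k)) * exp (w (\<sigma> k) z)) powr 2) \<partial>lebesgue_on (disc r))"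
        unfolding carea[OF r1] nn_integral_lebesgue_on_disc
        by (intro nn_integral_cong) (simp add: uw exp_powr_real algebra_simps flip: exp_add)
      also have "\<dots> \<le> ennreal (exp (c (\<sigma> k)) powr 2 * K)"
        by (rule nn_integral_exp_scaled_le[OF continuous_on_imp_measurable_disc[OF wc r1] _ _ K(1) K(2)]) simp_all
      finally show "emeasure (conf_area (u (\<sigma> k))) (disc r) \<le> ennreal (exp (c (\<sigma> k)) powr 2 * K)" .
    qed
  next
    have bl: "(\<lambda>k. exp (c (\<sigma> k))) \<longlonglongrightarrow> 0" using b b0 by simp
    define R where "R = (1 + r) / 2"
    have R: "r < R" "0 < R" "R < 1" using r by (auto simp: R_def)
    obtain K where K: "K \<ge> 0" "\<And>k. (\<integral>\<^sup>+z\<in>disc R. ennreal (exp (3 * \<bar>w k z\<bar>)) \<partial>lborel) \<le> ennreal K"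
      using EXP[OF R(2,3), of 3] \<tau>3 by auto
    obtain D where D: "\<And>w c. Ck_on 2 (disc 1) w \<Longrightarrow> (\<integral>\<^sup>+z\<in>disc R. ennreal (exp (3 * \<bar>w z\<bar>)) \<partial>lborel) \<le> ennreal K \<Longrightarrow>
      conf_diam (\<lambda>z. w z + c) (disc r) \<le> ennreal (exp c * D)"
      using conf_diam_bound[OF r(1) R(1) less_imp_le[OF R(3)] K(1)] by blast
    have ueq: "u k = (\<lambda>z. w k z + c k)" for k by (simp add: w_def fun_eq_iff)
    have "(\<lambda>k. exp (c (\<sigma> k)) * D) \<longlonglongrightarrow> 0 * D" by (intro tendsto_intros bl)
    then have g: "(\<lambda>k. exp (c (\<sigma> k)) * D) \<longlonglongrightarrow> 0" by simp
    show "(\<lambda>k. conf_diam (u (\<sigma> k)) (disc r)) \<longlonglongrightarrow> 0"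
      by (rule tendsto_0_ennreal_le[OF _ g]) (simp only: ueq, rule D[OF wC K(2)])
  qed
  \<comment> \<open>The normalised functions converge whichever alternative holds; the subtracted
    constants are the means.\<close>
  have more: "\<exists>c :: nat \<Rightarrow> real. \<exists>v. W1p_converges_weakly p (disc r) (\<lambda>k z. u (\<sigma> k) z - c k) v"
    if r: "0 < r" "r < 1" and p: "1 < p" "p < 2" for r p
  proof -
    obtain v where "W1p_converges_weakly p (disc r) (\<lambda>k z. w (\<sigma> k) z + 0) v" using W[OF r p convergent_const[of 0]] by blast
    then have "W1p_converges_weakly p (disc r) (\<lambda>k z. u (\<sigma> k) z - c (\<sigma> k)) v" by (simp add: w_def)
    then show ?thesis by (intro exI[of _ "\<lambda>k. c (\<sigma> k)"] exI[of _ v])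
  qed
  show ?thesis
    unfolding Let_def
  proof (intro exI[of _ \<sigma>] conjI allI impI \<sigma>)
    fix r q :: real assume "0 < r \<and> r < 1 \<and> 0 < q \<and> q < 4 * pi / \<tau>"
    then show "\<exists>F. Lp_converges q (disc r) (\<lambda>k z. exp (u (\<sigma> k) z)) F" using first by blast
  next
    fix r p :: real assume "0 < r \<and> r < 1 \<and> 1 < p \<and> p < 2"
    then have r: "0 < r" "r < 1" and p: "1 < p" "p < 2" by auto
    show "(\<exists>v. W1p_converges_weakly p (disc r) (\<lambda>k. u (\<sigma> k)) v) \<or>
      (\<forall>q. 0 < q \<and> q < 4 * pi / \<tau> \<longrightarrow> Lp_converges q (disc r) (\<lambda>k z. exp (u (\<sigma> k) z)) (\<lambda>_. 0)) \<and>
      (\<lambda>k. emeasure (conf_area (u (\<sigma> k))) (disc r)) \<longlonglongrightarrow> 0 \<and> (\<lambda>k. conf_diam (u (\<sigma> k)) (disc r)) \<longlonglongrightarrow> 0"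
    \<comment> \<open>The limit b was fixed before r and p, so the choice of the alternative is the
      same for all of them.\<close>
    proof (cases "b = 0")
      case True
      then show ?thesis using alt_b[OF r True] by (rule_tac disjI2)
    next
      case False
      then have "b > 0" using b0 by simp
      from alt_a[OF r p this] show ?thesis by (rule disjI1)
    qed
    show "\<exists>c :: nat \<Rightarrow> real. \<exists>v. W1p_converges_weakly p (disc r) (\<lambda>k z. u (\<sigma> k) z - c k) v"
      by (rule more[OF r p])
  qed
qed

end
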